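(* Let $\mathcal{C}$ be a model category. Then there is a model structure on $\mathrm{Arr}\,\mathcal{C}$, called the projective model structure, with the following properties. (1) A map $\alpha$ in $\mathrm{Arr}\,\mathcal{C}$ is a weak equivalence (resp. fibration) if and only if $\mathrm{Ev}_0\alpha$ and $\mathrm{Ev}_1\alpha$ are weak equivalences (resp. fibrations) in $\mathcal{C}$. (2) A map $\alpha\colon f\to g$ is a (trivial) cofibration if and only if the maps $\mathrm{Ev}_0\alpha$ and $$\mathrm{Ev}_1 f\amalg_{\mathrm{Ev}_0 f}\mathrm{Ev}_0 g\xrightarrow{(\mathrm{Ev}_1\alpha,\,g)}\mathrm{Ev}_1 g$$ are (trivial) cofibrations in $\mathcal{C}$. In particular, if $\alpha$ is a cofibration in $\mathrm{Arr}\,\mathcal{C}$, then both $\mathrm{Ev}_0\alpha$ and $\mathrm{Ev}_1\alpha$ are cofibrations in $\mathcal{C}$. (3) The functors $L_0,L_1\colon\mathcal{C}\to\mathrm{Arr}\,\mathcal{C}$ are left Quillen functors, as are $\mathrm{Ev}_0$ and $\mathrm{Ev}_1$. (4) If $\mathcal{C}$ is cofibrantly generated, so is the projective model structure on $\mathrm{Arr}\,\mathcal{C}$. (5) If $\mathcal{C}$ is a cofibrantly generated symmetric monoidal model category, the pushout product monoidal structure and the projective model structure on $\mathrm{Arr}\,\mathcal{C}$ make $\mathrm{Arr}\,\mathcal{C}$ into a symmetric monoidal model category.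
   Context: Model categories and symmetric monoidal model categories are in the sense of Hovey's book "Model Categories": model categories are bicomplete; a symmetric monoidal model category is a closed symmetric monoidal category with a model structure satisfying the pushout product axiom and the unit axiom (if $QS\to S$ is a cofibrant replacement of the unit $S$, then $QS\otimes A\to A$ is a weak equivalence for all cofibrant $A$). $\mathrm{Arr}\,\mathcal{C}$ is the category whose objects are morphisms of $\mathcal{C}$ and whose morphisms are commutative squares. $\mathrm{Ev}_0,\mathrm{Ev}_1\colon\mathrm{Arr}\,\mathcal{C}\to\mathcal{C}$ send $f\colon X_0\to X_1$ to $X_0$ and $X_1$ respectively. Their left adjoints are $L_0(X)=(1_X\colon X\to X)$ and $L_1(X)=(0\to X)$, with $0$ initial; their right adjoints are $U_0(X)=(X\to * )$ and $U_1(X)=1_X$, with $*$ terminal. The pushout product monoidal structure on $\mathrm{Arr}\,\mathcal{C}$ has, for $f\colon X_0\to X_1$ and $g\colon Y_0\to Y_1$, product $f\mathbin{\square} g\colon (X_0\otimes Y_1)\amalg_{X_0\otimes Y_0}(X_1\otimes Y_0)\to X_1\otimes Y_1$ and unit $0\to S$. *)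

theory Defs
  imports "HOL-Library.Equipollence"
begin

section \<open>Categories and functors\<close>

text \<open>
  Equations between arrows are only ever imposed on carriers; the values of the record fields
  outside \<open>Obj\<close> and \<open>Arr\<close>, or on pairs that are not composable, are irrelevant.
\<close>

record ('o, 'm) cat =
  Obj :: "'o set"
  Arr :: "'m set"
  Dom :: "'m \<Rightarrow> 'o"
  Cod :: "'m \<Rightarrow> 'o"
  Idt :: "'o \<Rightarrow> 'm"
  Cmp :: "'m \<Rightarrow> 'm \<Rightarrow> 'm"  (infixr \<open>\<cdot>\<index>\<close> 70)

definition hom :: "('o, 'm) cat \<Rightarrow> 'o \<Rightarrow> 'o \<Rightarrow> 'm set" where
  "hom C a b = {f \<in> Arr C. Dom C f = a \<and> Cod C f = b}"

definition is_category :: "('o, 'm) cat \<Rightarrow> bool" where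
  "is_category C \<longleftrightarrow>
     (\<forall>f\<in>Arr C. Dom C f \<in> Obj C \<and> Cod C f \<in> Obj C) \<and>
     (\<forall>a\<in>Obj C. Idt C a \<in> hom C a a) \<and>
     (\<forall>a b c f g. f \<in> hom C a b \<longrightarrow> g \<in> hom C b c \<longrightarrow> g \<cdot>\<^bsub>C\<^esub> f \<in> hom C a c) \<and>
     (\<forall>a b f. f \<in> hom C a b \<longrightarrow> f \<cdot>\<^bsub>C\<^esub> Idt C a = f \<and> Idt C b \<cdot>\<^bsub>C\<^esub> f = f) \<and>
     (\<forall>a b c d f g h. f \<in> hom C a b \<longrightarrow> g \<in> hom C b c \<longrightarrow> h \<in> hom C c d \<longrightarrow>
        (h \<cdot>\<^bsub>C\<^esub> g) \<cdot>\<^bsub>C\<^esub> f = h \<cdot>\<^bsub>C\<^esub> (g \<cdot>\<^bsub>C\<^esub> f))"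

definition is_iso :: "('o, 'm) cat \<Rightarrow> 'm \<Rightarrow> bool" where
  "is_iso C f \<longleftrightarrow> f \<in> Arr C \<and>
     (\<exists>g \<in> hom C (Cod C f) (Dom C f). g \<cdot>\<^bsub>C\<^esub> f = Idt C (Dom C f) \<and> f \<cdot>\<^bsub>C\<^esub> g = Idt C (Cod C f))"

record ('o1, 'm1, 'o2, 'm2) cfunctor =
  fob :: "'o1 \<Rightarrow> 'o2"
  far :: "'m1 \<Rightarrow> 'm2"

definition is_functor ::
  "('o1, 'm1) cat \<Rightarrow> ('o2, 'm2) cat \<Rightarrow> ('o1, 'm1, 'o2, 'm2) cfunctor \<Rightarrow> bool" where
  "is_functor C D F \<longleftrightarrow>
     (\<forall>a\<in>Obj C. fob F a \<in> Obj D) \<and>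
     (\<forall>a b f. f \<in> hom C a b \<longrightarrow> far F f \<in> hom D (fob F a) (fob F b)) \<and>
     (\<forall>a\<in>Obj C. far F (Idt C a) = Idt D (fob F a)) \<and>
     (\<forall>a b c f g. f \<in> hom C a b \<longrightarrow> g \<in> hom C b c \<longrightarrow>
        far F (g \<cdot>\<^bsub>C\<^esub> f) = far F g \<cdot>\<^bsub>D\<^esub> far F f)"

definition adjunction ::
  "('o1, 'm1) cat \<Rightarrow> ('o2, 'm2) cat \<Rightarrow> ('o1, 'm1, 'o2, 'm2) cfunctor \<Rightarrow> ('o2, 'm2, 'o1, 'm1) cfunctor
     \<Rightarrow> ('o1 \<Rightarrow> 'o2 \<Rightarrow> 'm2 \<Rightarrow> 'm1) \<Rightarrow> bool" where
  "adjunction C D F G \<phi> \<longleftrightarrow>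
     is_functor C D F \<and> is_functor D C G \<and>
     (\<forall>a\<in>Obj C. \<forall>b\<in>Obj D. bij_betw (\<phi> a b) (hom D (fob F a) b) (hom C a (fob G b))) \<and>
     (\<forall>a' a b b' u h v. u \<in> hom C a' a \<longrightarrow> h \<in> hom D (fob F a) b \<longrightarrow> v \<in> hom D b b' \<longrightarrow>
        \<phi> a' b' (v \<cdot>\<^bsub>D\<^esub> h \<cdot>\<^bsub>D\<^esub> far F u) = far G v \<cdot>\<^bsub>C\<^esub> \<phi> a b h \<cdot>\<^bsub>C\<^esub> u)"

definition left_adjoint ::
  "('o1, 'm1) cat \<Rightarrow> ('o2, 'm2) cat \<Rightarrow> ('o1, 'm1, 'o2, 'm2) cfunctor \<Rightarrow> bool" where
  "left_adjoint C D F \<longleftrightarrow> (\<exists>G \<phi>. adjunction C D F G \<phi>)"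


section \<open>Limits and colimits\<close>

text \<open>
  Size is measured against a type \<open>'u\<close>: a set is small if its cardinality is strictly below that of
  \<open>'u\<close>. If \<open>'u\<close> has inaccessible cardinality, these are the small sets of a Grothendieck universe.
  Infiniteness of \<open>'u\<close> makes all finite sets small. Local smallness of categories is not required.
\<close>

definition small :: "'u itself \<Rightarrow> 'a set \<Rightarrow> bool" where
  "small U A \<longleftrightarrow> A \<prec> (UNIV :: 'u set)"

definition is_cone ::
  "('j, 'k) cat \<Rightarrow> ('o, 'm) cat \<Rightarrow> ('j, 'k, 'o, 'm) cfunctor \<Rightarrow> 'o \<Rightarrow> ('j \<Rightarrow> 'm) \<Rightarrow> bool" where
  "is_cone J C F a t \<longleftrightarrow> a \<in> Obj C \<and>
     (\<forall>j\<in>Obj J. t j \<in> hom C a (fob F j)) \<and>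
     (\<forall>u\<in>Arr J. far F u \<cdot>\<^bsub>C\<^esub> t (Dom J u) = t (Cod J u))"

definition is_limit ::
  "('j, 'k) cat \<Rightarrow> ('o, 'm) cat \<Rightarrow> ('j, 'k, 'o, 'm) cfunctor \<Rightarrow> 'o \<Rightarrow> ('j \<Rightarrow> 'm) \<Rightarrow> bool" where
  "is_limit J C F a t \<longleftrightarrow> is_cone J C F a t \<and>
     (\<forall>b s. is_cone J C F b s \<longrightarrow> (\<exists>!h. h \<in> hom C b a \<and> (\<forall>j\<in>Obj J. t j \<cdot>\<^bsub>C\<^esub> h = s j)))"

definition is_cocone ::
  "('j, 'k) cat \<Rightarrow> ('o, 'm) cat \<Rightarrow> ('j, 'k, 'o, 'm) cfunctor \<Rightarrow> 'o \<Rightarrow> ('j \<Rightarrow> 'm) \<Rightarrow> bool" where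
  "is_cocone J C F a t \<longleftrightarrow> a \<in> Obj C \<and>
     (\<forall>j\<in>Obj J. t j \<in> hom C (fob F j) a) \<and>
     (\<forall>u\<in>Arr J. t (Cod J u) \<cdot>\<^bsub>C\<^esub> far F u = t (Dom J u))"

definition is_colimit ::
  "('j, 'k) cat \<Rightarrow> ('o, 'm) cat \<Rightarrow> ('j, 'k, 'o, 'm) cfunctor \<Rightarrow> 'o \<Rightarrow> ('j \<Rightarrow> 'm) \<Rightarrow> bool" where
  "is_colimit J C F a t \<longleftrightarrow> is_cocone J C F a t \<and>
     (\<forall>b s. is_cocone J C F b s \<longrightarrow> (\<exists>!h. h \<in> hom C a b \<and> (\<forall>j\<in>Obj J. h \<cdot>\<^bsub>C\<^esub> t j = s j)))"

text \<open>
  Every small category is isomorphic to one whose objects and arrows are elements of \<open>'u\<close>.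
\<close>

definition bicomplete :: "'u itself \<Rightarrow> ('o, 'm) cat \<Rightarrow> bool" where
  "bicomplete U C \<longleftrightarrow>
     (\<forall>(J :: ('u, 'u) cat) F. is_category J \<and> small U (Arr J) \<and> is_functor J C F \<longrightarrow>
        (\<exists>a t. is_limit J C F a t) \<and> (\<exists>a t. is_colimit J C F a t))"

definition is_initial :: "('o, 'm) cat \<Rightarrow> 'o \<Rightarrow> bool" where
  "is_initial C z \<longleftrightarrow> z \<in> Obj C \<and> (\<forall>a\<in>Obj C. \<exists>!f. f \<in> hom C z a)"

definition init :: "('o, 'm) cat \<Rightarrow> 'o" where
  "init C = (SOME z. is_initial C z)"

definition from_init :: "('o, 'm) cat \<Rightarrow> 'o \<Rightarrow> 'm" where
  "from_init C a = (THE f. f \<in> hom C (init C) a)"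

definition is_pushout :: "('o, 'm) cat \<Rightarrow> 'm \<Rightarrow> 'm \<Rightarrow> 'm \<Rightarrow> 'm \<Rightarrow> bool" where
  "is_pushout C f g p q \<longleftrightarrow>
     (\<exists>a b c d. f \<in> hom C a b \<and> g \<in> hom C a c \<and> p \<in> hom C b d \<and> q \<in> hom C c d \<and>
        p \<cdot>\<^bsub>C\<^esub> f = q \<cdot>\<^bsub>C\<^esub> g \<and>
        (\<forall>e u v. u \<in> hom C b e \<longrightarrow> v \<in> hom C c e \<longrightarrow> u \<cdot>\<^bsub>C\<^esub> f = v \<cdot>\<^bsub>C\<^esub> g \<longrightarrow>
           (\<exists>!h. h \<in> hom C d e \<and> h \<cdot>\<^bsub>C\<^esub> p = u \<and> h \<cdot>\<^bsub>C\<^esub> q = v)))"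

text \<open>
  A chosen pushout of each span, and the arrow \<open>(u, v)\<close> out of it induced by a commutative square.
\<close>

definition po :: "('o, 'm) cat \<Rightarrow> 'm \<Rightarrow> 'm \<Rightarrow> 'm \<times> 'm" where
  "po C f g = (SOME (p, q). is_pushout C f g p q)"

definition po_in1 :: "('o, 'm) cat \<Rightarrow> 'm \<Rightarrow> 'm \<Rightarrow> 'm" where
  "po_in1 C f g = fst (po C f g)"

definition po_in2 :: "('o, 'm) cat \<Rightarrow> 'm \<Rightarrow> 'm \<Rightarrow> 'm" where
  "po_in2 C f g = snd (po C f g)"

definition po_map :: "('o, 'm) cat \<Rightarrow> 'm \<Rightarrow> 'm \<Rightarrow> 'm \<Rightarrow> 'm \<Rightarrow> 'm" where
  "po_map C f g u v = (THE h. h \<in> hom C (Cod C (po_in1 C f g)) (Cod C u) \<and>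
     h \<cdot>\<^bsub>C\<^esub> po_in1 C f g = u \<and> h \<cdot>\<^bsub>C\<^esub> po_in2 C f g = v)"


section \<open>The category of arrows\<close>

text \<open>
  \<open>Square f g u v\<close> is the morphism \<open>f \<rightarrow> g\<close> with components \<open>u = Ev\<^sub>0\<close> and \<open>v = Ev\<^sub>1\<close>.
\<close>

datatype 'm square = Square (sq_src: 'm) (sq_tgt: 'm) (sq0: 'm) (sq1: 'm)

definition arrow_cat :: "('o, 'm) cat \<Rightarrow> ('m, 'm square) cat" where
  "arrow_cat C = \<lparr>
     Obj = Arr C,
     Arr = {Square f g u v | f g u v. f \<in> Arr C \<and> g \<in> Arr C \<and>
              u \<in> hom C (Dom C f) (Dom C g) \<and> v \<in> hom C (Cod C f) (Cod C g) \<and>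
              v \<cdot>\<^bsub>C\<^esub> f = g \<cdot>\<^bsub>C\<^esub> u},
     Dom = sq_src,
     Cod = sq_tgt,
     Idt = (\<lambda>f. Square f f (Idt C (Dom C f)) (Idt C (Cod C f))),
     Cmp = (\<lambda>t s. Square (sq_src s) (sq_tgt t) (sq0 t \<cdot>\<^bsub>C\<^esub> sq0 s) (sq1 t \<cdot>\<^bsub>C\<^esub> sq1 s)) \<rparr>"

definition Ev0 :: "('o, 'm) cat \<Rightarrow> ('m, 'm square, 'o, 'm) cfunctor" where
  "Ev0 C = \<lparr>fob = Dom C, far = sq0\<rparr>"

definition Ev1 :: "('o, 'm) cat \<Rightarrow> ('m, 'm square, 'o, 'm) cfunctor" where
  "Ev1 C = \<lparr>fob = Cod C, far = sq1\<rparr>"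

definition L0 :: "('o, 'm) cat \<Rightarrow> ('o, 'm, 'm, 'm square) cfunctor" where
  "L0 C = \<lparr>fob = Idt C, far = (\<lambda>u. Square (Idt C (Dom C u)) (Idt C (Cod C u)) u u)\<rparr>"

definition L1 :: "('o, 'm) cat \<Rightarrow> ('o, 'm, 'm, 'm square) cfunctor" where
  "L1 C = \<lparr>fob = from_init C,
           far = (\<lambda>u. Square (from_init C (Dom C u)) (from_init C (Cod C u)) (Idt C (init C)) u)\<rparr>"

text \<open>
  For \<open>\<alpha> : f \<rightarrow> g\<close>, the map \<open>(Ev\<^sub>1 \<alpha>, g)\<close> from the pushout of \<open>f\<close> and \<open>Ev\<^sub>0 \<alpha>\<close> to \<open>Ev\<^sub>1 g\<close>.
\<close>

definition corner :: "('o, 'm) cat \<Rightarrow> 'm square \<Rightarrow> 'm" where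
  "corner C \<alpha> = po_map C (sq_src \<alpha>) (sq0 \<alpha>) (sq1 \<alpha>) (sq_tgt \<alpha>)"


section \<open>Model categories\<close>

definition is_retract :: "('o, 'm) cat \<Rightarrow> 'm \<Rightarrow> 'm \<Rightarrow> bool" where
  "is_retract C f g \<longleftrightarrow> f \<in> Arr C \<and> g \<in> Arr C \<and>
     (\<exists>i \<in> hom (arrow_cat C) f g. \<exists>r \<in> hom (arrow_cat C) g f.
        r \<cdot>\<^bsub>arrow_cat C\<^esub> i = Idt (arrow_cat C) f)"

definition has_lifting :: "('o, 'm) cat \<Rightarrow> 'm \<Rightarrow> 'm \<Rightarrow> bool" where
  "has_lifting C i p \<longleftrightarrow>
     (\<forall>u v. Square i p u v \<in> Arr (arrow_cat C) \<longrightarrow>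
        (\<exists>h \<in> hom C (Cod C i) (Dom C p). h \<cdot>\<^bsub>C\<^esub> i = u \<and> p \<cdot>\<^bsub>C\<^esub> h = v))"

text \<open>
  A functorial factorization is a pair of endofunctors of the arrow category; the conditions on
  sources, targets and components say that they fit together as functors, not just objectwise.
\<close>

type_synonym 'm arrow_endofunctor = "('m, 'm square, 'm, 'm square) cfunctor"

definition functorial_factorization ::
  "('o, 'm) cat \<Rightarrow> 'm arrow_endofunctor \<times> 'm arrow_endofunctor \<Rightarrow> bool" where
  "functorial_factorization C F \<longleftrightarrow> (case F of (\<alpha>, \<beta>) \<Rightarrow>
     is_functor (arrow_cat C) (arrow_cat C) \<alpha> \<and> is_functor (arrow_cat C) (arrow_cat C) \<beta> \<and>
     (\<forall>f\<in>Arr C. Dom C (fob \<alpha> f) = Dom C f \<and> Cod C (fob \<alpha> f) = Dom C (fob \<beta> f) \<and>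
        Cod C (fob \<beta> f) = Cod C f \<and> fob \<beta> f \<cdot>\<^bsub>C\<^esub> fob \<alpha> f = f) \<and>
     (\<forall>s\<in>Arr (arrow_cat C). sq0 (far \<alpha> s) = sq0 s \<and> sq1 (far \<alpha> s) = sq0 (far \<beta> s) \<and>
        sq1 (far \<beta> s) = sq1 s))"

record 'm model_structure =
  weq :: "'m set"
  cof :: "'m set"
  fib :: "'m set"
  fact_cof :: "'m arrow_endofunctor \<times> 'm arrow_endofunctor"
  fact_fib :: "'m arrow_endofunctor \<times> 'm arrow_endofunctor"

definition subcategory :: "('o, 'm) cat \<Rightarrow> 'm set \<Rightarrow> bool" where
  "subcategory C S \<longleftrightarrow> S \<subseteq> Arr C \<and> (\<forall>a\<in>Obj C. Idt C a \<in> S) \<and>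
     (\<forall>f\<in>S. \<forall>g\<in>S. Dom C g = Cod C f \<longrightarrow> g \<cdot>\<^bsub>C\<^esub> f \<in> S)"

definition is_model_structure :: "('o, 'm) cat \<Rightarrow> 'm model_structure \<Rightarrow> bool" where
  "is_model_structure C M \<longleftrightarrow>
     subcategory C (weq M) \<and> subcategory C (cof M) \<and> subcategory C (fib M) \<and>
     functorial_factorization C (fact_cof M) \<and> functorial_factorization C (fact_fib M) \<and>
     (\<forall>f\<in>Arr C. \<forall>g\<in>Arr C. Dom C g = Cod C f \<longrightarrow>
        (f \<in> weq M \<and> g \<cdot>\<^bsub>C\<^esub> f \<in> weq M \<longrightarrow> g \<in> weq M) \<and>
        (g \<in> weq M \<and> g \<cdot>\<^bsub>C\<^esub> f \<in> weq M \<longrightarrow> f \<in> weq M)) \<and>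
     (\<forall>f g. is_retract C f g \<longrightarrow>
        (g \<in> weq M \<longrightarrow> f \<in> weq M) \<and> (g \<in> cof M \<longrightarrow> f \<in> cof M) \<and> (g \<in> fib M \<longrightarrow> f \<in> fib M)) \<and>
     (\<forall>i \<in> cof M \<inter> weq M. \<forall>p \<in> fib M. has_lifting C i p) \<and>
     (\<forall>i \<in> cof M. \<forall>p \<in> fib M \<inter> weq M. has_lifting C i p) \<and>
     (\<forall>f\<in>Arr C. fob (fst (fact_cof M)) f \<in> cof M \<and> fob (snd (fact_cof M)) f \<in> fib M \<inter> weq M) \<and>
     (\<forall>f\<in>Arr C. fob (fst (fact_fib M)) f \<in> cof M \<inter> weq M \<and> fob (snd (fact_fib M)) f \<in> fib M)"

definition model_category :: "'u itself \<Rightarrow> ('o, 'm) cat \<Rightarrow> 'm model_structure \<Rightarrow> bool" where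
  "model_category U C M \<longleftrightarrow> is_category C \<and> bicomplete U C \<and> is_model_structure C M"

definition left_quillen ::
  "('o1, 'm1) cat \<Rightarrow> 'm1 model_structure \<Rightarrow> ('o2, 'm2) cat \<Rightarrow> 'm2 model_structure
     \<Rightarrow> ('o1, 'm1, 'o2, 'm2) cfunctor \<Rightarrow> bool" where
  "left_quillen C M D N F \<longleftrightarrow> left_adjoint C D F \<and>
     (\<forall>f \<in> cof M. far F f \<in> cof N) \<and> (\<forall>f \<in> cof M \<inter> weq M. far F f \<in> cof N \<inter> weq N)"


section \<open>Transfinite composition and cofibrant generation\<close>

text \<open>
  Small ordinals are represented by well-orders \<open>r\<close> on small subsets of \<open>'u\<close>, and small cardinals by
  small subsets of \<open>'u\<close>.
\<close>

definition order_cat :: "'i rel \<Rightarrow> ('i, 'i \<times> 'i) cat" where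
  "order_cat r = \<lparr>Obj = Field r, Arr = r, Dom = fst, Cod = snd, Idt = (\<lambda>i. (i, i)),
     Cmp = (\<lambda>q p. (fst p, snd q))\<rparr>"

definition is_least :: "'i rel \<Rightarrow> 'i \<Rightarrow> bool" where
  "is_least r i \<longleftrightarrow> i \<in> Field r \<and> underS r i = {}"

definition is_succ :: "'i rel \<Rightarrow> 'i \<Rightarrow> 'i \<Rightarrow> bool" where
  "is_succ r i j \<longleftrightarrow> (i, j) \<in> r \<and> i \<noteq> j \<and> (\<forall>k. (i, k) \<in> r \<and> (k, j) \<in> r \<longrightarrow> k = i \<or> k = j)"

definition is_limit_elem :: "'i rel \<Rightarrow> 'i \<Rightarrow> bool" where
  "is_limit_elem r j \<longleftrightarrow> j \<in> Field r \<and> \<not> is_least r j \<and> (\<nexists>i. is_succ r i j)"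

definition ordinal_sequence :: "'i rel \<Rightarrow> ('o, 'm) cat \<Rightarrow> ('i, 'i \<times> 'i, 'o, 'm) cfunctor \<Rightarrow> bool" where
  "ordinal_sequence r C X \<longleftrightarrow> Well_order r \<and> is_functor (order_cat r) C X \<and>
     (\<forall>j. is_limit_elem r j \<longrightarrow>
        is_colimit (order_cat (Restr r (underS r j))) C X (fob X j) (\<lambda>i. far X (i, j)))"

definition sequence_of ::
  "'i rel \<Rightarrow> ('o, 'm) cat \<Rightarrow> 'm set \<Rightarrow> ('i, 'i \<times> 'i, 'o, 'm) cfunctor \<Rightarrow> bool" where
  "sequence_of r C S X \<longleftrightarrow> ordinal_sequence r C X \<and> (\<forall>i j. is_succ r i j \<longrightarrow> far X (i, j) \<in> S)"

definition transfinite_compositions :: "'u itself \<Rightarrow> ('o, 'm) cat \<Rightarrow> 'm set \<Rightarrow> 'm set" where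
  "transfinite_compositions U C S =
     {t z | (r :: 'u rel) X a t z. small U (Field r) \<and> sequence_of r C S X \<and>
        is_colimit (order_cat r) C X a t \<and> is_least r z}"

definition pushouts :: "('o, 'm) cat \<Rightarrow> 'm set \<Rightarrow> 'm set" where
  "pushouts C S = {q. \<exists>f\<in>S. \<exists>g p. is_pushout C f g p q}"

definition rel_cell :: "'u itself \<Rightarrow> ('o, 'm) cat \<Rightarrow> 'm set \<Rightarrow> 'm set" where
  "rel_cell U C I = transfinite_compositions U C (pushouts C I)"

definition inj_maps :: "('o, 'm) cat \<Rightarrow> 'm set \<Rightarrow> 'm set" where
  "inj_maps C I = {p \<in> Arr C. \<forall>i\<in>I. has_lifting C i p}"

text \<open>
  A limit ordinal in which every subset of cardinality at most \<open>|K|\<close> has supremum below the ordinal.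
\<close>

definition filtered_ordinal :: "'u set \<Rightarrow> 'u rel \<Rightarrow> bool" where
  "filtered_ordinal K r \<longleftrightarrow> Well_order r \<and> Field r \<noteq> {} \<and>
     (\<forall>i\<in>Field r. \<exists>j. (i, j) \<in> r \<and> i \<noteq> j) \<and>
     (\<forall>A \<subseteq> Field r. A \<lesssim> K \<longrightarrow> (\<exists>j\<in>Field r. \<forall>i\<in>A. (i, j) \<in> r))"

text \<open>
  The colimit of the sets \<open>hom C A (X i)\<close>, as a quotient of their disjoint union. The order being
  total, two elements are identified iff they become equal at some later stage.
\<close>

definition hom_sum ::
  "'i rel \<Rightarrow> ('o, 'm) cat \<Rightarrow> 'o \<Rightarrow> ('i, 'i \<times> 'i, 'o, 'm) cfunctor \<Rightarrow> ('i \<times> 'm) set" where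
  "hom_sum r C A X = (SIGMA i : Field r. hom C A (fob X i))"

definition hom_rel ::
  "'i rel \<Rightarrow> ('o, 'm) cat \<Rightarrow> 'o \<Rightarrow> ('i, 'i \<times> 'i, 'o, 'm) cfunctor \<Rightarrow> ('i \<times> 'm) rel" where
  "hom_rel r C A X = {((i, k), (j, l)) | i k j l.
     (i, k) \<in> hom_sum r C A X \<and> (j, l) \<in> hom_sum r C A X \<and>
     (\<exists>n. (i, n) \<in> r \<and> (j, n) \<in> r \<and> far X (i, n) \<cdot>\<^bsub>C\<^esub> k = far X (j, n) \<cdot>\<^bsub>C\<^esub> l)}"

definition hom_colim ::
  "'i rel \<Rightarrow> ('o, 'm) cat \<Rightarrow> 'o \<Rightarrow> ('i, 'i \<times> 'i, 'o, 'm) cfunctor \<Rightarrow> ('i \<times> 'm) set set" where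
  "hom_colim r C A X = hom_sum r C A X // hom_rel r C A X"

definition hom_colim_map :: "('o, 'm) cat \<Rightarrow> ('i \<Rightarrow> 'm) \<Rightarrow> ('i \<times> 'm) set \<Rightarrow> 'm" where
  "hom_colim_map C t c = the_elem ((\<lambda>(i, k). t i \<cdot>\<^bsub>C\<^esub> k) ` c)"

definition small_relative :: "'u itself \<Rightarrow> ('o, 'm) cat \<Rightarrow> 'o \<Rightarrow> 'm set \<Rightarrow> bool" where
  "small_relative U C A S \<longleftrightarrow> (\<exists>K :: 'u set. small U K \<and>
     (\<forall>(r :: 'u rel) X a t. small U (Field r) \<and> filtered_ordinal K r \<and> sequence_of r C S X \<and>
        is_colimit (order_cat r) C X a t \<longrightarrow>
        bij_betw (hom_colim_map C t) (hom_colim r C A X) (hom C A a)))"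

definition cofibrantly_generated :: "'u itself \<Rightarrow> ('o, 'm) cat \<Rightarrow> 'm model_structure \<Rightarrow> bool" where
  "cofibrantly_generated U C M \<longleftrightarrow> model_category U C M \<and>
     (\<exists>I J. I \<subseteq> Arr C \<and> J \<subseteq> Arr C \<and> small U I \<and> small U J \<and>
        (\<forall>i\<in>I. small_relative U C (Dom C i) (rel_cell U C I)) \<and>
        (\<forall>j\<in>J. small_relative U C (Dom C j) (rel_cell U C J)) \<and>
        fib M = inj_maps C J \<and> fib M \<inter> weq M = inj_maps C I)"


section \<open>Symmetric monoidal model categories\<close>

record ('o, 'm) monoidal =
  tob :: "'o \<Rightarrow> 'o \<Rightarrow> 'o"  (infixr \<open>\<otimes>\<index>\<close> 75)
  tar :: "'m \<Rightarrow> 'm \<Rightarrow> 'm"  (infixr \<open>\<otimes>\<^sub>a\<index>\<close> 75)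
  unt :: 'o
  asc :: "'o \<Rightarrow> 'o \<Rightarrow> 'o \<Rightarrow> 'm"
  lun :: "'o \<Rightarrow> 'm"
  run :: "'o \<Rightarrow> 'm"
  brd :: "'o \<Rightarrow> 'o \<Rightarrow> 'm"

definition is_bifunctor :: "('o, 'm) cat \<Rightarrow> ('o, 'm) monoidal \<Rightarrow> bool" where
  "is_bifunctor C T \<longleftrightarrow>
     (\<forall>X\<in>Obj C. \<forall>Y\<in>Obj C. X \<otimes>\<^bsub>T\<^esub> Y \<in> Obj C \<and>
        Idt C X \<otimes>\<^sub>a\<^bsub>T\<^esub> Idt C Y = Idt C (X \<otimes>\<^bsub>T\<^esub> Y)) \<and>
     (\<forall>f\<in>Arr C. \<forall>g\<in>Arr C.
        f \<otimes>\<^sub>a\<^bsub>T\<^esub> g \<in> hom C (Dom C f \<otimes>\<^bsub>T\<^esub> Dom C g) (Cod C f \<otimes>\<^bsub>T\<^esub> Cod C g)) \<and>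
     (\<forall>f\<in>Arr C. \<forall>f'\<in>Arr C. \<forall>g\<in>Arr C. \<forall>g'\<in>Arr C.
        Dom C f' = Cod C f \<longrightarrow> Dom C g' = Cod C g \<longrightarrow>
        (f' \<cdot>\<^bsub>C\<^esub> f) \<otimes>\<^sub>a\<^bsub>T\<^esub> (g' \<cdot>\<^bsub>C\<^esub> g) = (f' \<otimes>\<^sub>a\<^bsub>T\<^esub> g') \<cdot>\<^bsub>C\<^esub> (f \<otimes>\<^sub>a\<^bsub>T\<^esub> g))"

definition is_monoidal :: "('o, 'm) cat \<Rightarrow> ('o, 'm) monoidal \<Rightarrow> bool" where
  "is_monoidal C T \<longleftrightarrow> is_bifunctor C T \<and> unt T \<in> Obj C \<and>
     (\<forall>X\<in>Obj C. \<forall>Y\<in>Obj C. \<forall>Z\<in>Obj C.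
        asc T X Y Z \<in> hom C ((X \<otimes>\<^bsub>T\<^esub> Y) \<otimes>\<^bsub>T\<^esub> Z) (X \<otimes>\<^bsub>T\<^esub> (Y \<otimes>\<^bsub>T\<^esub> Z)) \<and> is_iso C (asc T X Y Z)) \<and>
     (\<forall>X\<in>Obj C. lun T X \<in> hom C (unt T \<otimes>\<^bsub>T\<^esub> X) X \<and> is_iso C (lun T X)) \<and>
     (\<forall>X\<in>Obj C. run T X \<in> hom C (X \<otimes>\<^bsub>T\<^esub> unt T) X \<and> is_iso C (run T X)) \<and>
     (\<forall>f\<in>Arr C. \<forall>g\<in>Arr C. \<forall>h\<in>Arr C.
        asc T (Cod C f) (Cod C g) (Cod C h) \<cdot>\<^bsub>C\<^esub> ((f \<otimes>\<^sub>a\<^bsub>T\<^esub> g) \<otimes>\<^sub>a\<^bsub>T\<^esub> h) =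
        (f \<otimes>\<^sub>a\<^bsub>T\<^esub> (g \<otimes>\<^sub>a\<^bsub>T\<^esub> h)) \<cdot>\<^bsub>C\<^esub> asc T (Dom C f) (Dom C g) (Dom C h)) \<and>
     (\<forall>f\<in>Arr C. lun T (Cod C f) \<cdot>\<^bsub>C\<^esub> (Idt C (unt T) \<otimes>\<^sub>a\<^bsub>T\<^esub> f) = f \<cdot>\<^bsub>C\<^esub> lun T (Dom C f)) \<and>
     (\<forall>f\<in>Arr C. run T (Cod C f) \<cdot>\<^bsub>C\<^esub> (f \<otimes>\<^sub>a\<^bsub>T\<^esub> Idt C (unt T)) = f \<cdot>\<^bsub>C\<^esub> run T (Dom C f)) \<and>
     (\<forall>W\<in>Obj C. \<forall>X\<in>Obj C. \<forall>Y\<in>Obj C. \<forall>Z\<in>Obj C.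
        asc T W X (Y \<otimes>\<^bsub>T\<^esub> Z) \<cdot>\<^bsub>C\<^esub> asc T (W \<otimes>\<^bsub>T\<^esub> X) Y Z =
        (Idt C W \<otimes>\<^sub>a\<^bsub>T\<^esub> asc T X Y Z) \<cdot>\<^bsub>C\<^esub> asc T W (X \<otimes>\<^bsub>T\<^esub> Y) Z \<cdot>\<^bsub>C\<^esub>
          (asc T W X Y \<otimes>\<^sub>a\<^bsub>T\<^esub> Idt C Z)) \<and>
     (\<forall>X\<in>Obj C. \<forall>Y\<in>Obj C.
        (Idt C X \<otimes>\<^sub>a\<^bsub>T\<^esub> lun T Y) \<cdot>\<^bsub>C\<^esub> asc T X (unt T) Y = run T X \<otimes>\<^sub>a\<^bsub>T\<^esub> Idt C Y)"

definition is_symmetric_monoidal :: "('o, 'm) cat \<Rightarrow> ('o, 'm) monoidal \<Rightarrow> bool" where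
  "is_symmetric_monoidal C T \<longleftrightarrow> is_monoidal C T \<and>
     (\<forall>X\<in>Obj C. \<forall>Y\<in>Obj C. brd T X Y \<in> hom C (X \<otimes>\<^bsub>T\<^esub> Y) (Y \<otimes>\<^bsub>T\<^esub> X) \<and>
        brd T Y X \<cdot>\<^bsub>C\<^esub> brd T X Y = Idt C (X \<otimes>\<^bsub>T\<^esub> Y)) \<and>
     (\<forall>f\<in>Arr C. \<forall>g\<in>Arr C.
        brd T (Cod C f) (Cod C g) \<cdot>\<^bsub>C\<^esub> (f \<otimes>\<^sub>a\<^bsub>T\<^esub> g) =
        (g \<otimes>\<^sub>a\<^bsub>T\<^esub> f) \<cdot>\<^bsub>C\<^esub> brd T (Dom C f) (Dom C g)) \<and>
     (\<forall>X\<in>Obj C. lun T X \<cdot>\<^bsub>C\<^esub> brd T X (unt T) = run T X) \<and>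
     (\<forall>X\<in>Obj C. \<forall>Y\<in>Obj C. \<forall>Z\<in>Obj C.
        asc T Y Z X \<cdot>\<^bsub>C\<^esub> brd T X (Y \<otimes>\<^bsub>T\<^esub> Z) \<cdot>\<^bsub>C\<^esub> asc T X Y Z =
        (Idt C Y \<otimes>\<^sub>a\<^bsub>T\<^esub> brd T X Z) \<cdot>\<^bsub>C\<^esub> asc T Y X Z \<cdot>\<^bsub>C\<^esub> (brd T X Y \<otimes>\<^sub>a\<^bsub>T\<^esub> Idt C Z))"

definition tensor_right :: "('o, 'm) cat \<Rightarrow> ('o, 'm) monoidal \<Rightarrow> 'o \<Rightarrow> ('o, 'm, 'o, 'm) cfunctor" where
  "tensor_right C T X = \<lparr>fob = (\<lambda>Y. Y \<otimes>\<^bsub>T\<^esub> X), far = (\<lambda>f. f \<otimes>\<^sub>a\<^bsub>T\<^esub> Idt C X)\<rparr>"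

definition is_closed_symmetric_monoidal :: "('o, 'm) cat \<Rightarrow> ('o, 'm) monoidal \<Rightarrow> bool" where
  "is_closed_symmetric_monoidal C T \<longleftrightarrow> is_symmetric_monoidal C T \<and>
     (\<forall>X\<in>Obj C. left_adjoint C C (tensor_right C T X))"

text \<open>
  The pushout product of \<open>f : X\<^sub>0 \<rightarrow> X\<^sub>1\<close> and \<open>g : Y\<^sub>0 \<rightarrow> Y\<^sub>1\<close>; \<open>pp_in1\<close> and \<open>pp_in2\<close> are the
  inclusions of \<open>X\<^sub>0 \<otimes> Y\<^sub>1\<close> and \<open>X\<^sub>1 \<otimes> Y\<^sub>0\<close> into its domain, and \<open>pp_map\<close> the map out of the domain
  with given restrictions to these two.
\<close>

definition pp_in1 :: "('o, 'm) cat \<Rightarrow> ('o, 'm) monoidal \<Rightarrow> 'm \<Rightarrow> 'm \<Rightarrow> 'm" where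
  "pp_in1 C T f g = po_in1 C (Idt C (Dom C f) \<otimes>\<^sub>a\<^bsub>T\<^esub> g) (f \<otimes>\<^sub>a\<^bsub>T\<^esub> Idt C (Dom C g))"

definition pp_in2 :: "('o, 'm) cat \<Rightarrow> ('o, 'm) monoidal \<Rightarrow> 'm \<Rightarrow> 'm \<Rightarrow> 'm" where
  "pp_in2 C T f g = po_in2 C (Idt C (Dom C f) \<otimes>\<^sub>a\<^bsub>T\<^esub> g) (f \<otimes>\<^sub>a\<^bsub>T\<^esub> Idt C (Dom C g))"

definition pp_map :: "('o, 'm) cat \<Rightarrow> ('o, 'm) monoidal \<Rightarrow> 'm \<Rightarrow> 'm \<Rightarrow> 'm \<Rightarrow> 'm \<Rightarrow> 'm" where
  "pp_map C T f g u v = po_map C (Idt C (Dom C f) \<otimes>\<^sub>a\<^bsub>T\<^esub> g) (f \<otimes>\<^sub>a\<^bsub>T\<^esub> Idt C (Dom C g)) u v"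

definition pushout_product :: "('o, 'm) cat \<Rightarrow> ('o, 'm) monoidal \<Rightarrow> 'm \<Rightarrow> 'm \<Rightarrow> 'm" where
  "pushout_product C T f g =
     pp_map C T f g (f \<otimes>\<^sub>a\<^bsub>T\<^esub> Idt C (Cod C g)) (Idt C (Cod C f) \<otimes>\<^sub>a\<^bsub>T\<^esub> g)"

definition cofibrant :: "('o, 'm) cat \<Rightarrow> 'm model_structure \<Rightarrow> 'o \<Rightarrow> bool" where
  "cofibrant C M A \<longleftrightarrow> A \<in> Obj C \<and> from_init C A \<in> cof M"

definition pushout_product_axiom ::
  "('o, 'm) cat \<Rightarrow> 'm model_structure \<Rightarrow> ('o, 'm) monoidal \<Rightarrow> bool" where
  "pushout_product_axiom C M T \<longleftrightarrow>
     (\<forall>f \<in> cof M. \<forall>g \<in> cof M. pushout_product C T f g \<in> cof M \<and>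
        (f \<in> weq M \<or> g \<in> weq M \<longrightarrow> pushout_product C T f g \<in> weq M))"

text \<open>
  A cofibrant replacement of the unit is any weak equivalence to it from a cofibrant object. The map
  required to be a weak equivalence is \<open>Q \<otimes> A \<rightarrow> S \<otimes> A \<rightarrow> A\<close>.
\<close>

definition unit_axiom ::
  "('o, 'm) cat \<Rightarrow> 'm model_structure \<Rightarrow> ('o, 'm) monoidal \<Rightarrow> bool" where
  "unit_axiom C M T \<longleftrightarrow>
     (\<forall>Q q. cofibrant C M Q \<and> q \<in> hom C Q (unt T) \<and> q \<in> weq M \<longrightarrow>
        (\<forall>A. cofibrant C M A \<longrightarrow> lun T A \<cdot>\<^bsub>C\<^esub> (q \<otimes>\<^sub>a\<^bsub>T\<^esub> Idt C A) \<in> weq M))"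

definition symmetric_monoidal_model_category ::
  "'u itself \<Rightarrow> ('o, 'm) cat \<Rightarrow> 'm model_structure \<Rightarrow> ('o, 'm) monoidal \<Rightarrow> bool" where
  "symmetric_monoidal_model_category U C M T \<longleftrightarrow>
     model_category U C M \<and> is_closed_symmetric_monoidal C T \<and>
     pushout_product_axiom C M T \<and> unit_axiom C M T"


section \<open>The pushout product monoidal structure\<close>

text \<open>
  The structure isomorphisms are the canonical ones: on \<open>Ev\<^sub>1\<close> they are those of \<open>C\<close>, and on \<open>Ev\<^sub>0\<close>
  they are induced by those of \<open>C\<close> on the pieces from which the domains are glued. For the
  associator these pieces are \<open>X\<^sub>0 \<otimes> Y\<^sub>1 \<otimes> Z\<^sub>1\<close>, \<open>X\<^sub>1 \<otimes> Y\<^sub>0 \<otimes> Z\<^sub>1\<close> and \<open>X\<^sub>1 \<otimes> Y\<^sub>1 \<otimes> Z\<^sub>0\<close>. For the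
  unitors only one piece needs mention, the other being \<open>0\<close> tensored with an object, hence initial
  when the structure is closed.
\<close>

definition pp_square :: "('o, 'm) cat \<Rightarrow> ('o, 'm) monoidal \<Rightarrow> 'm square \<Rightarrow> 'm square \<Rightarrow> 'm square" where
  "pp_square C T a b = Square
     (pushout_product C T (sq_src a) (sq_src b))
     (pushout_product C T (sq_tgt a) (sq_tgt b))
     (pp_map C T (sq_src a) (sq_src b)
        (pp_in1 C T (sq_tgt a) (sq_tgt b) \<cdot>\<^bsub>C\<^esub> (sq0 a \<otimes>\<^sub>a\<^bsub>T\<^esub> sq1 b))
        (pp_in2 C T (sq_tgt a) (sq_tgt b) \<cdot>\<^bsub>C\<^esub> (sq1 a \<otimes>\<^sub>a\<^bsub>T\<^esub> sq0 b)))
     (sq1 a \<otimes>\<^sub>a\<^bsub>T\<^esub> sq1 b)"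

definition pp_unit :: "('o, 'm) cat \<Rightarrow> ('o, 'm) monoidal \<Rightarrow> 'm" where
  "pp_unit C T = from_init C (unt T)"

definition pp_assoc :: "('o, 'm) cat \<Rightarrow> ('o, 'm) monoidal \<Rightarrow> 'm \<Rightarrow> 'm \<Rightarrow> 'm \<Rightarrow> 'm square" where
  "pp_assoc C T f g h =
     (let fg = pushout_product C T f g; gh = pushout_product C T g h;
          l = pushout_product C T fg h; r = pushout_product C T f gh
      in Square l r
        (THE w. w \<in> hom C (Dom C l) (Dom C r) \<and>
           w \<cdot>\<^bsub>C\<^esub> pp_in1 C T fg h \<cdot>\<^bsub>C\<^esub> (pp_in1 C T f g \<otimes>\<^sub>a\<^bsub>T\<^esub> Idt C (Cod C h)) =
             pp_in1 C T f gh \<cdot>\<^bsub>C\<^esub> asc T (Dom C f) (Cod C g) (Cod C h) \<and>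
           w \<cdot>\<^bsub>C\<^esub> pp_in1 C T fg h \<cdot>\<^bsub>C\<^esub> (pp_in2 C T f g \<otimes>\<^sub>a\<^bsub>T\<^esub> Idt C (Cod C h)) =
             pp_in2 C T f gh \<cdot>\<^bsub>C\<^esub> (Idt C (Cod C f) \<otimes>\<^sub>a\<^bsub>T\<^esub> pp_in1 C T g h) \<cdot>\<^bsub>C\<^esub>
               asc T (Cod C f) (Dom C g) (Cod C h) \<and>
           w \<cdot>\<^bsub>C\<^esub> pp_in2 C T fg h =
             pp_in2 C T f gh \<cdot>\<^bsub>C\<^esub> (Idt C (Cod C f) \<otimes>\<^sub>a\<^bsub>T\<^esub> pp_in2 C T g h) \<cdot>\<^bsub>C\<^esub>
               asc T (Cod C f) (Cod C g) (Dom C h))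
        (asc T (Cod C f) (Cod C g) (Cod C h)))"

definition pp_lunit :: "('o, 'm) cat \<Rightarrow> ('o, 'm) monoidal \<Rightarrow> 'm \<Rightarrow> 'm square" where
  "pp_lunit C T g =
     (let l = pushout_product C T (pp_unit C T) g
      in Square l g
        (THE w. w \<in> hom C (Dom C l) (Dom C g) \<and>
           w \<cdot>\<^bsub>C\<^esub> pp_in2 C T (pp_unit C T) g = lun T (Dom C g))
        (lun T (Cod C g)))"

definition pp_runit :: "('o, 'm) cat \<Rightarrow> ('o, 'm) monoidal \<Rightarrow> 'm \<Rightarrow> 'm square" where
  "pp_runit C T f =
     (let l = pushout_product C T f (pp_unit C T)
      in Square l f
        (THE w. w \<in> hom C (Dom C l) (Dom C f) \<and>
           w \<cdot>\<^bsub>C\<^esub> pp_in1 C T f (pp_unit C T) = run T (Dom C f))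
        (run T (Cod C f)))"

definition pp_sym :: "('o, 'm) cat \<Rightarrow> ('o, 'm) monoidal \<Rightarrow> 'm \<Rightarrow> 'm \<Rightarrow> 'm square" where
  "pp_sym C T f g = Square (pushout_product C T f g) (pushout_product C T g f)
     (pp_map C T f g
        (pp_in2 C T g f \<cdot>\<^bsub>C\<^esub> brd T (Dom C f) (Cod C g))
        (pp_in1 C T g f \<cdot>\<^bsub>C\<^esub> brd T (Cod C f) (Dom C g)))
     (brd T (Cod C f) (Cod C g))"

definition pushout_product_monoidal :: "('o, 'm) cat \<Rightarrow> ('o, 'm) monoidal \<Rightarrow> ('m, 'm square) monoidal" where
  "pushout_product_monoidal C T = \<lparr>
     tob = pushout_product C T,
     tar = pp_square C T,
     unt = pp_unit C T,
     asc = pp_assoc C T,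
     lun = pp_lunit C T,
     run = pp_runit C T,
     brd = pp_sym C T \<rparr>"

end

theory Submission
  imports Defs
begin

text \<open>
  Weak equivalences and fibrations of squares are pointwise, and the cofibrations are the squares with
  the left lifting property against pointwise trivial fibrations. A square lifts against every
  pointwise member of a class containing the identities iff its component at \<open>0\<close> and its corner map
  lift against that class; this yields (2), and both factorizations are obtained by factoring first
  the component at \<open>0\<close> and then the resulting corner map.

  For (4) the generators are \<open>L\<^sub>0 I \<union> L\<^sub>1 I\<close>. Evaluating a cell complex built from them at \<open>0\<close> produces
  a transfinite composition of cells of \<open>I\<close> and isomorphisms, and collapsing the isomorphisms makes it
  a cell complex of \<open>I\<close>, so that smallness transfers along the adjunctions.

  For (5), the domain of \<open>f \<box> g\<close> is glued from \<open>X\<^sub>0 \<otimes> Y\<^sub>1\<close> and \<open>X\<^sub>1 \<otimes> Y\<^sub>0\<close>, whose inclusions are jointly epic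
  and stay so after tensoring because the structure is closed; all coherence equations are checked on
  these pieces. A lift out of a pushout product of two squares is built by three successive lifts in \<open>C\<close>.
\<close>

section \<open>Categories and arrow categories\<close>

text \<open>Because cofibrations of squares are defined by lifting, closure under composition and
  retracts is formal and (2) is a theorem about them; applied once to trivial fibrations and once to
  fibrations, the same criterion also covers the trivial case. Identities are required in the class
  because a map is tested in one place by a square whose other component is an identity.

  The obstacle in (4) is that a cell complex may take no step other than a pushout of a generator,
  whereas \<open>Ev0\<close> sends \<open>L1 i\<close> to the identity of the initial object, whose
  pushouts are isomorphisms. The indexing well-order itself has to be thinned out, limit stages
  included.

  In (5) every pushout is an arbitrary choice, so induced maps are known only through their
  restrictions to the pieces. The unit axiom is the delicate point: a cofibrant replacement of
  \<open>0 -> S\<close> has a component at 0 whose source is merely weakly equivalent to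
  \<open>0\<close>, and tensoring with that source must be shown to turn cofibrations into trivial
  ones.\<close>

lemma in_hom [simp]: "f \<in> hom C a b \<longleftrightarrow> f \<in> Arr C \<and> Dom C f = a \<and> Cod C f = b"
  by (simp add: hom_def)

locale category =
  fixes C :: "('o, 'm) cat" (structure)
  assumes is_category: "is_category C"
begin

lemma Dom_Obj [simp]: "f \<in> Arr C \<Longrightarrow> Dom C f \<in> Obj C"
  and Cod_Obj [simp]: "f \<in> Arr C \<Longrightarrow> Cod C f \<in> Obj C"
  using is_category by (simp_all add: is_category_def)

lemma Idt_Arr [simp]: "a \<in> Obj C \<Longrightarrow> Idt C a \<in> Arr C"
  and Dom_Idt [simp]: "a \<in> Obj C \<Longrightarrow> Dom C (Idt C a) = a"
  and Cod_Idt [simp]: "a \<in> Obj C \<Longrightarrow> Cod C (Idt C a) = a"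
  using is_category by (simp_all add: is_category_def)

lemma comp_hom: "f \<in> Arr C \<Longrightarrow> g \<in> Arr C \<Longrightarrow> Dom C g = Cod C f \<Longrightarrow>
    g \<cdot> f \<in> Arr C \<and> Dom C (g \<cdot> f) = Dom C f \<and> Cod C (g \<cdot> f) = Cod C g"
  using is_category unfolding is_category_def in_hom by blast

lemma comp_Arr [simp]: "f \<in> Arr C \<Longrightarrow> g \<in> Arr C \<Longrightarrow> Dom C g = Cod C f \<Longrightarrow> g \<cdot> f \<in> Arr C"
  and Dom_comp [simp]: "f \<in> Arr C \<Longrightarrow> g \<in> Arr C \<Longrightarrow> Dom C g = Cod C f \<Longrightarrow> Dom C (g \<cdot> f) = Dom C f"
  and Cod_comp [simp]: "f \<in> Arr C \<Longrightarrow> g \<in> Arr C \<Longrightarrow> Dom C g = Cod C f \<Longrightarrow> Cod C (g \<cdot> f) = Cod C g"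
  using comp_hom by auto

lemma comp_Idt [simp]: "f \<in> Arr C \<Longrightarrow> Dom C f = a \<Longrightarrow> f \<cdot> Idt C a = f"
  and Idt_comp [simp]: "f \<in> Arr C \<Longrightarrow> Cod C f = a \<Longrightarrow> Idt C a \<cdot> f = f"
  using is_category unfolding is_category_def in_hom by blast+

lemma comp_assoc [simp]: "f \<in> Arr C \<Longrightarrow> g \<in> Arr C \<Longrightarrow> h \<in> Arr C \<Longrightarrow>
    Dom C g = Cod C f \<Longrightarrow> Dom C h = Cod C g \<Longrightarrow> (h \<cdot> g) \<cdot> f = h \<cdot> (g \<cdot> f)"
  using is_category by (simp add: is_category_def)

text \<open>Composites are normalised to the right by \<open>comp_assoc\<close>, so an equation for
  a composite of two arrows no longer matches inside a longer one. This turns it into a rewriting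
  rule with a tail.\<close>

lemma reassoc: "g \<cdot> f = w \<Longrightarrow> g \<in> Arr C \<Longrightarrow> f \<in> Arr C \<Longrightarrow> x \<in> Arr C \<Longrightarrow>
    Dom C g = Cod C f \<Longrightarrow> Dom C f = Cod C x \<Longrightarrow> g \<cdot> (f \<cdot> x) = w \<cdot> x"
  using comp_assoc by metis

lemma is_isoI: "f \<in> Arr C \<Longrightarrow> g \<in> Arr C \<Longrightarrow> Dom C g = Cod C f \<Longrightarrow> Cod C g = Dom C f \<Longrightarrow>
    g \<cdot> f = Idt C (Dom C f) \<Longrightarrow> f \<cdot> g = Idt C (Cod C f) \<Longrightarrow> is_iso C f"
  by (auto simp: is_iso_def)

lemma is_isoE:
  assumes "is_iso C f"
  obtains g where "f \<in> Arr C" "g \<in> Arr C" "Dom C g = Cod C f" "Cod C g = Dom C f"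
    "g \<cdot> f = Idt C (Dom C f)" "f \<cdot> g = Idt C (Cod C f)"
  using assms by (auto simp: is_iso_def)

lemma is_iso_Idt [simp]: "a \<in> Obj C \<Longrightarrow> is_iso C (Idt C a)"
  by (rule is_isoI[where g = "Idt C a"]) auto

lemma is_iso_comp:
  assumes "is_iso C f" "is_iso C g" "Dom C g = Cod C f"
  shows "is_iso C (g \<cdot> f)"
proof -
  obtain f' where f: "f \<in> Arr C" "f' \<in> Arr C" "Dom C f' = Cod C f" "Cod C f' = Dom C f"
    "f' \<cdot> f = Idt C (Dom C f)" "f \<cdot> f' = Idt C (Cod C f)" by (rule is_isoE[OF assms(1)])
  obtain g' where g: "g \<in> Arr C" "g' \<in> Arr C" "Dom C g' = Cod C g" "Cod C g' = Dom C g"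
    "g' \<cdot> g = Idt C (Dom C g)" "g \<cdot> g' = Idt C (Cod C g)" by (rule is_isoE[OF assms(2)])
  show ?thesis
    by (rule is_isoI[where g = "f' \<cdot> g'"])
      (use f g assms(3) in \<open>simp_all add: reassoc[OF f(5)] reassoc[OF f(6)] reassoc[OF g(5)] reassoc[OF g(6)]\<close>)
qed

end

section \<open>Squares as morphisms of the arrow category\<close>

lemma arrow_cat_simps [simp]:
  "Obj (arrow_cat C) = Arr C"
  "Dom (arrow_cat C) = sq_src"
  "Cod (arrow_cat C) = sq_tgt"
  "Idt (arrow_cat C) f = Square f f (Idt C (Dom C f)) (Idt C (Cod C f))"
  "t \<cdot>\<^bsub>arrow_cat C\<^esub> s = Square (sq_src s) (sq_tgt t) (sq0 t \<cdot>\<^bsub>C\<^esub> sq0 s) (sq1 t \<cdot>\<^bsub>C\<^esub> sq1 s)"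
  by (simp_all add: arrow_cat_def)

lemma Square_Arr [simp]:
  "Square f g u v \<in> Arr (arrow_cat C) \<longleftrightarrow> f \<in> Arr C \<and> g \<in> Arr C \<and>
     u \<in> Arr C \<and> Dom C u = Dom C f \<and> Cod C u = Dom C g \<and>
     v \<in> Arr C \<and> Dom C v = Cod C f \<and> Cod C v = Cod C g \<and> v \<cdot>\<^bsub>C\<^esub> f = g \<cdot>\<^bsub>C\<^esub> u"
  by (auto simp: arrow_cat_def)

lemma sq_Arr [simp]:
  assumes "s \<in> Arr (arrow_cat C)"
  shows "sq_src s \<in> Arr C" "sq_tgt s \<in> Arr C" "sq0 s \<in> Arr C" "sq1 s \<in> Arr C"
    "Dom C (sq0 s) = Dom C (sq_src s)" "Cod C (sq0 s) = Dom C (sq_tgt s)"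
    "Dom C (sq1 s) = Cod C (sq_src s)" "Cod C (sq1 s) = Cod C (sq_tgt s)"
  using assms by (cases s; simp)+

lemma sq_commutes:
  assumes "s \<in> Arr (arrow_cat C)"
  shows "sq1 s \<cdot>\<^bsub>C\<^esub> sq_src s = sq_tgt s \<cdot>\<^bsub>C\<^esub> sq0 s"
  using assms by (cases s; simp)

lemma square_eqI: "sq_src s = sq_src t \<Longrightarrow> sq_tgt s = sq_tgt t \<Longrightarrow> sq0 s = sq0 t \<Longrightarrow> sq1 s = sq1 t \<Longrightarrow> s = t"
  by (cases s; cases t) simp

abbreviation (in category) arrows :: "('m, 'm square) cat" (\<open>\<A>\<close>) where
  "\<A> \<equiv> arrow_cat C"

lemma (in category) is_category_arrow_cat: "is_category \<A>"
  unfolding is_category_def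
proof (intro conjI allI impI ballI)
  fix a b c f g
  assume "f \<in> hom \<A> a b" "g \<in> hom \<A> b c"
  then have f: "f \<in> Arr \<A>" "sq_src f = a" "sq_tgt f = b"
    and g: "g \<in> Arr \<A>" "sq_src g = b" "sq_tgt g = c" by auto
  have "(sq1 g \<cdot> sq1 f) \<cdot> a = c \<cdot> (sq0 g \<cdot> sq0 f)"
    using f g sq_commutes[OF f(1)] reassoc[OF sq_commutes[OF g(1)], of "sq0 f"] sq_Arr[OF f(1)] sq_Arr[OF g(1)]
    by simp
  then show "g \<cdot>\<^bsub>\<A>\<^esub> f \<in> hom \<A> a c"
    using f g sq_Arr[OF f(1)] sq_Arr[OF g(1)] by simp
next
  fix a b c d f g h
  assume "f \<in> hom \<A> a b" "g \<in> hom \<A> b c" "h \<in> hom \<A> c d"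
  then show "(h \<cdot>\<^bsub>\<A>\<^esub> g) \<cdot>\<^bsub>\<A>\<^esub> f = h \<cdot>\<^bsub>\<A>\<^esub> (g \<cdot>\<^bsub>\<A>\<^esub> f)"
    by (cases f; cases g; cases h) simp
qed (auto intro!: square_eqI)

lemma (in category) category_arrow_cat: "category \<A>"
  by (rule category.intro) (rule is_category_arrow_cat)

section \<open>Lifting properties\<close>

definition llp :: "('o, 'm) cat \<Rightarrow> 'm set \<Rightarrow> 'm set" where
  "llp C R = {i \<in> Arr C. \<forall>p\<in>R. has_lifting C i p}"

context category
begin

lemma has_liftingI:
  assumes "\<And>u v. u \<in> Arr C \<Longrightarrow> v \<in> Arr C \<Longrightarrow> Dom C u = Dom C i \<Longrightarrow> Cod C u = Dom C p \<Longrightarrow>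
    Dom C v = Cod C i \<Longrightarrow> Cod C v = Cod C p \<Longrightarrow> v \<cdot> i = p \<cdot> u \<Longrightarrow>
    \<exists>h. h \<in> Arr C \<and> Dom C h = Cod C i \<and> Cod C h = Dom C p \<and> h \<cdot> i = u \<and> p \<cdot> h = v"
  shows "has_lifting C i p"
  unfolding has_lifting_def Square_Arr in_hom Bex_def using assms by blast

lemma has_liftingE:
  assumes "has_lifting C i p" "i \<in> Arr C" "p \<in> Arr C" "u \<in> Arr C" "v \<in> Arr C" "Dom C u = Dom C i"
    "Cod C u = Dom C p" "Dom C v = Cod C i" "Cod C v = Cod C p" "v \<cdot> i = p \<cdot> u"
  obtains h where "h \<in> Arr C" "Dom C h = Cod C i" "Cod C h = Dom C p" "h \<cdot> i = u" "p \<cdot> h = v"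
  using assms unfolding has_lifting_def Square_Arr in_hom Bex_def by blast

lemma is_retractI:
  assumes "f \<in> Arr C" "g \<in> Arr C"
    "i0 \<in> hom C (Dom C f) (Dom C g)" "i1 \<in> hom C (Cod C f) (Cod C g)"
    "r0 \<in> hom C (Dom C g) (Dom C f)" "r1 \<in> hom C (Cod C g) (Cod C f)"
    "i1 \<cdot> f = g \<cdot> i0" "r1 \<cdot> g = f \<cdot> r0" "r0 \<cdot> i0 = Idt C (Dom C f)" "r1 \<cdot> i1 = Idt C (Cod C f)"
  shows "is_retract C f g"
  unfolding is_retract_def
proof (intro conjI)
  show "\<exists>i\<in>hom \<A> f g. \<exists>r\<in>hom \<A> g f. r \<cdot>\<^bsub>\<A>\<^esub> i = Idt \<A> f"
    using assms by (intro bexI[of _ "Square f g i0 i1"] bexI[of _ "Square g f r0 r1"]) auto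
qed (use assms in auto)

lemma is_retractE:
  assumes "is_retract C f g"
  obtains i0 i1 r0 r1 where "f \<in> Arr C" "g \<in> Arr C"
    "i0 \<in> hom C (Dom C f) (Dom C g)" "i1 \<in> hom C (Cod C f) (Cod C g)"
    "r0 \<in> hom C (Dom C g) (Dom C f)" "r1 \<in> hom C (Cod C g) (Cod C f)"
    "i1 \<cdot> f = g \<cdot> i0" "r1 \<cdot> g = f \<cdot> r0" "r0 \<cdot> i0 = Idt C (Dom C f)" "r1 \<cdot> i1 = Idt C (Cod C f)"
proof -
  obtain i r where "i \<in> hom \<A> f g" "r \<in> hom \<A> g f"
    "r \<cdot>\<^bsub>\<A>\<^esub> i = Idt \<A> f" "f \<in> Arr C" "g \<in> Arr C"
    using assms unfolding is_retract_def by blast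
  then show thesis
    using that[of "sq0 i" "sq1 i" "sq0 r" "sq1 r"] by (cases i; cases r) auto
qed

text \<open>Reduces questions about isomorphisms to identities for every class closed under
  retracts: the retract diagram has identities on the domains, and the inverse of \<open>f\<close>
  followed by \<open>f\<close> on the codomains.\<close>

lemma iso_is_retract_of_Idt:
  assumes "is_iso C f"
  shows "is_retract C f (Idt C (Dom C f))"
proof -
  obtain g where g: "f \<in> Arr C" "g \<in> Arr C" "Dom C g = Cod C f" "Cod C g = Dom C f"
    "g \<cdot> f = Idt C (Dom C f)" "f \<cdot> g = Idt C (Cod C f)" by (rule is_isoE[OF assms])
  then show ?thesis
    by (intro is_retractI[of f _ "Idt C (Dom C f)" g "Idt C (Dom C f)" f]) simp_all
qed

lemma llp_Arr: "i \<in> llp C R \<Longrightarrow> i \<in> Arr C"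
  by (simp add: llp_def)

lemma has_lifting_Idt: "a \<in> Obj C \<Longrightarrow> p \<in> Arr C \<Longrightarrow> has_lifting C (Idt C a) p"
  by (rule has_liftingI) auto

lemma llp_Idt: "a \<in> Obj C \<Longrightarrow> R \<subseteq> Arr C \<Longrightarrow> Idt C a \<in> llp C R"
  by (auto simp: llp_def intro: has_lifting_Idt)

lemma llp_comp:
  assumes "f \<in> llp C R" "g \<in> llp C R" "Dom C g = Cod C f" "R \<subseteq> Arr C"
  shows "g \<cdot> f \<in> llp C R"
proof -
  have [simp]: "f \<in> Arr C" "g \<in> Arr C" using assms by (auto simp: llp_def)
  have "has_lifting C (g \<cdot> f) p" if p: "p \<in> R" for p
  proof (rule has_liftingI)
    fix u v
    assume uv: "u \<in> Arr C" "v \<in> Arr C" "Dom C u = Dom C (g \<cdot> f)" "Cod C u = Dom C p"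
      "Dom C v = Cod C (g \<cdot> f)" "Cod C v = Cod C p" "v \<cdot> (g \<cdot> f) = p \<cdot> u"
    have P: "p \<in> Arr C" "has_lifting C f p" "has_lifting C g p" using p assms by (auto simp: llp_def)
    obtain h where h: "h \<in> Arr C" "Dom C h = Cod C f" "Cod C h = Dom C p" "h \<cdot> f = u" "p \<cdot> h = v \<cdot> g"
      by (rule has_liftingE[OF P(2), of u "v \<cdot> g"]) (use P uv assms in auto)
    obtain k where k: "k \<in> Arr C" "Dom C k = Cod C g" "Cod C k = Dom C p" "k \<cdot> g = h" "p \<cdot> k = v"
      by (rule has_liftingE[OF P(3), of h v]) (use P uv assms h in auto)
    show "\<exists>h. h \<in> Arr C \<and> Dom C h = Cod C (g \<cdot> f) \<and> Cod C h = Dom C p \<and> h \<cdot> (g \<cdot> f) = u \<and> p \<cdot> h = v"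
      using k h uv assms reassoc[OF k(4), of f] by (intro exI[of _ k]) simp
  qed
  then show ?thesis using assms by (simp add: llp_def)
qed

lemma llp_retract:
  assumes "is_retract C f g" "g \<in> llp C R" "R \<subseteq> Arr C"
  shows "f \<in> llp C R"
proof -
  obtain i0 i1 r0 r1 where *: "f \<in> Arr C" "g \<in> Arr C"
    "i0 \<in> hom C (Dom C f) (Dom C g)" "i1 \<in> hom C (Cod C f) (Cod C g)"
    "r0 \<in> hom C (Dom C g) (Dom C f)" "r1 \<in> hom C (Cod C g) (Cod C f)"
    "i1 \<cdot> f = g \<cdot> i0" "r1 \<cdot> g = f \<cdot> r0" "r0 \<cdot> i0 = Idt C (Dom C f)" "r1 \<cdot> i1 = Idt C (Cod C f)"
    by (rule is_retractE[OF assms(1)])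
  have "has_lifting C f p" if p: "p \<in> R" for p
  proof (rule has_liftingI)
    fix u v
    assume uv: "u \<in> Arr C" "v \<in> Arr C" "Dom C u = Dom C f" "Cod C u = Dom C p"
      "Dom C v = Cod C f" "Cod C v = Cod C p" "v \<cdot> f = p \<cdot> u"
    have P: "p \<in> Arr C" "has_lifting C g p" using p assms by (auto simp: llp_def)
    obtain h where h: "h \<in> Arr C" "Dom C h = Cod C g" "Cod C h = Dom C p" "h \<cdot> g = u \<cdot> r0" "p \<cdot> h = v \<cdot> r1"
      by (rule has_liftingE[OF P(2), of "u \<cdot> r0" "v \<cdot> r1"]) (use P uv * reassoc[OF uv(7)] in auto)
    show "\<exists>h. h \<in> Arr C \<and> Dom C h = Cod C f \<and> Cod C h = Dom C p \<and> h \<cdot> f = u \<and> p \<cdot> h = v"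
      using h uv P * reassoc[OF h(4)] reassoc[OF h(5)] by (intro exI[of _ "h \<cdot> i1"]) simp
  qed
  then show ?thesis using * by (simp add: llp_def)
qed

lemma llp_iso: "is_iso C f \<Longrightarrow> R \<subseteq> Arr C \<Longrightarrow> f \<in> llp C R"
  using iso_is_retract_of_Idt llp_retract llp_Idt is_iso_def Dom_Obj by metis

end

section \<open>Pushouts\<close>

context category
begin

text \<open>Existence and joint epimorphy are kept apart because they are proved by different means;
  \<open>is_pushout_ex\<close> and \<open>is_pushout_ext\<close> are the matching
  eliminations.\<close>

lemma is_pushoutI:
  assumes "f \<in> Arr C" "g \<in> Arr C" "p \<in> Arr C" "q \<in> Arr C" "Dom C f = Dom C g" "Dom C p = Cod C f" "Dom C q = Cod C g"
    "Cod C p = Cod C q" "p \<cdot> f = q \<cdot> g"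
    "\<And>u v. u \<in> Arr C \<Longrightarrow> v \<in> Arr C \<Longrightarrow> Dom C u = Cod C f \<Longrightarrow> Dom C v = Cod C g \<Longrightarrow> Cod C u = Cod C v \<Longrightarrow>
        u \<cdot> f = v \<cdot> g \<Longrightarrow> \<exists>h. h \<in> Arr C \<and> Dom C h = Cod C p \<and> Cod C h = Cod C v \<and> h \<cdot> p = u \<and> h \<cdot> q = v"
    "\<And>h k. h \<in> Arr C \<Longrightarrow> k \<in> Arr C \<Longrightarrow> Dom C h = Cod C p \<Longrightarrow> Dom C k = Cod C p \<Longrightarrow> Cod C k = Cod C h \<Longrightarrow>
        h \<cdot> p = k \<cdot> p \<Longrightarrow> h \<cdot> q = k \<cdot> q \<Longrightarrow> h = k"
  shows "is_pushout C f g p q"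
  unfolding is_pushout_def
proof (rule exI[of _ "Dom C f"], rule exI[of _ "Cod C f"], rule exI[of _ "Cod C g"], rule exI[of _ "Cod C p"], intro conjI allI impI)
  fix e u v
  assume "u \<in> hom C (Cod C f) e" "v \<in> hom C (Cod C g) e" "u \<cdot> f = v \<cdot> g"
  then have *: "u \<in> Arr C" "v \<in> Arr C" "Dom C u = Cod C f" "Dom C v = Cod C g" "Cod C u = e" "Cod C v = e" "u \<cdot> f = v \<cdot> g"
    by auto
  show "\<exists>!h. h \<in> hom C (Cod C p) e \<and> h \<cdot> p = u \<and> h \<cdot> q = v"
    using assms(10)[of u v] assms(11) * by (fastforce simp: in_hom)
qed (use assms in auto)

lemma is_pushout_Arr:
  assumes "is_pushout C f g p q"
  shows "f \<in> Arr C" "g \<in> Arr C" "p \<in> Arr C" "q \<in> Arr C" "Dom C g = Dom C f" "Dom C p = Cod C f" "Dom C q = Cod C g"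
    "Cod C q = Cod C p" "p \<cdot> f = q \<cdot> g"
  using assms by (auto simp: is_pushout_def)

lemma is_pushout_ex:
  assumes "is_pushout C f g p q" "u \<in> Arr C" "v \<in> Arr C" "Dom C u = Cod C f" "Dom C v = Cod C g" "Cod C u = Cod C v" "u \<cdot> f = v \<cdot> g"
  obtains h where "h \<in> Arr C" "Dom C h = Cod C p" "Cod C h = Cod C v" "h \<cdot> p = u" "h \<cdot> q = v"
  using assms unfolding is_pushout_def in_hom by metis

lemma is_pushout_ext:
  assumes "is_pushout C f g p q" "h \<in> Arr C" "k \<in> Arr C" "Dom C h = Cod C p" "Dom C k = Cod C p" "Cod C k = Cod C h"
    "h \<cdot> p = k \<cdot> p" "h \<cdot> q = k \<cdot> q"
  shows "h = k"
proof -
  note P = is_pushout_Arr[OF assms(1)]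
  have "(h \<cdot> p) \<cdot> f = (h \<cdot> q) \<cdot> g" using P assms by simp
  moreover have "\<And>e u v. u \<in> hom C (Cod C f) e \<Longrightarrow> v \<in> hom C (Cod C g) e \<Longrightarrow> u \<cdot> f = v \<cdot> g \<Longrightarrow>
     \<exists>!h. h \<in> hom C (Cod C p) e \<and> h \<cdot> p = u \<and> h \<cdot> q = v"
    using assms(1) unfolding is_pushout_def in_hom by metis
  from this[of "h \<cdot> p" "Cod C h" "h \<cdot> q"]
  have "(h \<cdot> p) \<cdot> f = (h \<cdot> q) \<cdot> g \<Longrightarrow> \<exists>!l. l \<in> hom C (Cod C p) (Cod C h) \<and> l \<cdot> p = h \<cdot> p \<and> l \<cdot> q = h \<cdot> q"
    using P assms by (simp only: in_hom) simp
  ultimately have "\<exists>!l. l \<in> hom C (Cod C p) (Cod C h) \<and> l \<cdot> p = h \<cdot> p \<and> l \<cdot> q = h \<cdot> q"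
    by blast
  then show ?thesis using assms by auto
qed

lemma is_pushout_flip: "is_pushout C f g p q \<Longrightarrow> is_pushout C g f q p"
  by (rule is_pushoutI)
    (simp_all add: is_pushout_Arr, metis is_pushout_ex is_pushout_Arr(8), metis is_pushout_ext)

lemma llp_pushout:
  assumes "is_pushout C f g p q" "f \<in> llp C R" "R \<subseteq> Arr C"
  shows "q \<in> llp C R"
proof -
  note P = is_pushout_Arr[OF assms(1)]
  have "has_lifting C q e" if e: "e \<in> R" for e
  proof (rule has_liftingI)
    fix u v
    assume uv: "u \<in> Arr C" "v \<in> Arr C" "Dom C u = Dom C q" "Cod C u = Dom C e"
      "Dom C v = Cod C q" "Cod C v = Cod C e" "v \<cdot> q = e \<cdot> u"
    have E: "e \<in> Arr C" "has_lifting C f e" using e assms by (auto simp: llp_def)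
    obtain h where h: "h \<in> Arr C" "Dom C h = Cod C f" "Cod C h = Dom C e" "h \<cdot> f = u \<cdot> g" "e \<cdot> h = v \<cdot> p"
      by (rule has_liftingE[OF E(2), of "u \<cdot> g" "v \<cdot> p"]) (use P E uv reassoc[OF uv(7)] in auto)
    obtain k where k: "k \<in> Arr C" "Dom C k = Cod C p" "Cod C k = Cod C u" "k \<cdot> p = h" "k \<cdot> q = u"
      by (rule is_pushout_ex[OF assms(1), of h u]) (use P uv h in auto)
    have "e \<cdot> k = v"
      by (rule is_pushout_ext[OF assms(1)]) (use P E uv h k in auto)
    then show "\<exists>h. h \<in> Arr C \<and> Dom C h = Cod C q \<and> Cod C h = Dom C e \<and> h \<cdot> q = u \<and> e \<cdot> h = v"
      using k P uv by (intro exI[of _ k]) simp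
  qed
  then show ?thesis using P by (simp add: llp_def)
qed

text \<open>The inverse of \<open>q\<close> is induced by the pair consisting of \<open>g\<close>
  after the inverse of \<open>f\<close> and the identity; the second composite is checked on the two
  legs.\<close>

lemma is_pushout_cobase_iso:
  assumes "is_pushout C f g p q" "is_iso C f"
  shows "is_iso C q"
proof -
  note P = is_pushout_Arr[OF assms(1)]
  obtain f' where f: "f \<in> Arr C" "f' \<in> Arr C" "Dom C f' = Cod C f" "Cod C f' = Dom C f"
    "f' \<cdot> f = Idt C (Dom C f)" "f \<cdot> f' = Idt C (Cod C f)" by (rule is_isoE[OF assms(2)])
  obtain k where k: "k \<in> Arr C" "Dom C k = Cod C p" "Cod C k = Cod C g" "k \<cdot> p = g \<cdot> f'" "k \<cdot> q = Idt C (Cod C g)"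
    by (rule is_pushout_ex[OF assms(1), of "g \<cdot> f'" "Idt C (Cod C g)"]) (use P f in auto)
  have "q \<cdot> k = Idt C (Cod C p)"
    by (rule is_pushout_ext[OF assms(1)]) (use P f k reassoc[OF P(9), of f'] in auto)
  then show ?thesis using P k by (auto intro!: is_isoI[of q k])
qed

end

text \<open>Assuming only the (co)limits that an argument needs keeps it free of the size type
  \<open>'u\<close>; bicompleteness enters through interpretations at the very end.\<close>

locale category_po = category C for C :: "('o, 'm) cat" (structure) +
  assumes pushouts_exist: "f \<in> Arr C \<Longrightarrow> g \<in> Arr C \<Longrightarrow> Dom C f = Dom C g \<Longrightarrow> \<exists>p q. is_pushout C f g p q"
begin

lemma po_is_pushout:
  assumes "f \<in> Arr C" "g \<in> Arr C" "Dom C g = Dom C f"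
  shows "is_pushout C f g (po_in1 C f g) (po_in2 C f g)"
proof -
  have "\<exists>x. case x of (p, q) \<Rightarrow> is_pushout C f g p q"
    using pushouts_exist[OF assms(1,2)] assms(3) by auto
  from someI_ex[OF this] have "case po C f g of (p, q) \<Rightarrow> is_pushout C f g p q"
    unfolding po_def .
  then show ?thesis by (simp add: po_in1_def po_in2_def case_prod_beta)
qed

lemma po_in_Arr [simp]:
  assumes "f \<in> Arr C" "g \<in> Arr C" "Dom C g = Dom C f"
  shows "po_in1 C f g \<in> Arr C" "po_in2 C f g \<in> Arr C" "Dom C (po_in1 C f g) = Cod C f" "Dom C (po_in2 C f g) = Cod C g"
    "Cod C (po_in2 C f g) = Cod C (po_in1 C f g)" "po_in1 C f g \<cdot> f = po_in2 C f g \<cdot> g"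
  using is_pushout_Arr[OF po_is_pushout[OF assms]] by auto

lemma po_map_props:
  assumes "f \<in> Arr C" "g \<in> Arr C" "Dom C g = Dom C f" "u \<in> Arr C" "v \<in> Arr C" "Dom C u = Cod C f" "Dom C v = Cod C g"
    "Cod C v = Cod C u" "u \<cdot> f = v \<cdot> g"
  shows "po_map C f g u v \<in> Arr C" "Dom C (po_map C f g u v) = Cod C (po_in1 C f g)" "Cod C (po_map C f g u v) = Cod C u"
    "po_map C f g u v \<cdot> po_in1 C f g = u" "po_map C f g u v \<cdot> po_in2 C f g = v"
proof -
  note po = po_is_pushout[OF assms(1-3)]
  obtain h where h: "h \<in> Arr C" "Dom C h = Cod C (po_in1 C f g)" "Cod C h = Cod C v" "h \<cdot> po_in1 C f g = u" "h \<cdot> po_in2 C f g = v"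
    by (rule is_pushout_ex[OF po, of u v]) (use assms in auto)
  have "po_map C f g u v = h"
    unfolding po_map_def
    by (rule the_equality) (use h assms in \<open>auto intro: is_pushout_ext[OF po]\<close>)
  then show "po_map C f g u v \<in> Arr C" "Dom C (po_map C f g u v) = Cod C (po_in1 C f g)" "Cod C (po_map C f g u v) = Cod C u"
    "po_map C f g u v \<cdot> po_in1 C f g = u" "po_map C f g u v \<cdot> po_in2 C f g = v"
    using h assms by auto
qed

lemma po_ext:
  assumes "h \<cdot> po_in1 C f g = k \<cdot> po_in1 C f g" "h \<cdot> po_in2 C f g = k \<cdot> po_in2 C f g"
    "f \<in> Arr C" "g \<in> Arr C" "Dom C g = Dom C f" "h \<in> Arr C" "k \<in> Arr C" "Dom C h = Cod C (po_in1 C f g)"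
    "Dom C k = Cod C (po_in1 C f g)" "Cod C k = Cod C h"
  shows "h = k"
  by (rule is_pushout_ext[OF po_is_pushout]) (use assms in auto)

lemma po_map_eqI:
  assumes "f \<in> Arr C" "g \<in> Arr C" "Dom C g = Dom C f" "h \<in> Arr C" "Dom C h = Cod C (po_in1 C f g)"
    "h \<cdot> po_in1 C f g = u" "h \<cdot> po_in2 C f g = v"
  shows "po_map C f g u v = h"
proof -
  have uv: "u \<in> Arr C" "v \<in> Arr C" "Dom C u = Cod C f" "Dom C v = Cod C g" "Cod C v = Cod C u" "Cod C u = Cod C h" "u \<cdot> f = v \<cdot> g"
    using assms by auto
  note P = po_map_props[OF assms(1-3) uv(1-5,7)]
  show ?thesis by (rule po_ext[of _ f g]) (use P assms uv in simp_all)
qed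

end

section \<open>Adjoints\<close>

lemma functor_simps [simp]:
  assumes "is_functor C D F"
  shows "a \<in> Obj C \<Longrightarrow> fob F a \<in> Obj D"
    "f \<in> Arr C \<Longrightarrow> far F f \<in> Arr D" "f \<in> Arr C \<Longrightarrow> Dom D (far F f) = fob F (Dom C f)"
    "f \<in> Arr C \<Longrightarrow> Cod D (far F f) = fob F (Cod C f)"
    "a \<in> Obj C \<Longrightarrow> far F (Idt C a) = Idt D (fob F a)"
  using assms by (auto simp: is_functor_def)

lemma functor_comp:
  assumes "is_functor C D F" "f \<in> Arr C" "g \<in> Arr C" "Dom C g = Cod C f"
  shows "far F (g \<cdot>\<^bsub>C\<^esub> f) = far F g \<cdot>\<^bsub>D\<^esub> far F f"
  using assms unfolding is_functor_def in_hom by blast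

lemma is_functorI:
  assumes "\<And>a. a \<in> Obj C \<Longrightarrow> fob F a \<in> Obj D"
    "\<And>f. f \<in> Arr C \<Longrightarrow> far F f \<in> hom D (fob F (Dom C f)) (fob F (Cod C f))"
    "\<And>a. a \<in> Obj C \<Longrightarrow> far F (Idt C a) = Idt D (fob F a)"
    "\<And>f g. f \<in> Arr C \<Longrightarrow> g \<in> Arr C \<Longrightarrow> Dom C g = Cod C f \<Longrightarrow> far F (g \<cdot>\<^bsub>C\<^esub> f) = far F g \<cdot>\<^bsub>D\<^esub> far F f"
  shows "is_functor C D F"
  unfolding is_functor_def using assms by (auto simp: in_hom)

section \<open>Composite functors and adjoints given by universal arrows\<close>

definition comp_functor ::
  "('o2, 'm2, 'o3, 'm3) cfunctor \<Rightarrow> ('o1, 'm1, 'o2, 'm2) cfunctor \<Rightarrow> ('o1, 'm1, 'o3, 'm3) cfunctor" where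
  "comp_functor G F = \<lparr>fob = (\<lambda>a. fob G (fob F a)), far = (\<lambda>f. far G (far F f))\<rparr>"

lemma comp_functor_simps [simp]:
  "fob (comp_functor G F) a = fob G (fob F a)" "far (comp_functor G F) f = far G (far F f)"
  by (simp_all add: comp_functor_def)

lemma is_functor_comp: "is_functor C D F \<Longrightarrow> is_functor D E G \<Longrightarrow> is_functor C E (comp_functor G F)"
  by (rule is_functorI) (simp_all add: functor_comp)

text \<open>A terminal object of the comma category of \<open>F\<close> over \<open>b\<close>: the
  value at \<open>b\<close> of a right adjoint, together with the counit there.\<close>

definition universal_arrow ::
  "('o1, 'm1) cat \<Rightarrow> ('o2, 'm2) cat \<Rightarrow> ('o1, 'm1, 'o2, 'm2) cfunctor \<Rightarrow> 'o2 \<Rightarrow> 'o1 \<Rightarrow> 'm2 \<Rightarrow> bool" where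
  "universal_arrow C D F b g e \<longleftrightarrow> g \<in> Obj C \<and> e \<in> hom D (fob F g) b \<and>
     (\<forall>a\<in>Obj C. \<forall>h\<in>hom D (fob F a) b. \<exists>!k. k \<in> hom C a g \<and> e \<cdot>\<^bsub>D\<^esub> far F k = h)"

text \<open>A right adjoint need only be specified objectwise. After a choice of universal arrows
  \<open>e b\<close>, its value on \<open>v\<close> is the arrow induced by \<open>v\<close> after
  \<open>e\<close>, and functoriality and naturality follow from uniqueness.\<close>

lemma left_adjointI:
  assumes C: "is_category C" and D: "is_category D" and F: "is_functor C D F"
    and univ: "\<And>b. b \<in> Obj D \<Longrightarrow> \<exists>g e. universal_arrow C D F b g e"
  shows "left_adjoint C D F"
proof -
  interpret C: category C by (rule category.intro) fact
  interpret D: category D by (rule category.intro) fact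
  note [simp] = functor_simps[OF F]
  obtain g e where U: "\<And>b. b \<in> Obj D \<Longrightarrow> universal_arrow C D F b (g b) (e b)"
    using univ by metis
  have e [simp]: "g b \<in> Obj C" "e b \<in> Arr D" "Dom D (e b) = fob F (g b)" "Cod D (e b) = b" if "b \<in> Obj D" for b
    using U[OF that] by (auto simp: universal_arrow_def)
  define \<phi> where "\<phi> = (\<lambda>a b h. THE k. k \<in> hom C a (g b) \<and> e b \<cdot>\<^bsub>D\<^esub> far F k = h)"
  have ex1: "\<exists>!k. k \<in> hom C a (g b) \<and> e b \<cdot>\<^bsub>D\<^esub> far F k = h"
    if "a \<in> Obj C" "b \<in> Obj D" "h \<in> hom D (fob F a) b" for a b h
    using U[OF that(2)] that unfolding universal_arrow_def by blast
  have \<phi>: "\<phi> a b h \<in> Arr C" "Dom C (\<phi> a b h) = a" "Cod C (\<phi> a b h) = g b" "e b \<cdot>\<^bsub>D\<^esub> far F (\<phi> a b h) = h"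
    if "a \<in> Obj C" "b \<in> Obj D" "h \<in> hom D (fob F a) b" for a b h
    using theI'[OF ex1[OF that]] unfolding \<phi>_def by auto
  have \<phi>_eq: "\<phi> a b h = k"
    if "a \<in> Obj C" "b \<in> Obj D" "k \<in> hom C a (g b)" "e b \<cdot>\<^bsub>D\<^esub> far F k = h" for a b h k
    using that unfolding \<phi>_def by (intro the1_equality[OF ex1]) auto
  define G where "G = \<lparr>fob = g, far = (\<lambda>v. \<phi> (g (Dom D v)) (Cod D v) (v \<cdot>\<^bsub>D\<^esub> e (Dom D v)))\<rparr>"
  have G: "far G v \<in> Arr C" "Dom C (far G v) = g (Dom D v)" "Cod C (far G v) = g (Cod D v)"
    "e (Cod D v) \<cdot>\<^bsub>D\<^esub> far F (far G v) = v \<cdot>\<^bsub>D\<^esub> e (Dom D v)" if "v \<in> Arr D" for v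
    unfolding G_def using that by (simp_all add: \<phi>)
  have G_eq: "far G v = k" if "v \<in> Arr D" "k \<in> hom C (g (Dom D v)) (g (Cod D v))" "e (Cod D v) \<cdot>\<^bsub>D\<^esub> far F k = v \<cdot>\<^bsub>D\<^esub> e (Dom D v)" for v k
    unfolding G_def using that by (simp add: \<phi>_eq)
  have [simp]: "fob G b = g b" for b by (simp add: G_def)
  note functor_comp[OF F, simp]
  have "is_functor D C G"
  proof (rule is_functorI)
    fix f h assume fh: "f \<in> Arr D" "h \<in> Arr D" "Dom D h = Cod D f"
    show "far G (h \<cdot>\<^bsub>D\<^esub> f) = far G h \<cdot>\<^bsub>C\<^esub> far G f"
      by (rule G_eq) (use fh G[OF fh(1)] G[OF fh(2)] D.reassoc[OF G(4)[OF fh(2)]] in simp_all)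
  next
    fix f assume "f \<in> Arr D" then show "far G f \<in> hom C (fob G (Dom D f)) (fob G (Cod D f))" using G by simp
  next
    fix a assume "a \<in> Obj D" then show "far G (Idt D a) = Idt C (fob G a)" by (intro G_eq) simp_all
  qed simp
  moreover have "bij_betw (\<phi> a b) (hom D (fob F a) b) (hom C a (fob G b))" if "a \<in> Obj C" "b \<in> Obj D" for a b
    by (rule bij_betw_byWitness[where f' = "\<lambda>k. e b \<cdot>\<^bsub>D\<^esub> far F k"])
      (use that \<phi> \<phi>_eq in \<open>auto simp: image_subset_iff\<close>)
  moreover have "\<phi> a' b' (v \<cdot>\<^bsub>D\<^esub> h \<cdot>\<^bsub>D\<^esub> far F u) = far G v \<cdot>\<^bsub>C\<^esub> \<phi> a b h \<cdot>\<^bsub>C\<^esub> u"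
    if "u \<in> hom C a' a" "h \<in> hom D (fob F a) b" "v \<in> hom D b b'" for a a' b b' u h v
  proof (rule \<phi>_eq)
    have *: "a' \<in> Obj C" "b' \<in> Obj D" "a \<in> Obj C" "b \<in> Obj D" using that by auto
    note P = \<phi>[OF *(3,4) that(2)]
    have v: "v \<in> Arr D" "Dom D v = b" "Cod D v = b'" using that by auto
    show "e b' \<cdot>\<^bsub>D\<^esub> far F (far G v \<cdot>\<^bsub>C\<^esub> \<phi> a b h \<cdot>\<^bsub>C\<^esub> u) = v \<cdot>\<^bsub>D\<^esub> h \<cdot>\<^bsub>D\<^esub> far F u"
      using that * P v G[OF v(1)] D.reassoc[OF G(4)[OF v(1)]] D.reassoc[OF P(4)] by simp
    show "far G v \<cdot>\<^bsub>C\<^esub> \<phi> a b h \<cdot>\<^bsub>C\<^esub> u \<in> hom C a' (g b')" using that * P v G[OF v(1)] by simp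
  qed (use that in auto)
  ultimately have "adjunction C D F G \<phi>"
    unfolding adjunction_def using F by blast
  then show ?thesis unfolding left_adjoint_def by blast
qed

locale left_adjoint_functor = C: category C + D: category D
  for C :: "('o1, 'm1) cat" and D :: "('o2, 'm2) cat" and F :: "('o1, 'm1, 'o2, 'm2) cfunctor" +
  assumes left_adjoint: "left_adjoint C D F"
begin

lemma is_functor: "is_functor C D F"
  using left_adjoint by (auto simp: left_adjoint_def adjunction_def)

lemmas functor_rules [simp] = functor_simps[OF is_functor] functor_comp[OF is_functor]

lemma universal_arrow_props:
  assumes "universal_arrow C D F b g e"
  shows "g \<in> Obj C" "e \<in> Arr D" "Dom D e = fob F g" "Cod D e = b"
    "\<And>h a. h \<in> Arr D \<Longrightarrow> Cod D h = b \<Longrightarrow> a \<in> Obj C \<Longrightarrow> Dom D h = fob F a \<Longrightarrow>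
       \<exists>k. k \<in> Arr C \<and> Dom C k = a \<and> Cod C k = g \<and> e \<cdot>\<^bsub>D\<^esub> far F k = h"
    "\<And>k l. k \<in> Arr C \<Longrightarrow> l \<in> Arr C \<Longrightarrow> Dom C k = Dom C l \<Longrightarrow> Cod C k = g \<Longrightarrow> Cod C l = g \<Longrightarrow>
       e \<cdot>\<^bsub>D\<^esub> far F k = e \<cdot>\<^bsub>D\<^esub> far F l \<Longrightarrow> k = l"
proof -
  from assms have *: "\<And>a h. a \<in> Obj C \<Longrightarrow> h \<in> hom D (fob F a) b \<Longrightarrow> \<exists>!k. k \<in> hom C a g \<and> e \<cdot>\<^bsub>D\<^esub> far F k = h"
    by (auto simp: universal_arrow_def)
  show e: "g \<in> Obj C" "e \<in> Arr D" "Dom D e = fob F g" "Cod D e = b"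
    using assms by (auto simp: universal_arrow_def)
  show "\<exists>k. k \<in> Arr C \<and> Dom C k = a \<and> Cod C k = g \<and> e \<cdot>\<^bsub>D\<^esub> far F k = h"
    if "h \<in> Arr D" "Cod D h = b" "a \<in> Obj C" "Dom D h = fob F a" for h a
    using *[of a h] that by auto
  show "k = l" if "k \<in> Arr C" "l \<in> Arr C" "Dom C k = Dom C l" "Cod C k = g" "Cod C l = g" "e \<cdot>\<^bsub>D\<^esub> far F k = e \<cdot>\<^bsub>D\<^esub> far F l" for k l
    using *[of "Dom C l" "e \<cdot>\<^bsub>D\<^esub> far F l"] that e by auto
qed

text \<open>The counit \<open>e\<close> is the preimage of the identity of \<open>G b\<close> under
  the bijection. Naturality in the first argument then makes \<open>e\<close> after
  \<open>F k\<close> the preimage of \<open>k\<close>, so the bijection is inverse to composition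
  with \<open>e\<close>.\<close>

lemma universal_arrow_exists:
  assumes b: "b \<in> Obj D"
  shows "\<exists>g e. universal_arrow C D F b g e"
proof -
  obtain G \<phi> where G: "is_functor D C G"
    and bij: "\<And>a b. a \<in> Obj C \<Longrightarrow> b \<in> Obj D \<Longrightarrow> bij_betw (\<phi> a b) (hom D (fob F a) b) (hom C a (fob G b))"
    and nat: "\<And>a' a b b' u h v. u \<in> hom C a' a \<Longrightarrow> h \<in> hom D (fob F a) b \<Longrightarrow> v \<in> hom D b b' \<Longrightarrow>
        \<phi> a' b' (v \<cdot>\<^bsub>D\<^esub> h \<cdot>\<^bsub>D\<^esub> far F u) = far G v \<cdot>\<^bsub>C\<^esub> \<phi> a b h \<cdot>\<^bsub>C\<^esub> u"
    using left_adjoint unfolding left_adjoint_def adjunction_def by blast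
  note [simp] = functor_simps[OF G]
  define g where "g = fob G b"
  have g [simp]: "g \<in> Obj C" using b by (simp add: g_def)
  have "Idt C g \<in> hom C g (fob G b)" using b by (simp add: g_def)
  then obtain e where e: "e \<in> hom D (fob F g) b" "\<phi> g b e = Idt C g"
    using bij[OF g b] unfolding bij_betw_def by (metis imageE)
  have \<phi>: "\<phi> (Dom C k) b (e \<cdot>\<^bsub>D\<^esub> far F k) = k" if "k \<in> Arr C" "Cod C k = g" for k
    using nat[of k "Dom C k" g e b "Idt D b" b] that e b by (simp add: g_def)
  have "\<exists>!k. k \<in> hom C a g \<and> e \<cdot>\<^bsub>D\<^esub> far F k = h" if "a \<in> Obj C" "h \<in> hom D (fob F a) b" for a h
  proof (rule ex1I[of _ "\<phi> a b h"])
    have "\<phi> a b h \<in> hom C a (fob G b)"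
      using bij[OF that(1) b] that unfolding bij_betw_def by blast
    then have k: "\<phi> a b h \<in> Arr C" "Dom C (\<phi> a b h) = a" "Cod C (\<phi> a b h) = g" by (auto simp: g_def)
    have "e \<cdot>\<^bsub>D\<^esub> far F (\<phi> a b h) = h"
      using \<phi>[OF k(1,3)] k bij[OF that(1) b] that e
      by (intro inj_onD[of "\<phi> a b" "hom D (fob F a) b"]) (simp_all add: bij_betw_def)
    then show "\<phi> a b h \<in> hom C a g \<and> e \<cdot>\<^bsub>D\<^esub> far F (\<phi> a b h) = h" using k by simp
  next
    fix k assume "k \<in> hom C a g \<and> e \<cdot>\<^bsub>D\<^esub> far F k = h"
    then show "k = \<phi> a b h" using \<phi>[of k] by auto
  qed
  then have "universal_arrow C D F b g e" unfolding universal_arrow_def using g e by blast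
  then show ?thesis by blast
qed

text \<open>Transposing along the universal arrow at \<open>b\<close> identifies cocones on the
  image of \<open>X\<close> under \<open>F\<close> with vertex \<open>b\<close> and cocones on
  \<open>X\<close> with vertex \<open>g\<close>; the uniqueness half of universality carries over
  both the cocone equations and uniqueness.\<close>

lemma preserves_colimit:
  assumes J: "is_category J" and X: "is_functor J C X" and lim: "is_colimit J C X a t"
  shows "is_colimit J D (comp_functor F X) (fob F a) (\<lambda>j. far F (t j))"
  unfolding is_colimit_def
proof (intro conjI allI impI)
  interpret J: category J by (rule category.intro) fact
  note [simp] = functor_simps[OF X]
  have t [simp]: "a \<in> Obj C" "\<And>j. j \<in> Obj J \<Longrightarrow> t j \<in> Arr C" "\<And>j. j \<in> Obj J \<Longrightarrow> Dom C (t j) = fob X j"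
    "\<And>j. j \<in> Obj J \<Longrightarrow> Cod C (t j) = a" "\<And>u. u \<in> Arr J \<Longrightarrow> t (Cod J u) \<cdot>\<^bsub>C\<^esub> far X u = t (Dom J u)"
    using lim by (auto simp: is_colimit_def is_cocone_def)
  have univ: "\<exists>!h. h \<in> hom C a b \<and> (\<forall>j\<in>Obj J. h \<cdot>\<^bsub>C\<^esub> t j = s j)" if "is_cocone J C X b s" for b s
    using lim that by (auto simp: is_colimit_def)
  show "is_cocone J D (comp_functor F X) (fob F a) (\<lambda>j. far F (t j))"
    unfolding is_cocone_def by (simp flip: functor_comp[OF is_functor])
  fix b s
  assume s: "is_cocone J D (comp_functor F X) b s"
  then have b: "b \<in> Obj D" and s1: "\<And>j. j \<in> Obj J \<Longrightarrow> s j \<in> Arr D" "\<And>j. j \<in> Obj J \<Longrightarrow> Dom D (s j) = fob F (fob X j)"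
    "\<And>j. j \<in> Obj J \<Longrightarrow> Cod D (s j) = b" "\<And>u. u \<in> Arr J \<Longrightarrow> s (Cod J u) \<cdot>\<^bsub>D\<^esub> far F (far X u) = s (Dom J u)"
    by (auto simp: is_cocone_def)
  obtain g e where "universal_arrow C D F (b) g e" using universal_arrow_exists[OF b] by blast
    note g = universal_arrow_props[OF this]
  have "\<forall>j. \<exists>k. j \<in> Obj J \<longrightarrow> k \<in> Arr C \<and> Dom C k = fob X j \<and> Cod C k = g \<and> e \<cdot>\<^bsub>D\<^esub> far F k = s j"
    using g(5) s1 by simp
  then obtain k where k: "\<And>j. j \<in> Obj J \<Longrightarrow> k j \<in> Arr C" "\<And>j. j \<in> Obj J \<Longrightarrow> Dom C (k j) = fob X j"
    "\<And>j. j \<in> Obj J \<Longrightarrow> Cod C (k j) = g" "\<And>j. j \<in> Obj J \<Longrightarrow> e \<cdot>\<^bsub>D\<^esub> far F (k j) = s j" by metis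
  have "k (Cod J u) \<cdot>\<^bsub>C\<^esub> far X u = k (Dom J u)" if "u \<in> Arr J" for u
    by (rule g(6)) (use that g(1-4) k s1 D.reassoc[OF k(4)[OF J.Cod_Obj[OF that]]] in auto)
  then have "is_cocone J C X g k" unfolding is_cocone_def using g(1-4) k by simp
  from univ[OF this] obtain h where h: "h \<in> Arr C" "Dom C h = a" "Cod C h = g" "\<And>j. j \<in> Obj J \<Longrightarrow> h \<cdot>\<^bsub>C\<^esub> t j = k j"
    and uniq: "\<And>h'. h' \<in> Arr C \<Longrightarrow> Dom C h' = a \<Longrightarrow> Cod C h' = g \<Longrightarrow> (\<And>j. j \<in> Obj J \<Longrightarrow> h' \<cdot>\<^bsub>C\<^esub> t j = k j) \<Longrightarrow> h' = h"
    unfolding in_hom by metis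
  show "\<exists>!h. h \<in> hom D (fob F a) b \<and> (\<forall>j\<in>Obj J. h \<cdot>\<^bsub>D\<^esub> far F (t j) = s j)"
  proof (rule ex1I[of _ "e \<cdot>\<^bsub>D\<^esub> far F h"])
    show "e \<cdot>\<^bsub>D\<^esub> far F h \<in> hom D (fob F a) b \<and> (\<forall>j\<in>Obj J. (e \<cdot>\<^bsub>D\<^esub> far F h) \<cdot>\<^bsub>D\<^esub> far F (t j) = s j)"
      using h g(1-4) k by (simp flip: functor_comp[OF is_functor])
    fix h' assume h': "h' \<in> hom D (fob F a) b \<and> (\<forall>j\<in>Obj J. h' \<cdot>\<^bsub>D\<^esub> far F (t j) = s j)"
    then obtain l where l: "l \<in> Arr C" "Dom C l = a" "Cod C l = g" "e \<cdot>\<^bsub>D\<^esub> far F l = h'"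
      using g(5)[of h' a] by auto
    have "l = h"
    proof (rule uniq)
      fix j assume j: "j \<in> Obj J"
      show "l \<cdot>\<^bsub>C\<^esub> t j = k j"
        by (rule g(6)) (use j l k g(1-4) h' D.reassoc[OF l(4)] in auto)
    qed (use l in auto)
    then show "h' = e \<cdot>\<^bsub>D\<^esub> far F h" using l by simp
  qed
qed

lemma preserves_initial:
  assumes "is_initial C z"
  shows "is_initial D (fob F z)"
  unfolding is_initial_def
proof (intro conjI ballI)
  fix b assume b: "b \<in> Obj D"
  have z: "z \<in> Obj C" "\<And>a. a \<in> Obj C \<Longrightarrow> \<exists>!f. f \<in> hom C z a" using assms by (auto simp: is_initial_def)
  obtain g e where "universal_arrow C D F (b) g e" using universal_arrow_exists[OF b] by blast
    note g = universal_arrow_props[OF this]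
  obtain k where k: "k \<in> hom C z g" "\<And>l. l \<in> hom C z g \<Longrightarrow> l = k" using z(2)[OF g(1)] by blast
  show "\<exists>!f. f \<in> hom D (fob F z) b"
  proof (rule ex1I[of _ "e \<cdot>\<^bsub>D\<^esub> far F k"])
    fix f assume "f \<in> hom D (fob F z) b"
    then obtain l where "l \<in> hom C z g" "e \<cdot>\<^bsub>D\<^esub> far F l = f" using g(5)[of f z] z(1) by auto
    then show "f = e \<cdot>\<^bsub>D\<^esub> far F k" using k(2) by blast
  qed (use g(1-4) k(1) z in auto)
qed (use assms in \<open>auto simp: is_initial_def\<close>)

lemma preserves_pushout:
  assumes po: "is_pushout C f g p q"
  shows "is_pushout D (far F f) (far F g) (far F p) (far F q)"
proof -
  note P [simp] = C.is_pushout_Arr[OF po]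
  show ?thesis
  proof (rule D.is_pushoutI)
    show "far F p \<cdot>\<^bsub>D\<^esub> far F f = far F q \<cdot>\<^bsub>D\<^esub> far F g" by (simp flip: functor_comp[OF is_functor])
  next
    fix u v
    assume uv: "u \<in> Arr D" "v \<in> Arr D" "Dom D u = Cod D (far F f)" "Dom D v = Cod D (far F g)" "Cod D u = Cod D v"
      "u \<cdot>\<^bsub>D\<^esub> far F f = v \<cdot>\<^bsub>D\<^esub> far F g"
    then have b: "Cod D v \<in> Obj D" by simp
    obtain b e where "universal_arrow C D F (Cod D v) b e" using universal_arrow_exists[OF b] by blast
    note g = universal_arrow_props[OF this]
    obtain u' where u': "u' \<in> Arr C" "Dom C u' = Cod C f" "Cod C u' = b" "e \<cdot>\<^bsub>D\<^esub> far F u' = u"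
      using g(5)[of u "Cod C f"] uv by auto
    obtain v' where v': "v' \<in> Arr C" "Dom C v' = Cod C g" "Cod C v' = b" "e \<cdot>\<^bsub>D\<^esub> far F v' = v"
      using g(5)[of v "Cod C g"] uv by auto
    have "u' \<cdot>\<^bsub>C\<^esub> f = v' \<cdot>\<^bsub>C\<^esub> g"
      by (rule g(6)) (use u' v' uv g(1-4) D.reassoc[OF u'(4)] D.reassoc[OF v'(4)] in auto)
    then obtain h where h: "h \<in> Arr C" "Dom C h = Cod C p" "Cod C h = b" "h \<cdot>\<^bsub>C\<^esub> p = u'" "h \<cdot>\<^bsub>C\<^esub> q = v'"
      using C.is_pushout_ex[OF po, of u' v'] u' v' by metis
    show "\<exists>h. h \<in> Arr D \<and> Dom D h = Cod D (far F p) \<and> Cod D h = Cod D v \<and> h \<cdot>\<^bsub>D\<^esub> far F p = u \<and> h \<cdot>\<^bsub>D\<^esub> far F q = v"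
      by (rule exI[of _ "e \<cdot>\<^bsub>D\<^esub> far F h"]) (use h u' v' g(1-4) in \<open>simp flip: functor_comp[OF is_functor]\<close>)
  next
    fix h k
    assume hk: "h \<in> Arr D" "k \<in> Arr D" "Dom D h = Cod D (far F p)" "Dom D k = Cod D (far F p)" "Cod D k = Cod D h"
      "h \<cdot>\<^bsub>D\<^esub> far F p = k \<cdot>\<^bsub>D\<^esub> far F p" "h \<cdot>\<^bsub>D\<^esub> far F q = k \<cdot>\<^bsub>D\<^esub> far F q"
    then have b: "Cod D h \<in> Obj D" by simp
    obtain b e where "universal_arrow C D F (Cod D h) b e" using universal_arrow_exists[OF b] by blast
    note g = universal_arrow_props[OF this]
    obtain h' where h': "h' \<in> Arr C" "Dom C h' = Cod C p" "Cod C h' = b" "e \<cdot>\<^bsub>D\<^esub> far F h' = h"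
      using g(5)[of h "Cod C p"] hk by auto
    obtain k' where k': "k' \<in> Arr C" "Dom C k' = Cod C p" "Cod C k' = b" "e \<cdot>\<^bsub>D\<^esub> far F k' = k"
      using g(5)[of k "Cod C p"] hk by auto
    have "h' = k'"
      by (rule C.is_pushout_ext[OF po]; (rule g(6))?)
        (use h' k' hk g(1-4) D.reassoc[OF h'(4)] D.reassoc[OF k'(4)] in auto)
    then show "h = k" using h' k' by simp
  qed simp_all
qed

end

section \<open>Finite limits and colimits\<close>

definition opposite :: "('o, 'm) cat \<Rightarrow> ('o, 'm) cat" where
  "opposite C = \<lparr>Obj = Obj C, Arr = Arr C, Dom = Cod C, Cod = Dom C, Idt = Idt C, Cmp = (\<lambda>g f. f \<cdot>\<^bsub>C\<^esub> g)\<rparr>"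

lemma opposite_simps [simp]:
  "Obj (opposite C) = Obj C" "Arr (opposite C) = Arr C" "Dom (opposite C) = Cod C" "Cod (opposite C) = Dom C"
  "Idt (opposite C) = Idt C" "g \<cdot>\<^bsub>opposite C\<^esub> f = f \<cdot>\<^bsub>C\<^esub> g"
  by (simp_all add: opposite_def)

lemma opposite_opposite [simp]: "opposite (opposite C) = C"
  by (simp add: opposite_def)

lemma is_category_opposite: "is_category C \<Longrightarrow> is_category (opposite C)"
proof -
  assume "is_category C"
  then interpret category C by (rule category.intro)
  show ?thesis unfolding is_category_def by auto
qed

lemma hom_opposite: "hom (opposite C) a b = hom C b a"
  by auto

lemma is_functor_opposite: "is_functor (opposite C) (opposite D) F \<longleftrightarrow> is_functor C D F"
  unfolding is_functor_def by auto

lemma is_functor_to_opposite: "is_functor J (opposite C) F \<longleftrightarrow> is_functor (opposite J) C F"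
  using is_functor_opposite[of "opposite J" C] by simp

lemma is_limit_opposite: "is_limit J (opposite C) F a t \<longleftrightarrow> is_colimit (opposite J) C F a t"
  by (simp only: is_limit_def is_colimit_def is_cone_def is_cocone_def opposite_simps hom_opposite)

lemma is_colimit_opposite: "is_colimit J (opposite C) F a t \<longleftrightarrow> is_limit (opposite J) C F a t"
  by (simp only: is_limit_def is_colimit_def is_cone_def is_cocone_def opposite_simps hom_opposite)

lemma bicomplete_opposite: "bicomplete U C \<Longrightarrow> bicomplete U (opposite C)"
  unfolding bicomplete_def is_limit_opposite is_colimit_opposite is_functor_to_opposite
  using is_category_opposite by (metis opposite_simps(2))

section \<open>Finite diagrams as diagrams over the size type\<close>

lemma small_finite:
  assumes "infinite (UNIV :: 'u set)" "finite A"
  shows "small TYPE('u) A"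
  unfolding small_def using assms by (rule finite_lesspoll_infinite)

lemma infinite_UNIV_nat_inj:
  assumes "infinite (UNIV :: 'u set)"
  obtains x :: "nat \<Rightarrow> 'u" where "inj x"
  using infinite_countable_subset[OF assms] by blast

lemma bicomplete_initial:
  fixes C :: "('o, 'm) cat"
  assumes "infinite (UNIV :: 'u set)" "bicomplete TYPE('u) C"
  shows "\<exists>z. is_initial C z"
proof -
  define J :: "('u, 'u) cat" where "J = \<lparr>Obj = {}, Arr = {}, Dom = id, Cod = id, Idt = id, Cmp = (\<lambda>_. id)\<rparr>"
  define F :: "('u, 'u, 'o, 'm) cfunctor" where "F = \<lparr>fob = undefined, far = undefined\<rparr>"
  have "Arr J = {}" "Obj J = {}" by (simp_all add: J_def)
  then have J: "is_category J" "small TYPE('u) (Arr J)" "is_functor J C F"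
    by (simp add: is_category_def, metis small_finite[OF assms(1)] finite.emptyI, intro is_functorI, simp_all)
  obtain a t where "is_colimit J C F a t"
    using assms(2) J unfolding bicomplete_def by blast
  then have "is_initial C a"
    unfolding is_colimit_def is_cocone_def is_initial_def using \<open>Arr J = {}\<close> \<open>Obj J = {}\<close> by simp
  then show ?thesis by blast
qed

lemma bicomplete_pushout:
  fixes C :: "('o, 'm) cat" (structure)
  assumes inf: "infinite (UNIV :: 'u set)" and bic: "bicomplete TYPE('u) C" and C: "is_category C"
    and f: "f \<in> Arr C" and g: "g \<in> Arr C" and fg: "Dom C f = Dom C g"
  shows "\<exists>p q. is_pushout C f g p q"
proof -
  interpret category C by (rule category.intro) fact
  obtain x :: "nat \<Rightarrow> 'u" where x: "inj x" by (rule infinite_UNIV_nat_inj[OF inf])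
  have [simp]: "x i = x j \<longleftrightarrow> i = j" for i j using x by (auto dest: injD)
  \<comment> \<open>The span as a category on five elements of \<open>'u\<close>:
    \<open>x 0\<close>, \<open>x 1\<close>, \<open>x 2\<close> serve both as the objects and as
    their identities, and \<open>x 3\<close>, \<open>x 4\<close> are the two legs out of
    \<open>x 0\<close>.\<close>
  define J :: "('u, 'u) cat" where "J = \<lparr>Obj = {x 0, x 1, x 2}, Arr = {x 0, x 1, x 2, x 3, x 4},
    Dom = (\<lambda>m. if m = x 1 then x 1 else if m = x 2 then x 2 else x 0),
    Cod = (\<lambda>m. if m = x 0 then x 0 else if m = x 1 \<or> m = x 3 then x 1 else x 2), Idt = id,
    Cmp = (\<lambda>n m. if m = x 0 \<or> m = x 1 \<or> m = x 2 then n else m)\<rparr>"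
  define F :: "('u, 'u, 'o, 'm) cfunctor" where
    "F = \<lparr>fob = (\<lambda>m. if m = x 0 then Dom C f else if m = x 1 then Cod C f else Cod C g),
          far = (\<lambda>m. if m = x 0 then Idt C (Dom C f) else if m = x 1 then Idt C (Cod C f)
             else if m = x 2 then Idt C (Cod C g) else if m = x 3 then f else g)\<rparr>"
  have "is_category J" unfolding is_category_def J_def by (auto split: if_splits)
  moreover have "small TYPE('u) (Arr J)" by (rule small_finite[OF inf]) (simp add: J_def)
  moreover have "is_functor J C F"
    by (rule is_functorI) (auto simp: J_def F_def f g fg split: if_splits)
  ultimately obtain a t where "is_colimit J C F a t" using bic unfolding bicomplete_def by blast
  then have t: "\<And>j. j \<in> Obj J \<Longrightarrow> t j \<in> Arr C" "\<And>j. j \<in> Obj J \<Longrightarrow> Dom C (t j) = fob F j" "\<And>j. j \<in> Obj J \<Longrightarrow> Cod C (t j) = a"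
    "\<And>u. u \<in> Arr J \<Longrightarrow> t (Cod J u) \<cdot> far F u = t (Dom J u)"
    and univ: "\<And>b s. is_cocone J C F b s \<Longrightarrow> \<exists>!h. h \<in> hom C a b \<and> (\<forall>j\<in>Obj J. h \<cdot> t j = s j)"
    by (auto simp: is_colimit_def is_cocone_def)
  have T [simp]: "t (x 0) \<in> Arr C" "t (x (Suc 0)) \<in> Arr C" "t (x 2) \<in> Arr C" "Dom C (t (x 0)) = Dom C f" "Dom C (t (x (Suc 0))) = Cod C f"
     "Dom C (t (x 2)) = Cod C g" "Cod C (t (x 0)) = a" "Cod C (t (x (Suc 0))) = a" "Cod C (t (x 2)) = a"
    using t(1-3)[of "x 0"] t(1-3)[of "x 1"] t(1-3)[of "x 2"] by (simp_all add: J_def F_def)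
  have T' [simp]: "t (x (Suc 0)) \<cdot> f = t (x 0)" "t (x 2) \<cdot> g = t (x 0)"
    using t(4)[of "x 3"] t(4)[of "x 4"] by (simp_all add: J_def F_def)
  \<comment> \<open>The leg at the apex \<open>x 0\<close> is forced to be the common
    composite.\<close>
  have cocone: "is_cocone J C F (Cod C v) (\<lambda>j. if j = x 0 then v \<cdot> g else if j = x 1 then u else v)"
    if "u \<in> Arr C" "v \<in> Arr C" "Dom C u = Cod C f" "Dom C v = Cod C g" "Cod C u = Cod C v" "u \<cdot> f = v \<cdot> g" for u v
    unfolding is_cocone_def using that fg f g by (auto simp: J_def F_def)
  have "is_pushout C f g (t (x 1)) (t (x 2))"
  proof (rule is_pushoutI)
    fix u v
    assume uv: "u \<in> Arr C" "v \<in> Arr C" "Dom C u = Cod C f" "Dom C v = Cod C g" "Cod C u = Cod C v" "u \<cdot> f = v \<cdot> g"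
    show "\<exists>h. h \<in> Arr C \<and> Dom C h = Cod C (t (x 1)) \<and> Cod C h = Cod C v \<and> h \<cdot> t (x 1) = u \<and> h \<cdot> t (x 2) = v"
      using univ[OF cocone[OF uv]] by (auto simp: J_def)
  next
    fix h k
    assume hk: "h \<in> Arr C" "k \<in> Arr C" "Dom C h = Cod C (t (x 1))" "Dom C k = Cod C (t (x 1))" "Cod C k = Cod C h"
      "h \<cdot> t (x 1) = k \<cdot> t (x 1)" "h \<cdot> t (x 2) = k \<cdot> t (x 2)"
    have "is_cocone J C F (Cod C h) (\<lambda>j. h \<cdot> t j)"
      unfolding is_cocone_def using hk fg f g by (auto simp: J_def F_def)
    from univ[OF this] have "\<exists>!l. l \<in> hom C a (Cod C h) \<and> (\<forall>j\<in>Obj J. l \<cdot> t j = h \<cdot> t j)" .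
    moreover have "h \<cdot> t (x 0) = k \<cdot> t (x 0)"
      using hk f T by (metis T'(1) comp_assoc One_nat_def)
    ultimately show "h = k" using hk by (auto simp: J_def)
  qed (use f g fg in auto)
  then show ?thesis by blast
qed

section \<open>Pointwise limits and colimits of arrows\<close>

context category
begin

lemma is_colimit_facts:
  assumes "is_colimit J C X a t"
  shows "a \<in> Obj C" "\<And>j. j \<in> Obj J \<Longrightarrow> t j \<in> Arr C" "\<And>j. j \<in> Obj J \<Longrightarrow> Dom C (t j) = fob X j"
    "\<And>j. j \<in> Obj J \<Longrightarrow> Cod C (t j) = a" "\<And>u. u \<in> Arr J \<Longrightarrow> t (Cod J u) \<cdot> far X u = t (Dom J u)"
  using assms by (auto simp: is_colimit_def is_cocone_def)

lemma is_colimit_ex: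
  assumes "is_colimit J C X a t" "b \<in> Obj C" "\<And>j. j \<in> Obj J \<Longrightarrow> s j \<in> hom C (fob X j) b"
    "\<And>u. u \<in> Arr J \<Longrightarrow> s (Cod J u) \<cdot> far X u = s (Dom J u)"
  obtains h where "h \<in> Arr C" "Dom C h = a" "Cod C h = b" "\<And>j. j \<in> Obj J \<Longrightarrow> h \<cdot> t j = s j"
proof -
  have "is_cocone J C X b s" unfolding is_cocone_def using assms(2-) by blast
  then have "\<exists>h. h \<in> hom C a b \<and> (\<forall>j\<in>Obj J. h \<cdot> t j = s j)"
    using assms(1) unfolding is_colimit_def by blast
  then show thesis using that by auto
qed

lemma is_colimit_ext:
  assumes "is_colimit J C X a t" "is_category J" "is_functor J C X" "h \<in> Arr C" "k \<in> Arr C" "Dom C h = a" "Dom C k = a" "Cod C h = Cod C k"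
    "\<And>j. j \<in> Obj J \<Longrightarrow> h \<cdot> t j = k \<cdot> t j"
  shows "h = k"
proof -
  interpret J: category J by (rule category.intro) fact
  note F [simp] = is_colimit_facts[OF assms(1)] functor_simps[OF assms(3)]
  have "is_cocone J C X (Cod C k) (\<lambda>j. k \<cdot> t j)" unfolding is_cocone_def using assms(4-8) by simp
  then have "\<exists>!h. h \<in> hom C a (Cod C k) \<and> (\<forall>j\<in>Obj J. h \<cdot> t j = k \<cdot> t j)"
    using assms(1) unfolding is_colimit_def by blast
  moreover have "h \<in> hom C a (Cod C k) \<and> (\<forall>j\<in>Obj J. h \<cdot> t j = k \<cdot> t j)"
    "k \<in> hom C a (Cod C k) \<and> (\<forall>j\<in>Obj J. k \<cdot> t j = k \<cdot> t j)" using assms by simp_all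
  ultimately show ?thesis by blast
qed

lemma is_colimitI:
  assumes "a \<in> Obj C" "\<And>j. j \<in> Obj J \<Longrightarrow> t j \<in> hom C (fob X j) a" "\<And>u. u \<in> Arr J \<Longrightarrow> t (Cod J u) \<cdot> far X u = t (Dom J u)"
    "\<And>b s. b \<in> Obj C \<Longrightarrow> (\<And>j. j \<in> Obj J \<Longrightarrow> s j \<in> Arr C) \<Longrightarrow> (\<And>j. j \<in> Obj J \<Longrightarrow> Dom C (s j) = fob X j) \<Longrightarrow>
      (\<And>j. j \<in> Obj J \<Longrightarrow> Cod C (s j) = b) \<Longrightarrow>
      (\<And>u. u \<in> Arr J \<Longrightarrow> s (Cod J u) \<cdot> far X u = s (Dom J u)) \<Longrightarrow> \<exists>h. h \<in> hom C a b \<and> (\<forall>j\<in>Obj J. h \<cdot> t j = s j)"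
    "\<And>h k. h \<in> Arr C \<Longrightarrow> k \<in> Arr C \<Longrightarrow> Dom C h = a \<Longrightarrow> Dom C k = a \<Longrightarrow> Cod C h = Cod C k \<Longrightarrow>
      (\<And>j. j \<in> Obj J \<Longrightarrow> h \<cdot> t j = k \<cdot> t j) \<Longrightarrow> h = k"
  shows "is_colimit J C X a t"
  unfolding is_colimit_def
proof (intro conjI allI impI)
  show "is_cocone J C X a t" unfolding is_cocone_def using assms(1-3) by blast
  fix b s assume s: "is_cocone J C X b s"
  then obtain h where h: "h \<in> hom C a b \<and> (\<forall>j\<in>Obj J. h \<cdot> t j = s j)"
    using assms(4)[of b s] unfolding is_cocone_def by auto
  have "k = h" if "k \<in> hom C a b \<and> (\<forall>j\<in>Obj J. k \<cdot> t j = s j)" for k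
    by (rule assms(5)) (use h that in auto)
  with h show "\<exists>!h. h \<in> hom C a b \<and> (\<forall>j\<in>Obj J. h \<cdot> t j = s j)" by blast
qed

lemma is_functor_Ev0: "is_functor \<A> C (Ev0 C)"
  and is_functor_Ev1: "is_functor \<A> C (Ev1 C)"
  by (rule is_functorI; simp add: Ev0_def Ev1_def)+

text \<open>Colimits are formed pointwise: the composites of \<open>fob X j\<close> with the colimit
  legs at 1 form a cocone on the diagram at 0, and the arrow \<open>a\<close> that it induces is the
  colimit of the arrows.\<close>

lemma arrow_colimit:
  assumes J: "is_category J" and X: "is_functor J \<A> X"
    and c0: "is_colimit J C (comp_functor (Ev0 C) X) a0 t0" and c1: "is_colimit J C (comp_functor (Ev1 C) X) a1 t1"
  shows "\<exists>a t. is_colimit J \<A> X a t"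
proof -
  interpret J: category J by (rule category.intro) fact
  interpret D: category \<A> by (rule category_arrow_cat)
  have X0: "is_functor J C (comp_functor (Ev0 C) X)" and X1: "is_functor J C (comp_functor (Ev1 C) X)"
    using is_functor_comp[OF X] is_functor_Ev0 is_functor_Ev1 by auto
  note [simp] = Ev0_def Ev1_def functor_simps[OF X, simplified]
  note F0 [simp] = is_colimit_facts[OF c0, simplified] and F1 [simp] = is_colimit_facts[OF c1, simplified]
  have N: "sq1 (far X u) \<cdot> fob X (Dom J u) = fob X (Cod J u) \<cdot> sq0 (far X u)" if "u \<in> Arr J" for u
    using sq_commutes[of "far X u" C] that by simp
  obtain a where a: "a \<in> Arr C" "Dom C a = a0" "Cod C a = a1" "\<And>j. j \<in> Obj J \<Longrightarrow> a \<cdot> t0 j = t1 j \<cdot> fob X j"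
  proof (rule is_colimit_ex[OF c0, of a1 "\<lambda>j. t1 j \<cdot> fob X j"])
    fix u assume u: "u \<in> Arr J"
    then show "(t1 (Cod J u) \<cdot> fob X (Cod J u)) \<cdot> far (comp_functor (Ev0 C) X) u = t1 (Dom J u) \<cdot> fob X (Dom J u)"
      using N[OF u] reassoc[OF F1(5)[OF u], of "fob X (Dom J u)"] by simp
  qed auto
  have "is_colimit J \<A> X a (\<lambda>j. Square (fob X j) a (t0 j) (t1 j))"
  proof (rule D.is_colimitI)
    fix b s
    assume s: "b \<in> Obj \<A>" "\<And>j. j \<in> Obj J \<Longrightarrow> s j \<in> Arr \<A>"
      "\<And>j. j \<in> Obj J \<Longrightarrow> Dom \<A> (s j) = fob X j" "\<And>j. j \<in> Obj J \<Longrightarrow> Cod \<A> (s j) = b"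
      "\<And>u. u \<in> Arr J \<Longrightarrow> s (Cod J u) \<cdot>\<^bsub>\<A>\<^esub> far X u = s (Dom J u)"
    note s' [simp] = s(2) s(1,3,4)[simplified]
    have s5: "sq0 (s (Cod J u)) \<cdot> sq0 (far X u) = sq0 (s (Dom J u))" "sq1 (s (Cod J u)) \<cdot> sq1 (far X u) = sq1 (s (Dom J u))"
      if "u \<in> Arr J" for u using arg_cong[OF s(5)[OF that], of sq0] arg_cong[OF s(5)[OF that], of sq1] by auto
    obtain h0 where h0: "h0 \<in> Arr C" "Dom C h0 = a0" "Cod C h0 = Dom C b" "\<And>j. j \<in> Obj J \<Longrightarrow> h0 \<cdot> t0 j = sq0 (s j)"
      by (rule is_colimit_ex[OF c0, of "Dom C b" "\<lambda>j. sq0 (s j)"]) (use s5 in auto)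
    obtain h1 where h1: "h1 \<in> Arr C" "Dom C h1 = a1" "Cod C h1 = Cod C b" "\<And>j. j \<in> Obj J \<Longrightarrow> h1 \<cdot> t1 j = sq1 (s j)"
      by (rule is_colimit_ex[OF c1, of "Cod C b" "\<lambda>j. sq1 (s j)"]) (use s5 in auto)
    have "h1 \<cdot> a = b \<cdot> h0"
    proof (rule is_colimit_ext[OF c0 J X0])
      fix j assume j: "j \<in> Obj J"
      show "(h1 \<cdot> a) \<cdot> t0 j = (b \<cdot> h0) \<cdot> t0 j"
        using j h0 h1 a reassoc[OF h1(4)[OF j], of "fob X j"] sq_commutes[OF s(2)[OF j]] by simp
    qed (use h0 h1 a in auto)
    then show "\<exists>h. h \<in> hom \<A> a b \<and> (\<forall>j\<in>Obj J. h \<cdot>\<^bsub>\<A>\<^esub> Square (fob X j) a (t0 j) (t1 j) = s j)"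
      by (intro exI[of _ "Square a b h0 h1"]) (use h0 h1 a in \<open>auto intro!: square_eqI\<close>)
  next
    fix h k
    assume hk: "h \<in> Arr \<A>" "k \<in> Arr \<A>" "Dom \<A> h = a" "Dom \<A> k = a"
      "Cod \<A> h = Cod \<A> k"
      "\<And>j. j \<in> Obj J \<Longrightarrow> h \<cdot>\<^bsub>\<A>\<^esub> Square (fob X j) a (t0 j) (t1 j) = k \<cdot>\<^bsub>\<A>\<^esub> Square (fob X j) a (t0 j) (t1 j)"
    have e: "sq0 h \<cdot> t0 j = sq0 k \<cdot> t0 j" "sq1 h \<cdot> t1 j = sq1 k \<cdot> t1 j" if "j \<in> Obj J" for j
      using hk(6)[OF that] by simp_all
    note hk' = hk(1-5)[simplified]
    have "sq0 h = sq0 k"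
      by (rule is_colimit_ext[OF c0 J X0]) (use hk' e a in simp_all)
    moreover have "sq1 h = sq1 k"
      by (rule is_colimit_ext[OF c1 J X1]) (use hk' e a in simp_all)
    ultimately show "h = k" using hk' by (intro square_eqI) simp_all
  next
    fix u assume "u \<in> Arr J"
    then show "Square (fob X (Cod J u)) a (t0 (Cod J u)) (t1 (Cod J u)) \<cdot>\<^bsub>\<A>\<^esub> far X u = Square (fob X (Dom J u)) a (t0 (Dom J u)) (t1 (Dom J u))"
      using F0(5) F1(5) by simp
  qed (use a in auto)
  then show ?thesis by blast
qed

lemma is_limit_facts:
  assumes "is_limit J C X a t"
  shows "a \<in> Obj C" "\<And>j. j \<in> Obj J \<Longrightarrow> t j \<in> Arr C" "\<And>j. j \<in> Obj J \<Longrightarrow> Cod C (t j) = fob X j"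
    "\<And>j. j \<in> Obj J \<Longrightarrow> Dom C (t j) = a" "\<And>u. u \<in> Arr J \<Longrightarrow> far X u \<cdot> t (Dom J u) = t (Cod J u)"
  using assms by (auto simp: is_limit_def is_cone_def)

lemma is_limit_ex:
  assumes "is_limit J C X a t" "b \<in> Obj C" "\<And>j. j \<in> Obj J \<Longrightarrow> s j \<in> hom C b (fob X j)"
    "\<And>u. u \<in> Arr J \<Longrightarrow> far X u \<cdot> s (Dom J u) = s (Cod J u)"
  obtains h where "h \<in> Arr C" "Dom C h = b" "Cod C h = a" "\<And>j. j \<in> Obj J \<Longrightarrow> t j \<cdot> h = s j"
proof -
  have "is_cone J C X b s" unfolding is_cone_def using assms(2-) by blast
  then have "\<exists>h. h \<in> hom C b a \<and> (\<forall>j\<in>Obj J. t j \<cdot> h = s j)"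
    using assms(1) unfolding is_limit_def by blast
  then show thesis using that by auto
qed

lemma is_limit_ext:
  assumes "is_limit J C X a t" "is_category J" "is_functor J C X" "h \<in> Arr C" "k \<in> Arr C" "Cod C h = a" "Cod C k = a" "Dom C h = Dom C k"
    "\<And>j. j \<in> Obj J \<Longrightarrow> t j \<cdot> h = t j \<cdot> k"
  shows "h = k"
proof -
  interpret op: category "opposite C" by (rule category.intro) (rule is_category_opposite[OF is_category])
  show ?thesis
    by (rule op.is_colimit_ext[of "opposite J" X a t])
      (use assms in \<open>simp_all add: is_colimit_opposite is_category_opposite is_functor_opposite\<close>)
qed

text \<open>Passing to the opposite of \<open>C\<close> exchanges the two evaluations, so this is
  not a literal instance of the statement on colimits. The argument is repeated dually, the
  connecting arrow now being induced into the limit \<open>a1\<close>.\<close>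

lemma arrow_limit:
  assumes J: "is_category J" and X: "is_functor J \<A> X"
    and c0: "is_limit J C (comp_functor (Ev0 C) X) a0 t0" and c1: "is_limit J C (comp_functor (Ev1 C) X) a1 t1"
  shows "\<exists>a t. is_limit J \<A> X a t"
proof -
  interpret J: category J by (rule category.intro) fact
  interpret D: category "opposite \<A>" by (rule category.intro) (intro is_category_opposite is_category_arrow_cat)
  have X0: "is_functor J C (comp_functor (Ev0 C) X)" and X1: "is_functor J C (comp_functor (Ev1 C) X)"
    using is_functor_comp[OF X] is_functor_Ev0 is_functor_Ev1 by auto
  note [simp] = Ev0_def Ev1_def functor_simps[OF X, simplified]
  note F0 [simp] = is_limit_facts[OF c0, simplified] and F1 [simp] = is_limit_facts[OF c1, simplified]
  have N: "sq1 (far X u) \<cdot> fob X (Dom J u) = fob X (Cod J u) \<cdot> sq0 (far X u)" if "u \<in> Arr J" for u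
    using sq_commutes[of "far X u" C] that by simp
  obtain a where a: "a \<in> Arr C" "Dom C a = a0" "Cod C a = a1" "\<And>j. j \<in> Obj J \<Longrightarrow> t1 j \<cdot> a = fob X j \<cdot> t0 j"
  proof (rule is_limit_ex[OF c1, of a0 "\<lambda>j. fob X j \<cdot> t0 j"])
    fix u assume u: "u \<in> Arr J"
    then show "far (comp_functor (Ev1 C) X) u \<cdot> (fob X (Dom J u) \<cdot> t0 (Dom J u)) = fob X (Cod J u) \<cdot> t0 (Cod J u)"
      using N[OF u] reassoc[OF N[OF u], of "t0 (Dom J u)"] by simp
  qed auto
  have "is_colimit (opposite J) (opposite \<A>) X a (\<lambda>j. Square a (fob X j) (t0 j) (t1 j))"
  proof (rule D.is_colimitI)
    fix b s
    assume s: "b \<in> Obj (opposite \<A>)" "\<And>j. j \<in> Obj (opposite J) \<Longrightarrow> s j \<in> Arr (opposite \<A>)"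
      "\<And>j. j \<in> Obj (opposite J) \<Longrightarrow> Dom (opposite \<A>) (s j) = fob X j"
      "\<And>j. j \<in> Obj (opposite J) \<Longrightarrow> Cod (opposite \<A>) (s j) = b"
      "\<And>u. u \<in> Arr (opposite J) \<Longrightarrow> s (Cod (opposite J) u) \<cdot>\<^bsub>opposite \<A>\<^esub> far X u = s (Dom (opposite J) u)"
    note s' [simp] = s(1,2,3,4)[simplified]
    have s5: "sq0 (far X u) \<cdot> sq0 (s (Dom J u)) = sq0 (s (Cod J u))" "sq1 (far X u) \<cdot> sq1 (s (Dom J u)) = sq1 (s (Cod J u))"
      if "u \<in> Arr J" for u using arg_cong[OF s(5)[simplified, OF that], of sq0] arg_cong[OF s(5)[simplified, OF that], of sq1] by auto
    obtain h0 where h0: "h0 \<in> Arr C" "Dom C h0 = Dom C b" "Cod C h0 = a0" "\<And>j. j \<in> Obj J \<Longrightarrow> t0 j \<cdot> h0 = sq0 (s j)"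
      by (rule is_limit_ex[OF c0, of "Dom C b" "\<lambda>j. sq0 (s j)"]) (use s5 in auto)
    obtain h1 where h1: "h1 \<in> Arr C" "Dom C h1 = Cod C b" "Cod C h1 = a1" "\<And>j. j \<in> Obj J \<Longrightarrow> t1 j \<cdot> h1 = sq1 (s j)"
      by (rule is_limit_ex[OF c1, of "Cod C b" "\<lambda>j. sq1 (s j)"]) (use s5 in auto)
    have "h1 \<cdot> b = a \<cdot> h0"
    proof (rule is_limit_ext[OF c1 J X1])
      fix j assume j: "j \<in> Obj J"
      show "t1 j \<cdot> (h1 \<cdot> b) = t1 j \<cdot> (a \<cdot> h0)"
        using j h0 h1 a reassoc[OF h1(4)[OF j], of b] reassoc[OF a(4)[OF j], of h0] sq_commutes[OF s(2)[simplified, OF j]] by simp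
    qed (use h0 h1 a in auto)
    then show "\<exists>h. h \<in> hom (opposite \<A>) a b \<and>
        (\<forall>j\<in>Obj (opposite J). h \<cdot>\<^bsub>opposite \<A>\<^esub> Square a (fob X j) (t0 j) (t1 j) = s j)"
      by (intro exI[of _ "Square b a h0 h1"]) (use h0 h1 a in \<open>auto intro!: square_eqI\<close>)
  next
    fix h k
    assume hk: "h \<in> Arr (opposite \<A>)" "k \<in> Arr (opposite \<A>)" "Dom (opposite \<A>) h = a"
      "Dom (opposite \<A>) k = a" "Cod (opposite \<A>) h = Cod (opposite \<A>) k"
      "\<And>j. j \<in> Obj (opposite J) \<Longrightarrow> h \<cdot>\<^bsub>opposite \<A>\<^esub> Square a (fob X j) (t0 j) (t1 j) =
         k \<cdot>\<^bsub>opposite \<A>\<^esub> Square a (fob X j) (t0 j) (t1 j)"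
    have e: "t0 j \<cdot> sq0 h = t0 j \<cdot> sq0 k" "t1 j \<cdot> sq1 h = t1 j \<cdot> sq1 k" if "j \<in> Obj J" for j
      using hk(6)[simplified, OF that] by simp_all
    note hk' = hk(1-5)[simplified]
    have "sq0 h = sq0 k"
      by (rule is_limit_ext[OF c0 J X0]) (use hk' e a in simp_all)
    moreover have "sq1 h = sq1 k"
      by (rule is_limit_ext[OF c1 J X1]) (use hk' e a in simp_all)
    ultimately show "h = k" using hk' by (intro square_eqI) simp_all
  next
    fix u assume "u \<in> Arr (opposite J)"
    then show "Square a (fob X (Cod (opposite J) u)) (t0 (Cod (opposite J) u)) (t1 (Cod (opposite J) u)) \<cdot>\<^bsub>opposite \<A>\<^esub> far X u =
        Square a (fob X (Dom (opposite J) u)) (t0 (Dom (opposite J) u)) (t1 (Dom (opposite J) u))"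
      using F0(5) F1(5) by simp
  qed (use a in auto)
  then show ?thesis using is_colimit_opposite[of "opposite J" \<A>] by auto
qed

lemma bicomplete_arrow_cat:
  fixes U :: "'u itself"
  assumes "bicomplete U C"
  shows "bicomplete U \<A>"
  unfolding bicomplete_def
proof (intro allI impI conjI)
  fix J :: "('u, 'u) cat" and X
  assume J: "is_category J \<and> small U (Arr J) \<and> is_functor J \<A> X"
  then have F: "is_functor J C (comp_functor (Ev0 C) X)" "is_functor J C (comp_functor (Ev1 C) X)"
    using is_functor_comp is_functor_Ev0 is_functor_Ev1 by blast+
  have *: "(\<exists>a t. is_limit J C Y a t) \<and> (\<exists>a t. is_colimit J C Y a t)" if "is_functor J C Y" for Y
    using assms J that unfolding bicomplete_def by blast
  show "\<exists>a t. is_limit J \<A> X a t" "\<exists>a t. is_colimit J \<A> X a t"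
    using *[OF F(1)] *[OF F(2)] J arrow_limit[of J X] arrow_colimit[of J X] by blast+
qed

end

section \<open>Lifting properties of squares\<close>

definition pointwise :: "('o, 'm) cat \<Rightarrow> 'm set \<Rightarrow> 'm square set" where
  "pointwise C R = {\<beta> \<in> Arr (arrow_cat C). sq0 \<beta> \<in> R \<and> sq1 \<beta> \<in> R}"

text \<open>The terminal object is the target in the test squares that isolate the component at 0,
  and gives the right adjoint of \<open>Ev0\<close>.\<close>

locale category_po_terminal = category_po C for C :: "('o, 'm) cat" (structure) +
  assumes terminal_exists: "\<exists>z. z \<in> Obj C \<and> (\<forall>a\<in>Obj C. \<exists>!f. f \<in> hom C a z)"
begin

lemma corner_props:
  assumes "\<alpha> \<in> Arr \<A>"
  shows "corner C \<alpha> \<in> Arr C" "Dom C (corner C \<alpha>) = Cod C (po_in1 C (sq_src \<alpha>) (sq0 \<alpha>))"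
    "Cod C (corner C \<alpha>) = Cod C (sq_tgt \<alpha>)" "corner C \<alpha> \<cdot> po_in1 C (sq_src \<alpha>) (sq0 \<alpha>) = sq1 \<alpha>"
    "corner C \<alpha> \<cdot> po_in2 C (sq_src \<alpha>) (sq0 \<alpha>) = sq_tgt \<alpha>"
  unfolding corner_def
  using po_map_props[of "sq_src \<alpha>" "sq0 \<alpha>" "sq1 \<alpha>" "sq_tgt \<alpha>"] assms sq_commutes[OF assms] by simp_all

text \<open>Necessity is tested on two special squares, one for each component. For sufficiency, a
  lift at 0 is chosen first; it prescribes the lift at 1 on the codomain of \<open>\<alpha>\<close>,
  so that what remains at 1 is a lifting problem for the corner map.\<close>

lemma llp_arrow:
  assumes R: "R \<subseteq> Arr C" "\<And>a. a \<in> Obj C \<Longrightarrow> Idt C a \<in> R" and \<alpha>: "\<alpha> \<in> Arr \<A>"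
  shows "\<alpha> \<in> llp \<A> (pointwise C R) \<longleftrightarrow> sq0 \<alpha> \<in> llp C R \<and> corner C \<alpha> \<in> llp C R"
proof -
  interpret D: category \<A> by (rule category_arrow_cat)
  note K = corner_props[OF \<alpha>] and [simp] = sq_Arr[OF \<alpha>] \<alpha>
  define f g where fg: "f = sq_src \<alpha>" "g = sq_tgt \<alpha>"
  define i j where ij: "i = po_in1 C f (sq0 \<alpha>)" "j = po_in2 C f (sq0 \<alpha>)"
  have po: "is_pushout C f (sq0 \<alpha>) i j" unfolding ij by (rule po_is_pushout) (simp_all add: fg)
  note P [simp] = is_pushout_Arr[OF po]
  have ci: "corner C \<alpha> \<cdot> i = sq1 \<alpha>" "corner C \<alpha> \<cdot> j = g" unfolding ij fg by (simp_all add: K)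
  have [simp]: "corner C \<alpha> \<in> Arr C" "Dom C (corner C \<alpha>) = Cod C i" "g \<in> Arr C" "sq_src \<alpha> = f" "sq_tgt \<alpha> = g"
    "sq1 \<alpha> \<cdot> f = g \<cdot> sq0 \<alpha>" "Dom C (sq0 \<alpha>) = Dom C f" "Cod C (sq0 \<alpha>) = Dom C g" "Dom C (sq1 \<alpha>) = Cod C f"
    "Cod C (sq1 \<alpha>) = Cod C g" "Cod C (corner C \<alpha>) = Cod C g" using sq_commutes[OF \<alpha>] by (simp_all add: ij fg K)
  show ?thesis
  proof (intro iffI conjI)
    assume L: "\<alpha> \<in> llp \<A> (pointwise C R)"
    obtain z where z: "z \<in> Obj C" "\<And>a. a \<in> Obj C \<Longrightarrow> \<exists>!f. f \<in> hom C a z" using terminal_exists by blast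
    define bang where "bang = (\<lambda>a. THE f. f \<in> hom C a z)"
    have bang: "bang a \<in> Arr C" "Dom C (bang a) = a" "Cod C (bang a) = z" if "a \<in> Obj C" for a
      using theI'[OF z(2)[OF that]] unfolding bang_def by auto
    have bang_eq: "h = k" if "h \<in> Arr C" "k \<in> Arr C" "Dom C h = Dom C k" "Cod C h = z" "Cod C k = z" for h k
      using z(2)[of "Dom C k"] that by auto
    have "has_lifting C (sq0 \<alpha>) p" if p: "p \<in> R" for p
    proof (rule has_liftingI)
      have pA [simp]: "p \<in> Arr C" using p R by auto
      \<comment> \<open>This is \<open>U0 p\<close>. Maps into its arrows are determined at 0, so a
        lift against it is a lift of \<open>sq0 \<alpha>\<close> against \<open>p\<close>.\<close>
      let ?\<beta> = "Square (bang (Dom C p)) (bang (Cod C p)) p (Idt C z)"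
      fix u v
      assume uv: "u \<in> Arr C" "v \<in> Arr C" "Dom C u = Dom C (sq0 \<alpha>)" "Cod C u = Dom C p" "Dom C v = Cod C (sq0 \<alpha>)"
        "Cod C v = Cod C p" "v \<cdot> sq0 \<alpha> = p \<cdot> u"
      have \<beta>: "?\<beta> \<in> Arr \<A>" using bang z by (auto intro!: bang_eq)
      then have lift: "has_lifting \<A> \<alpha> ?\<beta>" using L p R z by (auto simp: llp_def pointwise_def)
      obtain h where h: "h \<in> Arr \<A>" "sq_src h = g" "sq_tgt h = bang (Dom C p)"
        "h \<cdot>\<^bsub>\<A>\<^esub> \<alpha> = Square f (bang (Dom C p)) u (bang (Cod C f))"
        "?\<beta> \<cdot>\<^bsub>\<A>\<^esub> h = Square g (bang (Cod C p)) v (bang (Cod C g))"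
        by (rule D.has_liftingE[OF lift \<alpha> \<beta>, of "Square f (bang (Dom C p)) u (bang (Cod C f))" "Square g (bang (Cod C p)) v (bang (Cod C g))"])
          (use uv bang z in \<open>auto intro!: bang_eq\<close>)
      then show "\<exists>h. h \<in> Arr C \<and> Dom C h = Cod C (sq0 \<alpha>) \<and> Cod C h = Dom C p \<and> h \<cdot> sq0 \<alpha> = u \<and> p \<cdot> h = v"
        using bang by (intro exI[of _ "sq0 h"]) auto
    qed
    then show "sq0 \<alpha> \<in> llp C R" by (simp add: llp_def)
    have "has_lifting C (corner C \<alpha>) p" if p: "p \<in> R" for p
    proof (rule has_liftingI)
      have pA [simp]: "p \<in> Arr C" using p R by auto
      let ?I = "Idt C (Dom C p)"
      \<comment> \<open>The square from the identity of the domain of \<open>p\<close> to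
        \<open>p\<close>. Its component at 0 is an identity, which forces the lift at 0, and the
        lift at 1 then solves the problem for the corner map.\<close>
      let ?\<beta> = "Square ?I p ?I p"
      fix u v
      assume uv: "u \<in> Arr C" "v \<in> Arr C" "Dom C u = Dom C (corner C \<alpha>)" "Cod C u = Dom C p" "Dom C v = Cod C (corner C \<alpha>)"
        "Cod C v = Cod C p" "v \<cdot> corner C \<alpha> = p \<cdot> u"
      have \<beta>: "?\<beta> \<in> Arr \<A>" by simp
      then have lift: "has_lifting \<A> \<alpha> ?\<beta>" using L p R by (auto simp: llp_def pointwise_def)
      have "v \<cdot> g = p \<cdot> (u \<cdot> j)" "v \<cdot> sq1 \<alpha> = p \<cdot> (u \<cdot> i)"
        using reassoc[OF uv(7), of j] reassoc[OF uv(7), of i] ci uv by simp_all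
      note uv' = this uv(1-6)
      obtain h where h: "h \<in> Arr \<A>" "sq_src h = g" "sq_tgt h = ?I"
        "h \<cdot>\<^bsub>\<A>\<^esub> \<alpha> = Square f ?I (u \<cdot> j \<cdot> sq0 \<alpha>) (u \<cdot> i)"
        "?\<beta> \<cdot>\<^bsub>\<A>\<^esub> h = Square g p (u \<cdot> j) v"
        by (rule D.has_liftingE[OF lift \<alpha> \<beta>, of "Square f ?I (u \<cdot> j \<cdot> sq0 \<alpha>) (u \<cdot> i)" "Square g p (u \<cdot> j) v"])
          (use uv' in simp_all)
      note hA = sq_Arr[OF h(1)] sq_commutes[OF h(1)]
      have "sq1 h \<cdot> corner C \<alpha> = u"
        by (rule is_pushout_ext[OF po]) (use h hA uv ci in auto)
      then show "\<exists>h. h \<in> Arr C \<and> Dom C h = Cod C (corner C \<alpha>) \<and> Cod C h = Dom C p \<and> h \<cdot> corner C \<alpha> = u \<and> p \<cdot> h = v"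
        using h hA by (intro exI[of _ "sq1 h"]) auto
    qed
    then show "corner C \<alpha> \<in> llp C R" by (simp add: llp_def)
  next
    assume L: "sq0 \<alpha> \<in> llp C R \<and> corner C \<alpha> \<in> llp C R"
    have "has_lifting \<A> \<alpha> p" if p: "p \<in> pointwise C R" for p
    proof (rule D.has_liftingI)
      have pA: "p \<in> Arr \<A>" and L0: "has_lifting C (sq0 \<alpha>) (sq0 p)" and L1: "has_lifting C (corner C \<alpha>) (sq1 p)"
        using p L by (auto simp: llp_def pointwise_def)
      note pA' [simp] = pA sq_Arr[OF pA]
      define e b where eb: "e = sq_src p" "b = sq_tgt p"
      have eb' [simp]: "sq_src p = e" "sq_tgt p = b" "e \<in> Arr C" "b \<in> Arr C" by (simp_all add: eb)
      fix u v
      assume uv: "u \<in> Arr \<A>" "v \<in> Arr \<A>" "Dom \<A> u = Dom \<A> \<alpha>" "Cod \<A> u = Dom \<A> p"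
        "Dom \<A> v = Cod \<A> \<alpha>" "Cod \<A> v = Cod \<A> p" "v \<cdot>\<^bsub>\<A>\<^esub> \<alpha> = p \<cdot>\<^bsub>\<A>\<^esub> u"
      then have uv0: "sq_src u = f" "sq_tgt u = e" "sq_src v = g" "sq_tgt v = b" "sq0 v \<cdot> sq0 \<alpha> = sq0 p \<cdot> sq0 u" "sq1 v \<cdot> sq1 \<alpha> = sq1 p \<cdot> sq1 u"
        by auto
      note uA = sq_Arr[OF uv(1), unfolded uv0] sq_commutes[OF uv(1), unfolded uv0] and vA = sq_Arr[OF uv(2), unfolded uv0] sq_commutes[OF uv(2), unfolded uv0]
      have pc: "sq1 p \<cdot> e = b \<cdot> sq0 p" using sq_commutes[OF pA] by simp
      have [simp]: "Dom C (sq0 p) = Dom C e" "Cod C (sq0 p) = Dom C b" "Dom C (sq1 p) = Cod C e" "Cod C (sq1 p) = Cod C b" by simp_all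
      obtain h0 where h0: "h0 \<in> Arr C" "Dom C h0 = Dom C g" "Cod C h0 = Dom C e" "h0 \<cdot> sq0 \<alpha> = sq0 u" "sq0 p \<cdot> h0 = sq0 v"
        by (rule has_liftingE[OF L0, of "sq0 u" "sq0 v"]) (use uA vA uv0(5,6) in simp_all)
      \<comment> \<open>The given map at 1 and the lift already found at 0 agree on the span, so
        they glue to the upper edge of a lifting problem for the corner map.\<close>
      obtain k where k: "k \<in> Arr C" "Dom C k = Cod C i" "Cod C k = Cod C e" "k \<cdot> i = sq1 u" "k \<cdot> j = e \<cdot> h0"
        by (rule is_pushout_ex[OF po, of "sq1 u" "e \<cdot> h0"]) (use uA h0 in auto)
      have c: "sq1 v \<cdot> corner C \<alpha> = sq1 p \<cdot> k"
        by (rule is_pushout_ext[OF po]) (simp_all add: k h0 uA vA uv0(6) ci reassoc[OF pc, of h0])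
      obtain h1 where h1: "h1 \<in> Arr C" "Dom C h1 = Cod C g" "Cod C h1 = Cod C e" "h1 \<cdot> corner C \<alpha> = k" "sq1 p \<cdot> h1 = sq1 v"
        by (rule has_liftingE[OF L1, of k "sq1 v"]) (simp_all add: k(1-3) vA c)
      have "h1 \<cdot> g = e \<cdot> h0" "h1 \<cdot> sq1 \<alpha> = sq1 u"
        using reassoc[OF h1(4), of j] reassoc[OF h1(4), of i] ci h1 k by simp_all
      then show "\<exists>h. h \<in> Arr \<A> \<and> Dom \<A> h = Cod \<A> \<alpha> \<and> Cod \<A> h = Dom \<A> p \<and>
          h \<cdot>\<^bsub>\<A>\<^esub> \<alpha> = u \<and> p \<cdot>\<^bsub>\<A>\<^esub> h = v"
        by (intro exI[of _ "Square g e h0 h1"]) (use h0 h1 uv0 in \<open>auto intro!: square_eqI\<close>)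
    qed
    then show "\<alpha> \<in> llp \<A> (pointwise C R)" using \<alpha> by (simp add: llp_def)
  qed
qed

end

section \<open>Functorial factorizations of squares\<close>

text \<open>A functorial factorization \<open>f = b f \<cdot> a f\<close> with its action \<open>m\<close> on middle objects.\<close>

definition factorization_data ::
  "('o, 'm) cat \<Rightarrow> ('m \<Rightarrow> 'm) \<Rightarrow> ('m \<Rightarrow> 'm) \<Rightarrow> ('m square \<Rightarrow> 'm) \<Rightarrow> bool" where
  "factorization_data C a b m \<longleftrightarrow>
     (\<forall>f\<in>Arr C. a f \<in> Arr C \<and> b f \<in> Arr C \<and> Dom C (a f) = Dom C f \<and> Dom C (b f) = Cod C (a f) \<and>
        Cod C (b f) = Cod C f \<and> b f \<cdot>\<^bsub>C\<^esub> a f = f) \<and>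
     (\<forall>s\<in>Arr (arrow_cat C). m s \<in> hom C (Cod C (a (sq_src s))) (Cod C (a (sq_tgt s))) \<and>
        m s \<cdot>\<^bsub>C\<^esub> a (sq_src s) = a (sq_tgt s) \<cdot>\<^bsub>C\<^esub> sq0 s \<and> b (sq_tgt s) \<cdot>\<^bsub>C\<^esub> m s = sq1 s \<cdot>\<^bsub>C\<^esub> b (sq_src s)) \<and>
     (\<forall>f\<in>Arr C. m (Idt (arrow_cat C) f) = Idt C (Cod C (a f))) \<and>
     (\<forall>s\<in>Arr (arrow_cat C). \<forall>t\<in>Arr (arrow_cat C). sq_src t = sq_tgt s \<longrightarrow>
        m (t \<cdot>\<^bsub>arrow_cat C\<^esub> s) = m t \<cdot>\<^bsub>C\<^esub> m s)"

text \<open>The two functors of a factorization share their action on middle objects, so a single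
  map \<open>m\<close> records it. In this form a factorization of squares can be assembled one
  stage at a time.\<close>

lemma (in category) functorial_factorization_data:
  assumes "functorial_factorization C F"
  shows "factorization_data C (fob (fst F)) (fob (snd F)) (\<lambda>s. sq1 (far (fst F) s))"
proof -
  interpret D: category \<A> by (rule category_arrow_cat)
  obtain \<alpha> \<beta> where F: "F = (\<alpha>, \<beta>)" by (cases F)
  then have A: "is_functor \<A> \<A> \<alpha>" and B: "is_functor \<A> \<A> \<beta>"
    and o: "\<And>f. f \<in> Arr C \<Longrightarrow> Dom C (fob \<alpha> f) = Dom C f \<and> Cod C (fob \<alpha> f) = Dom C (fob \<beta> f) \<and>
        Cod C (fob \<beta> f) = Cod C f \<and> fob \<beta> f \<cdot> fob \<alpha> f = f"
    and s: "\<And>s. s \<in> Arr \<A> \<Longrightarrow> sq0 (far \<alpha> s) = sq0 s \<and> sq1 (far \<alpha> s) = sq0 (far \<beta> s) \<and> sq1 (far \<beta> s) = sq1 s"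
    using assms by (auto simp: functorial_factorization_def)
  note [simp] = functor_simps[OF A, simplified] functor_simps[OF B, simplified]
  show ?thesis
    unfolding factorization_data_def F fst_conv snd_conv
  proof (intro conjI ballI impI)
    fix s assume s': "s \<in> Arr \<A>"
    then have *: "far \<alpha> s \<in> Arr \<A>" "far \<beta> s \<in> Arr \<A>" by simp_all
    show "sq1 (far \<alpha> s) \<in> hom C (Cod C (fob \<alpha> (sq_src s))) (Cod C (fob \<alpha> (sq_tgt s)))"
      using sq_Arr[OF *(1)] s' by simp
    show "sq1 (far \<alpha> s) \<cdot> fob \<alpha> (sq_src s) = fob \<alpha> (sq_tgt s) \<cdot> sq0 s"
      using sq_commutes[OF *(1)] s[OF s'] s' by simp
    show "fob \<beta> (sq_tgt s) \<cdot> sq1 (far \<alpha> s) = sq1 s \<cdot> fob \<beta> (sq_src s)"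
      using sq_commutes[OF *(2)] s[OF s'] s' by simp
  next
    fix f assume "f \<in> Arr C"
    then show "sq1 (far \<alpha> (Idt \<A> f)) = Idt C (Cod C (fob \<alpha> f))" by simp
  next
    fix s t assume st: "s \<in> Arr \<A>" "t \<in> Arr \<A>" "sq_src t = sq_tgt s"
    show "sq1 (far \<alpha> (t \<cdot>\<^bsub>\<A>\<^esub> s)) = sq1 (far \<alpha> t) \<cdot> sq1 (far \<alpha> s)"
      using functor_comp[OF A st(1,2)] st by simp
  qed (use o in auto)
qed

lemma (in category) factorization_data_functorial:
  assumes "factorization_data C a b m"
  shows "functorial_factorization C
    (\<lparr>fob = a, far = (\<lambda>s. Square (a (sq_src s)) (a (sq_tgt s)) (sq0 s) (m s))\<rparr>,
     \<lparr>fob = b, far = (\<lambda>s. Square (b (sq_src s)) (b (sq_tgt s)) (m s) (sq1 s))\<rparr>)"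
proof -
  have [simp]: "a f \<in> Arr C" "b f \<in> Arr C" "Dom C (a f) = Dom C f" "Dom C (b f) = Cod C (a f)" "Cod C (b f) = Cod C f" "b f \<cdot> a f = f"
    if "f \<in> Arr C" for f using assms that by (auto simp: factorization_data_def)
  have M: "m s \<in> Arr C" "Dom C (m s) = Cod C (a (sq_src s))" "Cod C (m s) = Cod C (a (sq_tgt s))"
    "m s \<cdot> a (sq_src s) = a (sq_tgt s) \<cdot> sq0 s" "b (sq_tgt s) \<cdot> m s = sq1 s \<cdot> b (sq_src s)"
    if "s \<in> Arr \<A>" for s using assms that by (auto simp: factorization_data_def)
  have I: "m (Square f f (Idt C (Dom C f)) (Idt C (Cod C f))) = Idt C (Cod C (a f))" if "f \<in> Arr C" for f
    using assms that by (auto simp: factorization_data_def)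
  have K: "m (Square (sq_src s) (sq_tgt t) (sq0 t \<cdot> sq0 s) (sq1 t \<cdot> sq1 s)) = m t \<cdot> m s"
    if "s \<in> Arr \<A>" "t \<in> Arr \<A>" "sq_src t = sq_tgt s" for s t
    using assms that by (simp add: factorization_data_def)
  show ?thesis
    unfolding functorial_factorization_def prod.case
    by (intro conjI ballI is_functorI) (simp_all add: M I K)
qed

context category_po_terminal
begin

text \<open>Factor the component at 0, push its first factor out along the source of the square, and
  factor the map \<open>c\<close> from that pushout to the target at 1. The middle arrow
  \<open>z\<close> runs from the middle object at 0 through the pushout to the middle object at 1.
  The corner map of the first factor is then itself a first factor, as the criterion for
  cofibrations asks.\<close>

lemma arrow_factorization:
  assumes "factorization_data C a b m"
  obtains a' b' m' where "factorization_data \<A> a' b' m'"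
    "\<forall>\<sigma>\<in>Arr \<A>. \<exists>f\<in>Arr C. \<exists>g\<in>Arr C. sq0 (a' \<sigma>) = a f \<and> corner C (a' \<sigma>) = a g \<and> sq0 (b' \<sigma>) = b f \<and> sq1 (b' \<sigma>) = b g"
proof -
  interpret D: category \<A> by (rule category_arrow_cat)
  have ab: "a f \<in> Arr C" "b f \<in> Arr C" "Dom C (a f) = Dom C f" "Dom C (b f) = Cod C (a f)" "Cod C (b f) = Cod C f" "b f \<cdot> a f = f"
    if "f \<in> Arr C" for f using assms that by (auto simp: factorization_data_def)
  have M: "m s \<in> Arr C" "Dom C (m s) = Cod C (a (sq_src s))" "Cod C (m s) = Cod C (a (sq_tgt s))"
    "m s \<cdot> a (sq_src s) = a (sq_tgt s) \<cdot> sq0 s" "b (sq_tgt s) \<cdot> m s = sq1 s \<cdot> b (sq_src s)"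
    if "s \<in> Arr \<A>" for s using assms that by (auto simp: factorization_data_def)
  have I: "m (Square f f (Idt C (Dom C f)) (Idt C (Cod C f))) = Idt C (Cod C (a f))" if "f \<in> Arr C" for f
    using assms that by (auto simp: factorization_data_def)
  have K: "m (Square (sq_src s) (sq_tgt t) (sq0 t \<cdot> sq0 s) (sq1 t \<cdot> sq1 s)) = m t \<cdot> m s"
    if "s \<in> Arr \<A>" "t \<in> Arr \<A>" "sq_src t = sq_tgt s" for s t
    using assms that by (simp add: factorization_data_def)
  define i j c z where "i = (\<lambda>\<sigma> :: 'm square. po_in1 C (sq_src \<sigma>) (a (sq0 \<sigma>)))" and "j = (\<lambda>\<sigma> :: 'm square. po_in2 C (sq_src \<sigma>) (a (sq0 \<sigma>)))"
    and "c = (\<lambda>\<sigma> :: 'm square. po_map C (sq_src \<sigma>) (a (sq0 \<sigma>)) (sq1 \<sigma>) (sq_tgt \<sigma> \<cdot> b (sq0 \<sigma>)))" and "z = (\<lambda>\<sigma> :: 'm square. a (c \<sigma>) \<cdot> j \<sigma>)"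
  have ij_fold: "po_in1 C (sq_src \<sigma>) (a (sq0 \<sigma>)) = i \<sigma>" "po_in2 C (sq_src \<sigma>) (a (sq0 \<sigma>)) = j \<sigma>" for \<sigma> :: "'m square"
    by (simp_all add: i_def j_def)
  have po: "is_pushout C (sq_src \<sigma>) (a (sq0 \<sigma>)) (i \<sigma>) (j \<sigma>)" if "\<sigma> \<in> Arr \<A>" for \<sigma>
    unfolding i_def j_def by (rule po_is_pushout) (use that in \<open>simp_all add: ab\<close>)
  have ij: "i \<sigma> \<in> Arr C" "j \<sigma> \<in> Arr C" "Dom C (i \<sigma>) = Cod C (sq_src \<sigma>)" "Dom C (j \<sigma>) = Cod C (a (sq0 \<sigma>))"
    "Cod C (j \<sigma>) = Cod C (i \<sigma>)" "i \<sigma> \<cdot> sq_src \<sigma> = j \<sigma> \<cdot> a (sq0 \<sigma>)" if "\<sigma> \<in> Arr \<A>" for \<sigma>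
    using is_pushout_Arr[OF po[OF that]] by simp_all
  have c: "c \<sigma> \<in> Arr C" "Dom C (c \<sigma>) = Cod C (i \<sigma>)" "Cod C (c \<sigma>) = Cod C (sq_tgt \<sigma>)" "c \<sigma> \<cdot> i \<sigma> = sq1 \<sigma>" "c \<sigma> \<cdot> j \<sigma> = sq_tgt \<sigma> \<cdot> b (sq0 \<sigma>)"
    if "\<sigma> \<in> Arr \<A>" for \<sigma>
    unfolding c_def i_def j_def
    using po_map_props[of "sq_src \<sigma>" "a (sq0 \<sigma>)" "sq1 \<sigma>" "sq_tgt \<sigma> \<cdot> b (sq0 \<sigma>)"] that sq_commutes[OF that] by (simp_all add: ab)
  have z: "z \<sigma> \<in> Arr C" "Dom C (z \<sigma>) = Cod C (a (sq0 \<sigma>))" "Cod C (z \<sigma>) = Cod C (a (c \<sigma>))" if "\<sigma> \<in> Arr \<A>" for \<sigma>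
    unfolding z_def using that by (simp_all add: ab ij c)
  define a' where "a' = (\<lambda>\<sigma> :: 'm square. Square (sq_src \<sigma>) (z \<sigma>) (a (sq0 \<sigma>)) (a (c \<sigma>) \<cdot> i \<sigma>))"
  define b' where "b' = (\<lambda>\<sigma> :: 'm square. Square (z \<sigma>) (sq_tgt \<sigma>) (b (sq0 \<sigma>)) (b (c \<sigma>)))"
  \<comment> \<open>A morphism \<open>S\<close> of squares is a cube: \<open>s0 S\<close> is the
    square between the components at 0, \<open>k S\<close> the map that it induces on pushouts, and
    \<open>s1 S\<close> the resulting square between the maps \<open>c\<close>. The given action
    \<open>m\<close> is applied to \<open>s0 S\<close> and \<open>s1 S\<close>.\<close>
  define s0 where "s0 = (\<lambda>S :: 'm square square. Square (sq0 (sq_src S)) (sq0 (sq_tgt S)) (sq0 (sq0 S)) (sq0 (sq1 S)))"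
  define k where "k = (\<lambda>S :: 'm square square. po_map C (sq_src (sq_src S)) (a (sq0 (sq_src S))) (i (sq_tgt S) \<cdot> sq1 (sq0 S)) (j (sq_tgt S) \<cdot> m (s0 S)))"
  define s1 where "s1 = (\<lambda>S :: 'm square square. Square (c (sq_src S)) (c (sq_tgt S)) (k S) (sq1 (sq1 S)))"
  define m' where "m' = (\<lambda>S :: 'm square square. Square (z (sq_src S)) (z (sq_tgt S)) (m (s0 S)) (m (s1 S)))"
  have S: "sq_src S \<in> Arr \<A>" "sq_tgt S \<in> Arr \<A>" "sq0 S \<in> Arr \<A>" "sq1 S \<in> Arr \<A>"
    "sq_src (sq0 S) = sq_src (sq_src S)" "sq_tgt (sq0 S) = sq_src (sq_tgt S)" "sq_src (sq1 S) = sq_tgt (sq_src S)" "sq_tgt (sq1 S) = sq_tgt (sq_tgt S)"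
    "sq0 (sq1 S) \<cdot> sq0 (sq_src S) = sq0 (sq_tgt S) \<cdot> sq0 (sq0 S)" "sq1 (sq1 S) \<cdot> sq1 (sq_src S) = sq1 (sq_tgt S) \<cdot> sq1 (sq0 S)"
    if "S \<in> Arr (arrow_cat \<A>)" for S
    using sq_Arr[OF that] sq_commutes[OF that] by simp_all
  have s0: "s0 S \<in> Arr \<A>" "sq_src (s0 S) = sq0 (sq_src S)" "sq_tgt (s0 S) = sq0 (sq_tgt S)"
    "sq0 (s0 S) = sq0 (sq0 S)" "sq1 (s0 S) = sq0 (sq1 S)" if "S \<in> Arr (arrow_cat \<A>)" for S
    unfolding s0_def using that by (simp_all add: S)
  have kk: "k S \<in> Arr C" "Dom C (k S) = Cod C (i (sq_src S))" "Cod C (k S) = Cod C (i (sq_tgt S))"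
    "k S \<cdot> i (sq_src S) = i (sq_tgt S) \<cdot> sq1 (sq0 S)" "k S \<cdot> j (sq_src S) = j (sq_tgt S) \<cdot> m (s0 S)"
    if "S \<in> Arr (arrow_cat \<A>)" for S
  proof -
    have "(i (sq_tgt S) \<cdot> sq1 (sq0 S)) \<cdot> sq_src (sq_src S) = (j (sq_tgt S) \<cdot> m (s0 S)) \<cdot> a (sq0 (sq_src S))"
      using sq_commutes[OF S(3)[OF that]] M(4)[OF s0(1)[OF that]] reassoc[OF ij(6)[OF S(2)[OF that]], of "sq0 (sq0 S)"]
      by (simp add: that S s0 M(1-3) ij ab)
    then show "k S \<in> Arr C" "Dom C (k S) = Cod C (i (sq_src S))" "Cod C (k S) = Cod C (i (sq_tgt S))"
      "k S \<cdot> i (sq_src S) = i (sq_tgt S) \<cdot> sq1 (sq0 S)" "k S \<cdot> j (sq_src S) = j (sq_tgt S) \<cdot> m (s0 S)"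
      unfolding k_def
      using po_map_props[of "sq_src (sq_src S)" "a (sq0 (sq_src S))" "i (sq_tgt S) \<cdot> sq1 (sq0 S)" "j (sq_tgt S) \<cdot> m (s0 S)"]
      by (simp_all add: that S s0 M(1-3) ij ab ij_fold)
  qed
  have s1: "s1 S \<in> Arr \<A>" "sq_src (s1 S) = c (sq_src S)" "sq_tgt (s1 S) = c (sq_tgt S)"
    "sq0 (s1 S) = k S" "sq1 (s1 S) = sq1 (sq1 S)" if T: "S \<in> Arr (arrow_cat \<A>)" for S
  proof -
    have "sq1 (sq1 S) \<cdot> c (sq_src S) = c (sq_tgt S) \<cdot> k S"
      by (rule is_pushout_ext[OF po[OF S(1)[OF T]]])
        (simp_all add: T S s0 M ij ab c kk reassoc[OF c(4)[OF S(2)[OF T]]] reassoc[OF c(5)[OF S(2)[OF T]]]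
          M(5)[OF s0(1)[OF T], simplified s0(2-5)[OF T]] reassoc[OF sq_commutes[OF S(4)[OF T], unfolded S(7,8)[OF T]]])
    then show "s1 S \<in> Arr \<A>" "sq_src (s1 S) = c (sq_src S)" "sq_tgt (s1 S) = c (sq_tgt S)"
      "sq0 (s1 S) = k S" "sq1 (s1 S) = sq1 (sq1 S)"
      unfolding s1_def by (simp_all add: T S c kk)
  qed
  have a': "a' \<sigma> \<in> Arr \<A>" "sq_src (a' \<sigma>) = sq_src \<sigma>" "sq_tgt (a' \<sigma>) = z \<sigma>" "sq0 (a' \<sigma>) = a (sq0 \<sigma>)" "sq1 (a' \<sigma>) = a (c \<sigma>) \<cdot> i \<sigma>"
    if "\<sigma> \<in> Arr \<A>" for \<sigma>
    unfolding a'_def using that z[OF that] by (simp_all add: ab c ij z_def)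
  have b': "b' \<sigma> \<in> Arr \<A>" "sq_src (b' \<sigma>) = z \<sigma>" "sq_tgt (b' \<sigma>) = sq_tgt \<sigma>" "sq0 (b' \<sigma>) = b (sq0 \<sigma>)" "sq1 (b' \<sigma>) = b (c \<sigma>)"
    if "\<sigma> \<in> Arr \<A>" for \<sigma>
    unfolding b'_def using that z[OF that] reassoc[OF ab(6)[OF c(1)[OF that]], of "j \<sigma>"] by (simp_all add: ab c ij z_def)
  have m': "m' S \<in> Arr \<A>" if T: "S \<in> Arr (arrow_cat \<A>)" for S
    unfolding m'_def
    by (simp add: T S z s0 s1 M(1-3))
      (simp add: z_def T S s0 s1 M(1-3) ab c ij kk reassoc[OF M(4)[OF s1(1)[OF T], unfolded s1(2)[OF T]]])
  have fd: "factorization_data \<A> a' b' m'"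
    unfolding factorization_data_def
  proof (intro conjI ballI impI)
    fix \<sigma> assume T: "\<sigma> \<in> Arr \<A>"
    show "b' \<sigma> \<cdot>\<^bsub>\<A>\<^esub> a' \<sigma> = \<sigma>"
      by (rule square_eqI) (simp_all add: T a' b' ab c ij reassoc[OF ab(6)])
    have I0: "m (Square (sq0 \<sigma>) (sq0 \<sigma>) (Idt C (Dom C (sq_src \<sigma>))) (Idt C (Dom C (sq_tgt \<sigma>)))) = Idt C (Cod C (a (sq0 \<sigma>)))"
      using I[of "sq0 \<sigma>"] T by simp
    have "k (Square \<sigma> \<sigma> (Idt \<A> (sq_src \<sigma>)) (Idt \<A> (sq_tgt \<sigma>))) = Idt C (Cod C (i \<sigma>))"
      unfolding k_def s0_def by (simp add: T, intro po_map_eqI)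
        (simp_all add: T ab ij I0 ij_fold)
    then show "m' (Idt (arrow_cat \<A>) \<sigma>) = Idt \<A> (Cod \<A> (a' \<sigma>))"
      unfolding m'_def using T I0 I[of "c \<sigma>"] by (simp add: s0_def s1_def a' z c)
  next
    fix S assume T: "S \<in> Arr (arrow_cat \<A>)"
    show "m' S \<in> hom \<A> (Cod \<A> (a' (sq_src S))) (Cod \<A> (a' (sq_tgt S)))"
      using m'[OF T] by (simp add: T S a' m'_def)
    show "m' S \<cdot>\<^bsub>\<A>\<^esub> a' (sq_src S) = a' (sq_tgt S) \<cdot>\<^bsub>\<A>\<^esub> sq0 S"
      by (rule square_eqI) (simp_all add: m'_def T S a' s0 s1 M[OF s0(1)[OF T], simplified s0(2-5)[OF T]]
        M(1-3)[OF s1(1)[OF T], simplified s1(2-5)[OF T]] reassoc[OF M(4)[OF s1(1)[OF T], simplified s1(2-5)[OF T]]] ab c ij kk)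
    show "b' (sq_tgt S) \<cdot>\<^bsub>\<A>\<^esub> m' S = sq1 S \<cdot>\<^bsub>\<A>\<^esub> b' (sq_src S)"
      by (rule square_eqI) (simp_all add: m'_def T S b' s0 s1 M[OF s0(1)[OF T], simplified s0(2-5)[OF T]]
        M[OF s1(1)[OF T], simplified s1(2-5)[OF T]])
  next
    fix S T assume A: "S \<in> Arr (arrow_cat \<A>)" and B: "T \<in> Arr (arrow_cat \<A>)" and ST: "sq_src T = sq_tgt S"
    interpret DD: category "arrow_cat \<A>" by (rule category.intro) (rule D.is_category_arrow_cat)
    define TS where "TS = T \<cdot>\<^bsub>arrow_cat \<A>\<^esub> S"
    have TS: "TS \<in> Arr (arrow_cat \<A>)" unfolding TS_def using A B ST by (intro DD.comp_Arr) simp_all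
    have TS': "sq_src TS = sq_src S" "sq_tgt TS = sq_tgt T" "sq0 TS = sq0 T \<cdot>\<^bsub>\<A>\<^esub> sq0 S" "sq1 TS = sq1 T \<cdot>\<^bsub>\<A>\<^esub> sq1 S"
      by (simp_all add: TS_def)
    have "s0 TS = s0 T \<cdot>\<^bsub>\<A>\<^esub> s0 S" by (simp add: s0_def TS' S A B ST)
    then have m0: "m (s0 TS) = m (s0 T) \<cdot> m (s0 S)"
      using K[OF s0(1)[OF A] s0(1)[OF B]] by (simp add: s0 A B ST)
    have "k TS = k T \<cdot> k S"
      by (rule is_pushout_ext[OF po[OF S(1)[OF A]]])
        (simp_all add: A B ST S ij kk(1-3) kk(4,5)[OF A] kk(4,5)[OF TS, unfolded TS'] kk(1-3)[OF TS, unfolded TS'] m0 s0 M(1-3)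
          reassoc[OF kk(4)[OF B, unfolded ST]] reassoc[OF kk(5)[OF B, unfolded ST]])
    then have "s1 TS = s1 T \<cdot>\<^bsub>\<A>\<^esub> s1 S" by (simp add: s1_def TS' S A B ST)
    then have "m (s1 TS) = m (s1 T) \<cdot> m (s1 S)"
      using K[OF s1(1)[OF A] s1(1)[OF B]] by (simp add: s1 A B ST)
    then show "m' (T \<cdot>\<^bsub>arrow_cat \<A>\<^esub> S) = m' T \<cdot>\<^bsub>\<A>\<^esub> m' S"
      unfolding TS_def[symmetric] using m0 by (simp add: m'_def TS')
  qed (simp_all add: a' b')
  \<comment> \<open>The pushout in the corner map of \<open>a' \<sigma>\<close> is the chosen one
    out of which \<open>c \<sigma>\<close> was defined, so the two agree on the nose.\<close>
  have "corner C (a' \<sigma>) = a (c \<sigma>)" if T: "\<sigma> \<in> Arr \<A>" for \<sigma>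
    unfolding corner_def by (rule po_map_eqI) (simp_all add: T a' ab c ij z_def ij_fold)
  then show thesis
    by (intro that[OF fd]) (metis a'(4) b'(4,5) c(1) sq_Arr(3))
qed

end

section \<open>The projective model structure\<close>

lemma pointwise_Int: "pointwise C (R \<inter> S) = pointwise C R \<inter> pointwise C S"
  by (auto simp: pointwise_def)

locale model_setting = category_po_terminal C for C :: "('o, 'm) cat" (structure) +
  fixes M :: "'m model_structure"
  assumes model: "is_model_structure C M"
begin

lemma model_subcategories: "subcategory C (weq M)" "subcategory C (cof M)" "subcategory C (fib M)"
  using model by (auto simp: is_model_structure_def)

lemma model_Arr: "f \<in> weq M \<Longrightarrow> f \<in> Arr C" "f \<in> cof M \<Longrightarrow> f \<in> Arr C" "f \<in> fib M \<Longrightarrow> f \<in> Arr C"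
  using model_subcategories by (auto simp: subcategory_def)

lemma model_Idt: "a \<in> Obj C \<Longrightarrow> Idt C a \<in> weq M" "a \<in> Obj C \<Longrightarrow> Idt C a \<in> cof M" "a \<in> Obj C \<Longrightarrow> Idt C a \<in> fib M"
  using model_subcategories by (auto simp: subcategory_def)

lemma weq_cancel:
  assumes "f \<in> Arr C" "g \<in> Arr C" "Dom C g = Cod C f"
  shows "f \<in> weq M \<Longrightarrow> g \<cdot> f \<in> weq M \<Longrightarrow> g \<in> weq M" "g \<in> weq M \<Longrightarrow> g \<cdot> f \<in> weq M \<Longrightarrow> f \<in> weq M"
  using model assms by (auto simp: is_model_structure_def)

lemma model_comp:
  assumes "Dom C g = Cod C f"
  shows "f \<in> weq M \<Longrightarrow> g \<in> weq M \<Longrightarrow> g \<cdot> f \<in> weq M" "f \<in> cof M \<Longrightarrow> g \<in> cof M \<Longrightarrow> g \<cdot> f \<in> cof M"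
    "f \<in> fib M \<Longrightarrow> g \<in> fib M \<Longrightarrow> g \<cdot> f \<in> fib M"
  using model_subcategories assms by (auto simp: subcategory_def)

lemma model_retract:
  assumes "is_retract C f g"
  shows "g \<in> weq M \<Longrightarrow> f \<in> weq M" "g \<in> cof M \<Longrightarrow> f \<in> cof M" "g \<in> fib M \<Longrightarrow> f \<in> fib M"
  using model assms by (auto simp: is_model_structure_def)

lemma model_lifting:
  "i \<in> cof M \<Longrightarrow> i \<in> weq M \<Longrightarrow> p \<in> fib M \<Longrightarrow> has_lifting C i p"
  "i \<in> cof M \<Longrightarrow> p \<in> fib M \<Longrightarrow> p \<in> weq M \<Longrightarrow> has_lifting C i p"
  using model unfolding is_model_structure_def by blast+

lemma model_factorization_cof:
  obtains a b m where "factorization_data C a b m" "\<forall>f\<in>Arr C. a f \<in> cof M \<and> b f \<in> fib M \<inter> weq M"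
proof (rule that)
  show "factorization_data C (fob (fst (fact_cof M))) (fob (snd (fact_cof M))) (\<lambda>s. sq1 (far (fst (fact_cof M)) s))"
    using model by (auto simp: is_model_structure_def intro: functorial_factorization_data)
qed (use model in \<open>auto simp: is_model_structure_def\<close>)

lemma model_factorization_fib:
  obtains a b m where "factorization_data C a b m" "\<forall>f\<in>Arr C. a f \<in> cof M \<inter> weq M \<and> b f \<in> fib M"
proof (rule that)
  show "factorization_data C (fob (fst (fact_fib M))) (fob (snd (fact_fib M))) (\<lambda>s. sq1 (far (fst (fact_fib M)) s))"
    using model by (auto simp: is_model_structure_def intro: functorial_factorization_data)
qed (use model in \<open>auto simp: is_model_structure_def\<close>)

text \<open>The lift of \<open>i\<close> against its own second factor is a section of
  \<open>b\<close> that extends \<open>a\<close> along \<open>i\<close>; this is the missing part of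
  the retract diagram.\<close>

lemma retract_argument:
  assumes "i \<in> Arr C" "a \<in> Arr C" "b \<in> Arr C" "Dom C b = Cod C a" "b \<cdot> a = i" "has_lifting C i b"
  shows "is_retract C i a"
proof -
  obtain h where h: "h \<in> Arr C" "Dom C h = Cod C i" "Cod C h = Dom C b" "h \<cdot> i = a" "b \<cdot> h = Idt C (Cod C i)"
    by (rule has_liftingE[OF assms(6), of a "Idt C (Cod C i)"]) (use assms in auto)
  have [simp]: "Dom C i = Dom C a" "Cod C i = Cod C b" using assms by auto
  show ?thesis
    by (rule is_retractI[of i a "Idt C (Dom C i)" h "Idt C (Dom C i)" b]) (simp_all add: assms h)
qed

text \<open>The axioms give one inclusion; the other factors the map and applies the retract
  argument. With this and its trivial counterpart, both classes of left maps are instances of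
  \<open>llp\<close> and the criterion for squares applies to them.\<close>

lemma cof_eq_llp: "cof M = llp C (fib M \<inter> weq M)"
proof (intro equalityI subsetI)
  fix i assume i: "i \<in> llp C (fib M \<inter> weq M)"
  then have iA: "i \<in> Arr C" by (simp add: llp_def)
  obtain a b m where F: "factorization_data C a b m" "\<forall>f\<in>Arr C. a f \<in> cof M \<and> b f \<in> fib M \<inter> weq M"
    by (rule model_factorization_cof)
  have "a i \<in> Arr C" "b i \<in> Arr C" "Dom C (b i) = Cod C (a i)" "b i \<cdot> a i = i"
    using F(1) iA unfolding factorization_data_def by blast+
  moreover have "has_lifting C i (b i)" using i F(2) iA unfolding llp_def by blast
  ultimately have "is_retract C i (a i)" by (rule retract_argument[OF iA])
  then show "i \<in> cof M" using model_retract F(2) iA by blast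
qed (auto simp: llp_def model_Arr model_lifting)

lemma tcof_eq_llp: "cof M \<inter> weq M = llp C (fib M)"
proof (intro equalityI subsetI)
  fix i assume i: "i \<in> llp C (fib M)"
  then have iA: "i \<in> Arr C" by (simp add: llp_def)
  obtain a' b' m' where F: "factorization_data C a' b' m'" "\<forall>f\<in>Arr C. a' f \<in> cof M \<inter> weq M \<and> b' f \<in> fib M"
    by (rule model_factorization_fib)
  have "a' i \<in> Arr C" "b' i \<in> Arr C" "Dom C (b' i) = Cod C (a' i)" "b' i \<cdot> a' i = i"
    using F(1) iA unfolding factorization_data_def by blast+
  moreover have "has_lifting C i (b' i)" using i F(2) iA unfolding llp_def by blast
  ultimately have "is_retract C i (a' i)" by (rule retract_argument[OF iA])
  then show "i \<in> cof M \<inter> weq M" using model_retract F(2) iA by blast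
qed (auto simp: llp_def model_Arr model_lifting)

lemma arrow_cof_iff:
  assumes "\<alpha> \<in> Arr \<A>"
  shows "\<alpha> \<in> llp \<A> (pointwise C (fib M \<inter> weq M)) \<longleftrightarrow> sq0 \<alpha> \<in> cof M \<and> corner C \<alpha> \<in> cof M"
  unfolding cof_eq_llp by (rule llp_arrow) (use assms model_Idt model_Arr in auto)

lemma arrow_tcof_iff:
  assumes "\<alpha> \<in> Arr \<A>"
  shows "\<alpha> \<in> llp \<A> (pointwise C (fib M)) \<longleftrightarrow> sq0 \<alpha> \<in> cof M \<inter> weq M \<and> corner C \<alpha> \<in> cof M \<inter> weq M"
  unfolding tcof_eq_llp by (rule llp_arrow) (use assms model_Idt model_Arr in auto)

lemma fibs_Arr: "fib M \<subseteq> Arr C" "fib M \<inter> weq M \<subseteq> Arr C"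
  using model_Arr by auto

lemma po_in1_cobase:
  assumes "\<alpha> \<in> Arr \<A>"
  shows "sq0 \<alpha> \<in> cof M \<Longrightarrow> po_in1 C (sq_src \<alpha>) (sq0 \<alpha>) \<in> cof M"
    "sq0 \<alpha> \<in> cof M \<inter> weq M \<Longrightarrow> po_in1 C (sq_src \<alpha>) (sq0 \<alpha>) \<in> cof M \<inter> weq M"
proof -
  have "is_pushout C (sq0 \<alpha>) (sq_src \<alpha>) (po_in2 C (sq_src \<alpha>) (sq0 \<alpha>)) (po_in1 C (sq_src \<alpha>) (sq0 \<alpha>))"
    by (rule is_pushout_flip, rule po_is_pushout) (use assms in simp_all)
  note llp_pushout[OF this]
  then show "sq0 \<alpha> \<in> cof M \<Longrightarrow> po_in1 C (sq_src \<alpha>) (sq0 \<alpha>) \<in> cof M"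
    "sq0 \<alpha> \<in> cof M \<inter> weq M \<Longrightarrow> po_in1 C (sq_src \<alpha>) (sq0 \<alpha>) \<in> cof M \<inter> weq M"
    unfolding tcof_eq_llp unfolding cof_eq_llp using fibs_Arr by blast+
qed

text \<open>The component at 1 is the corner map after a cobase change of the component at 0. If the
  latter is a trivial cofibration, so is its cobase change, and two-out-of-three makes the corner
  map a weak equivalence exactly when the component at 1 is one.\<close>

lemma arrow_tcof_eq:
  "llp \<A> (pointwise C (fib M \<inter> weq M)) \<inter> pointwise C (weq M) = llp \<A> (pointwise C (fib M))"
proof (intro set_eqI)
  fix \<alpha>
  show "\<alpha> \<in> llp \<A> (pointwise C (fib M \<inter> weq M)) \<inter> pointwise C (weq M) \<longleftrightarrow> \<alpha> \<in> llp \<A> (pointwise C (fib M))"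
  proof (cases "\<alpha> \<in> Arr \<A>")
    case True
    let ?i = "po_in1 C (sq_src \<alpha>) (sq0 \<alpha>)"
    note c = corner_props(1-4)[OF True]
    have i: "?i \<in> Arr C" "Dom C (corner C \<alpha>) = Cod C ?i" using True c by simp_all
    have "corner C \<alpha> \<in> weq M" if "sq0 \<alpha> \<in> cof M \<inter> weq M" "sq1 \<alpha> \<in> weq M"
      using weq_cancel(1)[OF i(1) c(1) i(2)] po_in1_cobase(2)[OF True that(1)] c(4) that(2) by simp
    moreover have "sq1 \<alpha> \<in> weq M" if "sq0 \<alpha> \<in> cof M \<inter> weq M" "corner C \<alpha> \<in> weq M"
      using model_comp(1)[OF i(2)] po_in1_cobase(2)[OF True that(1)] c(4) that(2) by simp
    ultimately show ?thesis
      using True unfolding Int_iff arrow_cof_iff[OF True] arrow_tcof_iff[OF True] by (auto simp: pointwise_def)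
  qed (auto simp: llp_def)
qed

lemma is_retract_pointwise:
  assumes "is_retract \<A> \<alpha> \<beta>"
  shows "\<alpha> \<in> Arr \<A>" "\<beta> \<in> Arr \<A>" "is_retract C (sq0 \<alpha>) (sq0 \<beta>)" "is_retract C (sq1 \<alpha>) (sq1 \<beta>)"
proof -
  interpret D: category \<A> by (rule category_arrow_cat)
  obtain i0 i1 r0 r1 where *: "\<alpha> \<in> Arr \<A>" "\<beta> \<in> Arr \<A>"
    "i0 \<in> hom \<A> (Dom \<A> \<alpha>) (Dom \<A> \<beta>)" "i1 \<in> hom \<A> (Cod \<A> \<alpha>) (Cod \<A> \<beta>)"
    "r0 \<in> hom \<A> (Dom \<A> \<beta>) (Dom \<A> \<alpha>)" "r1 \<in> hom \<A> (Cod \<A> \<beta>) (Cod \<A> \<alpha>)"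
    "i1 \<cdot>\<^bsub>\<A>\<^esub> \<alpha> = \<beta> \<cdot>\<^bsub>\<A>\<^esub> i0" "r1 \<cdot>\<^bsub>\<A>\<^esub> \<beta> = \<alpha> \<cdot>\<^bsub>\<A>\<^esub> r0"
    "r0 \<cdot>\<^bsub>\<A>\<^esub> i0 = Idt \<A> (Dom \<A> \<alpha>)" "r1 \<cdot>\<^bsub>\<A>\<^esub> i1 = Idt \<A> (Cod \<A> \<alpha>)"
    by (rule D.is_retractE[OF assms])
  then show "\<alpha> \<in> Arr \<A>" "\<beta> \<in> Arr \<A>" by simp_all
  show "is_retract C (sq0 \<alpha>) (sq0 \<beta>)"
    by (rule is_retractI[of _ _ "sq0 i0" "sq0 i1" "sq0 r0" "sq0 r1"]) (use * in simp_all)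
  show "is_retract C (sq1 \<alpha>) (sq1 \<beta>)"
    by (rule is_retractI[of _ _ "sq1 i0" "sq1 i1" "sq1 r0" "sq1 r1"]) (use * in simp_all)
qed

lemma subcategory_pointwise: "subcategory C S \<Longrightarrow> subcategory \<A> (pointwise C S)"
proof -
  interpret D: category \<A> by (rule category_arrow_cat)
  assume "subcategory C S"
  then have S: "\<And>a. a \<in> Obj C \<Longrightarrow> Idt C a \<in> S" "\<And>f g. f \<in> S \<Longrightarrow> g \<in> S \<Longrightarrow> Dom C g = Cod C f \<Longrightarrow> g \<cdot> f \<in> S"
    by (auto simp: subcategory_def)
  have "g \<cdot>\<^bsub>\<A>\<^esub> f \<in> pointwise C S" if "f \<in> pointwise C S" "g \<in> pointwise C S" "sq_src g = sq_tgt f" for f g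
    using that D.comp_Arr[of f g] S(2)[of "sq0 f" "sq0 g"] S(2)[of "sq1 f" "sq1 g"] by (simp add: pointwise_def)
  then show ?thesis by (auto simp: subcategory_def S) (auto simp: pointwise_def S)
qed

lemma projective_model_structure:
  obtains P where "is_model_structure \<A> P" "weq P = pointwise C (weq M)" "fib P = pointwise C (fib M)"
    "cof P = llp \<A> (pointwise C (fib M \<inter> weq M))"
proof -
  interpret D: category \<A> by (rule category_arrow_cat)
  obtain a b m where F1: "factorization_data C a b m" "\<forall>f\<in>Arr C. a f \<in> cof M \<and> b f \<in> fib M \<inter> weq M"
    by (rule model_factorization_cof)
  obtain a' b' m' where F2: "factorization_data C a' b' m'" "\<forall>f\<in>Arr C. a' f \<in> cof M \<inter> weq M \<and> b' f \<in> fib M"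
    by (rule model_factorization_fib)
  obtain A B m2 where A: "factorization_data \<A> A B m2"
    "\<forall>\<sigma>\<in>Arr \<A>. \<exists>f\<in>Arr C. \<exists>g\<in>Arr C. sq0 (A \<sigma>) = a f \<and> corner C (A \<sigma>) = a g \<and> sq0 (B \<sigma>) = b f \<and> sq1 (B \<sigma>) = b g"
    by (rule arrow_factorization[OF F1(1)])
  obtain A' B' m2' where A': "factorization_data \<A> A' B' m2'"
    "\<forall>\<sigma>\<in>Arr \<A>. \<exists>f\<in>Arr C. \<exists>g\<in>Arr C. sq0 (A' \<sigma>) = a' f \<and> corner C (A' \<sigma>) = a' g \<and> sq0 (B' \<sigma>) = b' f \<and> sq1 (B' \<sigma>) = b' g"
    by (rule arrow_factorization[OF F2(1)])
  define P where "P = \<lparr>weq = pointwise C (weq M), cof = llp \<A> (pointwise C (fib M \<inter> weq M)), fib = pointwise C (fib M),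
    fact_cof = (\<lparr>fob = A, far = (\<lambda>s. Square (A (sq_src s)) (A (sq_tgt s)) (sq0 s) (m2 s))\<rparr>,
     \<lparr>fob = B, far = (\<lambda>s. Square (B (sq_src s)) (B (sq_tgt s)) (m2 s) (sq1 s))\<rparr>),
    fact_fib = (\<lparr>fob = A', far = (\<lambda>s. Square (A' (sq_src s)) (A' (sq_tgt s)) (sq0 s) (m2' s))\<rparr>,
     \<lparr>fob = B', far = (\<lambda>s. Square (B' (sq_src s)) (B' (sq_tgt s)) (m2' s) (sq1 s))\<rparr>)\<rparr>"
  have P: "weq P = pointwise C (weq M)" "fib P = pointwise C (fib M)" "cof P = llp \<A> (pointwise C (fib M \<inter> weq M))"
    by (simp_all add: P_def)
  have tP: "cof P \<inter> weq P = llp \<A> (pointwise C (fib M))" "fib P \<inter> weq P = pointwise C (fib M \<inter> weq M)"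
    unfolding P using arrow_tcof_eq by (simp_all add: pointwise_Int)
  have pw: "pointwise C R \<subseteq> Arr \<A>" for R by (auto simp: pointwise_def)
  have AB: "A \<sigma> \<in> Arr \<A>" "B \<sigma> \<in> Arr \<A>" "A' \<sigma> \<in> Arr \<A>" "B' \<sigma> \<in> Arr \<A>"
    if "\<sigma> \<in> Arr \<A>" for \<sigma> using that A(1) A'(1) by (auto simp: factorization_data_def)
  have fact: "A \<sigma> \<in> cof P" "B \<sigma> \<in> fib P \<inter> weq P" "A' \<sigma> \<in> cof P \<inter> weq P" "B' \<sigma> \<in> fib P" if T: "\<sigma> \<in> Arr \<A>" for \<sigma>
  proof -
    obtain f g where fg: "f \<in> Arr C" "g \<in> Arr C" "sq0 (A \<sigma>) = a f" "corner C (A \<sigma>) = a g" "sq0 (B \<sigma>) = b f" "sq1 (B \<sigma>) = b g"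
      using A(2) T by blast
    show "A \<sigma> \<in> cof P" "B \<sigma> \<in> fib P \<inter> weq P"
      unfolding tP unfolding P using fg F1(2) AB[OF T] by (auto simp only: arrow_cof_iff) (simp add: pointwise_def)
    obtain f g where fg: "f \<in> Arr C" "g \<in> Arr C" "sq0 (A' \<sigma>) = a' f" "corner C (A' \<sigma>) = a' g" "sq0 (B' \<sigma>) = b' f" "sq1 (B' \<sigma>) = b' g"
      using A'(2) T by blast
    show "A' \<sigma> \<in> cof P \<inter> weq P" "B' \<sigma> \<in> fib P"
      unfolding tP unfolding P using fg F2(2) AB[OF T] by (auto simp only: arrow_tcof_iff) (simp add: pointwise_def)
  qed
  have "is_model_structure \<A> P"
    unfolding is_model_structure_def
  proof (intro conjI)
    show "subcategory \<A> (weq P)" "subcategory \<A> (fib P)"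
      unfolding P by (intro subcategory_pointwise model_subcategories)+
    show "subcategory \<A> (cof P)"
      unfolding subcategory_def P using D.llp_Idt[OF _ pw] D.llp_comp[OF _ _ _ pw] D.llp_Arr by auto
    show "functorial_factorization \<A> (fact_cof P)" "functorial_factorization \<A> (fact_fib P)"
      using D.factorization_data_functorial[OF A(1)] D.factorization_data_functorial[OF A'(1)] by (simp_all add: P_def)
    show "\<forall>f\<in>Arr \<A>. \<forall>g\<in>Arr \<A>. Dom \<A> g = Cod \<A> f \<longrightarrow>
        (f \<in> weq P \<and> g \<cdot>\<^bsub>\<A>\<^esub> f \<in> weq P \<longrightarrow> g \<in> weq P) \<and>
        (g \<in> weq P \<and> g \<cdot>\<^bsub>\<A>\<^esub> f \<in> weq P \<longrightarrow> f \<in> weq P)"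
    proof (intro ballI impI)
      fix f g assume fg: "f \<in> Arr \<A>" "g \<in> Arr \<A>" "Dom \<A> g = Cod \<A> f"
      have "Dom C (sq0 g) = Cod C (sq0 f)" "Dom C (sq1 g) = Cod C (sq1 f)" using fg by simp_all
      note weq_cancel[OF _ _ this(1)] weq_cancel[OF _ _ this(2)]
      then show "(f \<in> weq P \<and> g \<cdot>\<^bsub>\<A>\<^esub> f \<in> weq P \<longrightarrow> g \<in> weq P) \<and> (g \<in> weq P \<and> g \<cdot>\<^bsub>\<A>\<^esub> f \<in> weq P \<longrightarrow> f \<in> weq P)"
        unfolding P pointwise_def using fg by simp
    qed
    show "\<forall>f g. is_retract \<A> f g \<longrightarrow>
        (g \<in> weq P \<longrightarrow> f \<in> weq P) \<and> (g \<in> cof P \<longrightarrow> f \<in> cof P) \<and> (g \<in> fib P \<longrightarrow> f \<in> fib P)"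
    proof (intro allI impI)
      fix f g assume r: "is_retract \<A> f g"
      note is_retract_pointwise(1)[OF r] model_retract[OF is_retract_pointwise(3)[OF r]] model_retract[OF is_retract_pointwise(4)[OF r]]
      then show "(g \<in> weq P \<longrightarrow> f \<in> weq P) \<and> (g \<in> cof P \<longrightarrow> f \<in> cof P) \<and> (g \<in> fib P \<longrightarrow> f \<in> fib P)"
        unfolding P using D.llp_retract[OF r _ pw] by (auto simp: pointwise_def[of C "fib M"] pointwise_def[of C "weq M"])
    qed
    show "\<forall>i\<in>cof P \<inter> weq P. \<forall>p\<in>fib P. has_lifting \<A> i p"
      unfolding tP unfolding P by (auto simp: llp_def)
    show "\<forall>i\<in>cof P. \<forall>p\<in>fib P \<inter> weq P. has_lifting \<A> i p"
      unfolding tP unfolding P by (auto simp: llp_def)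
    show "\<forall>f\<in>Arr \<A>. fob (fst (fact_cof P)) f \<in> cof P \<and> fob (snd (fact_cof P)) f \<in> fib P \<inter> weq P"
      using fact by (simp add: P_def)
    show "\<forall>f\<in>Arr \<A>. fob (fst (fact_fib P)) f \<in> cof P \<inter> weq P \<and> fob (snd (fact_fib P)) f \<in> fib P"
      using fact by (simp add: P_def)
  qed
  with that P show thesis by blast
qed

end

section \<open>Evaluation functors and their adjoints\<close>

text \<open>The initial object enters through \<open>L1\<close>, through cofibrant objects and as
  the source of the unit of the pushout product.\<close>

locale bicat = category_po_terminal C for C :: "('o, 'm) cat" (structure) +
  assumes initial_exists: "\<exists>z. is_initial C z"
begin

lemma is_initial_init: "is_initial C (init C)"
  unfolding init_def using initial_exists by (rule someI_ex)

lemma init_Obj [simp]: "init C \<in> Obj C"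
  using is_initial_init by (simp add: is_initial_def)

lemma from_init [simp]:
  assumes "a \<in> Obj C"
  shows "from_init C a \<in> Arr C" "Dom C (from_init C a) = init C" "Cod C (from_init C a) = a"
  using theI'[of "\<lambda>f. f \<in> hom C (init C) a"] is_initial_init assms unfolding from_init_def is_initial_def by auto

lemma init_ext: "f \<in> Arr C \<Longrightarrow> g \<in> Arr C \<Longrightarrow> Dom C f = init C \<Longrightarrow> Dom C g = init C \<Longrightarrow> Cod C f = Cod C g \<Longrightarrow> f = g"
  using is_initial_init unfolding is_initial_def in_hom by (metis Cod_Obj)

lemma is_functor_L0: "is_functor C \<A> (L0 C)"
  by (rule is_functorI) (auto simp: L0_def)

lemma is_functor_L1: "is_functor C \<A> (L1 C)"
  by (rule is_functorI) (auto simp: L1_def intro: init_ext)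

text \<open>The right adjoint is \<open>Ev0\<close>. Its counit at \<open>e\<close> is the square
  into \<open>e\<close> from the identity of its domain, with components an identity and
  \<open>e\<close>.\<close>

lemma left_adjoint_L0: "left_adjoint C \<A> (L0 C)"
proof (rule left_adjointI[OF is_category is_category_arrow_cat is_functor_L0])
  fix e assume "e \<in> Obj \<A>"
  then have e [simp]: "e \<in> Arr C" by simp
  have "universal_arrow C \<A> (L0 C) e (Dom C e) (Square (Idt C (Dom C e)) e (Idt C (Dom C e)) e)"
    unfolding universal_arrow_def
  proof (intro conjI ballI)
    fix a h assume a: "a \<in> Obj C" "h \<in> hom \<A> (fob (L0 C) a) e"
    then have h: "h \<in> Arr \<A>" "sq_src h = Idt C a" "sq_tgt h = e" by (auto simp: L0_def)
    note H = sq_Arr[OF h(1), unfolded h] sq_commutes[OF h(1), unfolded h]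
    show "\<exists>!k. k \<in> hom C a (Dom C e) \<and> Square (Idt C (Dom C e)) e (Idt C (Dom C e)) e \<cdot>\<^bsub>\<A>\<^esub> far (L0 C) k = h"
    proof (rule ex1I[of _ "sq0 h"])
      show "sq0 h \<in> hom C a (Dom C e) \<and> Square (Idt C (Dom C e)) e (Idt C (Dom C e)) e \<cdot>\<^bsub>\<A>\<^esub> far (L0 C) (sq0 h) = h"
        using a h H by (auto simp: L0_def intro!: square_eqI)
    next
      fix k assume k: "k \<in> hom C a (Dom C e) \<and> Square (Idt C (Dom C e)) e (Idt C (Dom C e)) e \<cdot>\<^bsub>\<A>\<^esub> far (L0 C) k = h"
      then have "sq0 (Square (Idt C (Dom C e)) e (Idt C (Dom C e)) e \<cdot>\<^bsub>\<A>\<^esub> far (L0 C) k) = sq0 h" by simp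
      then show "k = sq0 h" using k by (simp add: L0_def)
    qed
  qed (auto simp: L0_def)
  then show "\<exists>g eps. universal_arrow C \<A> (L0 C) e g eps" by blast
qed

text \<open>The right adjoint is \<open>Ev1\<close>; all conditions at 0 concern maps out of the
  initial object and hold automatically.\<close>

lemma left_adjoint_L1: "left_adjoint C \<A> (L1 C)"
proof (rule left_adjointI[OF is_category is_category_arrow_cat is_functor_L1])
  fix e assume "e \<in> Obj \<A>"
  then have e [simp]: "e \<in> Arr C" by simp
  have "universal_arrow C \<A> (L1 C) e (Cod C e) (Square (from_init C (Cod C e)) e (from_init C (Dom C e)) (Idt C (Cod C e)))"
    unfolding universal_arrow_def
  proof (intro conjI ballI)
    fix a h assume a: "a \<in> Obj C" "h \<in> hom \<A> (fob (L1 C) a) e"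
    then have h: "h \<in> Arr \<A>" "sq_src h = from_init C a" "sq_tgt h = e" by (auto simp: L1_def)
    note H = sq_Arr[OF h(1), unfolded h] sq_commutes[OF h(1), unfolded h]
    show "\<exists>!k. k \<in> hom C a (Cod C e) \<and> Square (from_init C (Cod C e)) e (from_init C (Dom C e)) (Idt C (Cod C e)) \<cdot>\<^bsub>\<A>\<^esub> far (L1 C) k = h"
    proof (rule ex1I[of _ "sq1 h"])
      have "from_init C (Dom C e) \<cdot> Idt C (init C) = sq0 h" by (rule init_ext) (use a H in simp_all)
      then show "sq1 h \<in> hom C a (Cod C e) \<and> Square (from_init C (Cod C e)) e (from_init C (Dom C e)) (Idt C (Cod C e)) \<cdot>\<^bsub>\<A>\<^esub> far (L1 C) (sq1 h) = h"
        using a h H by (simp add: L1_def) (auto intro!: square_eqI)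
    next
      fix k assume k: "k \<in> hom C a (Cod C e) \<and> Square (from_init C (Cod C e)) e (from_init C (Dom C e)) (Idt C (Cod C e)) \<cdot>\<^bsub>\<A>\<^esub> far (L1 C) k = h"
      then have "sq1 (Square (from_init C (Cod C e)) e (from_init C (Dom C e)) (Idt C (Cod C e)) \<cdot>\<^bsub>\<A>\<^esub> far (L1 C) k) = sq1 h" by simp
      then show "k = sq1 h" using k by (simp add: L1_def)
    qed
  qed (auto simp: L1_def intro: init_ext)
  then show "\<exists>g eps. universal_arrow C \<A> (L1 C) e g eps" by blast
qed

text \<open>The right adjoint is \<open>U0\<close>, with identity counit: at 1 a square into a map
  to the terminal object has only one possible component.\<close>

lemma left_adjoint_Ev0: "left_adjoint \<A> C (Ev0 C)"
proof (rule left_adjointI[OF is_category_arrow_cat is_category is_functor_Ev0])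
  fix b assume b: "b \<in> Obj C"
  obtain z where z: "z \<in> Obj C" "\<And>a. a \<in> Obj C \<Longrightarrow> \<exists>!f. f \<in> hom C a z" using terminal_exists by blast
  obtain bang where bang: "\<And>a. a \<in> Obj C \<Longrightarrow> bang a \<in> hom C a z" using z(2) by metis
  then have bang' [simp]: "bang a \<in> Arr C" "Dom C (bang a) = a" "Cod C (bang a) = z" if "a \<in> Obj C" for a using that by auto
  have bang_eq: "h = k" if "h \<in> Arr C" "k \<in> Arr C" "Dom C h = Dom C k" "Cod C h = z" "Cod C k = z" for h k
    using z(2)[of "Dom C k"] that by auto
  have "universal_arrow \<A> C (Ev0 C) b (bang b) (Idt C b)"
    unfolding universal_arrow_def
  proof (intro conjI ballI)
    fix f h assume f: "f \<in> Obj \<A>" "h \<in> hom C (fob (Ev0 C) f) b"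
    show "\<exists>!k. k \<in> hom \<A> f (bang b) \<and> Idt C b \<cdot> far (Ev0 C) k = h"
    proof (rule ex1I[of _ "Square f (bang b) h (bang (Cod C f))"])
      show "Square f (bang b) h (bang (Cod C f)) \<in> hom \<A> f (bang b) \<and> Idt C b \<cdot> far (Ev0 C) (Square f (bang b) h (bang (Cod C f))) = h"
        using f b z(1) by (auto simp: Ev0_def intro: bang_eq)
      fix k assume "k \<in> hom \<A> f (bang b) \<and> Idt C b \<cdot> far (Ev0 C) k = h"
      then have k: "k \<in> Arr \<A>" "sq_src k = f" "sq_tgt k = bang b" "Idt C b \<cdot> sq0 k = h" by (auto simp: Ev0_def)
      have "sq0 k = h" using k b by simp
      moreover have "sq1 k = bang (Cod C f)" by (rule bang_eq) (use k b f in simp_all)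
      ultimately show "k = Square f (bang b) h (bang (Cod C f))"
        using k by (intro square_eqI) simp_all
    qed
  qed (use b in \<open>auto simp: Ev0_def\<close>)
  then show "\<exists>g eps. universal_arrow \<A> C (Ev0 C) b g eps" by blast
qed

text \<open>The right adjoint is \<open>U1\<close>, with identity counit: into an identity, the
  component at 0 is forced by commutativity.\<close>

lemma left_adjoint_Ev1: "left_adjoint \<A> C (Ev1 C)"
proof (rule left_adjointI[OF is_category_arrow_cat is_category is_functor_Ev1])
  fix b assume b: "b \<in> Obj C"
  have "universal_arrow \<A> C (Ev1 C) b (Idt C b) (Idt C b)"
    unfolding universal_arrow_def
  proof (intro conjI ballI)
    fix f h assume f: "f \<in> Obj \<A>" "h \<in> hom C (fob (Ev1 C) f) b"
    show "\<exists>!k. k \<in> hom \<A> f (Idt C b) \<and> Idt C b \<cdot> far (Ev1 C) k = h"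
    proof (rule ex1I[of _ "Square f (Idt C b) (h \<cdot> f) h"])
      show "Square f (Idt C b) (h \<cdot> f) h \<in> hom \<A> f (Idt C b) \<and> Idt C b \<cdot> far (Ev1 C) (Square f (Idt C b) (h \<cdot> f) h) = h"
        using f b by (auto simp: Ev1_def)
      fix k assume "k \<in> hom \<A> f (Idt C b) \<and> Idt C b \<cdot> far (Ev1 C) k = h"
      then show "k = Square f (Idt C b) (h \<cdot> f) h"
        using f b sq_Arr[of k C] sq_commutes[of k C] by (intro square_eqI) (auto simp: Ev1_def)
    qed
  qed (use b in \<open>auto simp: Ev1_def\<close>)
  then show "\<exists>g eps. universal_arrow \<A> C (Ev1 C) b g eps" by blast
qed

text \<open>Lifting problems transpose along the adjunction with \<open>Ev0\<close>: out of an
  identity, the component at 1 is forced to be the target arrow after the component at 0.\<close>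

lemma has_lifting_L0:
  assumes u: "u \<in> Arr C" and p: "p \<in> Arr \<A>"
  shows "has_lifting \<A> (far (L0 C) u) p \<longleftrightarrow> has_lifting C u (sq0 p)"
proof -
  interpret D: category \<A> by (rule category_arrow_cat)
  note pA = sq_Arr[OF p] and pc = sq_commutes[OF p]
  have uA: "far (L0 C) u \<in> Arr \<A>" using u by (simp add: L0_def)
  show ?thesis
  proof
    assume L: "has_lifting \<A> (far (L0 C) u) p"
    show "has_lifting C u (sq0 p)"
    proof (rule has_liftingI)
      fix x y assume xy: "x \<in> Arr C" "y \<in> Arr C" "Dom C x = Dom C u" "Cod C x = Dom C (sq0 p)" "Dom C y = Cod C u"
        "Cod C y = Cod C (sq0 p)" "y \<cdot> u = sq0 p \<cdot> x"
      let ?e = "sq_src p" and ?b = "sq_tgt p"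
      obtain h where h: "h \<in> Arr \<A>" "sq_src h = Idt C (Cod C u)" "sq_tgt h = ?e"
        "h \<cdot>\<^bsub>\<A>\<^esub> far (L0 C) u = Square (Idt C (Dom C u)) ?e x (?e \<cdot> x)"
        "p \<cdot>\<^bsub>\<A>\<^esub> h = Square (Idt C (Cod C u)) ?b y (?b \<cdot> y)"
        by (rule D.has_liftingE[OF L uA p, of "Square (Idt C (Dom C u)) ?e x (?e \<cdot> x)" "Square (Idt C (Cod C u)) ?b y (?b \<cdot> y)"])
          (simp_all add: L0_def u xy pA reassoc[OF pc])
      show "\<exists>h. h \<in> Arr C \<and> Dom C h = Cod C u \<and> Cod C h = Dom C (sq0 p) \<and> h \<cdot> u = x \<and> sq0 p \<cdot> h = y"
        using h u pA sq_Arr[OF h(1)] by (intro exI[of _ "sq0 h"]) (simp add: L0_def)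
    qed
  next
    assume L: "has_lifting C u (sq0 p)"
    show "has_lifting \<A> (far (L0 C) u) p"
    proof (rule D.has_liftingI)
      fix x y assume xy: "x \<in> Arr \<A>" "y \<in> Arr \<A>" "Dom \<A> x = Dom \<A> (far (L0 C) u)"
        "Cod \<A> x = Dom \<A> p" "Dom \<A> y = Cod \<A> (far (L0 C) u)"
        "Cod \<A> y = Cod \<A> p" "y \<cdot>\<^bsub>\<A>\<^esub> far (L0 C) u = p \<cdot>\<^bsub>\<A>\<^esub> x"
      then have xy': "sq_src x = Idt C (Dom C u)" "sq_tgt x = sq_src p" "sq_src y = Idt C (Cod C u)" "sq_tgt y = sq_tgt p"
        "sq0 y \<cdot> u = sq0 p \<cdot> sq0 x" by (auto simp: L0_def)
      note X = sq_Arr[OF xy(1), unfolded xy'] sq_commutes[OF xy(1), unfolded xy'] sq_Arr[OF xy(2), unfolded xy'] sq_commutes[OF xy(2), unfolded xy']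
      obtain h where h: "h \<in> Arr C" "Dom C h = Cod C u" "Cod C h = Dom C (sq_src p)" "h \<cdot> u = sq0 x" "sq0 p \<cdot> h = sq0 y"
        by (rule has_liftingE[OF L u, of "sq0 x" "sq0 y"]) (use u X xy' pA in simp_all)
      have x1: "sq1 x = sq_src p \<cdot> sq0 x" "sq1 y = sq_tgt p \<cdot> sq0 y"
        using X u by simp_all
      have "Square (Idt C (Cod C u)) (sq_src p) h (sq_src p \<cdot> h) \<cdot>\<^bsub>\<A>\<^esub> far (L0 C) u = x"
        "p \<cdot>\<^bsub>\<A>\<^esub> Square (Idt C (Cod C u)) (sq_src p) h (sq_src p \<cdot> h) = y"
        by (rule square_eqI; simp add: L0_def u X(1-6,8-13) xy' h pA reassoc[OF pc] x1)+
      then show "\<exists>h. h \<in> Arr \<A> \<and> Dom \<A> h = Cod \<A> (far (L0 C) u) \<and>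
          Cod \<A> h = Dom \<A> p \<and> h \<cdot>\<^bsub>\<A>\<^esub> far (L0 C) u = x \<and> p \<cdot>\<^bsub>\<A>\<^esub> h = y"
        by (intro exI[of _ "Square (Idt C (Cod C u)) (sq_src p) h (sq_src p \<cdot> h)"])
          (simp add: L0_def u h pA)
    qed
  qed
qed

text \<open>Transposition along the adjunction with \<open>Ev1\<close>: the components at 0 have
  initial source and carry no condition.\<close>

lemma has_lifting_L1:
  assumes u: "u \<in> Arr C" and p: "p \<in> Arr \<A>"
  shows "has_lifting \<A> (far (L1 C) u) p \<longleftrightarrow> has_lifting C u (sq1 p)"
proof -
  interpret D: category \<A> by (rule category_arrow_cat)
  note pA = sq_Arr[OF p] and pc = sq_commutes[OF p]
  have uA: "far (L1 C) u \<in> Arr \<A>" using u by (auto simp: L1_def intro: init_ext)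
  let ?f = "from_init C"
  show ?thesis
  proof
    assume L: "has_lifting \<A> (far (L1 C) u) p"
    show "has_lifting C u (sq1 p)"
    proof (rule has_liftingI)
      fix x y assume xy: "x \<in> Arr C" "y \<in> Arr C" "Dom C x = Dom C u" "Cod C x = Dom C (sq1 p)" "Dom C y = Cod C u"
        "Cod C y = Cod C (sq1 p)" "y \<cdot> u = sq1 p \<cdot> x"
      let ?e = "sq_src p" and ?b = "sq_tgt p"
      obtain h where h: "h \<in> Arr \<A>" "sq_src h = ?f (Cod C u)" "sq_tgt h = ?e"
        "h \<cdot>\<^bsub>\<A>\<^esub> far (L1 C) u = Square (?f (Dom C u)) ?e (?f (Dom C ?e)) x"
        "p \<cdot>\<^bsub>\<A>\<^esub> h = Square (?f (Cod C u)) ?b (?f (Dom C ?b)) y"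
        by (rule D.has_liftingE[OF L uA p, of "Square (?f (Dom C u)) ?e (?f (Dom C ?e)) x" "Square (?f (Cod C u)) ?b (?f (Dom C ?b)) y"])
          (auto simp: L1_def u xy pA intro: init_ext)
      show "\<exists>h. h \<in> Arr C \<and> Dom C h = Cod C u \<and> Cod C h = Dom C (sq1 p) \<and> h \<cdot> u = x \<and> sq1 p \<cdot> h = y"
        using h u pA sq_Arr[OF h(1)] by (intro exI[of _ "sq1 h"]) (simp add: L1_def)
    qed
  next
    assume L: "has_lifting C u (sq1 p)"
    show "has_lifting \<A> (far (L1 C) u) p"
    proof (rule D.has_liftingI)
      fix x y assume xy: "x \<in> Arr \<A>" "y \<in> Arr \<A>" "Dom \<A> x = Dom \<A> (far (L1 C) u)"
        "Cod \<A> x = Dom \<A> p" "Dom \<A> y = Cod \<A> (far (L1 C) u)"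
        "Cod \<A> y = Cod \<A> p" "y \<cdot>\<^bsub>\<A>\<^esub> far (L1 C) u = p \<cdot>\<^bsub>\<A>\<^esub> x"
      then have xy': "sq_src x = ?f (Dom C u)" "sq_tgt x = sq_src p" "sq_src y = ?f (Cod C u)" "sq_tgt y = sq_tgt p"
        "sq1 y \<cdot> u = sq1 p \<cdot> sq1 x" by (auto simp: L1_def)
      note X = sq_Arr[OF xy(1), unfolded xy'] sq_commutes[OF xy(1), unfolded xy'] sq_Arr[OF xy(2), unfolded xy'] sq_commutes[OF xy(2), unfolded xy']
      obtain h where h: "h \<in> Arr C" "Dom C h = Cod C u" "Cod C h = Cod C (sq_src p)" "h \<cdot> u = sq1 x" "sq1 p \<cdot> h = sq1 y"
        by (rule has_liftingE[OF L u, of "sq1 x" "sq1 y"]) (use u X xy' pA in simp_all)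
      let ?h = "Square (?f (Cod C u)) (sq_src p) (?f (Dom C (sq_src p))) h"
      have i: "?f (Dom C (sq_src p)) \<cdot> Idt C (init C) = sq0 x" "sq0 p \<cdot> ?f (Dom C (sq_src p)) = sq0 y"
        by (rule init_ext; use u X pA in simp)+
      have "?h \<cdot>\<^bsub>\<A>\<^esub> far (L1 C) u = x" "p \<cdot>\<^bsub>\<A>\<^esub> ?h = y"
        using i by (auto intro!: square_eqI simp: L1_def xy' h)
      moreover have "?h \<in> Arr \<A>" using u h pA by (auto intro: init_ext)
      ultimately show "\<exists>h. h \<in> Arr \<A> \<and> Dom \<A> h = Cod \<A> (far (L1 C) u) \<and>
          Cod \<A> h = Dom \<A> p \<and> h \<cdot>\<^bsub>\<A>\<^esub> far (L1 C) u = x \<and> p \<cdot>\<^bsub>\<A>\<^esub> h = y"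
        by (intro exI[of _ ?h]) (simp add: L1_def)
    qed
  qed
qed

end

section \<open>Sequences indexed by well-orders\<close>

lemma order_cat_simps [simp]:
  "Obj (order_cat r) = Field r" "Arr (order_cat r) = r" "Dom (order_cat r) = fst" "Cod (order_cat r) = snd"
  "Idt (order_cat r) i = (i, i)" "q \<cdot>\<^bsub>order_cat r\<^esub> p = (fst p, snd q)"
  by (simp_all add: order_cat_def)

lemma Well_order_rules:
  assumes "Well_order r"
  shows "i \<in> Field r \<Longrightarrow> (i, i) \<in> r" "(i, j) \<in> r \<Longrightarrow> (j, k) \<in> r \<Longrightarrow> (i, k) \<in> r" "(i, j) \<in> r \<Longrightarrow> (j, i) \<in> r \<Longrightarrow> i = j"
    "i \<in> Field r \<Longrightarrow> j \<in> Field r \<Longrightarrow> (i, j) \<in> r \<or> (j, i) \<in> r" "(i, j) \<in> r \<Longrightarrow> i \<in> Field r" "(i, j) \<in> r \<Longrightarrow> j \<in> Field r"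
    "wf (r - Id)"
proof -
  have r: "refl_on (Field r) r" "trans r" "antisym r" "total_on (Field r) r" "wf (r - Id)"
    using assms by (auto simp: well_order_on_def linear_order_on_def partial_order_on_def preorder_on_def)
  show refl: "i \<in> Field r \<Longrightarrow> (i, i) \<in> r" using r(1) by (auto simp: refl_on_def)
  show "(i, j) \<in> r \<Longrightarrow> (j, k) \<in> r \<Longrightarrow> (i, k) \<in> r" using r(2) by (auto dest: transD)
  show "(i, j) \<in> r \<Longrightarrow> (j, i) \<in> r \<Longrightarrow> i = j" using r(3) by (auto dest: antisymD)
  show "i \<in> Field r \<Longrightarrow> j \<in> Field r \<Longrightarrow> (i, j) \<in> r \<or> (j, i) \<in> r"
    using r(4) refl by (cases "i = j") (auto simp: total_on_def)
  show "(i, j) \<in> r \<Longrightarrow> i \<in> Field r" "(i, j) \<in> r \<Longrightarrow> j \<in> Field r" by (auto simp: Field_def)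
  show "wf (r - Id)" by fact
qed

lemma Well_order_Field_Restr: "Well_order r \<Longrightarrow> Field (Restr r L) = Field r \<inter> L"
  by (rule Refl_Field_Restr) (simp add: well_order_on_def linear_order_on_def partial_order_on_def preorder_on_def)

lemma is_category_order_cat: "Well_order r \<Longrightarrow> is_category (order_cat r)"
  using Well_order_rules unfolding is_category_def in_hom order_cat_simps by (smt (verit) fst_conv snd_conv prod.collapse)

lemma order_functor_rules:
  assumes "Well_order r" "is_functor (order_cat r) C X"
  shows "i \<in> Field r \<Longrightarrow> fob X i \<in> Obj C" "(i, j) \<in> r \<Longrightarrow> far X (i, j) \<in> Arr C" "(i, j) \<in> r \<Longrightarrow> Dom C (far X (i, j)) = fob X i"
    "(i, j) \<in> r \<Longrightarrow> Cod C (far X (i, j)) = fob X j" "i \<in> Field r \<Longrightarrow> far X (i, i) = Idt C (fob X i)"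
    "(i, j) \<in> r \<Longrightarrow> (j, k) \<in> r \<Longrightarrow> far X (j, k) \<cdot>\<^bsub>C\<^esub> far X (i, j) = far X (i, k)"
  using functor_simps[OF assms(2)] functor_comp[OF assms(2), of "(i, j)" "(j, k)"] by auto

lemma order_functor_Restr:
  assumes "Well_order r" "is_functor (order_cat r) C X"
  shows "is_functor (order_cat (Restr r L)) C X"
  by (rule is_functorI)
    (use Well_order_Field_Restr[OF assms(1), of L] order_functor_rules[OF assms] in auto)

context left_adjoint_functor
begin

lemma ordinal_sequence_image:
  assumes "ordinal_sequence r C X"
  shows "ordinal_sequence r D (comp_functor F X)"
proof -
  have r: "Well_order r" "is_functor (order_cat r) C X"
    and lim: "\<And>j. is_limit_elem r j \<Longrightarrow> is_colimit (order_cat (Restr r (underS r j))) C X (fob X j) (\<lambda>i. far X (i, j))"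
    using assms by (auto simp: ordinal_sequence_def)
  show ?thesis
    unfolding ordinal_sequence_def comp_functor_simps
    by (intro conjI allI impI preserves_colimit lim is_category_order_cat Well_order_Restr order_functor_Restr r is_functor_comp[OF r(2) is_functor])
qed

lemma sequence_of_image:
  assumes "sequence_of r C S X" "far F ` S \<subseteq> S'"
  shows "sequence_of r D S' (comp_functor F X)"
  using assms ordinal_sequence_image by (auto simp: sequence_of_def)

lemma order_colimit_image:
  assumes "sequence_of r C S X" "is_colimit (order_cat r) C X a t"
  shows "is_colimit (order_cat r) D (comp_functor F X) (fob F a) (\<lambda>i. far F (t i))"
  using assms preserves_colimit[OF is_category_order_cat] by (auto simp: sequence_of_def ordinal_sequence_def)

lemma transfinite_compositions_image:
  assumes "t \<in> transfinite_compositions U C S" "far F ` S \<subseteq> S'"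
  shows "far F t \<in> transfinite_compositions U D S'"
  using assms(1) sequence_of_image[OF _ assms(2)] order_colimit_image
  unfolding transfinite_compositions_def by fastforce

lemma pushouts_image: "q \<in> pushouts C S \<Longrightarrow> far F q \<in> pushouts D (far F ` S)"
  unfolding pushouts_def using preserves_pushout by blast

end

text \<open>
  Removing the isomorphisms from a sequence: an index \<open>j\<close> is flat over \<open>i\<close> if no successor step between
  them is a jump, i.e. a non-isomorphism, and the indices that are flat only over themselves represent
  the classes of the relation generated by flatness.
\<close>

locale ordinal_seq = category C for C :: "('o, 'm) cat" (structure) +
  fixes r :: "'i rel" and X :: "('i, 'i \<times> 'i, 'o, 'm) cfunctor"
  assumes seq: "ordinal_sequence r C X"
begin

lemma wo: "Well_order r" and X_functor: "is_functor (order_cat r) C X"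
  using seq by (auto simp: ordinal_sequence_def)

lemmas r_rules = Well_order_rules[OF wo]
lemmas X_rules [simp] = order_functor_rules[OF wo X_functor]

definition jumps :: "'i set" where
  "jumps = {j. \<exists>i. is_succ r i j \<and> \<not> is_iso C (far X (i, j))}"

definition flat :: "'i \<Rightarrow> 'i \<Rightarrow> bool" where
  "flat i j \<longleftrightarrow> (i, j) \<in> r \<and> (\<forall>e\<in>jumps. (i, e) \<in> r \<and> (e, j) \<in> r \<longrightarrow> e = i)"

definition reps :: "'i set" where
  "reps = {j \<in> Field r. \<forall>i. flat i j \<longrightarrow> i = j}"

lemma flat_r [simp]: "flat i j \<Longrightarrow> (i, j) \<in> r"
  by (simp add: flat_def)

lemma flat_refl: "i \<in> Field r \<Longrightarrow> flat i i"
  unfolding flat_def using r_rules(1,3) by blast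

lemma flat_trans:
  assumes "flat i j" "flat j k"
  shows "flat i k"
  unfolding flat_def
proof (intro conjI ballI impI)
  note ij = flat_r[OF assms(1)] and jk = flat_r[OF assms(2)]
  show "(i, k) \<in> r" by (rule r_rules(2)[OF ij jk])
  fix e assume e: "e \<in> jumps" "(i, e) \<in> r \<and> (e, k) \<in> r"
  have "(e, j) \<in> r"
  proof (cases "(e, j) \<in> r")
    case False
    then have "(j, e) \<in> r" using r_rules(4)[of e j] r_rules(5)[OF jk] r_rules(6) e(2) by blast
    then have "e = j" using assms(2) e unfolding flat_def by blast
    then show ?thesis using r_rules(1)[OF r_rules(5)[OF jk]] by simp
  qed
  then show "e = i" using assms(1) e unfolding flat_def by blast
qed

lemma flat_between: "flat i k \<Longrightarrow> (i, j) \<in> r \<Longrightarrow> (j, k) \<in> r \<Longrightarrow> flat i j"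
  unfolding flat_def using r_rules(2)[of _ j k] by blast

text \<open>By well-founded induction on \<open>j\<close>. At a successor the last step is not a
  jump, hence invertible. At a limit, all stages between \<open>i\<close> and \<open>j\<close> are
  already isomorphic to \<open>X i\<close>, which makes \<open>X i\<close> a colimit of the stages
  below \<open>j\<close>.\<close>

lemma flat_iso:
  assumes "flat i j"
  shows "is_iso C (far X (i, j))"
  using assms
proof (induction j rule: wf_induct_rule[OF r_rules(7)])
  case (1 j)
  note IH = 1(1) and fl = 1(2)
  have ij: "(i, j) \<in> r" "i \<in> Field r" "j \<in> Field r" using flat_r[OF fl] r_rules(5,6) by blast+
  consider "i = j" | p where "i \<noteq> j" "is_succ r p j" | "i \<noteq> j" "\<nexists>p. is_succ r p j" by blast
  then show ?case
  proof cases
    case 1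
    then show ?thesis using ij by simp
  next
    case (2 p)
    then have p: "(p, j) \<in> r" "p \<noteq> j" "p \<in> Field r" using r_rules(5) by (auto simp: is_succ_def)
    have ip: "(i, p) \<in> r" using r_rules(4)[OF ij(2) p(3)] 2 ij(1) r_rules(1)[OF ij(2)] by (auto simp: is_succ_def)
    have "is_iso C (far X (i, p))" using IH[of p] flat_between[OF fl ip p(1)] p by simp
    moreover have "is_iso C (far X (p, j))"
    proof (rule ccontr)
      assume "\<not> ?thesis"
      then have "j \<in> jumps" using 2 unfolding jumps_def by blast
      then show False using fl 2(1) ij r_rules(1) unfolding flat_def by blast
    qed
    ultimately have "is_iso C (far X (p, j) \<cdot> far X (i, p))" using p ip by (intro is_iso_comp) simp_all
    then show ?thesis using p ip by simp
  next
    case 3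
    let ?L = "underS r j"
    have L: "?L \<subseteq> Field r" "Field (Restr r ?L) = ?L" "i \<in> ?L"
      using Well_order_Field_Restr[OF wo, of ?L] ij 3 by (auto simp: underS_def Field_def)
    have "is_limit_elem r j" using 3 L ij by (auto simp: is_limit_elem_def is_least_def)
    then have lim: "is_colimit (order_cat (Restr r ?L)) C X (fob X j) (\<lambda>i. far X (i, j))"
      using seq by (auto simp: ordinal_sequence_def)
    have "\<forall>k. \<exists>g. k \<in> ?L \<and> (i, k) \<in> r \<longrightarrow> g \<in> Arr C \<and> Dom C g = fob X k \<and> Cod C g = fob X i \<and>
        g \<cdot> far X (i, k) = Idt C (fob X i) \<and> far X (i, k) \<cdot> g = Idt C (fob X k)"
    proof
      fix k
      show "\<exists>g. k \<in> ?L \<and> (i, k) \<in> r \<longrightarrow> g \<in> Arr C \<and> Dom C g = fob X k \<and> Cod C g = fob X i \<and>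
        g \<cdot> far X (i, k) = Idt C (fob X i) \<and> far X (i, k) \<cdot> g = Idt C (fob X k)"
      proof (cases "k \<in> ?L \<and> (i, k) \<in> r")
        case True
        then have "is_iso C (far X (i, k))" using IH[of k] flat_between[OF fl] by (auto simp: underS_def)
        then show ?thesis using True by (auto elim!: is_isoE)
      qed blast
    qed
    then obtain g where g: "\<And>k. k \<in> ?L \<Longrightarrow> (i, k) \<in> r \<Longrightarrow> g k \<in> Arr C \<and> Dom C (g k) = fob X k \<and> Cod C (g k) = fob X i \<and>
        g k \<cdot> far X (i, k) = Idt C (fob X i) \<and> far X (i, k) \<cdot> g k = Idt C (fob X k)" by metis
    \<comment> \<open>A cocone on the stages below \<open>j\<close> with vertex \<open>X i\<close>:
      the inverse of the transition map above \<open>i\<close>, the transition map itself below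
      \<open>i\<close>. The arrow \<open>h\<close> that it induces inverts the map from
      \<open>X i\<close> to \<open>X j\<close>.\<close>
    define s where "s = (\<lambda>k. if (i, k) \<in> r then g k else far X (k, i))"
    have rL: "(k, j) \<in> r" "k \<in> Field r" "(i, k) \<notin> r \<Longrightarrow> (k, i) \<in> r" if "k \<in> ?L" for k
      using that r_rules(4)[OF ij(2)] L by (auto simp: underS_def)
    have comm: "s l \<cdot> far X (k, l) = s k" if kl: "(k, l) \<in> r" "k \<in> ?L" "l \<in> ?L" for k l
    proof -
      consider "(i, k) \<in> r" "(i, l) \<in> r" | "(i, k) \<notin> r" "(k, i) \<in> r" "(i, l) \<in> r" | "(i, k) \<notin> r" "(k, i) \<in> r" "(i, l) \<notin> r" "(l, i) \<in> r"
        using rL[OF kl(2)] rL[OF kl(3)] r_rules(2)[of i k l] kl(1) by blast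
      then show ?thesis
      proof cases
        case 1
        have "g l \<cdot> far X (k, l) = g l \<cdot> far X (k, l) \<cdot> far X (i, k) \<cdot> g k"
          using g[OF kl(2) 1(1)] g[OF kl(3) 1(2)] kl by simp
        also have "\<dots> = g l \<cdot> far X (i, l) \<cdot> g k"
          using g[OF kl(2) 1(1)] g[OF kl(3) 1(2)] kl 1 reassoc[OF X_rules(6)[OF 1(1) kl(1)], of "g k"] by simp
        also have "\<dots> = g k"
          using g[OF kl(2) 1(1)] g[OF kl(3) 1(2)] kl 1 reassoc[of "g l" "far X (i, l)" _ "g k"] by simp
        finally show ?thesis using 1 by (simp add: s_def)
      next
        case 2
        have "g l \<cdot> far X (k, l) = g l \<cdot> far X (i, l) \<cdot> far X (k, i)" using 2 by simp
        also have "\<dots> = far X (k, i)" using g[OF kl(3) 2(3)] 2 reassoc[of "g l" "far X (i, l)" _ "far X (k, i)"] by simp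
        finally show ?thesis using 2 by (simp add: s_def)
      next
        case 3
        then show ?thesis using kl by (simp add: s_def)
      qed
    qed
    obtain h where h: "h \<in> Arr C" "Dom C h = fob X j" "Cod C h = fob X i" "\<And>k. k \<in> ?L \<Longrightarrow> h \<cdot> far X (k, j) = s k"
    proof (rule is_colimit_ex[OF lim, of "fob X i" s])
      fix k assume "k \<in> Obj (order_cat (Restr r ?L))"
      then have "k \<in> ?L" using L by simp
      then show "s k \<in> hom C (fob X k) (fob X i)" using g[of k] rL(3)[of k] by (simp add: s_def)
    next
      fix u assume "u \<in> Arr (order_cat (Restr r ?L))"
      then show "s (Cod (order_cat (Restr r ?L)) u) \<cdot> far X u = s (Dom (order_cat (Restr r ?L)) u)"
        using comm[of "fst u" "snd u"] by (cases u) auto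
    qed (use L(2) ij in auto)
    have ii: "(i, i) \<in> r" using ij r_rules(1) by simp
    have "s i = Idt C (fob X i)" using g[OF L(3) ii] ii ij comp_Idt X_rules(5) unfolding s_def by metis
    then have 1: "h \<cdot> far X (i, j) = Idt C (fob X i)" using h(4)[OF L(3)] by simp
    have "far X (i, j) \<cdot> h = Idt C (fob X j)"
    proof (rule is_colimit_ext[OF lim is_category_order_cat[OF Well_order_Restr[OF wo]] order_functor_Restr[OF wo X_functor]])
      fix k assume "k \<in> Obj (order_cat (Restr r ?L))"
      then have k: "k \<in> ?L" using L by simp
      have "far X (i, j) \<cdot> s k = far X (k, j)"
      proof (cases "(i, k) \<in> r")
        case True
        have "far X (i, j) \<cdot> g k = (far X (k, j) \<cdot> far X (i, k)) \<cdot> g k"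
          using rL[OF k] True by simp
        also have "\<dots> = far X (k, j)" using g[OF k True] rL[OF k] True by (simp del: X_rules(6))
        finally show ?thesis using True by (simp add: s_def)
      qed (use rL[OF k] ij in \<open>simp add: s_def\<close>)
      then show "(far X (i, j) \<cdot> h) \<cdot> far X (k, j) = Idt C (fob X j) \<cdot> far X (k, j)"
        using h k ij rL[OF k] by simp
    qed (use h ij in simp_all)
    then show ?thesis using 1 h ij by (intro is_isoI[of _ h]) simp_all
  qed
qed

text \<open>The representative is the least index over which \<open>j\<close> is flat; by
  transitivity nothing smaller is joined to it.\<close>

lemma rep_exists:
  assumes "j \<in> Field r"
  obtains i where "flat i j" "i \<in> reps"
proof -
  have "\<exists>i\<in>{i. flat i j}. \<forall>k. (k, i) \<in> r - Id \<longrightarrow> k \<notin> {i. flat i j}"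
    using wfE_min[OF r_rules(7), of j "{i. flat i j}"] flat_refl[OF assms] by blast
  then obtain i where i: "flat i j" "\<And>k. (k, i) \<in> r \<Longrightarrow> k \<noteq> i \<Longrightarrow> \<not> flat k j" by auto
  moreover have "i \<in> reps"
    unfolding reps_def using i(2) flat_trans[OF _ i(1)] r_rules(5)[OF flat_r[OF i(1)]] flat_r by blast
  ultimately show thesis using that by blast
qed

lemma reps_flat: "flat i j \<Longrightarrow> j \<in> reps \<Longrightarrow> i = j"
  by (simp add: reps_def)

lemma reps_Field: "j \<in> reps \<Longrightarrow> j \<in> Field r"
  by (simp add: reps_def)

text \<open>If a jump is flat over \<open>i\<close>, it is itself one of the jumps between
  \<open>i\<close> and its end, hence equal to \<open>i\<close>.\<close>

lemma jumps_reps: "jumps \<subseteq> reps"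
proof
  fix e assume e: "e \<in> jumps"
  then have F: "e \<in> Field r" unfolding jumps_def is_succ_def using r_rules(6) by blast
  then show "e \<in> reps" unfolding reps_def flat_def using e r_rules(1)[OF F] by auto
qed

text \<open>The representatives need not be cofinal, as a sequence may become constant up to
  isomorphism. The colimit is kept because each stage is isomorphic to that of its representative,
  compatibly with the transition maps, so a cocone on the representatives extends uniquely.\<close>

lemma colimit_reps:
  assumes L: "L \<subseteq> Field r" "\<And>k i. k \<in> L \<Longrightarrow> flat i k \<Longrightarrow> i \<in> reps \<Longrightarrow> i \<in> L"
    and lim: "is_colimit (order_cat (Restr r L)) C X a t"
  shows "is_colimit (order_cat (Restr r (L \<inter> reps))) C X a t"
proof -
  have FL: "Field (Restr r L) = L" "Field (Restr r (L \<inter> reps)) = L \<inter> reps"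
    using Well_order_Field_Restr[OF wo] L by auto
  note T = is_colimit_facts[OF lim, simplified FL order_cat_simps]
  have T5: "t l \<cdot> far X (k, l) = t k" if "(k, l) \<in> r" "k \<in> L" "l \<in> L" for k l
    using T(5)[of "(k, l)"] that by simp
  have "\<forall>k. \<exists>i g. k \<in> L \<longrightarrow> flat i k \<and> i \<in> reps \<and> i \<in> L \<and> g \<in> Arr C \<and> Dom C g = fob X k \<and> Cod C g = fob X i \<and>
        g \<cdot> far X (i, k) = Idt C (fob X i) \<and> far X (i, k) \<cdot> g = Idt C (fob X k)"
  proof
    fix k
    show "\<exists>i g. k \<in> L \<longrightarrow> flat i k \<and> i \<in> reps \<and> i \<in> L \<and> g \<in> Arr C \<and> Dom C g = fob X k \<and> Cod C g = fob X i \<and>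
        g \<cdot> far X (i, k) = Idt C (fob X i) \<and> far X (i, k) \<cdot> g = Idt C (fob X k)"
    proof (cases "k \<in> L")
      case True
      then obtain i where i: "flat i k" "i \<in> reps" using rep_exists[of k] L by auto
      obtain g where "g \<in> Arr C" "Dom C g = fob X k" "Cod C g = fob X i"
        "g \<cdot> far X (i, k) = Idt C (fob X i)" "far X (i, k) \<cdot> g = Idt C (fob X k)"
        using flat_iso[OF i(1)] i by (auto elim!: is_isoE)
      then show ?thesis using i L True by blast
    qed simp
  qed
  then obtain \<rho> g where \<rho>: "\<And>k. k \<in> L \<Longrightarrow> flat (\<rho> k) k \<and> \<rho> k \<in> reps \<and> \<rho> k \<in> L"
    and g: "\<And>k. k \<in> L \<Longrightarrow> g k \<in> Arr C \<and> Dom C (g k) = fob X k \<and> Cod C (g k) = fob X (\<rho> k) \<and>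
        g k \<cdot> far X (\<rho> k, k) = Idt C (fob X (\<rho> k)) \<and> far X (\<rho> k, k) \<cdot> g k = Idt C (fob X k)" by metis
  have \<rho>_rep: "\<rho> k = k" if "k \<in> L" "k \<in> reps" for k using \<rho>[OF that(1)] reps_flat that by blast
  have \<rho>_r [simp]: "(\<rho> k, k) \<in> r" if "k \<in> L" for k using \<rho>[OF that] by simp
  \<comment> \<open>Were the order reversed, \<open>\<rho> k\<close> would lie between
    \<open>\<rho> l\<close> and \<open>l\<close>, hence be flat over \<open>\<rho> l\<close> and, as
    a representative, equal to it.\<close>
  have \<rho>_mono: "(\<rho> k, \<rho> l) \<in> r" if kl: "k \<in> L" "l \<in> L" "(k, l) \<in> r" for k l
  proof (rule ccontr)
    assume n: "(\<rho> k, \<rho> l) \<notin> r"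
    then have "(\<rho> l, \<rho> k) \<in> r" using r_rules(4) \<rho> kl L by blast
    then have "flat (\<rho> l) (\<rho> k)" using flat_between[of "\<rho> l" l "\<rho> k"] \<rho> kl r_rules(2) \<rho>_r by blast
    then show False using reps_flat \<rho> kl n r_rules(1) L by (metis subsetD)
  qed
  \<comment> \<open>The inverses \<open>g\<close> are natural in the index. This is what makes the
    extension of a cocone from the representatives again a cocone.\<close>
  have gX: "g l \<cdot> far X (k, l) = far X (\<rho> k, \<rho> l) \<cdot> g k" if kl: "k \<in> L" "l \<in> L" "(k, l) \<in> r" for k l
  proof -
    note G = g[OF kl(1)] g[OF kl(2)] \<rho>_r[OF kl(1)] \<rho>_r[OF kl(2)] \<rho>_mono[OF kl] kl
    have "far X (\<rho> k, l) \<cdot> g k = (far X (k, l) \<cdot> far X (\<rho> k, k)) \<cdot> g k" using G by simp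
    also have "\<dots> = far X (k, l)" using G by (simp del: X_rules(6))
    finally have "g l \<cdot> far X (k, l) = g l \<cdot> far X (\<rho> k, l) \<cdot> g k" by simp
    also have "\<dots> = g l \<cdot> (far X (\<rho> l, l) \<cdot> far X (\<rho> k, \<rho> l)) \<cdot> g k" using G by simp
    also have "\<dots> = far X (\<rho> k, \<rho> l) \<cdot> g k"
      using G reassoc[of "g l" "far X (\<rho> l, l)" _ "far X (\<rho> k, \<rho> l) \<cdot> g k"] by (simp del: X_rules(6))
    finally show ?thesis .
  qed
  show ?thesis
  proof (rule is_colimitI)
    fix b s
    assume "b \<in> Obj C" and s0: "\<And>j. j \<in> Obj (order_cat (Restr r (L \<inter> reps))) \<Longrightarrow> s j \<in> Arr C"
      "\<And>j. j \<in> Obj (order_cat (Restr r (L \<inter> reps))) \<Longrightarrow> Dom C (s j) = fob X j"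
      "\<And>j. j \<in> Obj (order_cat (Restr r (L \<inter> reps))) \<Longrightarrow> Cod C (s j) = b"
      "\<And>u. u \<in> Arr (order_cat (Restr r (L \<inter> reps))) \<Longrightarrow> s (Cod (order_cat (Restr r (L \<inter> reps))) u) \<cdot> far X u = s (Dom (order_cat (Restr r (L \<inter> reps))) u)"
    have s: "s j \<in> Arr C" "Dom C (s j) = fob X j" "Cod C (s j) = b" if "j \<in> L" "j \<in> reps" for j
      using s0(1-3)[of j] that FL by simp_all
    have s4: "s l \<cdot> far X (k, l) = s k" if "(k, l) \<in> r" "k \<in> L" "k \<in> reps" "l \<in> L" "l \<in> reps" for k l
      using s0(4)[of "(k, l)"] that by simp
    obtain h where h: "h \<in> Arr C" "Dom C h = a" "Cod C h = b" "\<And>j. j \<in> L \<Longrightarrow> h \<cdot> t j = s (\<rho> j) \<cdot> g j"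
    proof (rule is_colimit_ex[OF lim, of b "\<lambda>k. s (\<rho> k) \<cdot> g k"])
      fix u assume "u \<in> Arr (order_cat (Restr r L))"
      then obtain k l where u: "u = (k, l)" "(k, l) \<in> r" "k \<in> L" "l \<in> L" by (cases u) auto
      have "(s (\<rho> l) \<cdot> g l) \<cdot> far X (k, l) = s (\<rho> k) \<cdot> g k"
        using u \<rho> g s gX[OF u(3,4,2)] reassoc[OF s4[OF \<rho>_mono[OF u(3,4,2)]], of "g k"] \<rho>_mono[OF u(3,4,2)] by simp
      then show "(s (\<rho> (Cod (order_cat (Restr r L)) u)) \<cdot> g (Cod (order_cat (Restr r L)) u)) \<cdot> far X u =
          s (\<rho> (Dom (order_cat (Restr r L)) u)) \<cdot> g (Dom (order_cat (Restr r L)) u)" using u by simp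
    qed (use \<open>b \<in> Obj C\<close> FL \<rho> g s in auto)
    have "h \<cdot> t j = s j" if j: "j \<in> L" "j \<in> reps" for j
    proof -
      have "g j = Idt C (fob X j)" using g[OF j(1)] \<rho>_rep[OF j] L j comp_Idt X_rules(5) by (metis subsetD)
      then show ?thesis using h(4)[OF j(1)] \<rho>_rep[OF j] s[OF j] by simp
    qed
    then show "\<exists>h. h \<in> hom C a b \<and> (\<forall>j\<in>Obj (order_cat (Restr r (L \<inter> reps))). h \<cdot> t j = s j)"
      using h FL by auto
  next
    fix h k
    assume hk: "h \<in> Arr C" "k \<in> Arr C" "Dom C h = a" "Dom C k = a" "Cod C h = Cod C k"
      "\<And>j. j \<in> Obj (order_cat (Restr r (L \<inter> reps))) \<Longrightarrow> h \<cdot> t j = k \<cdot> t j"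
    show "h = k"
    proof (rule is_colimit_ext[OF lim is_category_order_cat[OF Well_order_Restr[OF wo]] order_functor_Restr[OF wo X_functor]])
      fix j assume "j \<in> Obj (order_cat (Restr r L))"
      then have j: "j \<in> L" using FL by simp
      have tj: "t j = t (\<rho> j) \<cdot> g j"
        using T5[OF \<rho>_r[OF j] _ j] \<rho>[OF j] g[OF j] T j reassoc[OF T5[OF \<rho>_r[OF j] _ j], of "g j"] by simp
      have "h \<cdot> t (\<rho> j) = k \<cdot> t (\<rho> j)" using hk(6)[of "\<rho> j"] \<rho>[OF j] FL by simp
      then have "(h \<cdot> t (\<rho> j)) \<cdot> g j = (k \<cdot> t (\<rho> j)) \<cdot> g j" by (rule arg_cong)
      then show "h \<cdot> t j = k \<cdot> t j"
        unfolding tj using hk(1-5) \<rho>[OF j] g[OF j] T(1-4) by simp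
    qed (use hk in auto)
  next
    fix u assume "u \<in> Arr (order_cat (Restr r (L \<inter> reps)))"
    then show "t (Cod (order_cat (Restr r (L \<inter> reps))) u) \<cdot> far X u = t (Dom (order_cat (Restr r (L \<inter> reps))) u)"
      using T5[of "fst u" "snd u"] by (cases u) auto
  qed (use T(1-4) FL in auto)
qed

text \<open>A successor step among representatives is, in the original order, a flat stretch from
  \<open>i\<close> to the predecessor of \<open>j\<close> followed by a jump; hence \<open>S\<close>
  has to absorb isomorphisms on the source side. A limit among representatives is a limit in the
  original order, since the representative of a predecessor would be a predecessor again.\<close>

lemma reps_sequence:
  assumes S: "\<And>f e. f \<in> S \<Longrightarrow> is_iso C e \<Longrightarrow> Dom C f = Cod C e \<Longrightarrow> f \<cdot> e \<in> S"
    and steps: "\<And>i j. is_succ r i j \<Longrightarrow> far X (i, j) \<in> S \<or> is_iso C (far X (i, j))"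
  shows "sequence_of (Restr r reps) C S X"
proof -
  let ?r = "Restr r reps"
  have F: "Field ?r = reps" using Well_order_Field_Restr[OF wo, of reps] by (auto simp: reps_def)
  have jump_between: "\<exists>e\<in>jumps. (i, e) \<in> r \<and> (e, j) \<in> r \<and> e \<noteq> i" if "j \<in> reps" "(i, j) \<in> r" "i \<noteq> j" for i j
    using that reps_flat unfolding flat_def by blast
  have "is_colimit (order_cat (Restr ?r (underS ?r j))) C X (fob X j) (\<lambda>i. far X (i, j))" if j: "is_limit_elem ?r j" for j
  proof -
    have jr: "j \<in> reps" "j \<in> Field r" using j F reps_Field by (auto simp: is_limit_elem_def)
    have "\<not> is_succ r i j" for i
    proof
      assume s: "is_succ r i j"
      then have i: "i \<in> Field r" "(i, j) \<in> r" "i \<noteq> j" using r_rules(5) by (auto simp: is_succ_def)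
      obtain i' where i': "flat i' i" "i' \<in> reps" using rep_exists[OF i(1)] by blast
      have "is_succ ?r i' j"
        unfolding is_succ_def
      proof (intro conjI allI impI)
        show "(i', j) \<in> ?r" using i' jr r_rules(2)[OF flat_r[OF i'(1)] i(2)] by auto
        show "i' \<noteq> j" using i i' r_rules(3) by auto
        fix k assume k: "(i', k) \<in> ?r \<and> (k, j) \<in> ?r"
        show "k = i' \<or> k = j"
        proof (rule ccontr)
          assume n: "\<not> (k = i' \<or> k = j)"
          have "(k, i) \<in> r" using s n k r_rules(4)[of k i] r_rules(5,6) i unfolding is_succ_def by blast
          then have "flat i' k" using flat_between[OF i'(1)] k by blast
          then show False using reps_flat k n by blast
        qed
      qed
      then show False using j by (auto simp: is_limit_elem_def)
    qed
    moreover have "\<not> is_least r j" using j jr F r_rules(2,3) by (auto simp: is_limit_elem_def is_least_def underS_def)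
    ultimately have "is_limit_elem r j" using jr by (simp add: is_limit_elem_def)
    then have "is_colimit (order_cat (Restr r (underS r j))) C X (fob X j) (\<lambda>i. far X (i, j))"
      using seq by (auto simp: ordinal_sequence_def)
    then have "is_colimit (order_cat (Restr r (underS r j \<inter> reps))) C X (fob X j) (\<lambda>i. far X (i, j))"
      by (rule colimit_reps[rotated 2]) (use r_rules(2,3,5) in \<open>auto simp: underS_def dest!: flat_r\<close>)
    moreover have "Restr ?r (underS ?r j) = Restr r (underS r j \<inter> reps)" using jr by (auto simp: underS_def)
    ultimately show ?thesis by simp
  qed
  moreover have "far X (i, j) \<in> S" if ij: "is_succ ?r i j" for i j
  proof -
    have i: "i \<in> reps" "j \<in> reps" "(i, j) \<in> r" "i \<noteq> j" "\<And>k. k \<in> reps \<Longrightarrow> (i, k) \<in> r \<Longrightarrow> (k, j) \<in> r \<Longrightarrow> k = i \<or> k = j"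
      using ij by (auto simp: is_succ_def)
    obtain e where "e \<in> jumps" "(i, e) \<in> r" "(e, j) \<in> r" "e \<noteq> i" using jump_between[OF i(2,3,4)] by blast
    \<comment> \<open>Jumps are representatives, and between \<open>i\<close> and \<open>j\<close>
      there is no other representative, so the jump found after \<open>i\<close> can only be
      \<open>j\<close>.\<close>
    then have "j \<in> jumps" using i(5) jumps_reps by blast
    then obtain p where p: "is_succ r p j" "\<not> is_iso C (far X (p, j))" by (auto simp: jumps_def)
    have pr: "(p, j) \<in> r" "p \<noteq> j" "p \<in> Field r" using p r_rules(5) by (auto simp: is_succ_def)
    have ip: "(i, p) \<in> r"
      using r_rules(4)[OF reps_Field[OF i(1)] pr(3)] p(1) i(3,4) r_rules(1) pr(3) unfolding is_succ_def by blast
    obtain p' where p': "flat p' p" "p' \<in> reps" using rep_exists[OF pr(3)] by blast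
    have "(i, p') \<in> r"
      using r_rules(4)[OF reps_Field[OF i(1)] reps_Field[OF p'(2)]] flat_between[OF p'(1) _ ip] reps_flat i(1) r_rules(1)[OF reps_Field[OF i(1)]] by blast
    \<comment> \<open>The representative of the predecessor lies between \<open>i\<close> and
      \<open>j\<close> and differs from \<open>j\<close>.\<close>
    then have "p' = i" using i(5)[OF p'(2)] p' pr r_rules(2,3) flat_r by blast
    then have "is_iso C (far X (i, p))" using flat_iso p' by simp
    moreover have "far X (p, j) \<in> S" using steps[OF p(1)] p(2) by blast
    ultimately have "far X (p, j) \<cdot> far X (i, p) \<in> S" using pr ip by (intro S) simp_all
    then show ?thesis using pr ip by simp
  qed
  ultimately show ?thesis
    using Well_order_Restr[OF wo] order_functor_Restr[OF wo X_functor] by (auto simp: sequence_of_def ordinal_sequence_def)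
qed

end

lemma lesspoll_subset: "A \<subseteq> B \<Longrightarrow> B \<prec> C \<Longrightarrow> A \<prec> C"
  by (meson lesspoll_trans1 subset_imp_lepoll)

text \<open>The composite itself is unchanged: the least index is always a representative, since
  nothing lies below it, and the colimit with its legs is the same over the representatives.\<close>

lemma (in category) transfinite_compositions_iso_steps:
  fixes U :: "'u itself"
  assumes S: "\<And>f e. f \<in> S \<Longrightarrow> is_iso C e \<Longrightarrow> Dom C f = Cod C e \<Longrightarrow> f \<cdot> e \<in> S"
  shows "transfinite_compositions U C (S \<union> {f. is_iso C f}) \<subseteq> transfinite_compositions U C S"
proof
  fix q assume "q \<in> transfinite_compositions U C (S \<union> {f. is_iso C f})"
  then obtain r :: "'u rel" and X a t z where q: "q = t z" "small U (Field r)" "sequence_of r C (S \<union> {f. is_iso C f}) X"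
    "is_colimit (order_cat r) C X a t" "is_least r z"
    unfolding transfinite_compositions_def by blast
  interpret ordinal_seq C r X
    by unfold_locales (use q in \<open>simp add: sequence_of_def\<close>)
  have F: "Field (Restr r reps) = reps" using Well_order_Field_Restr[OF wo, of reps] by (auto simp: reps_def)
  have 1: "sequence_of (Restr r reps) C S X"
    by (rule reps_sequence[OF S]) (use q in \<open>auto simp: sequence_of_def\<close>)
  have "is_colimit (order_cat (Restr r (Field r \<inter> reps))) C X a t"
    by (rule colimit_reps) (use q r_rules(5) in \<open>auto simp: Restr_Field dest!: flat_r\<close>)
  moreover have "Field r \<inter> reps = reps" by (auto simp: reps_def)
  ultimately have 2: "is_colimit (order_cat (Restr r reps)) C X a t" by simp
  have zF: "z \<in> Field r" and zu: "underS r z = {}" using q(5) by (auto simp: is_least_def)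
  then have "z \<in> reps" unfolding reps_def by (auto simp: underS_def dest: flat_r)
  then have 3: "is_least (Restr r reps) z" using zu F by (auto simp: is_least_def underS_def)
  have 4: "small U (Field (Restr r reps))"
    using q(2) unfolding F small_def by (rule lesspoll_subset[rotated]) (auto simp: reps_def)
  show "q \<in> transfinite_compositions U C S"
    unfolding transfinite_compositions_def using q(1) 1 2 3 4 by blast
qed

section \<open>Cofibrant generation\<close>

text \<open>Surjectivity is factorization of maps out of \<open>A\<close> through some stage,
  injectivity is agreement at a later stage of factorizations that agree in the colimit. Smallness
  can then be moved along functors without touching quotients.\<close>

lemma (in ordinal_seq) hom_colim_bij_iff:
  assumes lim: "is_colimit (order_cat r) C X a t"
  shows "bij_betw (hom_colim_map C t) (hom_colim r C A X) (hom C A a) \<longleftrightarrow>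
    (\<forall>h\<in>hom C A a. \<exists>i\<in>Field r. \<exists>k\<in>hom C A (fob X i). t i \<cdot> k = h) \<and>
    (\<forall>i\<in>Field r. \<forall>j\<in>Field r. \<forall>k\<in>hom C A (fob X i). \<forall>l\<in>hom C A (fob X j). t i \<cdot> k = t j \<cdot> l \<longrightarrow>
       (\<exists>n. (i, n) \<in> r \<and> (j, n) \<in> r \<and> far X (i, n) \<cdot> k = far X (j, n) \<cdot> l))"
proof -
  let ?H = "hom_sum r C A X" and ?R = "hom_rel r C A X"
  define g where "g = (\<lambda>(i, k). t i \<cdot> k)"
  note T = is_colimit_facts(1-4)[OF lim, simplified order_cat_simps]
  have T5: "t j \<cdot> far X (i, j) = t i" if "(i, j) \<in> r" for i j
    using is_colimit_facts(5)[OF lim, of "(i, j)"] that by simp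
  have R_iff: "((i, k), (j, l)) \<in> ?R \<longleftrightarrow> (i, k) \<in> ?H \<and> (j, l) \<in> ?H \<and>
      (\<exists>n. (i, n) \<in> r \<and> (j, n) \<in> r \<and> far X (i, n) \<cdot> k = far X (j, n) \<cdot> l)" for i j k l
    by (auto simp: hom_rel_def)
  have H_iff: "(i, k) \<in> ?H \<longleftrightarrow> i \<in> Field r \<and> k \<in> Arr C \<and> Dom C k = A \<and> Cod C k = fob X i" for i k
    by (auto simp: hom_sum_def)
  have push: "far X (i, q) \<cdot> k = far X (j, q) \<cdot> l"
    if "far X (i, n) \<cdot> k = far X (j, n) \<cdot> l" "(i, n) \<in> r" "(j, n) \<in> r" "(n, q) \<in> r" "(i, k) \<in> ?H" "(j, l) \<in> ?H" for i j k l n q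
  proof -
    have "(far X (n, q) \<cdot> far X (i, n)) \<cdot> k = (far X (n, q) \<cdot> far X (j, n)) \<cdot> l"
      using that by (simp add: H_iff del: X_rules(6))
    then show ?thesis using that by simp
  qed
  have eq: "equiv ?H ?R"
  proof (rule equivI)
    show "?R \<subseteq> ?H \<times> ?H" by (auto simp: hom_rel_def)
    show "refl_on ?H ?R"
      by (rule refl_onI) (use r_rules(1) in \<open>clarsimp simp: R_iff hom_sum_def; blast\<close>)
    show "sym ?R" by (rule symI) (auto simp: hom_rel_def, metis)
    show "trans ?R"
    proof (rule transI)
      fix x y z assume xy: "(x, y) \<in> ?R" "(y, z) \<in> ?R"
      obtain i k j l m o' where v: "x = (i, k)" "y = (j, l)" "z = (m, o')" by (metis surj_pair)
      obtain n p where n: "(i, n) \<in> r" "(j, n) \<in> r" "far X (i, n) \<cdot> k = far X (j, n) \<cdot> l"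
        and p: "(j, p) \<in> r" "(m, p) \<in> r" "far X (j, p) \<cdot> l = far X (m, p) \<cdot> o'"
        and H: "(i, k) \<in> ?H" "(j, l) \<in> ?H" "(m, o') \<in> ?H"
        using xy unfolding v R_iff by blast
      obtain q where q: "(n, q) \<in> r" "(p, q) \<in> r"
        using r_rules(4)[OF r_rules(6)[OF n(1)] r_rules(6)[OF p(1)]] r_rules(1)[OF r_rules(6)[OF n(1)]] r_rules(1)[OF r_rules(6)[OF p(1)]] by blast
      have "far X (i, q) \<cdot> k = far X (m, q) \<cdot> o'"
        using push[OF n(3) n(1,2) q(1) H(1,2)] push[OF p(3) p(1,2) q(2) H(2,3)] by simp
      then show "(x, z) \<in> ?R" unfolding v R_iff using H n p q r_rules(2) by blast
    qed
  qed
  have resp: "g x = g y" if xy: "(x, y) \<in> ?R" for x y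
  proof -
    obtain i k j l where v: "x = (i, k)" "y = (j, l)" by (metis surj_pair)
    obtain n where n: "(i, n) \<in> r" "(j, n) \<in> r" "far X (i, n) \<cdot> k = far X (j, n) \<cdot> l" and H: "(i, k) \<in> ?H" "(j, l) \<in> ?H"
      using xy unfolding v R_iff by blast
    have F: "n \<in> Field r" using r_rules(6)[OF n(1)] .
    have "t i \<cdot> k = (t n \<cdot> far X (i, n)) \<cdot> k" "t j \<cdot> l = (t n \<cdot> far X (j, n)) \<cdot> l" using T5 n by simp_all
    then show ?thesis using n H T F by (simp add: v g_def H_iff)
  qed
  \<comment> \<open>On an equivalence class \<open>g\<close> is constant, so \<open>the_elem\<close>
    in \<open>hom_colim_map\<close> returns that common value.\<close>
  have cls: "hom_colim_map C t (?R `` {x}) = g x" if x: "x \<in> ?H" for x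
  proof -
    have "g y = g x" if "y \<in> ?R `` {x}" for y using resp[of x y] that by simp
    then have "g ` (?R `` {x}) = {g x}" using equiv_class_self[OF eq x] by blast
    then show ?thesis unfolding hom_colim_map_def g_def by simp
  qed
  have im: "hom_colim_map C t ` hom_colim r C A X = g ` ?H"
  proof -
    have "hom_colim r C A X = (\<lambda>x. ?R `` {x}) ` ?H" unfolding hom_colim_def quotient_def by blast
    then show ?thesis using cls by (simp only: image_image cong: image_cong)
  qed
  have inj: "inj_on (hom_colim_map C t) (hom_colim r C A X) \<longleftrightarrow> (\<forall>x\<in>?H. \<forall>y\<in>?H. g x = g y \<longrightarrow> (x, y) \<in> ?R)"
  proof (intro iffI ballI impI)
    fix x y assume i: "inj_on (hom_colim_map C t) (hom_colim r C A X)" and xy: "x \<in> ?H" "y \<in> ?H" "g x = g y"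
    have "?R `` {x} = ?R `` {y}"
      by (rule inj_onD[OF i]) (use xy cls in \<open>auto simp: hom_colim_def quotientI\<close>)
    then show "(x, y) \<in> ?R" using eq_equiv_class[OF _ eq xy(2)] by simp
  next
    assume *: "\<forall>x\<in>?H. \<forall>y\<in>?H. g x = g y \<longrightarrow> (x, y) \<in> ?R"
    show "inj_on (hom_colim_map C t) (hom_colim r C A X)"
    proof (rule inj_onI)
      fix c d assume "c \<in> hom_colim r C A X" "d \<in> hom_colim r C A X" and e: "hom_colim_map C t c = hom_colim_map C t d"
      then obtain x y where "x \<in> ?H" "y \<in> ?H" "c = ?R `` {x}" "d = ?R `` {y}" by (auto simp: hom_colim_def elim!: quotientE)
      moreover have "g x = g y" using calculation cls e by metis
      ultimately show "c = d" using * equiv_class_eq[OF eq, of x y] by blast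
    qed
  qed
  have "g ` ?H = hom C A a \<longleftrightarrow> (\<forall>h\<in>hom C A a. \<exists>i\<in>Field r. \<exists>k\<in>hom C A (fob X i). t i \<cdot> k = h)"
  proof -
    have "g ` ?H \<subseteq> hom C A a" using T by (auto simp: g_def hom_sum_def)
    then have "g ` ?H = hom C A a \<longleftrightarrow> (\<forall>h\<in>hom C A a. h \<in> g ` ?H)" by (simp add: set_eq_subset subset_iff Ball_def del: in_hom)
    moreover have "h \<in> g ` ?H \<longleftrightarrow> (\<exists>i\<in>Field r. \<exists>k\<in>hom C A (fob X i). t i \<cdot> k = h)" for h
      unfolding g_def hom_sum_def by (auto simp: image_iff simp del: in_hom)
    ultimately show ?thesis by (simp del: in_hom)
  qed
  moreover have "(\<forall>x\<in>?H. \<forall>y\<in>?H. g x = g y \<longrightarrow> (x, y) \<in> ?R) \<longleftrightarrow>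
    (\<forall>i\<in>Field r. \<forall>j\<in>Field r. \<forall>k\<in>hom C A (fob X i). \<forall>l\<in>hom C A (fob X j). t i \<cdot> k = t j \<cdot> l \<longrightarrow>
       (\<exists>n. (i, n) \<in> r \<and> (j, n) \<in> r \<and> far X (i, n) \<cdot> k = far X (j, n) \<cdot> l))"
  proof -
    have "(\<forall>x\<in>?H. \<forall>y\<in>?H. g x = g y \<longrightarrow> (x, y) \<in> ?R) \<longleftrightarrow> (\<forall>i k j l. (i, k) \<in> ?H \<longrightarrow> (j, l) \<in> ?H \<longrightarrow> t i \<cdot> k = t j \<cdot> l \<longrightarrow>
       (\<exists>n. (i, n) \<in> r \<and> (j, n) \<in> r \<and> far X (i, n) \<cdot> k = far X (j, n) \<cdot> l))"
      unfolding Ball_def split_paired_All g_def prod.case R_iff by blast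
    also have "\<dots> \<longleftrightarrow> (\<forall>i\<in>Field r. \<forall>j\<in>Field r. \<forall>k\<in>hom C A (fob X i). \<forall>l\<in>hom C A (fob X j). t i \<cdot> k = t j \<cdot> l \<longrightarrow>
       (\<exists>n. (i, n) \<in> r \<and> (j, n) \<in> r \<and> far X (i, n) \<cdot> k = far X (j, n) \<cdot> l))"
      unfolding H_iff Ball_def in_hom by blast
    finally show ?thesis .
  qed
  ultimately show ?thesis unfolding bij_betw_def inj im by blast
qed

text \<open>\<open>F\<close> preserves the colimit and induces bijections on the hom sets out of
  \<open>L\<close>, so a factorization found for \<open>A\<close> in the image lifts back; the same
  bound \<open>K\<close> works. For \<open>F\<close> an evaluation and \<open>L\<close> the value at
  \<open>A\<close> of its left adjoint, \<open>bij\<close> is the adjunction bijection with identity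
  unit.\<close>

lemma (in left_adjoint_functor) small_relative_reflect:
  fixes U :: "'u itself"
  assumes small: "small_relative U D A S'" and S: "far F ` S \<subseteq> S'" and L: "L \<in> Obj C"
    and bij: "\<And>x. x \<in> Obj C \<Longrightarrow> bij_betw (far F) (hom C L x) (hom D A (fob F x))"
  shows "small_relative U C L S"
proof -
  obtain K :: "'u set" where K: "small U K"
    and bK: "\<And>(r :: 'u rel) X a t. small U (Field r) \<Longrightarrow> filtered_ordinal K r \<Longrightarrow> sequence_of r D S' X \<Longrightarrow>
        is_colimit (order_cat r) D X a t \<Longrightarrow> bij_betw (hom_colim_map D t) (hom_colim r D A X) (hom D A a)"
    using small unfolding small_relative_def by blast
  have inj: "k = l" if "far F k = far F l" "k \<in> Arr C" "l \<in> Arr C" "Dom C k = L" "Dom C l = L" "Cod C k = Cod C l" for k l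
    using bij[of "Cod C l"] that by (auto simp: bij_betw_def intro: inj_onD[of "far F" "hom C L (Cod C l)"])
  have surj: "\<exists>k. k \<in> Arr C \<and> Dom C k = L \<and> Cod C k = x \<and> far F k = h" if "h \<in> hom D A (fob F x)" "x \<in> Obj C" for h x
  proof -
    have "h \<in> far F ` hom C L x" using bij[OF that(2)] that by (simp add: bij_betw_def)
    then show ?thesis by auto
  qed
  \<comment> \<open>The image of the identity of \<open>L\<close> has source \<open>A\<close> by
    \<open>bij\<close> and source \<open>fob F L\<close> by functoriality.\<close>
  have AF: "A = fob F L"
    using bij[OF L] L unfolding bij_betw_def by (metis C.Idt_Arr C.Dom_Idt C.Cod_Idt functor_rules(3) image_eqI in_hom)
  have "bij_betw (hom_colim_map C t) (hom_colim r C L X) (hom C L a)"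
    if r: "small U (Field r)" "filtered_ordinal K r" "sequence_of r C S X" "is_colimit (order_cat r) C X a t" for r :: "'u rel" and X a t
  proof -
    interpret X: ordinal_seq C r X by unfold_locales (use r in \<open>simp add: sequence_of_def\<close>)
    let ?X = "comp_functor F X"
    have s: "sequence_of r D S' ?X" by (rule sequence_of_image[OF r(3) S])
    interpret Y: ordinal_seq D r ?X by unfold_locales (use s in \<open>simp add: sequence_of_def\<close>)
    have lim: "is_colimit (order_cat r) D ?X (fob F a) (\<lambda>i. far F (t i))" by (rule order_colimit_image[OF r(3,4)])
    note T = C.is_colimit_facts(1-4)[OF r(4), simplified order_cat_simps]
    note B = Y.hom_colim_bij_iff[OF lim, THEN iffD1, OF bK[OF r(1,2) s lim]]
    show ?thesis
      unfolding X.hom_colim_bij_iff[OF r(4)]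
    proof (intro conjI ballI impI)
      fix h assume h: "h \<in> hom C L a"
      then have "far F h \<in> hom D A (fob F a)" using AF by simp
      from B[THEN conjunct1, rule_format, OF this]
      obtain i k' where i: "i \<in> Field r" "k' \<in> hom D A (fob F (fob X i))" "far F (t i) \<cdot>\<^bsub>D\<^esub> k' = far F h"
        unfolding comp_functor_simps by blast
      obtain k where k: "k \<in> Arr C" "Dom C k = L" "Cod C k = fob X i" "far F k = k'" using surj[OF i(2)] i(1) by auto
      have "t i \<cdot>\<^bsub>C\<^esub> k = h" by (rule inj) (use k i h T in auto)
      then show "\<exists>i\<in>Field r. \<exists>k\<in>hom C L (fob X i). t i \<cdot>\<^bsub>C\<^esub> k = h" using i(1) k by (intro bexI[of _ i] bexI[of _ k]) simp_all
    next
      fix i j k l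
      assume a: "i \<in> Field r" "j \<in> Field r" "k \<in> hom C L (fob X i)" "l \<in> hom C L (fob X j)" "t i \<cdot>\<^bsub>C\<^esub> k = t j \<cdot>\<^bsub>C\<^esub> l"
      have "far F (t i \<cdot>\<^bsub>C\<^esub> k) = far F (t j \<cdot>\<^bsub>C\<^esub> l)" using a(5) by simp
      then have "far F (t i) \<cdot>\<^bsub>D\<^esub> far F k = far F (t j) \<cdot>\<^bsub>D\<^esub> far F l" using a(1-4) T by simp
      moreover have "far F k \<in> hom D A (fob ?X i)" "far F l \<in> hom D A (fob ?X j)" using a AF by auto
      ultimately obtain n where n: "(i, n) \<in> r" "(j, n) \<in> r" "far ?X (i, n) \<cdot>\<^bsub>D\<^esub> far F k = far ?X (j, n) \<cdot>\<^bsub>D\<^esub> far F l"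
        using B[THEN conjunct2, rule_format, of i j "far F k" "far F l"] a(1,2) by blast
      have "far X (i, n) \<cdot>\<^bsub>C\<^esub> k = far X (j, n) \<cdot>\<^bsub>C\<^esub> l" by (rule inj) (use a(1-4) n in auto)
      then show "\<exists>n. (i, n) \<in> r \<and> (j, n) \<in> r \<and> far X (i, n) \<cdot>\<^bsub>C\<^esub> k = far X (j, n) \<cdot>\<^bsub>C\<^esub> l" using n by blast
    qed
  qed
  then show ?thesis unfolding small_relative_def using K by blast
qed

text \<open>Strict domination by \<open>'u\<close> is translated into strict inequality of
  cardinals, where two sets below an infinite cardinal have their union below it.\<close>

lemma small_Un:
  assumes inf: "infinite (UNIV :: 'u set)" and A: "small TYPE('u) A" and B: "small TYPE('u) B"
  shows "small TYPE('u) (A \<union> B)"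
proof -
  have *: "Y \<prec> (UNIV :: 'u set) \<longleftrightarrow> (card_of Y, card_of (UNIV :: 'u set)) \<in> ordLess" for Y :: "'b set"
  proof -
    have "Y \<prec> (UNIV :: 'u set) \<longleftrightarrow> \<not> (UNIV :: 'u set) \<lesssim> Y"
      unfolding lesspoll_def by (metis eqpoll_imp_lepoll eqpoll_sym lepoll_antisym lepoll_def lepoll_iff card_of_ordLeq ordLeq_total card_of_Well_order)
    then show ?thesis using card_of_ordLess[of "UNIV :: 'u set" Y] by (auto simp: lepoll_def)
  qed
  have "(card_of A, card_of (UNIV :: 'u set)) \<in> ordLess" "(card_of B, card_of (UNIV :: 'u set)) \<in> ordLess" using A B unfolding small_def * .
  then have "(card_of (A \<union> B), card_of (UNIV :: 'u set)) \<in> ordLess" by (rule card_of_Un_ordLess_infinite[OF inf])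
  then show ?thesis unfolding small_def * .
qed

lemma small_image: "small U A \<Longrightarrow> small U (f ` A)"
  unfolding small_def by (meson image_lepoll lesspoll_trans1)

text \<open>The isomorphism is absorbed into the attaching map: \<open>q\<close> after
  \<open>e\<close> is the pushout of \<open>f\<close> along \<open>g\<close> followed by the inverse
  of \<open>e\<close>.\<close>

lemma (in category) pushouts_precomp_iso:
  assumes "q \<in> pushouts C I" "is_iso C e" "Dom C q = Cod C e"
  shows "q \<cdot> e \<in> pushouts C I"
proof -
  obtain f g p where f: "f \<in> I" and po: "is_pushout C f g p q" using assms(1) by (auto simp: pushouts_def)
  note P [simp] = is_pushout_Arr[OF po]
  obtain d where d: "e \<in> Arr C" "d \<in> Arr C" "Dom C d = Cod C e" "Cod C d = Dom C e"
    "d \<cdot> e = Idt C (Dom C e)" "e \<cdot> d = Idt C (Cod C e)" by (rule is_isoE[OF assms(2)])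
  have [simp]: "Cod C e = Cod C g" using assms(3) P(7) by simp
  have "is_pushout C f (d \<cdot> g) p (q \<cdot> e)"
  proof (rule is_pushoutI)
    show "p \<cdot> f = (q \<cdot> e) \<cdot> (d \<cdot> g)" using d reassoc[OF d(6), of g] by simp
    fix u v assume uv: "u \<in> Arr C" "v \<in> Arr C" "Dom C u = Cod C f" "Dom C v = Cod C (d \<cdot> g)" "Cod C u = Cod C v" "u \<cdot> f = v \<cdot> (d \<cdot> g)"
    obtain h where h: "h \<in> Arr C" "Dom C h = Cod C p" "Cod C h = Cod C v" "h \<cdot> p = u" "h \<cdot> q = v \<cdot> d"
      by (rule is_pushout_ex[OF po, of u "v \<cdot> d"]) (use uv d in simp_all)
    show "\<exists>h. h \<in> Arr C \<and> Dom C h = Cod C p \<and> Cod C h = Cod C v \<and> h \<cdot> p = u \<and> h \<cdot> q \<cdot> e = v"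
      by (rule exI[of _ h]) (use h d uv reassoc[OF h(5), of e] in simp)
  next
    fix h k assume hk: "h \<in> Arr C" "k \<in> Arr C" "Dom C h = Cod C p" "Dom C k = Cod C p" "Cod C k = Cod C h" "h \<cdot> p = k \<cdot> p" "h \<cdot> q \<cdot> e = k \<cdot> q \<cdot> e"
    have "(h \<cdot> q \<cdot> e) \<cdot> d = (k \<cdot> q \<cdot> e) \<cdot> d" using hk(7) by simp
    then have "h \<cdot> q = k \<cdot> q" using hk(1-5) d by simp
    then show "h = k" using is_pushout_ext[OF po] hk by blast
  qed (use d in auto)
  then show ?thesis using f by (auto simp: pushouts_def)
qed

section \<open>Generators of the projective model structure\<close>

context bicat
begin

lemma left_adjoint_functor_Ev0: "left_adjoint_functor \<A> C (Ev0 C)"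
  by unfold_locales (rule is_category_arrow_cat, rule left_adjoint_Ev0)

lemma left_adjoint_functor_Ev1: "left_adjoint_functor \<A> C (Ev1 C)"
  by unfold_locales (rule is_category_arrow_cat, rule left_adjoint_Ev1)

text \<open>Every \<open>L1 i\<close> becomes the identity of the initial object, so its pushouts
  become isomorphisms. Such steps are removed by thinning the sequence, for which pushouts of
  \<open>I\<close> must be stable under precomposition with isomorphisms.\<close>

lemma rel_cell_Ev0:
  "far (Ev0 C) ` rel_cell U \<A> (far (L0 C) ` I \<union> far (L1 C) ` I) \<subseteq> rel_cell U C I"
proof -
  interpret Ev0: left_adjoint_functor \<A> C "Ev0 C" by (rule left_adjoint_functor_Ev0)
  have "far (Ev0 C) ` (far (L0 C) ` I \<union> far (L1 C) ` I) \<subseteq> I \<union> {Idt C (init C)}"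
    by (auto simp: Ev0_def L0_def L1_def)
  then have "far (Ev0 C) ` pushouts \<A> (far (L0 C) ` I \<union> far (L1 C) ` I) \<subseteq> pushouts C (I \<union> {Idt C (init C)})"
    using Ev0.pushouts_image unfolding pushouts_def by blast
  also have "\<dots> \<subseteq> pushouts C I \<union> {f. is_iso C f}"
    using is_pushout_cobase_iso by (auto simp: pushouts_def)
  finally have "far (Ev0 C) ` rel_cell U \<A> (far (L0 C) ` I \<union> far (L1 C) ` I) \<subseteq> transfinite_compositions U C (pushouts C I \<union> {f. is_iso C f})"
    unfolding rel_cell_def using Ev0.transfinite_compositions_image by blast
  also have "\<dots> \<subseteq> rel_cell U C I"
    unfolding rel_cell_def by (rule transfinite_compositions_iso_steps) (rule pushouts_precomp_iso)
  finally show ?thesis .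
qed

text \<open>Both kinds of generator over \<open>i\<close> are sent to \<open>i\<close> itself, so
  nothing has to be collapsed.\<close>

lemma rel_cell_Ev1:
  "far (Ev1 C) ` rel_cell U \<A> (far (L0 C) ` I \<union> far (L1 C) ` I) \<subseteq> rel_cell U C I"
proof -
  interpret Ev1: left_adjoint_functor \<A> C "Ev1 C" by (rule left_adjoint_functor_Ev1)
  have "far (Ev1 C) ` (far (L0 C) ` I \<union> far (L1 C) ` I) \<subseteq> I"
    by (auto simp: Ev1_def L0_def L1_def)
  then have "far (Ev1 C) ` pushouts \<A> (far (L0 C) ` I \<union> far (L1 C) ` I) \<subseteq> pushouts C I"
    using Ev1.pushouts_image unfolding pushouts_def by blast
  then show ?thesis
    unfolding rel_cell_def using Ev1.transfinite_compositions_image by blast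
qed

text \<open>Maps out of \<open>L0 X\<close> are maps from \<open>X\<close> into the value of
  \<open>Ev0\<close>, and maps out of \<open>L1 X\<close> into that of \<open>Ev1\<close>; smallness
  of each kind of domain is therefore reflected along the evaluation adjoint to it.\<close>

lemma small_relative_generators:
  assumes I: "I \<subseteq> Arr C" "\<And>i. i \<in> I \<Longrightarrow> small_relative U C (Dom C i) (rel_cell U C I)"
    and j: "j \<in> far (L0 C) ` I \<union> far (L1 C) ` I"
  shows "small_relative U \<A> (Dom \<A> j) (rel_cell U \<A> (far (L0 C) ` I \<union> far (L1 C) ` I))"
proof -
  consider i where "i \<in> I" "j = far (L0 C) i" | i where "i \<in> I" "j = far (L1 C) i" using j by blast
  then show ?thesis
  proof cases
    case 1
    then have i: "i \<in> Arr C" using I by auto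
    have "small_relative U \<A> (Idt C (Dom C i)) (rel_cell U \<A> (far (L0 C) ` I \<union> far (L1 C) ` I))"
    proof (rule left_adjoint_functor.small_relative_reflect[OF left_adjoint_functor_Ev0 I(2)[OF 1(1)] rel_cell_Ev0])
      fix x assume "x \<in> Obj \<A>"
      then have x: "x \<in> Arr C" by simp
      show "bij_betw (far (Ev0 C)) (hom \<A> (Idt C (Dom C i)) x) (hom C (Dom C i) (fob (Ev0 C) x))"
      proof (rule bij_betw_byWitness[where f' = "\<lambda>k. Square (Idt C (Dom C i)) x k (x \<cdot> k)"])
        show "\<forall>s\<in>hom \<A> (Idt C (Dom C i)) x. Square (Idt C (Dom C i)) x (far (Ev0 C) s) (x \<cdot> far (Ev0 C) s) = s"
        proof
          fix s assume s: "s \<in> hom \<A> (Idt C (Dom C i)) x"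
          then show "Square (Idt C (Dom C i)) x (far (Ev0 C) s) (x \<cdot> far (Ev0 C) s) = s"
            using sq_commutes[of s C] i by (auto intro!: square_eqI simp: Ev0_def)
        qed
      qed (use i x in \<open>auto simp: Ev0_def\<close>)
    qed (use i in simp)
    then show ?thesis by (simp add: 1 L0_def)
  next
    case 2
    then have i: "i \<in> Arr C" using I by auto
    have "small_relative U \<A> (from_init C (Dom C i)) (rel_cell U \<A> (far (L0 C) ` I \<union> far (L1 C) ` I))"
    proof (rule left_adjoint_functor.small_relative_reflect[OF left_adjoint_functor_Ev1 I(2)[OF 2(1)] rel_cell_Ev1])
      fix x assume "x \<in> Obj \<A>"
      then have x: "x \<in> Arr C" by simp
      show "bij_betw (far (Ev1 C)) (hom \<A> (from_init C (Dom C i)) x) (hom C (Dom C i) (fob (Ev1 C) x))"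
      proof (rule bij_betw_byWitness[where f' = "\<lambda>k. Square (from_init C (Dom C i)) x (from_init C (Dom C x)) k"])
        show "\<forall>s\<in>hom \<A> (from_init C (Dom C i)) x. Square (from_init C (Dom C i)) x (from_init C (Dom C x)) (far (Ev1 C) s) = s"
        proof
          fix s assume "s \<in> hom \<A> (from_init C (Dom C i)) x"
          then have s: "s \<in> Arr \<A>" "sq_src s = from_init C (Dom C i)" "sq_tgt s = x" by auto
          have "from_init C (Dom C x) = sq0 s" by (rule init_ext) (use s i x in simp_all)
          then show "Square (from_init C (Dom C i)) x (from_init C (Dom C x)) (far (Ev1 C) s) = s"
            using s by (intro square_eqI) (simp_all add: Ev1_def)
        qed
        show "(\<lambda>k. Square (from_init C (Dom C i)) x (from_init C (Dom C x)) k) ` hom C (Dom C i) (fob (Ev1 C) x) \<subseteq> hom \<A> (from_init C (Dom C i)) x"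
        proof clarify
          fix k assume k: "k \<in> hom C (Dom C i) (fob (Ev1 C) x)"
          have "k \<cdot> from_init C (Dom C i) = x \<cdot> from_init C (Dom C x)" by (rule init_ext) (use k i x in \<open>auto simp: Ev1_def\<close>)
          then show "Square (from_init C (Dom C i)) x (from_init C (Dom C x)) k \<in> hom \<A> (from_init C (Dom C i)) x"
            using k i x by (simp add: Ev1_def)
        qed
      qed (use i x in \<open>auto simp: Ev1_def\<close>)
    qed (use i in simp)
    then show ?thesis by (simp add: 2 L1_def)
  qed
qed

lemma inj_maps_generators:
  assumes "I \<subseteq> Arr C"
  shows "inj_maps \<A> (far (L0 C) ` I \<union> far (L1 C) ` I) = pointwise C (inj_maps C I)"
proof (intro set_eqI)
  fix p
  have "p \<in> inj_maps \<A> (far (L0 C) ` I \<union> far (L1 C) ` I) \<longleftrightarrow>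
      p \<in> Arr \<A> \<and> (\<forall>i\<in>I. has_lifting C i (sq0 p) \<and> has_lifting C i (sq1 p))"
  proof (cases "p \<in> Arr \<A>")
    case True
    then have "has_lifting \<A> (far (L0 C) i) p \<longleftrightarrow> has_lifting C i (sq0 p)"
      "has_lifting \<A> (far (L1 C) i) p \<longleftrightarrow> has_lifting C i (sq1 p)" if "i \<in> I" for i
      using that assms has_lifting_L0[of i p] has_lifting_L1[of i p] by auto
    then show ?thesis using True by (simp add: inj_maps_def ball_Un) blast
  qed (simp add: inj_maps_def)
  also have "\<dots> \<longleftrightarrow> p \<in> pointwise C (inj_maps C I)" by (auto simp: pointwise_def inj_maps_def)
  finally show "p \<in> inj_maps \<A> (far (L0 C) ` I \<union> far (L1 C) ` I) \<longleftrightarrow> p \<in> pointwise C (inj_maps C I)" .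
qed

lemma cofibrantly_generated_arrow_cat:
  fixes P :: "'m square model_structure"
  assumes inf: "infinite (UNIV :: 'u set)" and cg: "cofibrantly_generated TYPE('u) C M"
    and P: "model_category TYPE('u) \<A> P" "weq P = pointwise C (weq M)" "fib P = pointwise C (fib M)"
  shows "cofibrantly_generated TYPE('u) \<A> P"
proof -
  obtain I J where I: "I \<subseteq> Arr C" "J \<subseteq> Arr C" "small TYPE('u) I" "small TYPE('u) J"
    "\<forall>i\<in>I. small_relative TYPE('u) C (Dom C i) (rel_cell TYPE('u) C I)"
    "\<forall>j\<in>J. small_relative TYPE('u) C (Dom C j) (rel_cell TYPE('u) C J)"
    "fib M = inj_maps C J" "fib M \<inter> weq M = inj_maps C I"
    using cg unfolding cofibrantly_generated_def by (elim conjE exE) (rule that)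
  have L: "far (L0 C) i \<in> Arr \<A>" "far (L1 C) i \<in> Arr \<A>" if "i \<in> Arr C" for i
    using that functor_simps(2)[OF is_functor_L0] functor_simps(2)[OF is_functor_L1] by auto
  let ?G = "\<lambda>I. far (L0 C) ` I \<union> far (L1 C) ` I"
  have "?G I \<subseteq> Arr \<A>" "?G J \<subseteq> Arr \<A>" using L I(1,2) by auto
  moreover have "small TYPE('u) (?G I)" "small TYPE('u) (?G J)" using I(3,4) by (auto intro!: small_Un[OF inf] small_image)
  moreover have "\<forall>i\<in>?G I. small_relative TYPE('u) \<A> (Dom \<A> i) (rel_cell TYPE('u) \<A> (?G I))"
    using small_relative_generators[OF I(1) I(5)[rule_format]] by blast
  moreover have "\<forall>i\<in>?G J. small_relative TYPE('u) \<A> (Dom \<A> i) (rel_cell TYPE('u) \<A> (?G J))"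
    using small_relative_generators[OF I(2) I(6)[rule_format]] by blast
  moreover have "fib P = inj_maps \<A> (?G J)" "fib P \<inter> weq P = inj_maps \<A> (?G I)"
    unfolding inj_maps_generators[OF I(1)] inj_maps_generators[OF I(2)] P I(7,8)[symmetric] pointwise_Int by simp_all
  ultimately show ?thesis unfolding cofibrantly_generated_def using P(1) by blast
qed

end

section \<open>Closed symmetric monoidal categories\<close>

locale closed_sym_mon = bicat C for C :: "('o, 'm) cat" (structure) +
  fixes T :: "('o, 'm) monoidal"
  assumes closed: "is_closed_symmetric_monoidal C T"
begin

abbreviation ten_obj :: "'o \<Rightarrow> 'o \<Rightarrow> 'o" (infixr \<open>\<boxtimes>\<close> 75) where
  "X \<boxtimes> Y \<equiv> tob T X Y"

abbreviation ten_arr :: "'m \<Rightarrow> 'm \<Rightarrow> 'm" (infixr \<open>\<odot>\<close> 75) where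
  "f \<odot> g \<equiv> tar T f g"

abbreviation idt :: "'o \<Rightarrow> 'm" (\<open>\<iota>\<close>) where
  "\<iota> \<equiv> Idt C"

lemma symmetric: "is_symmetric_monoidal C T" and monoidal: "is_monoidal C T" and bifunctor: "is_bifunctor C T"
  using closed by (auto simp: is_closed_symmetric_monoidal_def is_symmetric_monoidal_def is_monoidal_def)

lemma ten_Obj [simp]: "X \<in> Obj C \<Longrightarrow> Y \<in> Obj C \<Longrightarrow> X \<boxtimes> Y \<in> Obj C"
  and ten_Idt [simp]: "X \<in> Obj C \<Longrightarrow> Y \<in> Obj C \<Longrightarrow> \<iota> X \<odot> \<iota> Y = \<iota> (X \<boxtimes> Y)"
  using bifunctor by (auto simp: is_bifunctor_def)

lemma ten_Arr [simp]:
  assumes "f \<in> Arr C" "g \<in> Arr C"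
  shows "f \<odot> g \<in> Arr C" "Dom C (f \<odot> g) = Dom C f \<boxtimes> Dom C g" "Cod C (f \<odot> g) = Cod C f \<boxtimes> Cod C g"
  using bifunctor assms by (auto simp: is_bifunctor_def)

lemma interchange [simp]:
  "f \<in> Arr C \<Longrightarrow> f' \<in> Arr C \<Longrightarrow> g \<in> Arr C \<Longrightarrow> g' \<in> Arr C \<Longrightarrow> Dom C f' = Cod C f \<Longrightarrow> Dom C g' = Cod C g \<Longrightarrow>
    (f' \<odot> g') \<cdot> (f \<odot> g) = (f' \<cdot> f) \<odot> (g' \<cdot> g)"
  using bifunctor by (simp add: is_bifunctor_def)

text \<open>Equations between tensors are normalised by nesting composites to the right and merging
  adjacent tensor factors; rules for a composite of two arrows therefore get a companion with a
  tail, here and below.\<close>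

lemma interchange_tail [simp]:
  "f \<in> Arr C \<Longrightarrow> f' \<in> Arr C \<Longrightarrow> g \<in> Arr C \<Longrightarrow> g' \<in> Arr C \<Longrightarrow> Dom C f' = Cod C f \<Longrightarrow> Dom C g' = Cod C g \<Longrightarrow>
    x \<in> Arr C \<Longrightarrow> Cod C x = Dom C f \<boxtimes> Dom C g \<Longrightarrow> (f' \<odot> g') \<cdot> (f \<odot> g) \<cdot> x = ((f' \<cdot> f) \<odot> (g' \<cdot> g)) \<cdot> x"
  by (rule reassoc) simp_all

lemma asc_iso: "X \<in> Obj C \<Longrightarrow> Y \<in> Obj C \<Longrightarrow> Z \<in> Obj C \<Longrightarrow> is_iso C (asc T X Y Z)"
  and lun_iso: "X \<in> Obj C \<Longrightarrow> is_iso C (lun T X)"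
  and run_iso: "X \<in> Obj C \<Longrightarrow> is_iso C (run T X)"
  and unt_Obj [simp]: "unt T \<in> Obj C"
  using monoidal by (simp_all add: is_monoidal_def)

lemma asc_Arr [simp]:
  assumes "X \<in> Obj C" "Y \<in> Obj C" "Z \<in> Obj C"
  shows "asc T X Y Z \<in> Arr C" "Dom C (asc T X Y Z) = (X \<boxtimes> Y) \<boxtimes> Z" "Cod C (asc T X Y Z) = X \<boxtimes> (Y \<boxtimes> Z)"
  using monoidal assms by (simp_all add: is_monoidal_def)

lemma lun_Arr [simp]:
  assumes "X \<in> Obj C"
  shows "lun T X \<in> Arr C" "Dom C (lun T X) = unt T \<boxtimes> X" "Cod C (lun T X) = X"
    "run T X \<in> Arr C" "Dom C (run T X) = X \<boxtimes> unt T" "Cod C (run T X) = X"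
  using monoidal assms by (simp_all add: is_monoidal_def)

lemma brd_Arr [simp]:
  assumes "X \<in> Obj C" "Y \<in> Obj C"
  shows "brd T X Y \<in> Arr C" "Dom C (brd T X Y) = X \<boxtimes> Y" "Cod C (brd T X Y) = Y \<boxtimes> X" "brd T Y X \<cdot> brd T X Y = \<iota> (X \<boxtimes> Y)"
  using symmetric assms by (simp_all add: is_symmetric_monoidal_def)

lemma asc_nat [simp]:
  assumes "f \<in> Arr C" "g \<in> Arr C" "h \<in> Arr C" "Cod C f = X" "Cod C g = Y" "Cod C h = Z"
  shows "asc T X Y Z \<cdot> ((f \<odot> g) \<odot> h) = (f \<odot> (g \<odot> h)) \<cdot> asc T (Dom C f) (Dom C g) (Dom C h)"
  using monoidal assms unfolding is_monoidal_def by blast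

lemma asc_nat_tail [simp]:
  assumes "f \<in> Arr C" "g \<in> Arr C" "h \<in> Arr C" "Cod C f = X" "Cod C g = Y" "Cod C h = Z"
    "x \<in> Arr C" "Cod C x = (Dom C f \<boxtimes> Dom C g) \<boxtimes> Dom C h"
  shows "asc T X Y Z \<cdot> ((f \<odot> g) \<odot> h) \<cdot> x = (f \<odot> (g \<odot> h)) \<cdot> asc T (Dom C f) (Dom C g) (Dom C h) \<cdot> x"
  using reassoc[OF asc_nat[OF assms(1-6)], of x] assms by (auto simp del: asc_nat)

text \<open>\<open>ten_Idt\<close> rewrites a tensor of two identities to the identity of a tensor,
  a shape that \<open>asc_nat\<close> does not match.\<close>

lemma asc_nat_Idt [simp]:
  assumes "X \<in> Obj C" "Y \<in> Obj C" "h \<in> Arr C" "Cod C h = Z"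
  shows "asc T X Y Z \<cdot> (\<iota> (X \<boxtimes> Y) \<odot> h) = (\<iota> X \<odot> (\<iota> Y \<odot> h)) \<cdot> asc T X Y (Dom C h)"
  using asc_nat[of "\<iota> X" "\<iota> Y" h X Y Z] assms by (simp del: asc_nat)

lemma asc_nat_Idt_tail [simp]:
  assumes "X \<in> Obj C" "Y \<in> Obj C" "h \<in> Arr C" "Cod C h = Z" "x \<in> Arr C" "Cod C x = (X \<boxtimes> Y) \<boxtimes> Dom C h"
  shows "asc T X Y Z \<cdot> (\<iota> (X \<boxtimes> Y) \<odot> h) \<cdot> x = (\<iota> X \<odot> (\<iota> Y \<odot> h)) \<cdot> asc T X Y (Dom C h) \<cdot> x"
  using reassoc[OF asc_nat_Idt[OF assms(1-4)], of x] assms by (auto simp del: asc_nat_Idt)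

text \<open>After merging, the left factor may be a composite ending in a tensor product; the part
  \<open>w\<close> in front of it has to be split off before naturality applies.\<close>

lemma asc_nat_split [simp]:
  assumes "f \<in> Arr C" "g \<in> Arr C" "h \<in> Arr C" "Cod C f = X" "Cod C g = Y" "Cod C h = Z" "w \<in> Arr C" "Cod C w = Dom C f \<boxtimes> Dom C g"
  shows "asc T X Y Z \<cdot> (((f \<odot> g) \<cdot> w) \<odot> h) = (f \<odot> (g \<odot> h)) \<cdot> asc T (Dom C f) (Dom C g) (Dom C h) \<cdot> (w \<odot> \<iota> (Dom C h))"
  using asc_nat_tail[OF assms(1-6), of "w \<odot> \<iota> (Dom C h)"] assms by (simp del: asc_nat_tail)

lemma brd_nat [simp]:
  assumes "f \<in> Arr C" "g \<in> Arr C" "Cod C f = X" "Cod C g = Y"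
  shows "brd T X Y \<cdot> (f \<odot> g) = (g \<odot> f) \<cdot> brd T (Dom C f) (Dom C g)"
  using symmetric assms unfolding is_symmetric_monoidal_def by blast

lemma brd_nat_tail [simp]:
  assumes "f \<in> Arr C" "g \<in> Arr C" "Cod C f = X" "Cod C g = Y" "x \<in> Arr C" "Cod C x = Dom C f \<boxtimes> Dom C g"
  shows "brd T X Y \<cdot> (f \<odot> g) \<cdot> x = (g \<odot> f) \<cdot> brd T (Dom C f) (Dom C g) \<cdot> x"
  using reassoc[OF brd_nat[OF assms(1-4)], of x] assms by (auto simp del: brd_nat)

lemma lun_nat: "f \<in> Arr C \<Longrightarrow> lun T (Cod C f) \<cdot> (\<iota> (unt T) \<odot> f) = f \<cdot> lun T (Dom C f)"
  and run_nat: "f \<in> Arr C \<Longrightarrow> run T (Cod C f) \<cdot> (f \<odot> \<iota> (unt T)) = f \<cdot> run T (Dom C f)"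
  using monoidal by (simp_all add: is_monoidal_def)

lemma triangle: "X \<in> Obj C \<Longrightarrow> Y \<in> Obj C \<Longrightarrow> (\<iota> X \<odot> lun T Y) \<cdot> asc T X (unt T) Y = run T X \<odot> \<iota> Y"
  using monoidal by (simp add: is_monoidal_def)

lemma lun_brd: "X \<in> Obj C \<Longrightarrow> lun T X \<cdot> brd T X (unt T) = run T X"
  using symmetric by (simp add: is_symmetric_monoidal_def)

lemma pentagon:
  "W \<in> Obj C \<Longrightarrow> X \<in> Obj C \<Longrightarrow> Y \<in> Obj C \<Longrightarrow> Z \<in> Obj C \<Longrightarrow>
    asc T W X (Y \<boxtimes> Z) \<cdot> asc T (W \<boxtimes> X) Y Z = (\<iota> W \<odot> asc T X Y Z) \<cdot> asc T W (X \<boxtimes> Y) Z \<cdot> (asc T W X Y \<odot> \<iota> Z)"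
  using monoidal by (simp add: is_monoidal_def)

lemma hexagon:
  "X \<in> Obj C \<Longrightarrow> Y \<in> Obj C \<Longrightarrow> Z \<in> Obj C \<Longrightarrow>
    asc T Y Z X \<cdot> brd T X (Y \<boxtimes> Z) \<cdot> asc T X Y Z = (\<iota> Y \<odot> brd T X Z) \<cdot> asc T Y X Z \<cdot> (brd T X Y \<odot> \<iota> Z)"
  using symmetric by (simp add: is_symmetric_monoidal_def)

section \<open>Inverse associators\<close>

definition asc_inv :: "'o \<Rightarrow> 'o \<Rightarrow> 'o \<Rightarrow> 'm" where
  "asc_inv X Y Z = (SOME g. g \<in> Arr C \<and> Dom C g = X \<boxtimes> (Y \<boxtimes> Z) \<and> Cod C g = (X \<boxtimes> Y) \<boxtimes> Z \<and>
     g \<cdot> asc T X Y Z = \<iota> ((X \<boxtimes> Y) \<boxtimes> Z) \<and> asc T X Y Z \<cdot> g = \<iota> (X \<boxtimes> (Y \<boxtimes> Z)))"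

lemma asc_inv [simp]:
  assumes "X \<in> Obj C" "Y \<in> Obj C" "Z \<in> Obj C"
  shows "asc_inv X Y Z \<in> Arr C" "Dom C (asc_inv X Y Z) = X \<boxtimes> (Y \<boxtimes> Z)" "Cod C (asc_inv X Y Z) = (X \<boxtimes> Y) \<boxtimes> Z"
    "asc_inv X Y Z \<cdot> asc T X Y Z = \<iota> ((X \<boxtimes> Y) \<boxtimes> Z)" "asc T X Y Z \<cdot> asc_inv X Y Z = \<iota> (X \<boxtimes> (Y \<boxtimes> Z))"
proof -
  have "\<exists>g. g \<in> Arr C \<and> Dom C g = X \<boxtimes> (Y \<boxtimes> Z) \<and> Cod C g = (X \<boxtimes> Y) \<boxtimes> Z \<and>
     g \<cdot> asc T X Y Z = \<iota> ((X \<boxtimes> Y) \<boxtimes> Z) \<and> asc T X Y Z \<cdot> g = \<iota> (X \<boxtimes> (Y \<boxtimes> Z))"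
    using asc_iso[OF assms] assms unfolding is_iso_def by auto
  from someI_ex[OF this] show "asc_inv X Y Z \<in> Arr C" "Dom C (asc_inv X Y Z) = X \<boxtimes> (Y \<boxtimes> Z)" "Cod C (asc_inv X Y Z) = (X \<boxtimes> Y) \<boxtimes> Z"
    "asc_inv X Y Z \<cdot> asc T X Y Z = \<iota> ((X \<boxtimes> Y) \<boxtimes> Z)" "asc T X Y Z \<cdot> asc_inv X Y Z = \<iota> (X \<boxtimes> (Y \<boxtimes> Z))"
    unfolding asc_inv_def by auto
qed

lemma asc_inv_tail [simp]:
  assumes "X \<in> Obj C" "Y \<in> Obj C" "Z \<in> Obj C" "x \<in> Arr C"
  shows "Cod C x = (X \<boxtimes> Y) \<boxtimes> Z \<Longrightarrow> asc_inv X Y Z \<cdot> asc T X Y Z \<cdot> x = x"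
    "Cod C x = X \<boxtimes> (Y \<boxtimes> Z) \<Longrightarrow> asc T X Y Z \<cdot> asc_inv X Y Z \<cdot> x = x"
  using reassoc[OF asc_inv(4)] reassoc[OF asc_inv(5)] assms by simp_all

lemma asc_inv_nat [simp]:
  assumes "f \<in> Arr C" "g \<in> Arr C" "h \<in> Arr C" "Cod C f = X" "Cod C g = Y" "Cod C h = Z"
  shows "asc_inv X Y Z \<cdot> (f \<odot> (g \<odot> h)) = ((f \<odot> g) \<odot> h) \<cdot> asc_inv (Dom C f) (Dom C g) (Dom C h)"
proof -
  have [simp]: "X \<in> Obj C" "Y \<in> Obj C" "Z \<in> Obj C" using assms by auto
  have "asc_inv X Y Z \<cdot> (f \<odot> (g \<odot> h)) = asc_inv X Y Z \<cdot> ((f \<odot> (g \<odot> h)) \<cdot> asc T (Dom C f) (Dom C g) (Dom C h)) \<cdot> asc_inv (Dom C f) (Dom C g) (Dom C h)"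
    using assms by simp
  also have "\<dots> = asc_inv X Y Z \<cdot> (asc T X Y Z \<cdot> ((f \<odot> g) \<odot> h)) \<cdot> asc_inv (Dom C f) (Dom C g) (Dom C h)"
    using assms by (simp only: asc_nat)
  also have "\<dots> = ((f \<odot> g) \<odot> h) \<cdot> asc_inv (Dom C f) (Dom C g) (Dom C h)"
    using assms by (simp del: asc_nat asc_nat_tail)
  finally show ?thesis .
qed

lemma asc_inv_nat_Idt [simp]:
  assumes "f \<in> Arr C" "Y \<in> Obj C" "Z \<in> Obj C" "Cod C f = X"
  shows "asc_inv X Y Z \<cdot> (f \<odot> \<iota> (Y \<boxtimes> Z)) = ((f \<odot> \<iota> Y) \<odot> \<iota> Z) \<cdot> asc_inv (Dom C f) Y Z"
  using asc_inv_nat[of f "\<iota> Y" "\<iota> Z" X Y Z] assms by (simp del: asc_inv_nat)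

lemma left_adjoint_tensor: "Z \<in> Obj C \<Longrightarrow> left_adjoint_functor C C (tensor_right C T Z)"
  using closed by unfold_locales (simp add: is_closed_symmetric_monoidal_def)

lemma tensor_pushout:
  assumes po: "is_pushout C f g p q" and Z: "Z \<in> Obj C"
  shows "is_pushout C (f \<odot> \<iota> Z) (g \<odot> \<iota> Z) (p \<odot> \<iota> Z) (q \<odot> \<iota> Z)"
proof -
  interpret F: left_adjoint_functor C C "tensor_right C T Z" by (rule left_adjoint_tensor[OF Z])
  show ?thesis using F.preserves_pushout[OF po] by (simp add: tensor_right_def)
qed

text \<open>Closedness is stated for tensoring on the right; conjugation with the braiding
  transports the universal property to the left.\<close>

lemma tensor_pushout_left:
  assumes po: "is_pushout C f g p q" and Z: "Z \<in> Obj C"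
  shows "is_pushout C (\<iota> Z \<odot> f) (\<iota> Z \<odot> g) (\<iota> Z \<odot> p) (\<iota> Z \<odot> q)"
proof -
  note P [simp] = is_pushout_Arr[OF po] and [simp] = Z
  note R = tensor_pushout[OF po Z]
  show ?thesis
  proof (rule is_pushoutI)
    fix u v assume uv: "u \<in> Arr C" "v \<in> Arr C" "Dom C u = Cod C (\<iota> Z \<odot> f)" "Dom C v = Cod C (\<iota> Z \<odot> g)" "Cod C u = Cod C v"
      "u \<cdot> (\<iota> Z \<odot> f) = v \<cdot> (\<iota> Z \<odot> g)"
    have "u \<cdot> brd T (Cod C f) Z \<cdot> (f \<odot> \<iota> Z) = v \<cdot> brd T (Cod C g) Z \<cdot> (g \<odot> \<iota> Z)"
      using uv reassoc[OF uv(6), of "brd T (Dom C f) Z"] by simp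
    then obtain h where h: "h \<in> Arr C" "Dom C h = Cod C p \<boxtimes> Z" "Cod C h = Cod C v" "h \<cdot> (p \<odot> \<iota> Z) = u \<cdot> brd T (Cod C f) Z"
      "h \<cdot> (q \<odot> \<iota> Z) = v \<cdot> brd T (Cod C g) Z"
      using is_pushout_ex[OF R, of "u \<cdot> brd T (Cod C f) Z" "v \<cdot> brd T (Cod C g) Z"] uv by auto
    show "\<exists>h. h \<in> Arr C \<and> Dom C h = Cod C (\<iota> Z \<odot> p) \<and> Cod C h = Cod C v \<and> h \<cdot> (\<iota> Z \<odot> p) = u \<and> h \<cdot> (\<iota> Z \<odot> q) = v"
      by (rule exI[of _ "h \<cdot> brd T Z (Cod C p)"])
        (use uv h reassoc[OF h(4), of "brd T Z (Cod C f)"] reassoc[OF h(5), of "brd T Z (Cod C g)"] in simp)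
  next
    fix h k assume hk: "h \<in> Arr C" "k \<in> Arr C" "Dom C h = Cod C (\<iota> Z \<odot> p)" "Dom C k = Cod C (\<iota> Z \<odot> p)" "Cod C k = Cod C h"
      "h \<cdot> (\<iota> Z \<odot> p) = k \<cdot> (\<iota> Z \<odot> p)" "h \<cdot> (\<iota> Z \<odot> q) = k \<cdot> (\<iota> Z \<odot> q)"
    have "h \<cdot> brd T (Cod C p) Z = k \<cdot> brd T (Cod C p) Z"
      by (rule is_pushout_ext[OF R])
        (use hk(1-5) reassoc[OF hk(6), of "brd T (Cod C f) Z"] reassoc[OF hk(7), of "brd T (Cod C g) Z"] in simp_all)
    then have "(h \<cdot> brd T (Cod C p) Z) \<cdot> brd T Z (Cod C p) = (k \<cdot> brd T (Cod C p) Z) \<cdot> brd T Z (Cod C p)" by simp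
    then show "h = k" using hk(1-5) by simp
  qed simp_all
qed

lemma is_initial_ext:
  "is_initial C z \<Longrightarrow> f \<in> Arr C \<Longrightarrow> g \<in> Arr C \<Longrightarrow> Dom C f = z \<Longrightarrow> Dom C g = z \<Longrightarrow> Cod C f = Cod C g \<Longrightarrow> f = g"
  unfolding is_initial_def in_hom by (metis Cod_Obj)

text \<open>Tensoring with \<open>Z\<close> is a left adjoint and so preserves the initial
  object.\<close>

lemma init_tensor_ext:
  assumes "Z \<in> Obj C" "f \<in> Arr C" "g \<in> Arr C" "Dom C f = init C \<boxtimes> Z" "Dom C g = init C \<boxtimes> Z" "Cod C f = Cod C g"
  shows "f = g"
proof -
  interpret F: left_adjoint_functor C C "tensor_right C T Z" by (rule left_adjoint_tensor[OF assms(1)])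
  have "is_initial C (init C \<boxtimes> Z)" using F.preserves_initial[OF is_initial_init] by (simp add: tensor_right_def)
  then show ?thesis using assms(2-) by (rule is_initial_ext)
qed

lemma tensor_init_ext:
  assumes "Z \<in> Obj C" "f \<in> Arr C" "g \<in> Arr C" "Dom C f = Z \<boxtimes> init C" "Dom C g = Z \<boxtimes> init C" "Cod C f = Cod C g"
  shows "f = g"
proof -
  have "f \<cdot> brd T (init C) Z = g \<cdot> brd T (init C) Z" by (rule init_tensor_ext[OF assms(1)]) (use assms in simp_all)
  then have "(f \<cdot> brd T (init C) Z) \<cdot> brd T Z (init C) = (g \<cdot> brd T (init C) Z) \<cdot> brd T Z (init C)" by simp
  then show ?thesis using assms by simp
qed

section \<open>The pushout product\<close>

abbreviation "in1 \<equiv> pp_in1 C T"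
abbreviation "in2 \<equiv> pp_in2 C T"
abbreviation "pp \<equiv> pushout_product C T"

lemma pp_is_pushout:
  assumes "f \<in> Arr C" "g \<in> Arr C"
  shows "is_pushout C (\<iota> (Dom C f) \<odot> g) (f \<odot> \<iota> (Dom C g)) (in1 f g) (in2 f g)"
  unfolding pp_in1_def pp_in2_def by (rule po_is_pushout) (use assms in simp_all)

lemma pp_props:
  assumes "f \<in> Arr C" "g \<in> Arr C"
  shows "pp f g \<in> Arr C" "Dom C (pp f g) = Cod C (in1 f g)" "Cod C (pp f g) = Cod C f \<boxtimes> Cod C g"
    "pp f g \<cdot> in1 f g = f \<odot> \<iota> (Cod C g)" "pp f g \<cdot> in2 f g = \<iota> (Cod C f) \<odot> g"
  unfolding pushout_product_def pp_map_def pp_in1_def pp_in2_def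
  using po_map_props[of "\<iota> (Dom C f) \<odot> g" "f \<odot> \<iota> (Dom C g)" "f \<odot> \<iota> (Cod C g)" "\<iota> (Cod C f) \<odot> g"] assms by simp_all

lemma pp_rules [simp]:
  assumes "f \<in> Arr C" "g \<in> Arr C"
  shows "pp f g \<in> Arr C" "Cod C (pp f g) = Cod C f \<boxtimes> Cod C g"
    "in1 f g \<in> Arr C" "Dom C (in1 f g) = Dom C f \<boxtimes> Cod C g" "Cod C (in1 f g) = Dom C (pp f g)"
    "in2 f g \<in> Arr C" "Dom C (in2 f g) = Cod C f \<boxtimes> Dom C g" "Cod C (in2 f g) = Dom C (pp f g)"
    "pp f g \<cdot> in1 f g = f \<odot> \<iota> (Cod C g)" "pp f g \<cdot> in2 f g = \<iota> (Cod C f) \<odot> g"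
  using pp_props[OF assms] is_pushout_Arr[OF pp_is_pushout[OF assms]] assms by simp_all

lemma pp_tail [simp]:
  assumes "f \<in> Arr C" "g \<in> Arr C" "x \<in> Arr C"
  shows "Cod C x = Dom C f \<boxtimes> Cod C g \<Longrightarrow> pp f g \<cdot> in1 f g \<cdot> x = (f \<odot> \<iota> (Cod C g)) \<cdot> x"
    "Cod C x = Cod C f \<boxtimes> Dom C g \<Longrightarrow> pp f g \<cdot> in2 f g \<cdot> x = (\<iota> (Cod C f) \<odot> g) \<cdot> x"
  using reassoc[OF pp_rules(9)[OF assms(1,2)], of x] reassoc[OF pp_rules(10)[OF assms(1,2)], of x] assms by auto

text \<open>The gluing relation of the pushout precomposed with a tensor of maps \<open>x\<close>
  and \<open>y\<close>, the form in which it occurs once tensor factors are merged.\<close>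

lemma in_glue:
  assumes "f \<in> Arr C" "g \<in> Arr C" "x \<in> Arr C" "y \<in> Arr C" "Cod C x = Dom C f" "Cod C y = Dom C g"
  shows "in1 f g \<cdot> (x \<odot> (g \<cdot> y)) = in2 f g \<cdot> ((f \<cdot> x) \<odot> y)"
proof -
  have "(in1 f g \<cdot> (\<iota> (Dom C f) \<odot> g)) \<cdot> (x \<odot> y) = (in2 f g \<cdot> (f \<odot> \<iota> (Dom C g))) \<cdot> (x \<odot> y)"
    using is_pushout_Arr(9)[OF pp_is_pushout[OF assms(1,2)]] by simp
  then show ?thesis using assms by simp
qed

lemma pp_ext:
  assumes "f \<in> Arr C" "g \<in> Arr C" "h \<in> Arr C" "k \<in> Arr C" "Dom C h = Dom C (pp f g)" "Dom C k = Dom C (pp f g)" "Cod C k = Cod C h"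
    "h \<cdot> in1 f g = k \<cdot> in1 f g" "h \<cdot> in2 f g = k \<cdot> in2 f g"
  shows "h = k"
  by (rule is_pushout_ext[OF pp_is_pushout[OF assms(1,2)]]) (use assms in simp_all)

lemma pp_map_rules:
  assumes "f \<in> Arr C" "g \<in> Arr C" "u \<in> Arr C" "v \<in> Arr C" "Dom C u = Dom C f \<boxtimes> Cod C g" "Dom C v = Cod C f \<boxtimes> Dom C g" "Cod C v = Cod C u"
    "u \<cdot> (\<iota> (Dom C f) \<odot> g) = v \<cdot> (f \<odot> \<iota> (Dom C g))"
  shows "pp_map C T f g u v \<in> Arr C" "Dom C (pp_map C T f g u v) = Dom C (pp f g)" "Cod C (pp_map C T f g u v) = Cod C u"
    "pp_map C T f g u v \<cdot> in1 f g = u" "pp_map C T f g u v \<cdot> in2 f g = v"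
  using po_map_props[of "\<iota> (Dom C f) \<odot> g" "f \<odot> \<iota> (Dom C g)" u v] assms pp_props(2)[OF assms(1,2)]
  by (simp_all add: pp_map_def pp_in1_def pp_in2_def)

lemma pp_tensor_ext:
  assumes fg: "f \<in> Arr C" "g \<in> Arr C" and "Z \<in> Obj C" "h \<in> Arr C" "k \<in> Arr C" "Dom C h = Dom C (pp f g) \<boxtimes> Z" "Dom C k = Dom C (pp f g) \<boxtimes> Z"
    "Cod C k = Cod C h" "h \<cdot> (in1 f g \<odot> \<iota> Z) = k \<cdot> (in1 f g \<odot> \<iota> Z)" "h \<cdot> (in2 f g \<odot> \<iota> Z) = k \<cdot> (in2 f g \<odot> \<iota> Z)"
  shows "h = k"
  by (rule is_pushout_ext[OF tensor_pushout[OF pp_is_pushout[OF fg] assms(3)]]) (use assms in simp_all)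

lemma pp_tensor_ext_left:
  assumes fg: "f \<in> Arr C" "g \<in> Arr C" and "Z \<in> Obj C" "h \<in> Arr C" "k \<in> Arr C" "Dom C h = Z \<boxtimes> Dom C (pp f g)" "Dom C k = Z \<boxtimes> Dom C (pp f g)"
    "Cod C k = Cod C h" "h \<cdot> (\<iota> Z \<odot> in1 f g) = k \<cdot> (\<iota> Z \<odot> in1 f g)" "h \<cdot> (\<iota> Z \<odot> in2 f g) = k \<cdot> (\<iota> Z \<odot> in2 f g)"
  shows "h = k"
  by (rule is_pushout_ext[OF tensor_pushout_left[OF pp_is_pushout[OF fg] assms(3)]]) (use assms in simp_all)

text \<open>The domain of a triple product is covered by three pieces. \<open>in1\<close> and
  \<open>in2\<close> of the outer product are jointly epic, and the source of the first is again
  covered by two pieces because tensoring preserves pushouts.\<close>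

lemma tri_ext:
  assumes fgh: "f \<in> Arr C" "g \<in> Arr C" "h \<in> Arr C" and uv: "u \<in> Arr C" "v \<in> Arr C" "Dom C u = Dom C (pp (pp f g) h)" "Dom C v = Dom C (pp (pp f g) h)"
    "Cod C v = Cod C u"
    "u \<cdot> in1 (pp f g) h \<cdot> (in1 f g \<odot> \<iota> (Cod C h)) = v \<cdot> in1 (pp f g) h \<cdot> (in1 f g \<odot> \<iota> (Cod C h))"
    "u \<cdot> in1 (pp f g) h \<cdot> (in2 f g \<odot> \<iota> (Cod C h)) = v \<cdot> in1 (pp f g) h \<cdot> (in2 f g \<odot> \<iota> (Cod C h))"
    "u \<cdot> in2 (pp f g) h = v \<cdot> in2 (pp f g) h"
  shows "u = v"
proof -
  have "u \<cdot> in1 (pp f g) h = v \<cdot> in1 (pp f g) h"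
    by (rule pp_tensor_ext[OF fgh(1,2), of "Cod C h"]) (use assms in simp_all)
  then show ?thesis using pp_ext[of "pp f g" h u v] assms by simp
qed

lemma tri_ext':
  assumes fgh: "f \<in> Arr C" "g \<in> Arr C" "h \<in> Arr C" and uv: "u \<in> Arr C" "v \<in> Arr C" "Dom C u = Dom C (pp f (pp g h))" "Dom C v = Dom C (pp f (pp g h))"
    "Cod C v = Cod C u"
    "u \<cdot> in1 f (pp g h) = v \<cdot> in1 f (pp g h)"
    "u \<cdot> in2 f (pp g h) \<cdot> (\<iota> (Cod C f) \<odot> in1 g h) = v \<cdot> in2 f (pp g h) \<cdot> (\<iota> (Cod C f) \<odot> in1 g h)"
    "u \<cdot> in2 f (pp g h) \<cdot> (\<iota> (Cod C f) \<odot> in2 g h) = v \<cdot> in2 f (pp g h) \<cdot> (\<iota> (Cod C f) \<odot> in2 g h)"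
  shows "u = v"
proof -
  have "u \<cdot> in2 f (pp g h) = v \<cdot> in2 f (pp g h)"
    by (rule pp_tensor_ext_left[OF fgh(2,3), of "Cod C f"]) (use assms in simp_all)
  then show ?thesis using pp_ext[of f "pp g h" u v] assms by simp
qed

text \<open>The three conditions \<open>c\<close> are the agreements on the pairwise overlaps of the
  pieces. The first lets \<open>r0\<close> and \<open>r1\<close> glue over the tensored inner
  pushout; the other two, tested on its pieces, say that the result is compatible with
  \<open>r2\<close>.\<close>

lemma tri_ex:
  assumes fgh: "f \<in> Arr C" "g \<in> Arr C" "h \<in> Arr C"
    and r: "r0 \<in> Arr C" "Dom C r0 = (Dom C f \<boxtimes> Cod C g) \<boxtimes> Cod C h" "r1 \<in> Arr C" "Dom C r1 = (Cod C f \<boxtimes> Dom C g) \<boxtimes> Cod C h"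
      "r2 \<in> Arr C" "Dom C r2 = (Cod C f \<boxtimes> Cod C g) \<boxtimes> Dom C h" "Cod C r1 = Cod C r0" "Cod C r2 = Cod C r0"
    and c: "r0 \<cdot> ((\<iota> (Dom C f) \<odot> g) \<odot> \<iota> (Cod C h)) = r1 \<cdot> ((f \<odot> \<iota> (Dom C g)) \<odot> \<iota> (Cod C h))"
      "r0 \<cdot> (\<iota> (Dom C f \<boxtimes> Cod C g) \<odot> h) = r2 \<cdot> ((f \<odot> \<iota> (Cod C g)) \<odot> \<iota> (Dom C h))"
      "r1 \<cdot> (\<iota> (Cod C f \<boxtimes> Dom C g) \<odot> h) = r2 \<cdot> ((\<iota> (Cod C f) \<odot> g) \<odot> \<iota> (Dom C h))"
  obtains w where "w \<in> Arr C" "Dom C w = Dom C (pp (pp f g) h)" "Cod C w = Cod C r0"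
    "w \<cdot> in1 (pp f g) h \<cdot> (in1 f g \<odot> \<iota> (Cod C h)) = r0" "w \<cdot> in1 (pp f g) h \<cdot> (in2 f g \<odot> \<iota> (Cod C h)) = r1" "w \<cdot> in2 (pp f g) h = r2"
proof -
  note [simp] = fgh r
  obtain s where s: "s \<in> Arr C" "Dom C s = Dom C (pp f g) \<boxtimes> Cod C h" "Cod C s = Cod C r0"
    "s \<cdot> (in1 f g \<odot> \<iota> (Cod C h)) = r0" "s \<cdot> (in2 f g \<odot> \<iota> (Cod C h)) = r1"
    by (rule is_pushout_ex[OF tensor_pushout[OF pp_is_pushout[OF fgh(1,2)], of "Cod C h"], of r0 r1]) (use c in simp_all)
  \<comment> \<open>The gluing condition of the outer pushout, checked on the two pieces of the
    domain of the inner product.\<close>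
  have "s \<cdot> (\<iota> (Dom C (pp f g)) \<odot> h) = r2 \<cdot> (pp f g \<odot> \<iota> (Dom C h))"
    by (rule pp_tensor_ext[OF fgh(1,2), of "Dom C h"])
      (use s c(2,3) reassoc[OF s(4), of "\<iota> (Dom C f \<boxtimes> Cod C g) \<odot> h"] reassoc[OF s(5), of "\<iota> (Cod C f \<boxtimes> Dom C g) \<odot> h"] in simp_all)
  then show thesis
    using that[of "pp_map C T (pp f g) h s r2"] pp_map_rules[of "pp f g" h s r2] s
      reassoc[of "pp_map C T (pp f g) h s r2" "in1 (pp f g) h" s] by simp
qed

lemma tri_ex':
  assumes fgh: "f \<in> Arr C" "g \<in> Arr C" "h \<in> Arr C"
    and r: "r0 \<in> Arr C" "Dom C r0 = Dom C f \<boxtimes> (Cod C g \<boxtimes> Cod C h)" "r1 \<in> Arr C" "Dom C r1 = Cod C f \<boxtimes> (Dom C g \<boxtimes> Cod C h)"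
      "r2 \<in> Arr C" "Dom C r2 = Cod C f \<boxtimes> (Cod C g \<boxtimes> Dom C h)" "Cod C r1 = Cod C r0" "Cod C r2 = Cod C r0"
    and c: "r0 \<cdot> (\<iota> (Dom C f) \<odot> (g \<odot> \<iota> (Cod C h))) = r1 \<cdot> (f \<odot> \<iota> (Dom C g \<boxtimes> Cod C h))"
      "r0 \<cdot> (\<iota> (Dom C f) \<odot> (\<iota> (Cod C g) \<odot> h)) = r2 \<cdot> (f \<odot> \<iota> (Cod C g \<boxtimes> Dom C h))"
      "r1 \<cdot> (\<iota> (Cod C f) \<odot> (\<iota> (Dom C g) \<odot> h)) = r2 \<cdot> (\<iota> (Cod C f) \<odot> (g \<odot> \<iota> (Dom C h)))"
  obtains w where "w \<in> Arr C" "Dom C w = Dom C (pp f (pp g h))" "Cod C w = Cod C r0"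
    "w \<cdot> in1 f (pp g h) = r0" "w \<cdot> in2 f (pp g h) \<cdot> (\<iota> (Cod C f) \<odot> in1 g h) = r1" "w \<cdot> in2 f (pp g h) \<cdot> (\<iota> (Cod C f) \<odot> in2 g h) = r2"
proof -
  note [simp] = fgh r
  obtain s where s: "s \<in> Arr C" "Dom C s = Cod C f \<boxtimes> Dom C (pp g h)" "Cod C s = Cod C r0"
    "s \<cdot> (\<iota> (Cod C f) \<odot> in1 g h) = r1" "s \<cdot> (\<iota> (Cod C f) \<odot> in2 g h) = r2"
    by (rule is_pushout_ex[OF tensor_pushout_left[OF pp_is_pushout[OF fgh(2,3)], of "Cod C f"], of r1 r2]) (use c in simp_all)
  have "r0 \<cdot> (\<iota> (Dom C f) \<odot> pp g h) = s \<cdot> (f \<odot> \<iota> (Dom C (pp g h)))"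
    by (rule pp_tensor_ext_left[OF fgh(2,3), of "Dom C f"])
      (use s c(1,2) reassoc[OF s(4), of "f \<odot> \<iota> (Dom C g \<boxtimes> Cod C h)"] reassoc[OF s(5), of "f \<odot> \<iota> (Cod C g \<boxtimes> Dom C h)"] in simp_all)
  then show thesis
    using that[of "pp_map C T f (pp g h) r0 s"] pp_map_rules[of f "pp g h" r0 s] s
      reassoc[of "pp_map C T f (pp g h) r0 s" "in2 f (pp g h)" s] by simp
qed

end

section \<open>Coherence of the pushout product\<close>

context closed_sym_mon
begin

abbreviation "Q \<equiv> pushout_product_monoidal C T"

lemma Q_simps [simp]:
  "tob Q = pp" "tar Q = pp_square C T" "unt Q = pp_unit C T" "asc Q = pp_assoc C T" "lun Q = pp_lunit C T"
  "run Q = pp_runit C T" "brd Q = pp_sym C T"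
  by (simp_all add: pushout_product_monoidal_def)

text \<open>With the components at 0 named, they can be handled by their restrictions to the pieces
  alone, and the choices behind them stay folded.\<close>

definition "pp0 a b = sq0 (pp_square C T a b)"
definition "asc0 f g h = sq0 (pp_assoc C T f g h)"
definition "lun0 g = sq0 (pp_lunit C T g)"
definition "run0 f = sq0 (pp_runit C T f)"
definition "brd0 f g = sq0 (pp_sym C T f g)"

lemma pp_square_eq: "pp_square C T a b = Square (pp (sq_src a) (sq_src b)) (pp (sq_tgt a) (sq_tgt b)) (pp0 a b) (sq1 a \<odot> sq1 b)"
  and pp_assoc_eq: "pp_assoc C T f g h = Square (pp (pp f g) h) (pp f (pp g h)) (asc0 f g h) (asc T (Cod C f) (Cod C g) (Cod C h))"
  and pp_lunit_eq: "pp_lunit C T g = Square (pp (pp_unit C T) g) g (lun0 g) (lun T (Cod C g))"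
  and pp_runit_eq: "pp_runit C T f = Square (pp f (pp_unit C T)) f (run0 f) (run T (Cod C f))"
  and pp_sym_eq: "pp_sym C T f g = Square (pp f g) (pp g f) (brd0 f g) (brd T (Cod C f) (Cod C g))"
  by (simp_all add: pp0_def asc0_def lun0_def run0_def brd0_def pp_square_def pp_assoc_def pp_lunit_def pp_runit_def pp_sym_def Let_def)

lemma pp0_rules [simp]:
  assumes "a \<in> Arr \<A>" "b \<in> Arr \<A>"
  shows "pp0 a b \<in> Arr C" "Dom C (pp0 a b) = Dom C (pp (sq_src a) (sq_src b))" "Cod C (pp0 a b) = Dom C (pp (sq_tgt a) (sq_tgt b))"
    "pp0 a b \<cdot> in1 (sq_src a) (sq_src b) = in1 (sq_tgt a) (sq_tgt b) \<cdot> (sq0 a \<odot> sq1 b)"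
    "pp0 a b \<cdot> in2 (sq_src a) (sq_src b) = in2 (sq_tgt a) (sq_tgt b) \<cdot> (sq1 a \<odot> sq0 b)"
proof -
  have "in1 (sq_tgt a) (sq_tgt b) \<cdot> (sq0 a \<odot> (sq1 b \<cdot> sq_src b)) = in2 (sq_tgt a) (sq_tgt b) \<cdot> ((sq1 a \<cdot> sq_src a) \<odot> sq0 b)"
    unfolding sq_commutes[OF assms(1)] sq_commutes[OF assms(2)] by (rule in_glue) (use assms in simp_all)
  then show "pp0 a b \<in> Arr C" "Dom C (pp0 a b) = Dom C (pp (sq_src a) (sq_src b))" "Cod C (pp0 a b) = Dom C (pp (sq_tgt a) (sq_tgt b))"
    "pp0 a b \<cdot> in1 (sq_src a) (sq_src b) = in1 (sq_tgt a) (sq_tgt b) \<cdot> (sq0 a \<odot> sq1 b)"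
    "pp0 a b \<cdot> in2 (sq_src a) (sq_src b) = in2 (sq_tgt a) (sq_tgt b) \<cdot> (sq1 a \<odot> sq0 b)"
    unfolding pp0_def pp_square_def
    using assms pp_map_rules[of "sq_src a" "sq_src b" "in1 (sq_tgt a) (sq_tgt b) \<cdot> (sq0 a \<odot> sq1 b)" "in2 (sq_tgt a) (sq_tgt b) \<cdot> (sq1 a \<odot> sq0 b)"]
    by simp_all
qed

lemma pp_square_Arr [simp]:
  assumes "a \<in> Arr \<A>" "b \<in> Arr \<A>"
  shows "pp_square C T a b \<in> Arr \<A>"
  unfolding pp_square_eq Square_Arr
proof (intro conjI)
  have "(sq1 a \<odot> sq1 b) \<cdot> pp (sq_src a) (sq_src b) = pp (sq_tgt a) (sq_tgt b) \<cdot> pp0 a b"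
    by (rule pp_ext[of "sq_src a" "sq_src b"]) (use assms sq_commutes[OF assms(1)] sq_commutes[OF assms(2)] in simp_all)
  then show "(sq1 a \<odot> sq1 b) \<cdot> pp (sq_src a) (sq_src b) = pp (sq_tgt a) (sq_tgt b) \<cdot> pp0 a b" .
qed (use assms in simp_all)

text \<open>The overlaps of the pieces are \<open>X0 Y0 Z1\<close>, \<open>X0 Y1 Z0\<close> and
  \<open>X1 Y0 Z0\<close>; the relations 1, 2 and 3 are the gluing relations there, transported by
  naturality of the associator.\<close>

lemma asc0_exists:
  assumes [simp]: "f \<in> Arr C" "g \<in> Arr C" "h \<in> Arr C"
  shows "\<exists>w. w \<in> hom C (Dom C (pp (pp f g) h)) (Dom C (pp f (pp g h))) \<and>
    w \<cdot> in1 (pp f g) h \<cdot> (in1 f g \<odot> \<iota> (Cod C h)) = in1 f (pp g h) \<cdot> asc T (Dom C f) (Cod C g) (Cod C h) \<and>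
    w \<cdot> in1 (pp f g) h \<cdot> (in2 f g \<odot> \<iota> (Cod C h)) = in2 f (pp g h) \<cdot> (\<iota> (Cod C f) \<odot> in1 g h) \<cdot> asc T (Cod C f) (Dom C g) (Cod C h) \<and>
    w \<cdot> in2 (pp f g) h = in2 f (pp g h) \<cdot> (\<iota> (Cod C f) \<odot> in2 g h) \<cdot> asc T (Cod C f) (Cod C g) (Dom C h)"
proof -
  have 1: "in1 f (pp g h) \<cdot> (\<iota> (Dom C f) \<odot> (g \<odot> \<iota> (Cod C h))) = in2 f (pp g h) \<cdot> (f \<odot> in1 g h)"
    using in_glue[of f "pp g h" "\<iota> (Dom C f)" "in1 g h"] by simp
  have 2: "in1 f (pp g h) \<cdot> (\<iota> (Dom C f) \<odot> (\<iota> (Cod C g) \<odot> h)) = in2 f (pp g h) \<cdot> (f \<odot> in2 g h)"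
    using in_glue[of f "pp g h" "\<iota> (Dom C f)" "in2 g h"] by simp
  have 3: "in1 g h \<cdot> (\<iota> (Dom C g) \<odot> h) = in2 g h \<cdot> (g \<odot> \<iota> (Dom C h))"
    using in_glue[of g h "\<iota> (Dom C g)" "\<iota> (Dom C h)"] by simp
  obtain w where "w \<in> Arr C" "Dom C w = Dom C (pp (pp f g) h)" "Cod C w = Dom C (pp f (pp g h))"
    "w \<cdot> in1 (pp f g) h \<cdot> (in1 f g \<odot> \<iota> (Cod C h)) = in1 f (pp g h) \<cdot> asc T (Dom C f) (Cod C g) (Cod C h)"
    "w \<cdot> in1 (pp f g) h \<cdot> (in2 f g \<odot> \<iota> (Cod C h)) = in2 f (pp g h) \<cdot> (\<iota> (Cod C f) \<odot> in1 g h) \<cdot> asc T (Cod C f) (Dom C g) (Cod C h)"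
    "w \<cdot> in2 (pp f g) h = in2 f (pp g h) \<cdot> (\<iota> (Cod C f) \<odot> in2 g h) \<cdot> asc T (Cod C f) (Cod C g) (Dom C h)"
    by (rule tri_ex[of f g h "in1 f (pp g h) \<cdot> asc T (Dom C f) (Cod C g) (Cod C h)"
      "in2 f (pp g h) \<cdot> (\<iota> (Cod C f) \<odot> in1 g h) \<cdot> asc T (Cod C f) (Dom C g) (Cod C h)"
      "in2 f (pp g h) \<cdot> (\<iota> (Cod C f) \<odot> in2 g h) \<cdot> asc T (Cod C f) (Cod C g) (Dom C h)"])
      (simp_all add: reassoc[OF 1] reassoc[OF 2] 3)
  then show ?thesis by (intro exI[of _ w]) simp
qed

lemma asc0_rules [simp]:
  assumes [simp]: "f \<in> Arr C" "g \<in> Arr C" "h \<in> Arr C"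
  shows "asc0 f g h \<in> Arr C" "Dom C (asc0 f g h) = Dom C (pp (pp f g) h)" "Cod C (asc0 f g h) = Dom C (pp f (pp g h))"
    "asc0 f g h \<cdot> in1 (pp f g) h \<cdot> (in1 f g \<odot> \<iota> (Cod C h)) = in1 f (pp g h) \<cdot> asc T (Dom C f) (Cod C g) (Cod C h)"
    "asc0 f g h \<cdot> in1 (pp f g) h \<cdot> (in2 f g \<odot> \<iota> (Cod C h)) = in2 f (pp g h) \<cdot> (\<iota> (Cod C f) \<odot> in1 g h) \<cdot> asc T (Cod C f) (Dom C g) (Cod C h)"
    "asc0 f g h \<cdot> in2 (pp f g) h = in2 f (pp g h) \<cdot> (\<iota> (Cod C f) \<odot> in2 g h) \<cdot> asc T (Cod C f) (Cod C g) (Dom C h)"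
proof -
  let ?P = "\<lambda>w. w \<in> hom C (Dom C (pp (pp f g) h)) (Dom C (pp f (pp g h))) \<and>
    w \<cdot> in1 (pp f g) h \<cdot> (in1 f g \<odot> \<iota> (Cod C h)) = in1 f (pp g h) \<cdot> asc T (Dom C f) (Cod C g) (Cod C h) \<and>
    w \<cdot> in1 (pp f g) h \<cdot> (in2 f g \<odot> \<iota> (Cod C h)) = in2 f (pp g h) \<cdot> (\<iota> (Cod C f) \<odot> in1 g h) \<cdot> asc T (Cod C f) (Dom C g) (Cod C h) \<and>
    w \<cdot> in2 (pp f g) h = in2 f (pp g h) \<cdot> (\<iota> (Cod C f) \<odot> in2 g h) \<cdot> asc T (Cod C f) (Cod C g) (Dom C h)"
  obtain w where w: "?P w" using asc0_exists[OF assms] by blast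
  have "v = w" if "?P v" for v
    by (rule tri_ext[OF assms]) (use that w in simp_all)
  then have "(THE w. ?P w) = w" using w by (intro the_equality) blast+
  then have "asc0 f g h = w" by (simp add: asc0_def pp_assoc_def Let_def)
  then show "asc0 f g h \<in> Arr C" "Dom C (asc0 f g h) = Dom C (pp (pp f g) h)" "Cod C (asc0 f g h) = Dom C (pp f (pp g h))"
    "asc0 f g h \<cdot> in1 (pp f g) h \<cdot> (in1 f g \<odot> \<iota> (Cod C h)) = in1 f (pp g h) \<cdot> asc T (Dom C f) (Cod C g) (Cod C h)"
    "asc0 f g h \<cdot> in1 (pp f g) h \<cdot> (in2 f g \<odot> \<iota> (Cod C h)) = in2 f (pp g h) \<cdot> (\<iota> (Cod C f) \<odot> in1 g h) \<cdot> asc T (Cod C f) (Dom C g) (Cod C h)"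
    "asc0 f g h \<cdot> in2 (pp f g) h = in2 f (pp g h) \<cdot> (\<iota> (Cod C f) \<odot> in2 g h) \<cdot> asc T (Cod C f) (Cod C g) (Dom C h)"
    using w by auto
qed

text \<open>Restatements in the shapes that arise once the simplifier has fused adjacent tensor factors.\<close>

lemma asc0_in1_in1 [simp]:
  assumes [simp]: "f \<in> Arr C" "g \<in> Arr C" "h \<in> Arr C" "x \<in> Arr C" "z \<in> Arr C" "Cod C x = Dom C f \<boxtimes> Cod C g" "Cod C z = Cod C h"
  shows "asc0 f g h \<cdot> in1 (pp f g) h \<cdot> ((in1 f g \<cdot> x) \<odot> z) = in1 f (pp g h) \<cdot> asc T (Dom C f) (Cod C g) (Cod C h) \<cdot> (x \<odot> z)"
proof -
  have "(asc0 f g h \<cdot> in1 (pp f g) h \<cdot> (in1 f g \<odot> \<iota> (Cod C h))) \<cdot> (x \<odot> z) = (in1 f (pp g h) \<cdot> asc T (Dom C f) (Cod C g) (Cod C h)) \<cdot> (x \<odot> z)"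
    by (simp only: asc0_rules(4)[OF assms(1-3)])
  then show ?thesis by (simp del: asc0_rules(4))
qed

lemma asc0_in1_in2 [simp]:
  assumes [simp]: "f \<in> Arr C" "g \<in> Arr C" "h \<in> Arr C" "x \<in> Arr C" "z \<in> Arr C" "Cod C x = Cod C f \<boxtimes> Dom C g" "Cod C z = Cod C h"
  shows "asc0 f g h \<cdot> in1 (pp f g) h \<cdot> ((in2 f g \<cdot> x) \<odot> z) =
    in2 f (pp g h) \<cdot> (\<iota> (Cod C f) \<odot> in1 g h) \<cdot> asc T (Cod C f) (Dom C g) (Cod C h) \<cdot> (x \<odot> z)"
proof -
  have "(asc0 f g h \<cdot> in1 (pp f g) h \<cdot> (in2 f g \<odot> \<iota> (Cod C h))) \<cdot> (x \<odot> z) =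
      (in2 f (pp g h) \<cdot> (\<iota> (Cod C f) \<odot> in1 g h) \<cdot> asc T (Cod C f) (Dom C g) (Cod C h)) \<cdot> (x \<odot> z)"
    by (simp only: asc0_rules(5)[OF assms(1-3)])
  then show ?thesis by (simp del: asc0_rules(5))
qed

lemma asc0_in1_plain [simp]:
  assumes [simp]: "f \<in> Arr C" "g \<in> Arr C" "h \<in> Arr C" "z \<in> Arr C" "Cod C z = Cod C h"
  shows "asc0 f g h \<cdot> in1 (pp f g) h \<cdot> (in1 f g \<odot> z) = in1 f (pp g h) \<cdot> asc T (Dom C f) (Cod C g) (Cod C h) \<cdot> (\<iota> (Dom C f \<boxtimes> Cod C g) \<odot> z)"
    "asc0 f g h \<cdot> in1 (pp f g) h \<cdot> (in2 f g \<odot> z) =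
    in2 f (pp g h) \<cdot> (\<iota> (Cod C f) \<odot> in1 g h) \<cdot> asc T (Cod C f) (Dom C g) (Cod C h) \<cdot> (\<iota> (Cod C f \<boxtimes> Dom C g) \<odot> z)"
  using asc0_in1_in1[of f g h "\<iota> (Dom C f \<boxtimes> Cod C g)" z] asc0_in1_in2[of f g h "\<iota> (Cod C f \<boxtimes> Dom C g)" z]
  by (simp_all del: asc0_in1_in1 asc0_in1_in2)

lemma asc0_plain_tail [simp]:
  assumes [simp]: "f \<in> Arr C" "g \<in> Arr C" "h \<in> Arr C" "z \<in> Arr C" "Cod C z = Cod C h" "y \<in> Arr C"
  shows "Cod C y = (Dom C f \<boxtimes> Cod C g) \<boxtimes> Dom C z \<Longrightarrow>
      asc0 f g h \<cdot> in1 (pp f g) h \<cdot> (in1 f g \<odot> z) \<cdot> y = in1 f (pp g h) \<cdot> asc T (Dom C f) (Cod C g) (Cod C h) \<cdot> (\<iota> (Dom C f \<boxtimes> Cod C g) \<odot> z) \<cdot> y"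
    "Cod C y = (Cod C f \<boxtimes> Dom C g) \<boxtimes> Dom C z \<Longrightarrow>
      asc0 f g h \<cdot> in1 (pp f g) h \<cdot> (in2 f g \<odot> z) \<cdot> y =
      in2 f (pp g h) \<cdot> (\<iota> (Cod C f) \<odot> in1 g h) \<cdot> asc T (Cod C f) (Dom C g) (Cod C h) \<cdot> (\<iota> (Cod C f \<boxtimes> Dom C g) \<odot> z) \<cdot> y"
  using arg_cong[OF asc0_in1_plain(1)[of f g h z], of "\<lambda>t. t \<cdot> y"] arg_cong[OF asc0_in1_plain(2)[of f g h z], of "\<lambda>t. t \<cdot> y"]
  by (simp_all del: asc0_in1_plain)

lemma asc0_in2_tail [simp]:
  assumes [simp]: "f \<in> Arr C" "g \<in> Arr C" "h \<in> Arr C" "y \<in> Arr C" "Cod C y = (Cod C f \<boxtimes> Cod C g) \<boxtimes> Dom C h"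
  shows "asc0 f g h \<cdot> in2 (pp f g) h \<cdot> y = in2 f (pp g h) \<cdot> (\<iota> (Cod C f) \<odot> in2 g h) \<cdot> asc T (Cod C f) (Cod C g) (Dom C h) \<cdot> y"
  using arg_cong[OF asc0_rules(6)[of f g h], of "\<lambda>t. t \<cdot> y"] by (simp del: asc0_rules(6))

lemma pp_assoc_Arr [simp]:
  assumes [simp]: "f \<in> Arr C" "g \<in> Arr C" "h \<in> Arr C"
  shows "pp_assoc C T f g h \<in> Arr \<A>"
proof -
  have "asc T (Cod C f) (Cod C g) (Cod C h) \<cdot> pp (pp f g) h = pp f (pp g h) \<cdot> asc0 f g h"
    by (rule tri_ext[of f g h]) simp_all
  then show ?thesis unfolding pp_assoc_eq by simp
qed

text \<open>The inverse is glued from inverse associators over the pieces of the other bracketing,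
  and both composites are identities because they are so on the pieces.\<close>

lemma asc0_iso:
  assumes [simp]: "f \<in> Arr C" "g \<in> Arr C" "h \<in> Arr C"
  shows "is_iso C (asc0 f g h)"
proof -
  have 1: "in1 (pp f g) h \<cdot> ((in1 f g \<cdot> (\<iota> (Dom C f) \<odot> g)) \<odot> \<iota> (Cod C h)) = in1 (pp f g) h \<cdot> ((in2 f g \<cdot> (f \<odot> \<iota> (Dom C g))) \<odot> \<iota> (Cod C h))"
    using in_glue[of f g "\<iota> (Dom C f)" "\<iota> (Dom C g)"] by simp
  have 2: "in1 (pp f g) h \<cdot> (in1 f g \<odot> h) = in2 (pp f g) h \<cdot> ((f \<odot> \<iota> (Cod C g)) \<odot> \<iota> (Dom C h))"
    using in_glue[of "pp f g" h "in1 f g" "\<iota> (Dom C h)"] by simp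
  have 3: "in1 (pp f g) h \<cdot> (in2 f g \<odot> h) = in2 (pp f g) h \<cdot> ((\<iota> (Cod C f) \<odot> g) \<odot> \<iota> (Dom C h))"
    using in_glue[of "pp f g" h "in2 f g" "\<iota> (Dom C h)"] by simp
  obtain w where w: "w \<in> Arr C" "Dom C w = Dom C (pp f (pp g h))" "Cod C w = Dom C (pp (pp f g) h)"
    "w \<cdot> in1 f (pp g h) = in1 (pp f g) h \<cdot> (in1 f g \<odot> \<iota> (Cod C h)) \<cdot> asc_inv (Dom C f) (Cod C g) (Cod C h)"
    "w \<cdot> in2 f (pp g h) \<cdot> (\<iota> (Cod C f) \<odot> in1 g h) = in1 (pp f g) h \<cdot> (in2 f g \<odot> \<iota> (Cod C h)) \<cdot> asc_inv (Cod C f) (Dom C g) (Cod C h)"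
    "w \<cdot> in2 f (pp g h) \<cdot> (\<iota> (Cod C f) \<odot> in2 g h) = in2 (pp f g) h \<cdot> asc_inv (Cod C f) (Cod C g) (Dom C h)"
    by (rule tri_ex'[of f g h "in1 (pp f g) h \<cdot> (in1 f g \<odot> \<iota> (Cod C h)) \<cdot> asc_inv (Dom C f) (Cod C g) (Cod C h)"
      "in1 (pp f g) h \<cdot> (in2 f g \<odot> \<iota> (Cod C h)) \<cdot> asc_inv (Cod C f) (Dom C g) (Cod C h)"
      "in2 (pp f g) h \<cdot> asc_inv (Cod C f) (Cod C g) (Dom C h)"])
      (simp_all add: reassoc[OF 1] reassoc[OF 2] reassoc[OF 3])
  have "w \<cdot> asc0 f g h = \<iota> (Dom C (pp (pp f g) h))"
    by (rule tri_ext[of f g h])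
      (use arg_cong[OF w(5), of "\<lambda>t. t \<cdot> asc T (Cod C f) (Dom C g) (Cod C h)"]
        arg_cong[OF w(6), of "\<lambda>t. t \<cdot> asc T (Cod C f) (Cod C g) (Dom C h)"] in \<open>simp_all add: w(1-3) reassoc[OF w(4)]\<close>)
  moreover have "asc0 f g h \<cdot> w = \<iota> (Dom C (pp f (pp g h)))"
    by (rule tri_ext'[of f g h]) (simp_all add: w)
  ultimately show ?thesis using w by (intro is_isoI[of _ w]) simp_all
qed

lemma is_iso_square:
  assumes "s \<in> Arr \<A>" "is_iso C (sq0 s)" "is_iso C (sq1 s)"
  shows "is_iso \<A> s"
proof -
  interpret D: category \<A> by (rule category_arrow_cat)
  obtain u where u: "u \<in> Arr C" "Dom C u = Cod C (sq0 s)" "Cod C u = Dom C (sq0 s)"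
    "u \<cdot> sq0 s = \<iota> (Dom C (sq0 s))" "sq0 s \<cdot> u = \<iota> (Cod C (sq0 s))" by (rule is_isoE[OF assms(2)])
  obtain v where v: "v \<in> Arr C" "Dom C v = Cod C (sq1 s)" "Cod C v = Dom C (sq1 s)"
    "v \<cdot> sq1 s = \<iota> (Dom C (sq1 s))" "sq1 s \<cdot> v = \<iota> (Cod C (sq1 s))" by (rule is_isoE[OF assms(3)])
  note A = sq_Arr[OF assms(1)]
  have "v \<cdot> sq_tgt s = v \<cdot> (sq_tgt s \<cdot> sq0 s) \<cdot> u" using u v A by simp
  also have "\<dots> = v \<cdot> (sq1 s \<cdot> sq_src s) \<cdot> u" by (simp only: sq_commutes[OF assms(1)])
  also have "\<dots> = sq_src s \<cdot> u" using u v A reassoc[OF v(4), of "sq_src s \<cdot> u"] by simp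
  finally show ?thesis
    using u v A assms(1) by (intro D.is_isoI[of _ "Square (sq_tgt s) (sq_src s) u v"]) simp_all
qed

text \<open>The second piece, \<open>0\<close> tensored with the codomain of \<open>g\<close>, is
  initial: the map on it exists, and the gluing condition is an equation between maps out of an
  initial object.\<close>

lemma lun_run_exists:
  assumes [simp]: "g \<in> Arr C"
  shows "\<exists>w. w \<in> hom C (Dom C (pp (pp_unit C T) g)) (Dom C g) \<and> w \<cdot> in2 (pp_unit C T) g = lun T (Dom C g)"
    "\<exists>w. w \<in> hom C (Dom C (pp g (pp_unit C T))) (Dom C g) \<and> w \<cdot> in1 g (pp_unit C T) = run T (Dom C g)"
proof -
  let ?u = "pp_unit C T"
  have [simp]: "?u \<in> Arr C" "Dom C ?u = init C" "Cod C ?u = unt T" by (simp_all add: pp_unit_def)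
  interpret F: left_adjoint_functor C C "tensor_right C T (Cod C g)" by (rule left_adjoint_tensor) simp
  have "is_initial C (init C \<boxtimes> Cod C g)" using F.preserves_initial[OF is_initial_init] by (simp add: tensor_right_def)
  then obtain u where u: "u \<in> Arr C" "Dom C u = init C \<boxtimes> Cod C g" "Cod C u = Dom C g"
    unfolding is_initial_def by (metis Dom_Obj assms in_hom)
  have "u \<cdot> (\<iota> (Dom C ?u) \<odot> g) = lun T (Dom C g) \<cdot> (?u \<odot> \<iota> (Dom C g))"
    by (rule init_tensor_ext[of "Dom C g"]) (use u in simp_all)
  then show "\<exists>w. w \<in> hom C (Dom C (pp (pp_unit C T) g)) (Dom C g) \<and> w \<cdot> in2 (pp_unit C T) g = lun T (Dom C g)"
    using pp_map_rules[of ?u g u "lun T (Dom C g)"] u by auto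
  let ?v = "u \<cdot> brd T (Cod C g) (init C)"
  have "run T (Dom C g) \<cdot> (\<iota> (Dom C g) \<odot> ?u) = ?v \<cdot> (g \<odot> \<iota> (Dom C ?u))"
    by (rule tensor_init_ext[of "Dom C g"]) (use u in simp_all)
  then show "\<exists>w. w \<in> hom C (Dom C (pp g (pp_unit C T))) (Dom C g) \<and> w \<cdot> in1 g (pp_unit C T) = run T (Dom C g)"
    using pp_map_rules[of g ?u "run T (Dom C g)" ?v] u by auto
qed

lemma pp_unit_rules [simp]: "pp_unit C T \<in> Arr C" "Dom C (pp_unit C T) = init C" "Cod C (pp_unit C T) = unt T"
  by (simp_all add: pp_unit_def)

text \<open>One inclusion suffices to detect equality because the other piece of the domain is
  initial.\<close>

lemma pp_unit_ext:
  assumes "g \<in> Arr C" "h \<in> Arr C" "k \<in> Arr C" "Dom C h = Dom C (pp (pp_unit C T) g)" "Dom C k = Dom C (pp (pp_unit C T) g)" "Cod C k = Cod C h"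
    "h \<cdot> in2 (pp_unit C T) g = k \<cdot> in2 (pp_unit C T) g"
  shows "h = k"
proof (rule pp_ext[of "pp_unit C T" g])
  show "h \<cdot> in1 (pp_unit C T) g = k \<cdot> in1 (pp_unit C T) g" by (rule init_tensor_ext[of "Cod C g"]) (use assms in simp_all)
qed (use assms in simp_all)

lemma pp_unit_ext':
  assumes "g \<in> Arr C" "h \<in> Arr C" "k \<in> Arr C" "Dom C h = Dom C (pp g (pp_unit C T))" "Dom C k = Dom C (pp g (pp_unit C T))" "Cod C k = Cod C h"
    "h \<cdot> in1 g (pp_unit C T) = k \<cdot> in1 g (pp_unit C T)"
  shows "h = k"
proof (rule pp_ext[of g "pp_unit C T"])
  show "h \<cdot> in2 g (pp_unit C T) = k \<cdot> in2 g (pp_unit C T)" by (rule tensor_init_ext[of "Cod C g"]) (use assms in simp_all)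
qed (use assms in simp_all)

lemma lun0_rules [simp]:
  assumes [simp]: "g \<in> Arr C"
  shows "lun0 g \<in> Arr C" "Dom C (lun0 g) = Dom C (pp (pp_unit C T) g)" "Cod C (lun0 g) = Dom C g"
    "lun0 g \<cdot> in2 (pp_unit C T) g = lun T (Dom C g)"
proof -
  let ?P = "\<lambda>w. w \<in> hom C (Dom C (pp (pp_unit C T) g)) (Dom C g) \<and> w \<cdot> in2 (pp_unit C T) g = lun T (Dom C g)"
  obtain w where w: "?P w" using lun_run_exists(1)[OF assms] by blast
  have "v = w" if "?P v" for v by (rule pp_unit_ext[OF assms]) (use that w in simp_all)
  then have "(THE w. ?P w) = w" using w by (intro the_equality) blast+
  then have "lun0 g = w" by (simp add: lun0_def pp_lunit_def Let_def)
  then show "lun0 g \<in> Arr C" "Dom C (lun0 g) = Dom C (pp (pp_unit C T) g)" "Cod C (lun0 g) = Dom C g"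
    "lun0 g \<cdot> in2 (pp_unit C T) g = lun T (Dom C g)" using w by auto
qed

lemma run0_rules [simp]:
  assumes [simp]: "g \<in> Arr C"
  shows "run0 g \<in> Arr C" "Dom C (run0 g) = Dom C (pp g (pp_unit C T))" "Cod C (run0 g) = Dom C g"
    "run0 g \<cdot> in1 g (pp_unit C T) = run T (Dom C g)"
proof -
  let ?P = "\<lambda>w. w \<in> hom C (Dom C (pp g (pp_unit C T))) (Dom C g) \<and> w \<cdot> in1 g (pp_unit C T) = run T (Dom C g)"
  obtain w where w: "?P w" using lun_run_exists(2)[OF assms] by blast
  have "v = w" if "?P v" for v by (rule pp_unit_ext'[OF assms]) (use that w in simp_all)
  then have "(THE w. ?P w) = w" using w by (intro the_equality) blast+
  then have "run0 g = w" by (simp add: run0_def pp_runit_def Let_def)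
  then show "run0 g \<in> Arr C" "Dom C (run0 g) = Dom C (pp g (pp_unit C T))" "Cod C (run0 g) = Dom C g"
    "run0 g \<cdot> in1 g (pp_unit C T) = run T (Dom C g)" using w by auto
qed

lemma lun0_tail [simp]:
  "g \<in> Arr C \<Longrightarrow> x \<in> Arr C \<Longrightarrow> Cod C x = unt T \<boxtimes> Dom C g \<Longrightarrow> lun0 g \<cdot> in2 (pp_unit C T) g \<cdot> x = lun T (Dom C g) \<cdot> x"
  and run0_tail [simp]:
  "g \<in> Arr C \<Longrightarrow> x \<in> Arr C \<Longrightarrow> Cod C x = Dom C g \<boxtimes> unt T \<Longrightarrow> run0 g \<cdot> in1 g (pp_unit C T) \<cdot> x = run T (Dom C g) \<cdot> x"
  by (simp_all add: reassoc[OF lun0_rules(4)] reassoc[OF run0_rules(4)])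

lemma lun0_iso:
  assumes [simp]: "g \<in> Arr C"
  shows "is_iso C (lun0 g)"
proof -
  obtain l where l: "l \<in> Arr C" "Dom C l = Dom C g" "Cod C l = unt T \<boxtimes> Dom C g"
    "l \<cdot> lun T (Dom C g) = \<iota> (unt T \<boxtimes> Dom C g)" "lun T (Dom C g) \<cdot> l = \<iota> (Dom C g)"
    by (rule is_isoE[OF lun_iso[of "Dom C g"]]) simp_all
  have "(in2 (pp_unit C T) g \<cdot> l) \<cdot> lun0 g = \<iota> (Dom C (pp (pp_unit C T) g))"
    by (rule pp_unit_ext[of g]) (use l in simp_all)
  then show ?thesis
    using l reassoc[OF lun0_rules(4), of g l] by (intro is_isoI[of _ "in2 (pp_unit C T) g \<cdot> l"]) simp_all
qed

lemma run0_iso: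
  assumes [simp]: "g \<in> Arr C"
  shows "is_iso C (run0 g)"
proof -
  obtain l where l: "l \<in> Arr C" "Dom C l = Dom C g" "Cod C l = Dom C g \<boxtimes> unt T"
    "l \<cdot> run T (Dom C g) = \<iota> (Dom C g \<boxtimes> unt T)" "run T (Dom C g) \<cdot> l = \<iota> (Dom C g)"
    by (rule is_isoE[OF run_iso[of "Dom C g"]]) simp_all
  have "(in1 g (pp_unit C T) \<cdot> l) \<cdot> run0 g = \<iota> (Dom C (pp g (pp_unit C T)))"
    by (rule pp_unit_ext'[of g]) (use l in simp_all)
  then show ?thesis
    using l reassoc[OF run0_rules(4), of g l] by (intro is_isoI[of _ "in1 g (pp_unit C T) \<cdot> l"]) simp_all
qed

lemma pp_lunit_Arr [simp]:
  assumes [simp]: "g \<in> Arr C"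
  shows "pp_lunit C T g \<in> Arr \<A>"
proof -
  have "lun T (Cod C g) \<cdot> pp (pp_unit C T) g = g \<cdot> lun0 g"
    by (rule pp_unit_ext[of g]) (simp_all add: lun_nat)
  then show ?thesis unfolding pp_lunit_eq by simp
qed

lemma pp_runit_Arr [simp]:
  assumes [simp]: "g \<in> Arr C"
  shows "pp_runit C T g \<in> Arr \<A>"
proof -
  have "run T (Cod C g) \<cdot> pp g (pp_unit C T) = g \<cdot> run0 g"
    by (rule pp_unit_ext'[of g]) (simp_all add: run_nat)
  then show ?thesis unfolding pp_runit_eq by simp
qed

lemma brd0_rules [simp]:
  assumes [simp]: "f \<in> Arr C" "g \<in> Arr C"
  shows "brd0 f g \<in> Arr C" "Dom C (brd0 f g) = Dom C (pp f g)" "Cod C (brd0 f g) = Dom C (pp g f)"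
    "brd0 f g \<cdot> in1 f g = in2 g f \<cdot> brd T (Dom C f) (Cod C g)" "brd0 f g \<cdot> in2 f g = in1 g f \<cdot> brd T (Cod C f) (Dom C g)"
proof -
  have "in1 g f \<cdot> (\<iota> (Dom C g) \<odot> f) = in2 g f \<cdot> (g \<odot> \<iota> (Dom C f))"
    using in_glue[of g f "\<iota> (Dom C g)" "\<iota> (Dom C f)"] by simp
  then have "in2 g f \<cdot> brd T (Dom C f) (Cod C g) \<cdot> (\<iota> (Dom C f) \<odot> g) = in1 g f \<cdot> brd T (Cod C f) (Dom C g) \<cdot> (f \<odot> \<iota> (Dom C g))"
    using reassoc[of "in1 g f" "\<iota> (Dom C g) \<odot> f" "in2 g f \<cdot> (g \<odot> \<iota> (Dom C f))" "brd T (Dom C f) (Dom C g)"] by simp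
  then show "brd0 f g \<in> Arr C" "Dom C (brd0 f g) = Dom C (pp f g)" "Cod C (brd0 f g) = Dom C (pp g f)"
    "brd0 f g \<cdot> in1 f g = in2 g f \<cdot> brd T (Dom C f) (Cod C g)" "brd0 f g \<cdot> in2 f g = in1 g f \<cdot> brd T (Cod C f) (Dom C g)"
    unfolding brd0_def pp_sym_def
    using pp_map_rules[of f g "in2 g f \<cdot> brd T (Dom C f) (Cod C g)" "in1 g f \<cdot> brd T (Cod C f) (Dom C g)"] by simp_all
qed

lemma brd0_tail [simp]:
  assumes [simp]: "f \<in> Arr C" "g \<in> Arr C" "x \<in> Arr C"
  shows "Cod C x = Dom C f \<boxtimes> Cod C g \<Longrightarrow> brd0 f g \<cdot> in1 f g \<cdot> x = in2 g f \<cdot> brd T (Dom C f) (Cod C g) \<cdot> x"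
    "Cod C x = Cod C f \<boxtimes> Dom C g \<Longrightarrow> brd0 f g \<cdot> in2 f g \<cdot> x = in1 g f \<cdot> brd T (Cod C f) (Dom C g) \<cdot> x"
  using reassoc[OF brd0_rules(4)[OF assms(1,2)], of x] reassoc[OF brd0_rules(5)[OF assms(1,2)], of x] by simp_all

lemma pp_sym_Arr [simp]:
  assumes [simp]: "f \<in> Arr C" "g \<in> Arr C"
  shows "pp_sym C T f g \<in> Arr \<A>"
proof -
  have "brd T (Cod C f) (Cod C g) \<cdot> pp f g = pp g f \<cdot> brd0 f g"
    by (rule pp_ext[of f g]) simp_all
  then show ?thesis unfolding pp_sym_eq by simp
qed

lemma structure_squares [simp]:
  "sq_src (pp_square C T a b) = pp (sq_src a) (sq_src b)" "sq_tgt (pp_square C T a b) = pp (sq_tgt a) (sq_tgt b)"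
  "sq0 (pp_square C T a b) = pp0 a b" "sq1 (pp_square C T a b) = sq1 a \<odot> sq1 b"
  "sq_src (pp_assoc C T f g h) = pp (pp f g) h" "sq_tgt (pp_assoc C T f g h) = pp f (pp g h)"
  "sq0 (pp_assoc C T f g h) = asc0 f g h" "sq1 (pp_assoc C T f g h) = asc T (Cod C f) (Cod C g) (Cod C h)"
  "sq_src (pp_lunit C T g) = pp (pp_unit C T) g" "sq_tgt (pp_lunit C T g) = g" "sq0 (pp_lunit C T g) = lun0 g"
  "sq1 (pp_lunit C T g) = lun T (Cod C g)"
  "sq_src (pp_runit C T f) = pp f (pp_unit C T)" "sq_tgt (pp_runit C T f) = f" "sq0 (pp_runit C T f) = run0 f"
  "sq1 (pp_runit C T f) = run T (Cod C f)"
  "sq_src (pp_sym C T f g) = pp f g" "sq_tgt (pp_sym C T f g) = pp g f" "sq0 (pp_sym C T f g) = brd0 f g"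
  "sq1 (pp_sym C T f g) = brd T (Cod C f) (Cod C g)"
  by (simp_all add: pp_square_eq pp_assoc_eq pp_lunit_eq pp_runit_eq pp_sym_eq)

lemma pp0_in1 [simp]:
  "a \<in> Arr \<A> \<Longrightarrow> b \<in> Arr \<A> \<Longrightarrow> sq_src a = f \<Longrightarrow> sq_src b = g \<Longrightarrow>
    pp0 a b \<cdot> in1 f g = in1 (sq_tgt a) (sq_tgt b) \<cdot> (sq0 a \<odot> sq1 b)"
  and pp0_in2 [simp]:
  "a \<in> Arr \<A> \<Longrightarrow> b \<in> Arr \<A> \<Longrightarrow> sq_src a = f \<Longrightarrow> sq_src b = g \<Longrightarrow>
    pp0 a b \<cdot> in2 f g = in2 (sq_tgt a) (sq_tgt b) \<cdot> (sq1 a \<odot> sq0 b)"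
  using pp0_rules(4,5) by blast+

lemma pp0_in1_tail [simp]:
  "a \<in> Arr \<A> \<Longrightarrow> b \<in> Arr \<A> \<Longrightarrow> sq_src a = f \<Longrightarrow> sq_src b = g \<Longrightarrow> x \<in> Arr C \<Longrightarrow> Cod C x = Dom C f \<boxtimes> Cod C g \<Longrightarrow>
    pp0 a b \<cdot> in1 f g \<cdot> x = in1 (sq_tgt a) (sq_tgt b) \<cdot> (sq0 a \<odot> sq1 b) \<cdot> x"
  and pp0_in2_tail [simp]:
  "a \<in> Arr \<A> \<Longrightarrow> b \<in> Arr \<A> \<Longrightarrow> sq_src a = f \<Longrightarrow> sq_src b = g \<Longrightarrow> x \<in> Arr C \<Longrightarrow> Cod C x = Cod C f \<boxtimes> Dom C g \<Longrightarrow>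
    pp0 a b \<cdot> in2 f g \<cdot> x = in2 (sq_tgt a) (sq_tgt b) \<cdot> (sq1 a \<odot> sq0 b) \<cdot> x"
  using reassoc[OF pp0_rules(4), of a b x] reassoc[OF pp0_rules(5), of a b x] by (auto simp del: pp0_rules(4,5))

section \<open>The coherence equations\<close>

lemma pentagon_tail:
  "W \<in> Obj C \<Longrightarrow> X \<in> Obj C \<Longrightarrow> Y \<in> Obj C \<Longrightarrow> Z \<in> Obj C \<Longrightarrow> x \<in> Arr C \<Longrightarrow> Cod C x = ((W \<boxtimes> X) \<boxtimes> Y) \<boxtimes> Z \<Longrightarrow>
    asc T W X (Y \<boxtimes> Z) \<cdot> asc T (W \<boxtimes> X) Y Z \<cdot> x = (\<iota> W \<odot> asc T X Y Z) \<cdot> asc T W (X \<boxtimes> Y) Z \<cdot> (asc T W X Y \<odot> \<iota> Z) \<cdot> x"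
  using arg_cong[OF pentagon, of W X Y Z "\<lambda>t. t \<cdot> x"] by simp

lemma is_bifunctor_pp: "is_bifunctor \<A> Q"
  unfolding is_bifunctor_def Q_simps
proof (intro conjI ballI impI)
  fix X Y assume "X \<in> Obj \<A>" "Y \<in> Obj \<A>"
  then have [simp]: "X \<in> Arr C" "Y \<in> Arr C" by simp_all
  show "pp X Y \<in> Obj \<A>" by simp
  have "pp0 (Idt \<A> X) (Idt \<A> Y) = \<iota> (Dom C (pp X Y))"
    by (rule pp_ext[of X Y]) simp_all
  then show "pp_square C T (Idt \<A> X) (Idt \<A> Y) = Idt \<A> (pp X Y)"
    by (intro square_eqI) simp_all
next
  fix a b assume "a \<in> Arr \<A>" "b \<in> Arr \<A>"
  then show "pp_square C T a b \<in> hom \<A> (pp (Dom \<A> a) (Dom \<A> b)) (pp (Cod \<A> a) (Cod \<A> b))"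
    by simp
next
  fix a a' b b' assume A: "a \<in> Arr \<A>" "a' \<in> Arr \<A>" "b \<in> Arr \<A>" "b' \<in> Arr \<A>"
    "Dom \<A> a' = Cod \<A> a" "Dom \<A> b' = Cod \<A> b"
  interpret D: category \<A> by (rule category_arrow_cat)
  define a2 b2 where ab: "a2 = a' \<cdot>\<^bsub>\<A>\<^esub> a" "b2 = b' \<cdot>\<^bsub>\<A>\<^esub> b"
  have [simp]: "a2 \<in> Arr \<A>" "b2 \<in> Arr \<A>" unfolding ab using A by (intro D.comp_Arr; simp)+
  have [simp]: "sq_src a2 = sq_src a" "sq_tgt a2 = sq_tgt a'" "sq0 a2 = sq0 a' \<cdot> sq0 a" "sq1 a2 = sq1 a' \<cdot> sq1 a"
    "sq_src b2 = sq_src b" "sq_tgt b2 = sq_tgt b'" "sq0 b2 = sq0 b' \<cdot> sq0 b" "sq1 b2 = sq1 b' \<cdot> sq1 b" by (simp_all add: ab)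
  have "pp0 a2 b2 = pp0 a' b' \<cdot> pp0 a b"
    by (rule pp_ext[of "sq_src a" "sq_src b"]) (use A in simp_all)
  then show "pp_square C T (a' \<cdot>\<^bsub>\<A>\<^esub> a) (b' \<cdot>\<^bsub>\<A>\<^esub> b) = pp_square C T a' b' \<cdot>\<^bsub>\<A>\<^esub> pp_square C T a b"
    unfolding ab[symmetric] by (intro square_eqI) (use A in simp_all)
qed

lemma pp_asc_natural:
  assumes [simp]: "a \<in> Arr \<A>" "b \<in> Arr \<A>" "c \<in> Arr \<A>"
  shows "asc0 (sq_tgt a) (sq_tgt b) (sq_tgt c) \<cdot> pp0 (pp_square C T a b) c = pp0 a (pp_square C T b c) \<cdot> asc0 (sq_src a) (sq_src b) (sq_src c)"
  by (rule tri_ext[of "sq_src a" "sq_src b" "sq_src c"]) simp_all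

text \<open>There are four pieces: the three for the triple \<open>pp f g\<close>, \<open>h\<close>,
  \<open>k\<close>, the first of which contains the domain of \<open>pp f g\<close> tensored twice
  only after one more splitting. On each piece the claim reduces to the pentagon of
  \<open>C\<close>.\<close>

lemma pp_pentagon:
  assumes [simp]: "f \<in> Arr C" "g \<in> Arr C" "h \<in> Arr C" "k \<in> Arr C"
  shows "asc0 f g (pp h k) \<cdot> asc0 (pp f g) h k =
    pp0 (Idt \<A> f) (pp_assoc C T g h k) \<cdot> asc0 f (pp g h) k \<cdot> pp0 (pp_assoc C T f g h) (Idt \<A> k)" (is "?l = ?r")
proof (rule tri_ext[of "pp f g" h k])
  show "?l \<cdot> in1 (pp (pp f g) h) k \<cdot> (in1 (pp f g) h \<odot> \<iota> (Cod C k)) = ?r \<cdot> in1 (pp (pp f g) h) k \<cdot> (in1 (pp f g) h \<odot> \<iota> (Cod C k))"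
    \<comment> \<open>Here the pieces come from the pushout of \<open>f\<close> and \<open>g\<close>
      tensored with the codomains of \<open>h\<close> and \<open>k\<close>, which is still a
      pushout.\<close>
    by (rule is_pushout_ext[OF tensor_pushout[OF tensor_pushout[OF pp_is_pushout[of f g], of "Cod C h"], of "Cod C k"]])
      (simp_all add: pentagon pentagon_tail)
qed (simp_all add: pentagon pentagon_tail)

text \<open>On the two pieces where the middle factor is the unit the claim is the triangle of
  \<open>C\<close>. On the third piece the middle factor is \<open>0\<close>; braiding it to the
  front exhibits the piece as initial.\<close>

lemma pp_triangle:
  assumes [simp]: "f \<in> Arr C" "g \<in> Arr C"
  shows "pp0 (Idt \<A> f) (pp_lunit C T g) \<cdot> asc0 f (pp_unit C T) g = pp0 (pp_runit C T f) (Idt \<A> g)" (is "?l = ?r")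
proof (rule tri_ext[of f "pp_unit C T" g])
  interpret F: left_adjoint_functor C C "tensor_right C T (Cod C g)" by (rule left_adjoint_tensor) simp
  interpret G: left_adjoint_functor C C "tensor_right C T (Cod C f)" by (rule left_adjoint_tensor) simp
  have i: "is_initial C ((init C \<boxtimes> Cod C f) \<boxtimes> Cod C g)"
    using F.preserves_initial[OF G.preserves_initial[OF is_initial_init]] by (simp add: tensor_right_def)
  let ?e = "in1 (pp f (pp_unit C T)) g \<cdot> (in2 f (pp_unit C T) \<odot> \<iota> (Cod C g))"
  let ?b = "brd T (init C) (Cod C f) \<odot> \<iota> (Cod C g)" and ?b' = "brd T (Cod C f) (init C) \<odot> \<iota> (Cod C g)"
  have "(?l \<cdot> ?e) \<cdot> ?b = (?r \<cdot> ?e) \<cdot> ?b" by (rule is_initial_ext[OF i]) simp_all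
  then have "((?l \<cdot> ?e) \<cdot> ?b) \<cdot> ?b' = ((?r \<cdot> ?e) \<cdot> ?b) \<cdot> ?b'" by simp
  moreover have "(x \<cdot> ?b) \<cdot> ?b' = x" if "x \<in> Arr C" "Dom C x = (Cod C f \<boxtimes> init C) \<boxtimes> Cod C g" for x using that by simp
  ultimately show "?l \<cdot> ?e = ?r \<cdot> ?e" by simp
qed (simp_all add: triangle)

lemma is_monoidal_pp: "is_monoidal \<A> Q"
  unfolding is_monoidal_def Q_simps
proof (intro conjI ballI impI)
  show "is_bifunctor \<A> Q" by (rule is_bifunctor_pp)
  show "pp_unit C T \<in> Obj \<A>" by simp
next
  fix f g h assume "f \<in> Obj \<A>" "g \<in> Obj \<A>" "h \<in> Obj \<A>"
  then have [simp]: "f \<in> Arr C" "g \<in> Arr C" "h \<in> Arr C" by simp_all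
  show "pp_assoc C T f g h \<in> hom \<A> (pp (pp f g) h) (pp f (pp g h))" by simp
  show "is_iso \<A> (pp_assoc C T f g h)" by (rule is_iso_square) (simp_all add: asc0_iso asc_iso)
next
  fix f assume "f \<in> Obj \<A>"
  then have [simp]: "f \<in> Arr C" by simp
  show "pp_lunit C T f \<in> hom \<A> (pp (pp_unit C T) f) f" "pp_runit C T f \<in> hom \<A> (pp f (pp_unit C T)) f" by simp_all
  show "is_iso \<A> (pp_lunit C T f)" by (rule is_iso_square) (simp_all add: lun0_iso lun_iso)
  show "is_iso \<A> (pp_runit C T f)" by (rule is_iso_square) (simp_all add: run0_iso run_iso)
next
  fix a b c assume A [simp]: "a \<in> Arr \<A>" "b \<in> Arr \<A>" "c \<in> Arr \<A>"
  show "pp_assoc C T (Cod \<A> a) (Cod \<A> b) (Cod \<A> c) \<cdot>\<^bsub>\<A>\<^esub> pp_square C T (pp_square C T a b) c =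
      pp_square C T a (pp_square C T b c) \<cdot>\<^bsub>\<A>\<^esub> pp_assoc C T (Dom \<A> a) (Dom \<A> b) (Dom \<A> c)"
    by (rule square_eqI) (simp_all add: pp_asc_natural)
next
  fix a assume A [simp]: "a \<in> Arr \<A>"
  have "lun0 (sq_tgt a) \<cdot> pp0 (Idt \<A> (pp_unit C T)) a = sq0 a \<cdot> lun0 (sq_src a)"
    by (rule pp_unit_ext[of "sq_src a"]) (use lun_nat[of "sq0 a"] in simp_all)
  then show "pp_lunit C T (Cod \<A> a) \<cdot>\<^bsub>\<A>\<^esub> pp_square C T (Idt \<A> (pp_unit C T)) a =
      a \<cdot>\<^bsub>\<A>\<^esub> pp_lunit C T (Dom \<A> a)"
    by (intro square_eqI) (use lun_nat[of "sq1 a"] in simp_all)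
  have "run0 (sq_tgt a) \<cdot> pp0 a (Idt \<A> (pp_unit C T)) = sq0 a \<cdot> run0 (sq_src a)"
    by (rule pp_unit_ext'[of "sq_src a"]) (use run_nat[of "sq0 a"] in simp_all)
  then show "pp_runit C T (Cod \<A> a) \<cdot>\<^bsub>\<A>\<^esub> pp_square C T a (Idt \<A> (pp_unit C T)) =
      a \<cdot>\<^bsub>\<A>\<^esub> pp_runit C T (Dom \<A> a)"
    by (intro square_eqI) (use run_nat[of "sq1 a"] in simp_all)
next
  fix f g h k assume "f \<in> Obj \<A>" "g \<in> Obj \<A>" "h \<in> Obj \<A>" "k \<in> Obj \<A>"
  then have [simp]: "f \<in> Arr C" "g \<in> Arr C" "h \<in> Arr C" "k \<in> Arr C" by simp_all
  show "pp_assoc C T f g (pp h k) \<cdot>\<^bsub>\<A>\<^esub> pp_assoc C T (pp f g) h k =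
      pp_square C T (Idt \<A> f) (pp_assoc C T g h k) \<cdot>\<^bsub>\<A>\<^esub>
      pp_assoc C T f (pp g h) k \<cdot>\<^bsub>\<A>\<^esub> pp_square C T (pp_assoc C T f g h) (Idt \<A> k)"
    using pp_pentagon[of f g h k] by (intro square_eqI) (simp_all add: pentagon)
next
  fix f g assume "f \<in> Obj \<A>" "g \<in> Obj \<A>"
  then have [simp]: "f \<in> Arr C" "g \<in> Arr C" by simp_all
  show "pp_square C T (Idt \<A> f) (pp_lunit C T g) \<cdot>\<^bsub>\<A>\<^esub> pp_assoc C T f (pp_unit C T) g =
      pp_square C T (pp_runit C T f) (Idt \<A> g)"
    using pp_triangle[of f g] by (intro square_eqI) (simp_all add: triangle)
qed

lemma hexagon_tail:
  "X \<in> Obj C \<Longrightarrow> Y \<in> Obj C \<Longrightarrow> Z \<in> Obj C \<Longrightarrow> x \<in> Arr C \<Longrightarrow> Cod C x = (X \<boxtimes> Y) \<boxtimes> Z \<Longrightarrow>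
    asc T Y Z X \<cdot> brd T X (Y \<boxtimes> Z) \<cdot> asc T X Y Z \<cdot> x = (\<iota> Y \<odot> brd T X Z) \<cdot> asc T Y X Z \<cdot> (brd T X Y \<odot> \<iota> Z) \<cdot> x"
  using arg_cong[OF hexagon, of X Y Z "\<lambda>t. t \<cdot> x"] by simp

lemma pp_hexagon:
  assumes [simp]: "f \<in> Arr C" "g \<in> Arr C" "h \<in> Arr C"
  shows "asc0 g h f \<cdot> brd0 f (pp g h) \<cdot> asc0 f g h =
    pp0 (Idt \<A> g) (pp_sym C T f h) \<cdot> asc0 g f h \<cdot> pp0 (pp_sym C T f g) (Idt \<A> h)"
  by (rule tri_ext[of f g h]) (simp_all add: hexagon hexagon_tail)

lemma is_symmetric_monoidal_pp: "is_symmetric_monoidal \<A> Q"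
  unfolding is_symmetric_monoidal_def Q_simps
proof (intro conjI ballI impI)
  show "is_monoidal \<A> Q" by (rule is_monoidal_pp)
next
  fix f g assume "f \<in> Obj \<A>" "g \<in> Obj \<A>"
  then have [simp]: "f \<in> Arr C" "g \<in> Arr C" by simp_all
  show "pp_sym C T f g \<in> hom \<A> (pp f g) (pp g f)" by simp
  have "brd0 g f \<cdot> brd0 f g = \<iota> (Dom C (pp f g))" by (rule pp_ext[of f g]) simp_all
  then show "pp_sym C T g f \<cdot>\<^bsub>\<A>\<^esub> pp_sym C T f g = Idt \<A> (pp f g)"
    by (intro square_eqI) simp_all
next
  fix a b assume [simp]: "a \<in> Arr \<A>" "b \<in> Arr \<A>"
  have "brd0 (sq_tgt a) (sq_tgt b) \<cdot> pp0 a b = pp0 b a \<cdot> brd0 (sq_src a) (sq_src b)"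
    by (rule pp_ext[of "sq_src a" "sq_src b"]) simp_all
  then show "pp_sym C T (Cod \<A> a) (Cod \<A> b) \<cdot>\<^bsub>\<A>\<^esub> pp_square C T a b =
      pp_square C T b a \<cdot>\<^bsub>\<A>\<^esub> pp_sym C T (Dom \<A> a) (Dom \<A> b)"
    by (intro square_eqI) simp_all
next
  fix f assume "f \<in> Obj \<A>"
  then have [simp]: "f \<in> Arr C" by simp
  have "lun0 f \<cdot> brd0 f (pp_unit C T) = run0 f"
    by (rule pp_unit_ext'[of f]) (simp_all add: lun_brd reassoc[OF lun0_rules(4)])
  then show "pp_lunit C T f \<cdot>\<^bsub>\<A>\<^esub> pp_sym C T f (pp_unit C T) = pp_runit C T f"
    by (intro square_eqI) (simp_all add: lun_brd)
next
  fix f g h assume "f \<in> Obj \<A>" "g \<in> Obj \<A>" "h \<in> Obj \<A>"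
  then have [simp]: "f \<in> Arr C" "g \<in> Arr C" "h \<in> Arr C" by simp_all
  show "pp_assoc C T g h f \<cdot>\<^bsub>\<A>\<^esub> pp_sym C T f (pp g h) \<cdot>\<^bsub>\<A>\<^esub> pp_assoc C T f g h =
      pp_square C T (Idt \<A> g) (pp_sym C T f h) \<cdot>\<^bsub>\<A>\<^esub>
      pp_assoc C T g f h \<cdot>\<^bsub>\<A>\<^esub> pp_square C T (pp_sym C T f g) (Idt \<A> h)"
    using pp_hexagon[of f g h] by (intro square_eqI) (simp_all add: hexagon)
qed

end

section \<open>Internal homs of arrows\<close>

context closed_sym_mon
begin

text \<open>\<open>H\<close> is an internal hom from \<open>Z\<close> to \<open>b\<close> with
  evaluation \<open>ev\<close>: the universal arrow of tensoring with \<open>Z\<close>, unfolded so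
  that no functor record appears in its rules.\<close>

definition is_evaluation :: "'o \<Rightarrow> 'o \<Rightarrow> 'o \<Rightarrow> 'm \<Rightarrow> bool" where
  "is_evaluation Z b H ev \<longleftrightarrow> H \<in> Obj C \<and> ev \<in> Arr C \<and> Dom C ev = H \<boxtimes> Z \<and> Cod C ev = b \<and>
    (\<forall>h a. h \<in> Arr C \<longrightarrow> a \<in> Obj C \<longrightarrow> Dom C h = a \<boxtimes> Z \<longrightarrow> Cod C h = b \<longrightarrow>
       (\<exists>k. k \<in> Arr C \<and> Dom C k = a \<and> Cod C k = H \<and> ev \<cdot> (k \<odot> \<iota> Z) = h)) \<and>
    (\<forall>k l. k \<in> Arr C \<longrightarrow> l \<in> Arr C \<longrightarrow> Dom C k = Dom C l \<longrightarrow> Cod C k = H \<longrightarrow> Cod C l = H \<longrightarrow>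
       ev \<cdot> (k \<odot> \<iota> Z) = ev \<cdot> (l \<odot> \<iota> Z) \<longrightarrow> k = l)"

lemma evaluation_exists:
  assumes "Z \<in> Obj C" "b \<in> Obj C"
  shows "\<exists>H ev. is_evaluation Z b H ev"
proof -
  interpret F: left_adjoint_functor C C "tensor_right C T Z" by (rule left_adjoint_tensor[OF assms(1)])
  obtain g e where "universal_arrow C C (tensor_right C T Z) b g e" using F.universal_arrow_exists[OF assms(2)] by blast
  note U = F.universal_arrow_props[OF this, unfolded tensor_right_def cfunctor.simps]
  show ?thesis
    unfolding is_evaluation_def by (rule exI[of _ g], rule exI[of _ e]) (use U in blast)
qed

lemma is_functor_tensor_right:
  assumes [simp]: "g \<in> Arr C"
  shows "is_functor \<A> \<A> (tensor_right \<A> Q g)"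
proof -
  have B: "\<And>X Y. X \<in> Arr C \<Longrightarrow> Y \<in> Arr C \<Longrightarrow> pp_square C T (Idt \<A> X) (Idt \<A> Y) = Idt \<A> (pp X Y)"
    "\<And>a a' b b'. a \<in> Arr \<A> \<Longrightarrow> a' \<in> Arr \<A> \<Longrightarrow> b \<in> Arr \<A> \<Longrightarrow> b' \<in> Arr \<A> \<Longrightarrow>
      sq_src a' = sq_tgt a \<Longrightarrow> sq_src b' = sq_tgt b \<Longrightarrow>
      pp_square C T (a' \<cdot>\<^bsub>\<A>\<^esub> a) (b' \<cdot>\<^bsub>\<A>\<^esub> b) = pp_square C T a' b' \<cdot>\<^bsub>\<A>\<^esub> pp_square C T a b"
    using is_bifunctor_pp unfolding is_bifunctor_def Q_simps arrow_cat_simps(1-3) by blast+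
  interpret D: category \<A> by (rule category_arrow_cat)
  show ?thesis
  proof (rule is_functorI)
    fix X assume "X \<in> Obj \<A>"
    then show "far (tensor_right \<A> Q g) (Idt \<A> X) = Idt \<A> (fob (tensor_right \<A> Q g) X)"
      using B(1)[of X g] unfolding tensor_right_def Q_simps cfunctor.simps by simp
  next
    fix a b assume ab: "a \<in> Arr \<A>" "b \<in> Arr \<A>" "Dom \<A> b = Cod \<A> a"
    have "Idt \<A> g \<cdot>\<^bsub>\<A>\<^esub> Idt \<A> g = Idt \<A> g" by simp
    then show "far (tensor_right \<A> Q g) (b \<cdot>\<^bsub>\<A>\<^esub> a) =
        far (tensor_right \<A> Q g) b \<cdot>\<^bsub>\<A>\<^esub> far (tensor_right \<A> Q g) a"
      using B(2)[of a b "Idt \<A> g" "Idt \<A> g"] ab unfolding tensor_right_def Q_simps cfunctor.simps by simp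
  qed (simp_all add: tensor_right_def)
qed

text \<open>The internal hom from \<open>g\<close> to \<open>e\<close> is \<open>[Y\<^sub>1, E\<^sub>0] \<rightarrow> [Y\<^sub>0, E\<^sub>0] \<times>\<^bsub>[Y\<^sub>0, E\<^sub>1]\<^esub> [Y\<^sub>1, E\<^sub>1]\<close>.\<close>

lemma pp_left_adjoint:
  assumes pb: "\<And>r s. r \<in> Arr C \<Longrightarrow> s \<in> Arr C \<Longrightarrow> Cod C r = Cod C s \<Longrightarrow> \<exists>p q. is_pushout (opposite C) r s p q"
    and g [simp]: "g \<in> Arr C"
  shows "left_adjoint \<A> \<A> (tensor_right \<A> Q g)"
proof (rule left_adjointI[OF is_category_arrow_cat is_category_arrow_cat is_functor_tensor_right[OF g]])
  interpret op: category "opposite C" by (rule category.intro) (rule is_category_opposite[OF is_category])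
  fix e assume "e \<in> Obj \<A>"
  then have e [simp]: "e \<in> Arr C" by simp
  obtain H ev where "\<And>Z b. Z \<in> Obj C \<Longrightarrow> b \<in> Obj C \<Longrightarrow> is_evaluation Z b (H Z b) (ev Z b)"
    using evaluation_exists by metis
  then have H [simp]: "H Z b \<in> Obj C" "ev Z b \<in> Arr C" "Dom C (ev Z b) = H Z b \<boxtimes> Z" "Cod C (ev Z b) = b"
    and curry: "\<And>h a. h \<in> Arr C \<Longrightarrow> a \<in> Obj C \<Longrightarrow> Dom C h = a \<boxtimes> Z \<Longrightarrow> Cod C h = b \<Longrightarrow>
       \<exists>k. k \<in> Arr C \<and> Dom C k = a \<and> Cod C k = H Z b \<and> ev Z b \<cdot> (k \<odot> \<iota> Z) = h"
    and ev_ext: "\<And>k l. k \<in> Arr C \<Longrightarrow> l \<in> Arr C \<Longrightarrow> Dom C k = Dom C l \<Longrightarrow> Cod C k = H Z b \<Longrightarrow> Cod C l = H Z b \<Longrightarrow>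
       ev Z b \<cdot> (k \<odot> \<iota> Z) = ev Z b \<cdot> (l \<odot> \<iota> Z) \<Longrightarrow> k = l"
    if "Z \<in> Obj C" "b \<in> Obj C" for Z b
    using that unfolding is_evaluation_def by blast+
  let ?Y0 = "Dom C g" and ?Y1 = "Cod C g" and ?E0 = "Dom C e" and ?E1 = "Cod C e"
  \<comment> \<open>The four maps between internal homs: \<open>\<pi>\<close> and \<open>s\<close>
    restrict along \<open>g\<close>, with values in the domain and in the codomain of
    \<open>e\<close> respectively; \<open>r\<close> and \<open>t\<close> compose with
    \<open>e\<close> on maps out of the domain and of the codomain of \<open>g\<close>.\<close>
  obtain \<pi> where \<pi>: "\<pi> \<in> Arr C" "Dom C \<pi> = H ?Y1 ?E0" "Cod C \<pi> = H ?Y0 ?E0"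
    "ev ?Y0 ?E0 \<cdot> (\<pi> \<odot> \<iota> ?Y0) = ev ?Y1 ?E0 \<cdot> (\<iota> (H ?Y1 ?E0) \<odot> g)"
    using curry[of ?Y0 ?E0 "ev ?Y1 ?E0 \<cdot> (\<iota> (H ?Y1 ?E0) \<odot> g)" "H ?Y1 ?E0"] by auto
  obtain r where r: "r \<in> Arr C" "Dom C r = H ?Y0 ?E0" "Cod C r = H ?Y0 ?E1" "ev ?Y0 ?E1 \<cdot> (r \<odot> \<iota> ?Y0) = e \<cdot> ev ?Y0 ?E0"
    using curry[of ?Y0 ?E1 "e \<cdot> ev ?Y0 ?E0" "H ?Y0 ?E0"] by auto
  obtain s where s: "s \<in> Arr C" "Dom C s = H ?Y1 ?E1" "Cod C s = H ?Y0 ?E1"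
    "ev ?Y0 ?E1 \<cdot> (s \<odot> \<iota> ?Y0) = ev ?Y1 ?E1 \<cdot> (\<iota> (H ?Y1 ?E1) \<odot> g)"
    using curry[of ?Y0 ?E1 "ev ?Y1 ?E1 \<cdot> (\<iota> (H ?Y1 ?E1) \<odot> g)" "H ?Y1 ?E1"] by auto
  obtain t where t: "t \<in> Arr C" "Dom C t = H ?Y1 ?E0" "Cod C t = H ?Y1 ?E1" "ev ?Y1 ?E1 \<cdot> (t \<odot> \<iota> ?Y1) = e \<cdot> ev ?Y1 ?E0"
    using curry[of ?Y1 ?E1 "e \<cdot> ev ?Y1 ?E0" "H ?Y1 ?E0"] by auto
  note [simp] = \<pi>(1-3) r(1-3) s(1-3) t(1-3)
  have ev_\<pi>: "ev ?Y0 ?E0 \<cdot> ((\<pi> \<cdot> x) \<odot> \<iota> ?Y0) = ev ?Y1 ?E0 \<cdot> (x \<odot> g)" if "x \<in> Arr C" "Cod C x = H ?Y1 ?E0" for x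
    using reassoc[OF \<pi>(4), of "x \<odot> \<iota> ?Y0"] that by simp
  have ev_r: "ev ?Y0 ?E1 \<cdot> ((r \<cdot> x) \<odot> \<iota> ?Y0) = e \<cdot> ev ?Y0 ?E0 \<cdot> (x \<odot> \<iota> ?Y0)" if "x \<in> Arr C" "Cod C x = H ?Y0 ?E0" for x
    using reassoc[OF r(4), of "x \<odot> \<iota> ?Y0"] that by simp
  have ev_s: "ev ?Y0 ?E1 \<cdot> ((s \<cdot> x) \<odot> \<iota> ?Y0) = ev ?Y1 ?E1 \<cdot> (x \<odot> g)" if "x \<in> Arr C" "Cod C x = H ?Y1 ?E1" for x
    using reassoc[OF s(4), of "x \<odot> \<iota> ?Y0"] that by simp
  have ev_t: "ev ?Y1 ?E1 \<cdot> ((t \<cdot> x) \<odot> y) = e \<cdot> ev ?Y1 ?E0 \<cdot> (x \<odot> y)" if "x \<in> Arr C" "Cod C x = H ?Y1 ?E0" "y \<in> Arr C" "Cod C y = ?Y1" for x y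
    using reassoc[OF t(4), of "x \<odot> y"] that by simp
  have rs: "r \<cdot> \<pi> = s \<cdot> t"
    by (rule ev_ext[of ?Y0 ?E1]) (use ev_t[of "\<iota> (H ?Y1 ?E0)" g] in \<open>simp_all add: ev_r ev_s \<pi>\<close>)
  \<comment> \<open>The pullback of \<open>r\<close> and \<open>s\<close>, with projections
    \<open>p\<close> and \<open>q\<close>, read as a pushout in the opposite category.\<close>
  obtain p q where pb': "is_pushout (opposite C) r s p q" using pb[of r s] by auto
  note pq = op.is_pushout_Arr[OF pb', simplified]
  have pq' [simp]: "p \<in> Arr C" "q \<in> Arr C" "Cod C p = H ?Y0 ?E0" "Cod C q = H ?Y1 ?E1" "Dom C q = Dom C p" "r \<cdot> p = s \<cdot> q"
    using pq by simp_all
  have pair: "\<exists>h. h \<in> Arr C \<and> Dom C h = Dom C v \<and> Cod C h = Dom C p \<and> p \<cdot> h = u \<and> q \<cdot> h = v"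
    if "u \<in> Arr C" "v \<in> Arr C" "Cod C u = H ?Y0 ?E0" "Cod C v = H ?Y1 ?E1" "Dom C u = Dom C v" "r \<cdot> u = s \<cdot> v" for u v
    using op.is_pushout_ex[OF pb', of u v] that by auto
  have pair_ext: "h = k" if "h \<in> Arr C" "k \<in> Arr C" "Cod C h = Dom C p" "Cod C k = Dom C p" "Dom C h = Dom C k" "p \<cdot> h = p \<cdot> k" "q \<cdot> h = q \<cdot> k" for h k
    using op.is_pushout_ext[OF pb', of h k] that by auto
  \<comment> \<open>The value at \<open>e\<close> of the right adjoint: restriction along
    \<open>g\<close> paired with composition with \<open>e\<close>.\<close>
  obtain d where d: "d \<in> Arr C" "Dom C d = H ?Y1 ?E0" "Cod C d = Dom C p" "p \<cdot> d = \<pi>" "q \<cdot> d = t" using pair[of \<pi> t] rs by auto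
  note [simp] = d(1-3)
  let ?b = "ev ?Y0 ?E0 \<cdot> (p \<odot> \<iota> ?Y0)" and ?c = "ev ?Y1 ?E1 \<cdot> (q \<odot> \<iota> ?Y1)"
  \<comment> \<open>The counit at 0 is evaluation on the first piece and, on the second, evaluation
    after the projection \<open>p\<close>; at 1 it is evaluation after \<open>q\<close>, namely
    \<open>?c\<close>.\<close>
  define E where "E = pp_map C T d g (ev ?Y1 ?E0) ?b"
  have E [simp]: "E \<in> Arr C" "Dom C E = Dom C (pp d g)" "Cod C E = ?E0" "E \<cdot> in1 d g = ev ?Y1 ?E0" "E \<cdot> in2 d g = ?b"
    unfolding E_def using pp_map_rules[of d g "ev ?Y1 ?E0" ?b] \<pi>(4) d(4) by simp_all
  have E_tail [simp]: "E \<cdot> in1 d g \<cdot> x = ev ?Y1 ?E0 \<cdot> x" if "x \<in> Arr C" "Cod C x = H ?Y1 ?E0 \<boxtimes> ?Y1" for x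
    using that reassoc[OF E(4), of x] by simp
  have E_tail' [simp]: "E \<cdot> in2 d g \<cdot> x = ev ?Y0 ?E0 \<cdot> (p \<odot> \<iota> ?Y0) \<cdot> x" if "x \<in> Arr C" "Cod C x = Dom C p \<boxtimes> ?Y0" for x
    using that reassoc[OF E(5), of x] by simp
  have "?c \<cdot> pp d g = e \<cdot> E"
  proof (rule pp_ext[of d g])
    show "(?c \<cdot> pp d g) \<cdot> in1 d g = (e \<cdot> E) \<cdot> in1 d g" by (simp add: d t)
    have "ev ?Y1 ?E1 \<cdot> (q \<odot> g) = e \<cdot> ?b" using ev_s[of q] ev_r[of p] by simp
    then show "(?c \<cdot> pp d g) \<cdot> in2 d g = (e \<cdot> E) \<cdot> in2 d g" by simp
  qed simp_all
  then have \<epsilon>: "Square (pp d g) e E ?c \<in> Arr \<A>" by simp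
  have "universal_arrow \<A> \<A> (tensor_right \<A> Q g) e d (Square (pp d g) e E ?c)"
    unfolding universal_arrow_def
  proof (intro conjI ballI)
    show "d \<in> Obj \<A>" by simp
    show "Square (pp d g) e E ?c \<in> hom \<A> (fob (tensor_right \<A> Q g) d) e" using \<epsilon> by (simp add: tensor_right_def)
    fix f h assume "f \<in> Obj \<A>" "h \<in> hom \<A> (fob (tensor_right \<A> Q g) f) e"
    then have f [simp]: "f \<in> Arr C" and h: "h \<in> Arr \<A>" "sq_src h = pp f g" "sq_tgt h = e" by (auto simp: tensor_right_def)
    note hA [simp] = sq_Arr[OF h(1), unfolded h]
    have hc: "sq1 h \<cdot> pp f g = e \<cdot> sq0 h" using sq_commutes[OF h(1)] h by simp
    have hc1: "e \<cdot> sq0 h \<cdot> in1 f g = sq1 h \<cdot> (f \<odot> \<iota> ?Y1)" using arg_cong[OF hc, of "\<lambda>t. t \<cdot> in1 f g"] by simp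
    have hc2: "e \<cdot> sq0 h \<cdot> in2 f g = sq1 h \<cdot> (\<iota> (Cod C f) \<odot> g)" using arg_cong[OF hc, of "\<lambda>t. t \<cdot> in2 f g"] by simp
    \<comment> \<open>The transpose of \<open>h\<close>: \<open>k0\<close> comes from its
      restriction to the first piece, \<open>kp\<close> from the restriction to the second, and
      \<open>kq\<close> from its component at 1. The last two combine to a map \<open>k1\<close>
      into the pullback.\<close>
    obtain k0 where k0: "k0 \<in> Arr C" "Dom C k0 = Dom C f" "Cod C k0 = H ?Y1 ?E0" "ev ?Y1 ?E0 \<cdot> (k0 \<odot> \<iota> ?Y1) = sq0 h \<cdot> in1 f g"
      using curry[of ?Y1 ?E0 "sq0 h \<cdot> in1 f g" "Dom C f"] by auto
    obtain kp where kp: "kp \<in> Arr C" "Dom C kp = Cod C f" "Cod C kp = H ?Y0 ?E0" "ev ?Y0 ?E0 \<cdot> (kp \<odot> \<iota> ?Y0) = sq0 h \<cdot> in2 f g"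
      using curry[of ?Y0 ?E0 "sq0 h \<cdot> in2 f g" "Cod C f"] by auto
    obtain kq where kq: "kq \<in> Arr C" "Dom C kq = Cod C f" "Cod C kq = H ?Y1 ?E1" "ev ?Y1 ?E1 \<cdot> (kq \<odot> \<iota> ?Y1) = sq1 h"
      using curry[of ?Y1 ?E1 "sq1 h" "Cod C f"] by auto
    note [simp] = k0(1-3) kp(1-3) kq(1-3)
    have k0': "ev ?Y1 ?E0 \<cdot> (k0 \<odot> x) = sq0 h \<cdot> in1 f g \<cdot> (\<iota> (Dom C f) \<odot> x)" if "x \<in> Arr C" "Cod C x = ?Y1" for x
      using reassoc[OF k0(4), of "\<iota> (Dom C f) \<odot> x"] that by simp
    have kp': "ev ?Y0 ?E0 \<cdot> ((kp \<cdot> x) \<odot> \<iota> ?Y0) = sq0 h \<cdot> in2 f g \<cdot> (x \<odot> \<iota> ?Y0)" if "x \<in> Arr C" "Cod C x = Cod C f" for x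
      using reassoc[OF kp(4), of "x \<odot> \<iota> ?Y0"] that by simp
    have kq': "ev ?Y1 ?E1 \<cdot> ((kq \<cdot> x) \<odot> y) = sq1 h \<cdot> (x \<odot> y)" if "x \<in> Arr C" "Cod C x = Cod C f" "y \<in> Arr C" "Cod C y = ?Y1" for x y
      using reassoc[OF kq(4), of "x \<odot> y"] that by simp
    have "r \<cdot> kp = s \<cdot> kq"
      by (rule ev_ext[of ?Y0 ?E1]) (use kq'[of "\<iota> (Cod C f)" g] in \<open>simp_all add: ev_r ev_s kp(4) hc2\<close>)
    then obtain k1 where k1: "k1 \<in> Arr C" "Dom C k1 = Cod C f" "Cod C k1 = Dom C p" "p \<cdot> k1 = kp" "q \<cdot> k1 = kq" using pair[of kp kq] by auto
    note [simp] = k1(1-3)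
    have "k1 \<cdot> f = d \<cdot> k0"
    proof (rule pair_ext)
      have "kp \<cdot> f = \<pi> \<cdot> k0"
        by (rule ev_ext[of ?Y0 ?E0]) (use in_glue[of f g "\<iota> (Dom C f)" "\<iota> ?Y0"] in \<open>simp_all add: kp' ev_\<pi> k0'\<close>)
      then show "p \<cdot> k1 \<cdot> f = p \<cdot> d \<cdot> k0" by (simp add: reassoc[OF k1(4)] reassoc[OF d(4)])
      have "kq \<cdot> f = t \<cdot> k0"
        by (rule ev_ext[of ?Y1 ?E1]) (simp_all add: kq' ev_t k0(4) hc1)
      then show "q \<cdot> k1 \<cdot> f = q \<cdot> d \<cdot> k0" by (simp add: reassoc[OF k1(5)] reassoc[OF d(5)])
    qed simp_all
    then have kA [simp]: "Square f d k0 k1 \<in> Arr \<A>" by simp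
    have I [simp]: "Square g g (\<iota> ?Y0) (\<iota> ?Y1) \<in> Arr \<A>" by simp
    have "E \<cdot> pp0 (Square f d k0 k1) (Square g g (\<iota> ?Y0) (\<iota> ?Y1)) = sq0 h"
      by (rule pp_ext[of f g]) (simp_all add: k0 k1 kp del: Square_Arr)
    then have ok: "Square (pp d g) e E ?c \<cdot>\<^bsub>\<A>\<^esub> far (tensor_right \<A> Q g) (Square f d k0 k1) = h"
      by (intro square_eqI) (simp_all add: tensor_right_def h k1 kq)
    show "\<exists>!k. k \<in> hom \<A> f d \<and> Square (pp d g) e E ?c \<cdot>\<^bsub>\<A>\<^esub> far (tensor_right \<A> Q g) k = h"
    proof (rule ex1I[of _ "Square f d k0 k1"])
      show "Square f d k0 k1 \<in> hom \<A> f d \<and>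
          Square (pp d g) e E ?c \<cdot>\<^bsub>\<A>\<^esub> far (tensor_right \<A> Q g) (Square f d k0 k1) = h" using kA ok by simp
      fix k assume "k \<in> hom \<A> f d \<and> Square (pp d g) e E ?c \<cdot>\<^bsub>\<A>\<^esub> far (tensor_right \<A> Q g) k = h"
      then have k: "k \<in> Arr \<A>" "sq_src k = f" "sq_tgt k = d"
        and kh: "Square (pp d g) e E ?c \<cdot>\<^bsub>\<A>\<^esub> far (tensor_right \<A> Q g) k = h" by auto
      note K [simp] = k(1) sq_Arr[OF k(1), unfolded k]
      have "E \<cdot> pp0 k (Square g g (\<iota> ?Y0) (\<iota> ?Y1)) = sq0 h" "?c \<cdot> (sq1 k \<odot> \<iota> ?Y1) = sq1 h"
        using arg_cong[OF kh, of sq0] arg_cong[OF kh, of sq1] by (simp_all add: tensor_right_def)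
      then have e1: "(E \<cdot> pp0 k (Square g g (\<iota> ?Y0) (\<iota> ?Y1))) \<cdot> in1 f g = sq0 h \<cdot> in1 f g"
        "(E \<cdot> pp0 k (Square g g (\<iota> ?Y0) (\<iota> ?Y1))) \<cdot> in2 f g = sq0 h \<cdot> in2 f g" "?c \<cdot> (sq1 k \<odot> \<iota> ?Y1) = sq1 h" by simp_all
      have k_0: "sq0 k = k0" by (rule ev_ext[of ?Y1 ?E0]) (use e1(1) k in \<open>simp_all add: k0 del: Square_Arr\<close>)
      have k_p: "p \<cdot> sq1 k = kp" by (rule ev_ext[of ?Y0 ?E0]) (use e1(2) k in \<open>simp_all add: kp del: Square_Arr\<close>)
      have k_q: "q \<cdot> sq1 k = kq" by (rule ev_ext[of ?Y1 ?E1]) (use e1(3) in \<open>simp_all add: kq\<close>)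
      have "sq1 k = k1" by (rule pair_ext) (simp_all add: k_p k_q k1(4,5))
      then show "k = Square f d k0 k1" using k_0 k by (intro square_eqI) simp_all
    qed
  qed
  then show "\<exists>d \<epsilon>. universal_arrow \<A> \<A> (tensor_right \<A> Q g) e d \<epsilon>" by blast
qed

lemma is_closed_symmetric_monoidal_pp:
  assumes "\<And>r s. r \<in> Arr C \<Longrightarrow> s \<in> Arr C \<Longrightarrow> Cod C r = Cod C s \<Longrightarrow> \<exists>p q. is_pushout (opposite C) r s p q"
  shows "is_closed_symmetric_monoidal \<A> Q"
  unfolding is_closed_symmetric_monoidal_def
  by (intro conjI ballI is_symmetric_monoidal_pp pp_left_adjoint assms) simp_all

section \<open>The pushout product axiom\<close>

text \<open>A map out of the domain of \<open>pp i j\<close> is a compatible pair of maps, so a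
  lifting problem for the product can be stated on the pieces. This form is used both in
  \<open>C\<close> and, with \<open>Q\<close>, in the arrow category.\<close>

lemma pp_liftI:
  assumes [simp]: "i \<in> Arr C" "j \<in> Arr C" "p \<in> Arr C"
    and L: "\<And>u1 u2 v. u1 \<in> Arr C \<Longrightarrow> u2 \<in> Arr C \<Longrightarrow> v \<in> Arr C \<Longrightarrow> Dom C u1 = Dom C i \<boxtimes> Cod C j \<Longrightarrow> Dom C u2 = Cod C i \<boxtimes> Dom C j \<Longrightarrow>
      Dom C v = Cod C i \<boxtimes> Cod C j \<Longrightarrow> Cod C u1 = Dom C p \<Longrightarrow> Cod C u2 = Dom C p \<Longrightarrow> Cod C v = Cod C p \<Longrightarrow>
      u1 \<cdot> (\<iota> (Dom C i) \<odot> j) = u2 \<cdot> (i \<odot> \<iota> (Dom C j)) \<Longrightarrow> p \<cdot> u1 = v \<cdot> (i \<odot> \<iota> (Cod C j)) \<Longrightarrow> p \<cdot> u2 = v \<cdot> (\<iota> (Cod C i) \<odot> j) \<Longrightarrow>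
      \<exists>h. h \<in> Arr C \<and> Dom C h = Cod C i \<boxtimes> Cod C j \<and> Cod C h = Dom C p \<and> h \<cdot> (i \<odot> \<iota> (Cod C j)) = u1 \<and> h \<cdot> (\<iota> (Cod C i) \<odot> j) = u2 \<and> p \<cdot> h = v"
  shows "has_lifting C (pp i j) p"
proof (rule has_liftingI)
  fix u v assume uv: "u \<in> Arr C" "v \<in> Arr C" "Dom C u = Dom C (pp i j)" "Cod C u = Dom C p" "Dom C v = Cod C (pp i j)" "Cod C v = Cod C p"
    "v \<cdot> pp i j = p \<cdot> u"
  have "in1 i j \<cdot> (\<iota> (Dom C i) \<odot> j) = in2 i j \<cdot> (i \<odot> \<iota> (Dom C j))"
    using in_glue[of i j "\<iota> (Dom C i)" "\<iota> (Dom C j)"] by simp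
  then obtain h where h: "h \<in> Arr C" "Dom C h = Cod C i \<boxtimes> Cod C j" "Cod C h = Dom C p" "h \<cdot> (i \<odot> \<iota> (Cod C j)) = u \<cdot> in1 i j"
    "h \<cdot> (\<iota> (Cod C i) \<odot> j) = u \<cdot> in2 i j" "p \<cdot> h = v"
    using L[of "u \<cdot> in1 i j" "u \<cdot> in2 i j" v] uv reassoc[OF uv(7), of "in1 i j"] reassoc[OF uv(7), of "in2 i j"] by auto
  have "h \<cdot> pp i j = u" by (rule pp_ext[of i j]) (use h uv in simp_all)
  then show "\<exists>h. h \<in> Arr C \<and> Dom C h = Cod C (pp i j) \<and> Cod C h = Dom C p \<and> h \<cdot> pp i j = u \<and> p \<cdot> h = v"
    using h by (intro exI[of _ h]) simp
qed

lemma pp_liftE: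
  assumes "has_lifting C (pp i j) p" and [simp]: "i \<in> Arr C" "j \<in> Arr C" "p \<in> Arr C"
    "u1 \<in> Arr C" "u2 \<in> Arr C" "v \<in> Arr C" "Dom C u1 = Dom C i \<boxtimes> Cod C j" "Dom C u2 = Cod C i \<boxtimes> Dom C j"
    "Dom C v = Cod C i \<boxtimes> Cod C j" "Cod C u1 = Dom C p" "Cod C u2 = Dom C p" "Cod C v = Cod C p"
    and c: "u1 \<cdot> (\<iota> (Dom C i) \<odot> j) = u2 \<cdot> (i \<odot> \<iota> (Dom C j))" "p \<cdot> u1 = v \<cdot> (i \<odot> \<iota> (Cod C j))" "p \<cdot> u2 = v \<cdot> (\<iota> (Cod C i) \<odot> j)"
  obtains h where "h \<in> Arr C" "Dom C h = Cod C i \<boxtimes> Cod C j" "Cod C h = Dom C p" "h \<cdot> (i \<odot> \<iota> (Cod C j)) = u1"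
    "h \<cdot> (\<iota> (Cod C i) \<odot> j) = u2" "p \<cdot> h = v"
proof -
  define u where "u = pp_map C T i j u1 u2"
  have u: "u \<in> Arr C" "Dom C u = Dom C (pp i j)" "Cod C u = Dom C p" "u \<cdot> in1 i j = u1" "u \<cdot> in2 i j = u2"
    unfolding u_def using pp_map_rules[of i j u1 u2] c(1) by simp_all
  have "v \<cdot> pp i j = p \<cdot> u" by (rule pp_ext[of i j]) (use u c in simp_all)
  then obtain h where h: "h \<in> Arr C" "Dom C h = Cod C i \<boxtimes> Cod C j" "Cod C h = Dom C p" "h \<cdot> pp i j = u" "p \<cdot> h = v"
    using has_liftingE[OF assms(1), of u v] u by auto
  then show thesis
    using that[of h] reassoc[OF h(4), of "in1 i j"] reassoc[OF h(4), of "in2 i j"] u by simp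
qed

text \<open>
  For \<open>\<alpha> : f \<rightarrow> f'\<close> and \<open>\<beta> : g \<rightarrow> g'\<close> a lift out of \<open>f' \<box> g'\<close> is built on \<open>X\<^sub>0' \<otimes> Y\<^sub>1'\<close>, then on
  \<open>X\<^sub>1' \<otimes> Y\<^sub>0'\<close>, then on \<open>X\<^sub>1' \<otimes> Y\<^sub>1'\<close>; each step is a lifting problem in \<open>C\<close> against a pushout product
  of components or corner maps of \<open>\<alpha>\<close> and \<open>\<beta>\<close>.
\<close>

lemma arrow_pp_lift:
  assumes \<alpha>: "\<alpha> \<in> Arr \<A>" and \<beta>: "\<beta> \<in> Arr \<A>" and p: "p \<in> Arr \<A>"
    and L1: "has_lifting C (pp (sq0 \<alpha>) (sq1 \<beta>)) (sq0 p)"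
    and L2: "has_lifting C (pp (corner C \<alpha>) (sq0 \<beta>)) (sq0 p)"
    and L3: "has_lifting C (pp (corner C \<alpha>) (corner C \<beta>)) (sq1 p)"
    and src: "sq_src \<alpha> = f" "sq_tgt \<alpha> = f'" "sq_src \<beta> = g" "sq_tgt \<beta> = g'" "sq_src p = e" "sq_tgt p = b"
    and u: "u \<in> Arr \<A>" "sq_src u = pp f g'" "sq_tgt u = e"
    and w: "w \<in> Arr \<A>" "sq_src w = pp f' g" "sq_tgt w = e"
    and v: "v \<in> Arr \<A>" "sq_src v = pp f' g'" "sq_tgt v = b"
    and c1: "u \<cdot>\<^bsub>\<A>\<^esub> pp_square C T (Idt \<A> f) \<beta> = w \<cdot>\<^bsub>\<A>\<^esub> pp_square C T \<alpha> (Idt \<A> g)"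
    and c2: "p \<cdot>\<^bsub>\<A>\<^esub> u = v \<cdot>\<^bsub>\<A>\<^esub> pp_square C T \<alpha> (Idt \<A> g')"
    and c3: "p \<cdot>\<^bsub>\<A>\<^esub> w = v \<cdot>\<^bsub>\<A>\<^esub> pp_square C T (Idt \<A> f') \<beta>"
  shows "\<exists>h. h \<in> Arr \<A> \<and> sq_src h = pp f' g' \<and> sq_tgt h = e \<and>
    h \<cdot>\<^bsub>\<A>\<^esub> pp_square C T \<alpha> (Idt \<A> g') = u \<and>
    h \<cdot>\<^bsub>\<A>\<^esub> pp_square C T (Idt \<A> f') \<beta> = w \<and> p \<cdot>\<^bsub>\<A>\<^esub> h = v"
proof -
  define a0 a1 b0 b1 p0 p1 where ab: "a0 = sq0 \<alpha>" "a1 = sq1 \<alpha>" "b0 = sq0 \<beta>" "b1 = sq1 \<beta>" "p0 = sq0 p" "p1 = sq1 p"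
  have fld [simp]: "sq0 \<alpha> = a0" "sq1 \<alpha> = a1" "sq0 \<beta> = b0" "sq1 \<beta> = b1" "sq0 p = p0" "sq1 p = p1" by (simp_all add: ab)
  note [simp] = \<alpha> \<beta> p src u w v sq_Arr[OF \<alpha>, unfolded src fld] sq_Arr[OF \<beta>, unfolded src fld] sq_Arr[OF p, unfolded src fld]
    sq_Arr[OF u(1), unfolded u] sq_Arr[OF w(1), unfolded w] sq_Arr[OF v(1), unfolded v]
  note com = sq_commutes[OF \<alpha>, unfolded src fld] sq_commutes[OF \<beta>, unfolded src fld] sq_commutes[OF p, unfolded src fld]
  have I [simp]: "Square k k (\<iota> (Dom C k)) (\<iota> (Cod C k)) \<in> Arr \<A>" if "k \<in> Arr C" for k using that by simp
  \<comment> \<open>Indices 1 and 2 are the restrictions of the component at 0 to its two pieces,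
    index 3 is the component at 1. All hypotheses on squares become equations between these nine
    maps of \<open>C\<close>.\<close>
  define u1 u2 u3 w1 w2 w3 v1 v2 v3
    where uwv: "u1 = sq0 u \<cdot> in1 f g'" "u2 = sq0 u \<cdot> in2 f g'" "u3 = sq1 u"
      "w1 = sq0 w \<cdot> in1 f' g" "w2 = sq0 w \<cdot> in2 f' g" "w3 = sq1 w" "v1 = sq0 v \<cdot> in1 f' g'" "v2 = sq0 v \<cdot> in2 f' g'" "v3 = sq1 v"
  have tps [simp]: "u1 \<in> Arr C" "u2 \<in> Arr C" "u3 \<in> Arr C" "w1 \<in> Arr C" "w2 \<in> Arr C" "w3 \<in> Arr C" "v1 \<in> Arr C" "v2 \<in> Arr C" "v3 \<in> Arr C"
    "Dom C u1 = Dom C f \<boxtimes> Cod C g'" "Dom C u2 = Cod C f \<boxtimes> Dom C g'" "Dom C u3 = Cod C f \<boxtimes> Cod C g'"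
    "Dom C w1 = Dom C f' \<boxtimes> Cod C g" "Dom C w2 = Cod C f' \<boxtimes> Dom C g" "Dom C w3 = Cod C f' \<boxtimes> Cod C g"
    "Dom C v1 = Dom C f' \<boxtimes> Cod C g'" "Dom C v2 = Cod C f' \<boxtimes> Dom C g'" "Dom C v3 = Cod C f' \<boxtimes> Cod C g'"
    "Cod C u1 = Dom C e" "Cod C u2 = Dom C e" "Cod C u3 = Cod C e" "Cod C w1 = Dom C e" "Cod C w2 = Dom C e" "Cod C w3 = Cod C e"
    "Cod C v1 = Dom C b" "Cod C v2 = Dom C b" "Cod C v3 = Cod C b"
    by (simp_all add: uwv)
  have glue: "u1 \<cdot> (x \<odot> (g' \<cdot> y)) = u2 \<cdot> ((f \<cdot> x) \<odot> y)" if "x \<in> Arr C" "y \<in> Arr C" "Cod C x = Dom C f" "Cod C y = Dom C g'" for x y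
    using that in_glue[of f g' x y] by (simp add: uwv)
  have gluw: "w1 \<cdot> (x \<odot> (g \<cdot> y)) = w2 \<cdot> ((f' \<cdot> x) \<odot> y)" if "x \<in> Arr C" "y \<in> Arr C" "Cod C x = Dom C f'" "Cod C y = Dom C g" for x y
    using that in_glue[of f' g x y] by (simp add: uwv)
  have gluv: "v1 \<cdot> (x \<odot> (g' \<cdot> y)) = v2 \<cdot> ((f' \<cdot> x) \<odot> y)" if "x \<in> Arr C" "y \<in> Arr C" "Cod C x = Dom C f'" "Cod C y = Dom C g'" for x y
    using that in_glue[of f' g' x y] by (simp add: uwv)
  have su: "e \<cdot> u1 = u3 \<cdot> (f \<odot> \<iota> (Cod C g'))" "e \<cdot> u2 = u3 \<cdot> (\<iota> (Cod C f) \<odot> g')"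
    using arg_cong[OF sq_commutes[OF u(1), unfolded u], of "\<lambda>t. t \<cdot> in1 f g'"]
      arg_cong[OF sq_commutes[OF u(1), unfolded u], of "\<lambda>t. t \<cdot> in2 f g'"] by (simp_all add: uwv)
  have sw: "e \<cdot> w1 = w3 \<cdot> (f' \<odot> \<iota> (Cod C g))" "e \<cdot> w2 = w3 \<cdot> (\<iota> (Cod C f') \<odot> g)"
    using arg_cong[OF sq_commutes[OF w(1), unfolded w], of "\<lambda>t. t \<cdot> in1 f' g"]
      arg_cong[OF sq_commutes[OF w(1), unfolded w], of "\<lambda>t. t \<cdot> in2 f' g"] by (simp_all add: uwv)
  have sv: "b \<cdot> v1 = v3 \<cdot> (f' \<odot> \<iota> (Cod C g'))" "b \<cdot> v2 = v3 \<cdot> (\<iota> (Cod C f') \<odot> g')"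
    using arg_cong[OF sq_commutes[OF v(1), unfolded v], of "\<lambda>t. t \<cdot> in1 f' g'"]
      arg_cong[OF sq_commutes[OF v(1), unfolded v], of "\<lambda>t. t \<cdot> in2 f' g'"] by (simp_all add: uwv)
  have C: "u1 \<cdot> (\<iota> (Dom C f) \<odot> b1) = w1 \<cdot> (a0 \<odot> \<iota> (Cod C g))" "u2 \<cdot> (\<iota> (Cod C f) \<odot> b0) = w2 \<cdot> (a1 \<odot> \<iota> (Dom C g))"
    "u3 \<cdot> (\<iota> (Cod C f) \<odot> b1) = w3 \<cdot> (a1 \<odot> \<iota> (Cod C g))"
    using arg_cong[OF c1, of "\<lambda>t. sq0 t \<cdot> in1 f g"] arg_cong[OF c1, of "\<lambda>t. sq0 t \<cdot> in2 f g"] arg_cong[OF c1, of sq1]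
    by (simp_all add: uwv del: Square_Arr)
  have P: "p0 \<cdot> u1 = v1 \<cdot> (a0 \<odot> \<iota> (Cod C g'))" "p0 \<cdot> u2 = v2 \<cdot> (a1 \<odot> \<iota> (Dom C g'))" "p1 \<cdot> u3 = v3 \<cdot> (a1 \<odot> \<iota> (Cod C g'))"
    using arg_cong[OF c2, of "\<lambda>t. sq0 t \<cdot> in1 f g'"] arg_cong[OF c2, of "\<lambda>t. sq0 t \<cdot> in2 f g'"] arg_cong[OF c2, of sq1]
    by (simp_all add: uwv del: Square_Arr)
  have W: "p0 \<cdot> w1 = v1 \<cdot> (\<iota> (Dom C f') \<odot> b1)" "p0 \<cdot> w2 = v2 \<cdot> (\<iota> (Cod C f') \<odot> b0)" "p1 \<cdot> w3 = v3 \<cdot> (\<iota> (Cod C f') \<odot> b1)"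
    using arg_cong[OF c3, of "\<lambda>t. sq0 t \<cdot> in1 f' g"] arg_cong[OF c3, of "\<lambda>t. sq0 t \<cdot> in2 f' g"] arg_cong[OF c3, of sq1]
    by (simp_all add: uwv del: Square_Arr)
  obtain A where A: "A \<in> Arr C" "Dom C A = Dom C f' \<boxtimes> Cod C g'" "Cod C A = Dom C e"
    "A \<cdot> (a0 \<odot> \<iota> (Cod C g')) = u1" "A \<cdot> (\<iota> (Dom C f') \<odot> b1) = w1" "p0 \<cdot> A = v1"
    by (rule pp_liftE[OF L1, of u1 w1 v1]) (simp_all add: C P W)
  note [simp] = A(1-3)
  define i j ca where ij: "i = po_in1 C f a0" "j = po_in2 C f a0" "ca = corner C \<alpha>"
  have poP: "is_pushout C f a0 i j" unfolding ij by (rule po_is_pushout) simp_all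
  note po [simp] = is_pushout_Arr(3,4,6-8)[OF poP]
  have ca [simp]: "ca \<in> Arr C" "Dom C ca = Cod C i" "Cod C ca = Cod C f'" "ca \<cdot> i = a1" "ca \<cdot> j = f'"
    using corner_props[OF \<alpha>] by (simp_all add: ij)
  \<comment> \<open>The source of the corner map of \<open>\<alpha>\<close>, tensored with
    \<open>Dom C g'\<close>, is glued from the sources of \<open>u2\<close> and of the restricted
    first lift; the two agree on the overlap and give \<open>U1\<close>.\<close>
  have "u2 \<cdot> (f \<odot> \<iota> (Dom C g')) = A \<cdot> (\<iota> (Dom C f') \<odot> g') \<cdot> (a0 \<odot> \<iota> (Dom C g'))"
    using glue[of "\<iota> (Dom C f)" "\<iota> (Dom C g')"] reassoc[OF A(4), of "\<iota> (Dom C f) \<odot> g'"] by simp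
  then obtain U1 where U1: "U1 \<in> Arr C" "Dom C U1 = Cod C i \<boxtimes> Dom C g'" "Cod C U1 = Dom C e"
    "U1 \<cdot> (i \<odot> \<iota> (Dom C g')) = u2" "U1 \<cdot> (j \<odot> \<iota> (Dom C g')) = A \<cdot> (\<iota> (Dom C f') \<odot> g')"
    using is_pushout_ex[OF tensor_pushout[OF poP, of "Dom C g'"], of u2 "A \<cdot> (\<iota> (Dom C f') \<odot> g')"] by auto
  note [simp] = U1(1-3)
  have U1': "U1 \<cdot> (i \<odot> x) = u2 \<cdot> (\<iota> (Cod C f) \<odot> x)" "U1 \<cdot> (j \<odot> x) = A \<cdot> (\<iota> (Dom C f') \<odot> (g' \<cdot> x))" if "x \<in> Arr C" "Cod C x = Dom C g'" for x
    using reassoc[OF U1(4), of "\<iota> (Cod C f) \<odot> x"] reassoc[OF U1(5), of "\<iota> (Dom C f') \<odot> x"] that by simp_all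
  have "U1 \<cdot> (\<iota> (Dom C ca) \<odot> b0) = w2 \<cdot> (ca \<odot> \<iota> (Dom C b0))"
    by (rule is_pushout_ext[OF tensor_pushout[OF poP, of "Dom C g"]])
      (use gluw[of "\<iota> (Dom C f')" "\<iota> (Dom C g)"] reassoc[OF A(5), of "\<iota> (Dom C f') \<odot> g"] in \<open>simp_all add: U1' C com(2)[symmetric]\<close>)
  moreover have "p0 \<cdot> U1 = v2 \<cdot> (ca \<odot> \<iota> (Cod C b0))"
    by (rule is_pushout_ext[OF tensor_pushout[OF poP, of "Dom C g'"]])
      (use gluv[of "\<iota> (Dom C f')" "\<iota> (Dom C g')"] in \<open>simp_all add: U1(4,5) P reassoc[OF A(6)]\<close>)
  ultimately obtain B where B: "B \<in> Arr C" "Dom C B = Cod C f' \<boxtimes> Dom C g'" "Cod C B = Dom C e"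
    "B \<cdot> (ca \<odot> \<iota> (Dom C g')) = U1" "B \<cdot> (\<iota> (Cod C f') \<odot> b0) = w2" "p0 \<cdot> B = v2"
    using pp_liftE[OF L2, of U1 w2 v2] by (auto simp: W ij[symmetric])
  note [simp] = B(1-3)
  have B': "B \<cdot> (a1 \<odot> \<iota> (Dom C g')) = u2" "B \<cdot> (f' \<odot> \<iota> (Dom C g')) = A \<cdot> (\<iota> (Dom C f') \<odot> g')"
    using reassoc[OF B(4), of "i \<odot> \<iota> (Dom C g')"] reassoc[OF B(4), of "j \<odot> \<iota> (Dom C g')"] by (simp_all add: U1(4,5))
  define k l cb where kl: "k = po_in1 C g b0" "l = po_in2 C g b0" "cb = corner C \<beta>"
  have poR: "is_pushout C g b0 k l" unfolding kl by (rule po_is_pushout) simp_all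
  note po' [simp] = is_pushout_Arr(3,4,6-8)[OF poR]
  have cb [simp]: "cb \<in> Arr C" "Dom C cb = Cod C k" "Cod C cb = Cod C g'" "cb \<cdot> k = b1" "cb \<cdot> l = g'"
    using corner_props[OF \<beta>] by (simp_all add: kl)
  \<comment> \<open>For the last lift both corner maps occur: \<open>V1\<close> extends
    \<open>u3\<close> by the image of \<open>A\<close> under \<open>e\<close>, and \<open>V2\<close>
    extends \<open>w3\<close> by the image of \<open>B\<close>. A lift of this pair is then
    automatically compatible with \<open>A\<close> and \<open>B\<close>.\<close>
  have "u3 \<cdot> (f \<odot> \<iota> (Cod C g')) = e \<cdot> A \<cdot> (a0 \<odot> \<iota> (Cod C g'))" using su by (simp add: A(4))
  then obtain V1 where V1: "V1 \<in> Arr C" "Dom C V1 = Cod C i \<boxtimes> Cod C g'" "Cod C V1 = Cod C e"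
    "V1 \<cdot> (i \<odot> \<iota> (Cod C g')) = u3" "V1 \<cdot> (j \<odot> \<iota> (Cod C g')) = e \<cdot> A"
    using is_pushout_ex[OF tensor_pushout[OF poP, of "Cod C g'"], of u3 "e \<cdot> A"] by auto
  note [simp] = V1(1-3)
  have V1': "V1 \<cdot> (i \<odot> x) = u3 \<cdot> (\<iota> (Cod C f) \<odot> x)" "V1 \<cdot> (j \<odot> x) = e \<cdot> A \<cdot> (\<iota> (Dom C f') \<odot> x)" if "x \<in> Arr C" "Cod C x = Cod C g'" for x
    using reassoc[OF V1(4), of "\<iota> (Cod C f) \<odot> x"] reassoc[OF V1(5), of "\<iota> (Dom C f') \<odot> x"] that by simp_all
  have "w3 \<cdot> (\<iota> (Cod C f') \<odot> g) = e \<cdot> B \<cdot> (\<iota> (Cod C f') \<odot> b0)" using sw by (simp add: B(5))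
  then obtain V2 where V2: "V2 \<in> Arr C" "Dom C V2 = Cod C f' \<boxtimes> Cod C k" "Cod C V2 = Cod C e"
    "V2 \<cdot> (\<iota> (Cod C f') \<odot> k) = w3" "V2 \<cdot> (\<iota> (Cod C f') \<odot> l) = e \<cdot> B"
    using is_pushout_ex[OF tensor_pushout_left[OF poR, of "Cod C f'"], of w3 "e \<cdot> B"] by auto
  note [simp] = V2(1-3)
  have V2': "V2 \<cdot> (x \<odot> k) = w3 \<cdot> (x \<odot> \<iota> (Cod C g))" "V2 \<cdot> (x \<odot> l) = e \<cdot> B \<cdot> (x \<odot> \<iota> (Dom C g'))" if "x \<in> Arr C" "Cod C x = Cod C f'" for x
    using reassoc[OF V2(4), of "x \<odot> \<iota> (Cod C g)"] reassoc[OF V2(5), of "x \<odot> \<iota> (Dom C g')"] that by simp_all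
  have "V1 \<cdot> (\<iota> (Dom C ca) \<odot> cb) = V2 \<cdot> (ca \<odot> \<iota> (Dom C cb))"
  proof (rule is_pushout_ext[OF tensor_pushout[OF poP, of "Cod C k"]])
    have "V1 \<cdot> (i \<odot> cb) = V2 \<cdot> (a1 \<odot> \<iota> (Cod C k))"
      by (rule is_pushout_ext[OF tensor_pushout_left[OF poR, of "Cod C f"]]) (simp_all add: V1' V2' C B' su)
    then show "(V1 \<cdot> (\<iota> (Dom C ca) \<odot> cb)) \<cdot> (i \<odot> \<iota> (Cod C k)) = (V2 \<cdot> (ca \<odot> \<iota> (Dom C cb))) \<cdot> (i \<odot> \<iota> (Cod C k))" by simp
    have "V1 \<cdot> (j \<odot> cb) = V2 \<cdot> (f' \<odot> \<iota> (Cod C k))"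
      by (rule is_pushout_ext[OF tensor_pushout_left[OF poR, of "Dom C f'"]]) (simp_all add: V1' V2' A(5) B' sw)
    then show "(V1 \<cdot> (\<iota> (Dom C ca) \<odot> cb)) \<cdot> (j \<odot> \<iota> (Cod C k)) = (V2 \<cdot> (ca \<odot> \<iota> (Dom C cb))) \<cdot> (j \<odot> \<iota> (Cod C k))" by simp
  qed simp_all
  moreover have "p1 \<cdot> V1 = v3 \<cdot> (ca \<odot> \<iota> (Cod C cb))"
    by (rule is_pushout_ext[OF tensor_pushout[OF poP, of "Cod C g'"]]) (simp_all add: V1(4,5) P reassoc[OF com(3)] A(6) sv)
  moreover have "p1 \<cdot> V2 = v3 \<cdot> (\<iota> (Cod C ca) \<odot> cb)"
    by (rule is_pushout_ext[OF tensor_pushout_left[OF poR, of "Cod C f'"]]) (simp_all add: V2(4,5) W reassoc[OF com(3)] B(6) sv)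
  ultimately obtain H where H: "H \<in> Arr C" "Dom C H = Cod C f' \<boxtimes> Cod C g'" "Cod C H = Cod C e"
    "H \<cdot> (ca \<odot> \<iota> (Cod C g')) = V1" "H \<cdot> (\<iota> (Cod C f') \<odot> cb) = V2" "p1 \<cdot> H = v3"
    using pp_liftE[OF L3, of V1 V2 v3] by (auto simp: ij(3)[symmetric] kl(3)[symmetric])
  note [simp] = H(1-3)
  have H': "H \<cdot> (a1 \<odot> \<iota> (Cod C g')) = u3" "H \<cdot> (f' \<odot> \<iota> (Cod C g')) = e \<cdot> A" "H \<cdot> (\<iota> (Cod C f') \<odot> b1) = w3" "H \<cdot> (\<iota> (Cod C f') \<odot> g') = e \<cdot> B"
    using reassoc[OF H(4), of "i \<odot> \<iota> (Cod C g')"] reassoc[OF H(4), of "j \<odot> \<iota> (Cod C g')"]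
      reassoc[OF H(5), of "\<iota> (Cod C f') \<odot> k"] reassoc[OF H(5), of "\<iota> (Cod C f') \<odot> l"] by (simp_all add: V1(4,5) V2(4,5))
  \<comment> \<open>The first two lifts glue to the component at 0 of the required square;
    \<open>H\<close> is its component at 1.\<close>
  define K where "K = pp_map C T f' g' A B"
  have K [simp]: "K \<in> Arr C" "Dom C K = Dom C (pp f' g')" "Cod C K = Dom C e" "K \<cdot> in1 f' g' = A" "K \<cdot> in2 f' g' = B"
    unfolding K_def using pp_map_rules[of f' g' A B] B'(2) by simp_all
  have K_tail: "K \<cdot> in1 f' g' \<cdot> x = A \<cdot> x" "K \<cdot> in2 f' g' \<cdot> y = B \<cdot> y"
    if "x \<in> Arr C" "Cod C x = Dom C f' \<boxtimes> Cod C g'" "y \<in> Arr C" "Cod C y = Cod C f' \<boxtimes> Dom C g'" for x y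
    using reassoc[OF K(4), of x] reassoc[OF K(5), of y] that by simp_all
  have "H \<cdot> pp f' g' = e \<cdot> K" by (rule pp_ext[of f' g']) (simp_all add: H')
  then have "Square (pp f' g') e K H \<in> Arr \<A>" by simp
  moreover have "K \<cdot> pp0 \<alpha> (Square g' g' (\<iota> (Dom C g')) (\<iota> (Cod C g'))) = sq0 u"
    by (rule pp_ext[of f g']) (simp_all add: K_tail[of _ "\<iota> (Cod C f' \<boxtimes> Dom C g')"] K_tail[of "\<iota> (Dom C f' \<boxtimes> Cod C g')"] A(4) B' uwv[symmetric] del: Square_Arr)
  moreover have "K \<cdot> pp0 (Square f' f' (\<iota> (Dom C f')) (\<iota> (Cod C f'))) \<beta> = sq0 w"
    by (rule pp_ext[of f' g]) (simp_all add: K_tail[of _ "\<iota> (Cod C f' \<boxtimes> Dom C g')"] K_tail[of "\<iota> (Dom C f' \<boxtimes> Cod C g')"] A(5) B(5) uwv[symmetric] del: Square_Arr)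
  moreover have "p0 \<cdot> K = sq0 v"
    by (rule pp_ext[of f' g']) (simp_all add: A(6) B(6) uwv[symmetric])
  ultimately show ?thesis
    by (intro exI[of _ "Square (pp f' g') e K H"] conjI square_eqI) (simp_all add: H' H(6) uwv[symmetric])
qed

end

section \<open>The symmetric monoidal model structure on arrows\<close>

lemma bicat_of_bicomplete:
  fixes C :: "('o, 'm) cat"
  assumes "infinite (UNIV :: 'u set)" "is_category C" "bicomplete TYPE('u) C"
  shows "bicat C"
proof -
  interpret category C by (rule category.intro) fact
  show ?thesis
  proof unfold_locales
    show "\<exists>p q. is_pushout C f g p q" if "f \<in> Arr C" "g \<in> Arr C" "Dom C f = Dom C g" for f g
      by (rule bicomplete_pushout[OF assms(1,3,2) that])
    show "\<exists>z. is_initial C z" by (rule bicomplete_initial[OF assms(1,3)])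
    obtain z where "is_initial (opposite C) z" using bicomplete_initial[OF assms(1) bicomplete_opposite[OF assms(3)]] by blast
    then show "\<exists>z. z \<in> Obj C \<and> (\<forall>a\<in>Obj C. \<exists>!f. f \<in> hom C a z)"
      unfolding is_initial_def hom_opposite by auto
  qed
qed

lemma pullbacks_of_bicomplete:
  assumes "infinite (UNIV :: 'u set)" "is_category C" "bicomplete TYPE('u) C" "r \<in> Arr C" "s \<in> Arr C" "Cod C r = Cod C s"
  shows "\<exists>p q. is_pushout (opposite C) r s p q"
  by (rule bicomplete_pushout[OF assms(1) bicomplete_opposite[OF assms(3)] is_category_opposite[OF assms(2)]]) (use assms in simp_all)

text \<open>\<open>bicat_arrow\<close> and \<open>pullbacks\<close> record what bicompleteness
  provides, which keeps the size type out of the locale.\<close>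

locale monoidal_model = closed_sym_mon C T + model_setting C M
  for C :: "('o, 'm) cat" (structure) and T :: "('o, 'm) monoidal" and M :: "'m model_structure" +
  assumes pp_axiom: "pushout_product_axiom C M T" and unit_ax: "unit_axiom C M T"
    and bicat_arrow: "bicat (arrow_cat C)"
    and pullbacks: "r \<in> Arr C \<Longrightarrow> s \<in> Arr C \<Longrightarrow> Cod C r = Cod C s \<Longrightarrow> \<exists>p q. is_pushout (opposite C) r s p q"
begin

lemma pp_cof: "f \<in> cof M \<Longrightarrow> g \<in> cof M \<Longrightarrow> pp f g \<in> cof M"
  and pp_tcof: "f \<in> cof M \<Longrightarrow> g \<in> cof M \<Longrightarrow> f \<in> weq M \<or> g \<in> weq M \<Longrightarrow> pp f g \<in> cof M \<inter> weq M"
  using pp_axiom by (auto simp: pushout_product_axiom_def)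

text \<open>The component at 1 is the corner map after a cobase change of the component at 0, both
  cofibrations.\<close>

lemma arrow_cof_components:
  assumes "\<alpha> \<in> llp \<A> (pointwise C (fib M \<inter> weq M))"
  shows "sq0 \<alpha> \<in> cof M" "sq1 \<alpha> \<in> cof M" "corner C \<alpha> \<in> cof M"
proof -
  have A: "\<alpha> \<in> Arr \<A>" using assms by (simp add: llp_def)
  show *: "sq0 \<alpha> \<in> cof M" "corner C \<alpha> \<in> cof M" using assms arrow_cof_iff[OF A] by auto
  note c = corner_props[OF A]
  show "sq1 \<alpha> \<in> cof M" using model_comp(2)[OF c(2) po_in1_cobase(1)[OF A *(1)] *(2)] c(4) by simp
qed

lemma arrow_tcof_components:
  assumes "\<alpha> \<in> llp \<A> (pointwise C (fib M))"
  shows "sq0 \<alpha> \<in> weq M" "sq1 \<alpha> \<in> weq M" "corner C \<alpha> \<in> weq M"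
proof -
  have A: "\<alpha> \<in> Arr \<A>" using assms by (simp add: llp_def)
  have *: "sq0 \<alpha> \<in> cof M \<inter> weq M" "corner C \<alpha> \<in> cof M \<inter> weq M" using assms arrow_tcof_iff[OF A] by auto
  then show "sq0 \<alpha> \<in> weq M" "corner C \<alpha> \<in> weq M" by auto
  note c = corner_props[OF A]
  show "sq1 \<alpha> \<in> weq M" using model_comp(1)[OF c(2), of] po_in1_cobase(2)[OF A *(1)] *(2) c(4) by auto
qed

text \<open>Instantiating the locale at the arrow category makes the rules for pushout products
  available one level up, for pushout products of squares.\<close>

lemma closed_sym_mon_arrow: "closed_sym_mon \<A> Q"
proof -
  interpret D: bicat \<A> by (rule bicat_arrow)
  show ?thesis by unfold_locales (rule is_closed_symmetric_monoidal_pp[OF pullbacks])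
qed

lemma has_lifting_arrow_pp:
  assumes \<alpha>: "\<alpha> \<in> Arr \<A>" and \<beta>: "\<beta> \<in> Arr \<A>" and p: "p \<in> Arr \<A>"
    and L: "has_lifting C (pp (sq0 \<alpha>) (sq1 \<beta>)) (sq0 p)" "has_lifting C (pp (corner C \<alpha>) (sq0 \<beta>)) (sq0 p)"
      "has_lifting C (pp (corner C \<alpha>) (corner C \<beta>)) (sq1 p)"
  shows "has_lifting \<A> (pushout_product \<A> Q \<alpha> \<beta>) p"
proof -
  interpret D: closed_sym_mon \<A> Q by (rule closed_sym_mon_arrow)
  show ?thesis
  proof (rule D.pp_liftI[OF \<alpha> \<beta> p])
    fix u w v
    assume "u \<in> Arr \<A>" "w \<in> Arr \<A>" "v \<in> Arr \<A>"
      "Dom \<A> u = tob Q (Dom \<A> \<alpha>) (Cod \<A> \<beta>)"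
      "Dom \<A> w = tob Q (Cod \<A> \<alpha>) (Dom \<A> \<beta>)"
      "Dom \<A> v = tob Q (Cod \<A> \<alpha>) (Cod \<A> \<beta>)"
      "Cod \<A> u = Dom \<A> p" "Cod \<A> w = Dom \<A> p" "Cod \<A> v = Cod \<A> p"
      "u \<cdot>\<^bsub>\<A>\<^esub> tar Q (Idt \<A> (Dom \<A> \<alpha>)) \<beta> = w \<cdot>\<^bsub>\<A>\<^esub> tar Q \<alpha> (Idt \<A> (Dom \<A> \<beta>))"
      "p \<cdot>\<^bsub>\<A>\<^esub> u = v \<cdot>\<^bsub>\<A>\<^esub> tar Q \<alpha> (Idt \<A> (Cod \<A> \<beta>))"
      "p \<cdot>\<^bsub>\<A>\<^esub> w = v \<cdot>\<^bsub>\<A>\<^esub> tar Q (Idt \<A> (Cod \<A> \<alpha>)) \<beta>"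
    note X = this[unfolded arrow_cat_simps(1-3) Q_simps(1,2)]
    show "\<exists>h. h \<in> Arr \<A> \<and> Dom \<A> h = tob Q (Cod \<A> \<alpha>) (Cod \<A> \<beta>) \<and>
      Cod \<A> h = Dom \<A> p \<and> h \<cdot>\<^bsub>\<A>\<^esub> tar Q \<alpha> (Idt \<A> (Cod \<A> \<beta>)) = u \<and>
      h \<cdot>\<^bsub>\<A>\<^esub> tar Q (Idt \<A> (Cod \<A> \<alpha>)) \<beta> = w \<and> p \<cdot>\<^bsub>\<A>\<^esub> h = v"
      unfolding arrow_cat_simps(1-3) Q_simps(1,2)
      by (rule arrow_pp_lift[OF \<alpha> \<beta> p L refl refl refl refl refl refl X(1,4,7) X(2,5,8) X(3,6,9) X(10-12)])
  qed
qed

lemma pushout_product_axiom_arrow: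
  fixes P :: "'m square model_structure"
  assumes P: "weq P = pointwise C (weq M)" "cof P = llp \<A> (pointwise C (fib M \<inter> weq M))"
  shows "pushout_product_axiom \<A> P Q"
  unfolding pushout_product_axiom_def
proof (intro ballI conjI impI)
  interpret D: closed_sym_mon \<A> Q by (rule closed_sym_mon_arrow)
  fix \<alpha> \<beta> assume ab: "\<alpha> \<in> cof P" "\<beta> \<in> cof P"
  then have A: "\<alpha> \<in> Arr \<A>" "\<beta> \<in> Arr \<A>" unfolding P by (simp_all add: llp_def)
  have Arr: "pushout_product \<A> Q \<alpha> \<beta> \<in> Arr \<A>" using A by (rule D.pp_rules(1))
  note c = arrow_cof_components[OF ab(1)[unfolded P]] arrow_cof_components[OF ab(2)[unfolded P]]
  show "pushout_product \<A> Q \<alpha> \<beta> \<in> cof P"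
    unfolding P llp_def
  proof (intro CollectI conjI ballI Arr)
    fix p assume p: "p \<in> pointwise C (fib M \<inter> weq M)"
    then have "p \<in> Arr \<A>" "sq0 p \<in> fib M \<inter> weq M" "sq1 p \<in> fib M \<inter> weq M" by (auto simp: pointwise_def)
    then show "has_lifting \<A> (pushout_product \<A> Q \<alpha> \<beta>) p"
      using c by (intro has_lifting_arrow_pp A model_lifting(2) pp_cof) auto
  qed
  assume "\<alpha> \<in> weq P \<or> \<beta> \<in> weq P"
  then have "\<alpha> \<in> llp \<A> (pointwise C (fib M)) \<or> \<beta> \<in> llp \<A> (pointwise C (fib M))"
    unfolding arrow_tcof_eq[symmetric] using ab unfolding P by blast
  \<comment> \<open>Each of the three products in the lifting problems has
    \<open>sq0 \<alpha>\<close> or the corner map of \<open>\<alpha>\<close> as its first factor,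
    while all three maps attached to \<open>\<beta>\<close> occur as second factors; so triviality
    of either square makes all three products trivial.\<close>
  then have t: "sq0 \<alpha> \<in> weq M \<and> corner C \<alpha> \<in> weq M \<or> sq0 \<beta> \<in> weq M \<and> sq1 \<beta> \<in> weq M \<and> corner C \<beta> \<in> weq M"
    using arrow_tcof_components by blast
  have "pushout_product \<A> Q \<alpha> \<beta> \<in> llp \<A> (pointwise C (fib M))"
    unfolding llp_def
  proof (intro CollectI conjI ballI Arr)
    fix p assume p: "p \<in> pointwise C (fib M)"
    then have p: "p \<in> Arr \<A>" "sq0 p \<in> fib M" "sq1 p \<in> fib M" by (auto simp: pointwise_def)
    have "pp (sq0 \<alpha>) (sq1 \<beta>) \<in> cof M \<inter> weq M" "pp (corner C \<alpha>) (sq0 \<beta>) \<in> cof M \<inter> weq M" "pp (corner C \<alpha>) (corner C \<beta>) \<in> cof M \<inter> weq M"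
      using c t by (auto intro!: pp_tcof[THEN IntD1] pp_tcof[THEN IntD2])
    then show "has_lifting \<A> (pushout_product \<A> Q \<alpha> \<beta>) p"
      using p by (intro has_lifting_arrow_pp A model_lifting(1)) auto
  qed
  then show "pushout_product \<A> Q \<alpha> \<beta> \<in> weq P"
    unfolding P arrow_tcof_eq[symmetric] by blast
qed

section \<open>The unit axiom\<close>

lemma initial_iso:
  assumes "is_initial C z" "is_initial C z'" "f \<in> Arr C" "Dom C f = z" "Cod C f = z'"
  shows "is_iso C f"
proof -
  obtain g where g: "g \<in> Arr C" "Dom C g = z'" "Cod C g = z" using assms(1,2) unfolding is_initial_def by auto
  show ?thesis
    by (rule is_isoI[of f g]) (use assms g in \<open>auto intro: is_initial_ext[OF assms(1)] is_initial_ext[OF assms(2)]\<close>)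
qed

lemma iso_tcof: "is_iso C f \<Longrightarrow> f \<in> cof M \<inter> weq M"
  unfolding tcof_eq_llp by (rule llp_iso) (use fibs_Arr in auto)

text \<open>The chosen initial arrow \<open>z\<close> is only known to run between initial objects,
  so cofibrancy is carried along isomorphisms. The arrow \<open>x\<close> is a cofibration because
  it is the corner map of the square from \<open>z\<close>, precomposed with a pushout of the
  isomorphism \<open>z\<close>.\<close>

lemma cofibrant_arrow:
  fixes P :: "'m square model_structure"
  assumes P: "cof P = llp \<A> (pointwise C (fib M \<inter> weq M))" and x: "cofibrant \<A> P x"
  shows "x \<in> cof M" "cofibrant C M (Dom C x)" "cofibrant C M (Cod C x)"
proof -
  interpret D: bicat \<A> by (rule bicat_arrow)
  interpret E0: left_adjoint_functor \<A> C "Ev0 C" by (rule left_adjoint_functor_Ev0)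
  interpret E1: left_adjoint_functor \<A> C "Ev1 C" by (rule left_adjoint_functor_Ev1)
  define z where "z = init \<A>"
  define \<alpha> where "\<alpha> = from_init \<A> x"
  have xA [simp]: "x \<in> Arr C" using x by (simp add: cofibrant_def)
  have \<alpha>: "\<alpha> \<in> Arr \<A>" "sq_src \<alpha> = z" "sq_tgt \<alpha> = x"
    using D.from_init[of x] by (simp_all add: \<alpha>_def z_def)
  note A [simp] = sq_Arr[OF \<alpha>(1), unfolded \<alpha>]
  have "\<alpha> \<in> llp \<A> (pointwise C (fib M \<inter> weq M))" using x P by (simp add: cofibrant_def \<alpha>_def)
  note c = arrow_cof_components[OF this]
  have z0: "is_initial C (Dom C z)" and z1: "is_initial C (Cod C z)"
    using E0.preserves_initial[OF D.is_initial_init] E1.preserves_initial[OF D.is_initial_init] by (simp_all add: z_def Ev0_def Ev1_def)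
  have "is_iso C z" by (rule initial_iso[OF z0 z1]) simp_all
  moreover have "is_pushout C z (sq0 \<alpha>) (po_in1 C z (sq0 \<alpha>)) (po_in2 C z (sq0 \<alpha>))" by (rule po_is_pushout) simp_all
  ultimately have "po_in2 C z (sq0 \<alpha>) \<in> cof M" using iso_tcof is_pushout_cobase_iso by blast
  then show xc: "x \<in> cof M"
    using model_comp(2)[OF _ _ c(3), of "po_in2 C z (sq0 \<alpha>)"] corner_props[OF \<alpha>(1)] \<alpha> by simp
  obtain i where i: "i \<in> Arr C" "Dom C i = init C" "Cod C i = Dom C z" by (rule that[of "from_init C (Dom C z)"]) simp_all
  have "i \<in> cof M" using initial_iso[OF is_initial_init z0 i] iso_tcof by blast
  then have "sq0 \<alpha> \<cdot> i \<in> cof M" using model_comp(2)[OF _ _ c(1), of i] i by simp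
  moreover have "sq0 \<alpha> \<cdot> i = from_init C (Dom C x)" by (rule init_ext) (use i in simp_all)
  ultimately show c0: "cofibrant C M (Dom C x)" by (simp add: cofibrant_def)
  have "x \<cdot> from_init C (Dom C x) \<in> cof M" using model_comp(2)[OF _ _ xc, of "from_init C (Dom C x)"] c0 by (simp add: cofibrant_def)
  moreover have "x \<cdot> from_init C (Dom C x) = from_init C (Cod C x)" by (rule init_ext) simp_all
  ultimately show "cofibrant C M (Cod C x)" by (simp add: cofibrant_def)
qed

text \<open>By two-out-of-three the map from the initial object to \<open>X\<close> is a trivial
  cofibration, hence so is its pushout product with \<open>A\<close>. The latter agrees with
  \<open>X\<close> tensored with \<open>A\<close> up to \<open>in2\<close>, a pushout of an
  isomorphism between initial objects.\<close>

lemma tensor_acyclic: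
  assumes X: "cofibrant C M X" and w: "w \<in> weq M" "Dom C w = X" "Cod C w = init C" and A: "A \<in> cof M"
  shows "\<iota> X \<odot> A \<in> cof M \<inter> weq M"
proof -
  have [simp]: "X \<in> Obj C" "A \<in> Arr C" "w \<in> Arr C" using X A w model_Arr by (auto simp: cofibrant_def)
  let ?j = "from_init C X"
  have "w \<cdot> ?j = \<iota> (init C)" by (rule init_ext) (simp_all add: w)
  then have "w \<cdot> ?j \<in> weq M" using model_Idt by simp
  then have "?j \<in> weq M" using weq_cancel(2)[of ?j w] w by simp
  then have pt: "pp ?j A \<in> cof M \<inter> weq M" using pp_tcof[of ?j A] X A by (simp add: cofibrant_def)
  interpret F: left_adjoint_functor C C "tensor_right C T (Dom C A)" by (rule left_adjoint_tensor) simp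
  interpret G: left_adjoint_functor C C "tensor_right C T (Cod C A)" by (rule left_adjoint_tensor) simp
  have "is_initial C (init C \<boxtimes> Dom C A)" "is_initial C (init C \<boxtimes> Cod C A)"
    using F.preserves_initial[OF is_initial_init] G.preserves_initial[OF is_initial_init] by (simp_all add: tensor_right_def)
  then have "is_iso C (\<iota> (Dom C ?j) \<odot> A)" by (rule initial_iso) simp_all
  then have "in2 ?j A \<in> cof M \<inter> weq M" using is_pushout_cobase_iso[OF pp_is_pushout[of ?j A]] iso_tcof by simp
  then have "pp ?j A \<cdot> in2 ?j A \<in> cof M \<inter> weq M" using pt model_comp[of "pp ?j A" "in2 ?j A"] by simp
  then show ?thesis by simp
qed

text \<open>At 1 this is the unit axiom of \<open>C\<close>. At 0, \<open>in2 q A\<close> is a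
  cobase change of the domain of \<open>q\<close> tensored with \<open>A\<close>, a trivial
  cofibration as that domain is weakly equivalent to the initial object. After
  \<open>in2 q A\<close> the map becomes the one in the unit axiom for the codomain of
  \<open>q\<close> and the domain of \<open>A\<close>, and two-out-of-three applies.\<close>

lemma unit_axiom_arrow:
  fixes P :: "'m square model_structure"
  assumes P: "weq P = pointwise C (weq M)" "cof P = llp \<A> (pointwise C (fib M \<inter> weq M))"
  shows "unit_axiom \<A> P Q"
  unfolding unit_axiom_def
proof (intro allI impI)
  fix q w A
  assume qw: "cofibrant \<A> P q \<and> w \<in> hom \<A> q (unt Q) \<and> w \<in> weq P" and cA: "cofibrant \<A> P A"
  then have w: "w \<in> Arr \<A>" "sq_src w = q" "sq_tgt w = pp_unit C T" "sq0 w \<in> weq M" "sq1 w \<in> weq M"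
    by (auto simp: P pointwise_def)
  note q = cofibrant_arrow[OF P(2) conjunct1[OF qw]] and a = cofibrant_arrow[OF P(2) cA]
  have [simp]: "q \<in> Arr C" "A \<in> Arr C" using q a model_Arr by auto
  note W [simp] = w(1-3) sq_Arr[OF w(1), unfolded w]
  have [simp]: "Square A A (\<iota> (Dom C A)) (\<iota> (Cod C A)) \<in> Arr \<A>" by simp
  have unit: "lun T X \<cdot> (sq1 w \<odot> \<iota> X) \<in> weq M" if "cofibrant C M X" for X
    using unit_ax q(3) w(5) that unfolding unit_axiom_def by (auto simp: cofibrant_def)
  let ?\<phi> = "lun0 A \<cdot> pp0 w (Square A A (\<iota> (Dom C A)) (\<iota> (Cod C A)))"
  have "\<iota> (Dom C q) \<odot> A \<in> cof M \<inter> weq M"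
    by (rule tensor_acyclic[of _ "sq0 w"]) (use q a w(4) in simp_all)
  then have "in2 q A \<in> weq M"
    using llp_pushout[OF pp_is_pushout[of q A], of "fib M"] fibs_Arr unfolding tcof_eq_llp[symmetric] by auto
  moreover have "?\<phi> \<cdot> in2 q A = lun T (Dom C A) \<cdot> (sq1 w \<odot> \<iota> (Dom C A))" by (simp del: Square_Arr)
  ultimately have "?\<phi> \<in> weq M"
    using weq_cancel(1)[of "in2 q A" ?\<phi>] unit[OF a(2)] by (simp del: Square_Arr)
  moreover have "lun Q A \<cdot>\<^bsub>\<A>\<^esub> tar Q w (Idt \<A> A) \<in> Arr \<A>"
  proof -
    interpret D: category \<A> by (rule category_arrow_cat)
    show ?thesis by (rule D.comp_Arr) (simp_all del: Square_Arr)
  qed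
  ultimately show "lun Q A \<cdot>\<^bsub>\<A>\<^esub> tar Q w (Idt \<A> A) \<in> weq P"
    unfolding P pointwise_def using unit[OF a(3)] by simp
qed

end

theorem theorem3p1:
  fixes C :: "('o, 'm) cat" and M :: "'m model_structure"
  assumes "infinite (UNIV :: 'u set)"
    and "model_category TYPE('u) C M"
  shows "\<exists>P :: 'm square model_structure.
    model_category TYPE('u) (arrow_cat C) P \<and>
    (\<forall>\<alpha> \<in> Arr (arrow_cat C).
       (\<alpha> \<in> weq P \<longleftrightarrow> far (Ev0 C) \<alpha> \<in> weq M \<and> far (Ev1 C) \<alpha> \<in> weq M) \<and>
       (\<alpha> \<in> fib P \<longleftrightarrow> far (Ev0 C) \<alpha> \<in> fib M \<and> far (Ev1 C) \<alpha> \<in> fib M)) \<and>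
    (\<forall>\<alpha> \<in> Arr (arrow_cat C).
       (\<alpha> \<in> cof P \<longleftrightarrow> far (Ev0 C) \<alpha> \<in> cof M \<and> corner C \<alpha> \<in> cof M) \<and>
       (\<alpha> \<in> cof P \<inter> weq P \<longleftrightarrow> far (Ev0 C) \<alpha> \<in> cof M \<inter> weq M \<and> corner C \<alpha> \<in> cof M \<inter> weq M) \<and>
       (\<alpha> \<in> cof P \<longrightarrow> far (Ev0 C) \<alpha> \<in> cof M \<and> far (Ev1 C) \<alpha> \<in> cof M)) \<and>
    left_quillen C M (arrow_cat C) P (L0 C) \<and>
    left_quillen C M (arrow_cat C) P (L1 C) \<and>
    left_quillen (arrow_cat C) P C M (Ev0 C) \<and>
    left_quillen (arrow_cat C) P C M (Ev1 C) \<and>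
    (cofibrantly_generated TYPE('u) C M \<longrightarrow> cofibrantly_generated TYPE('u) (arrow_cat C) P) \<and>
    (\<forall>T. cofibrantly_generated TYPE('u) C M \<and> symmetric_monoidal_model_category TYPE('u) C M T \<longrightarrow>
       symmetric_monoidal_model_category TYPE('u) (arrow_cat C) P (pushout_product_monoidal C T))"
proof -
  have C: "is_category C" "bicomplete TYPE('u) C" "is_model_structure C M"
    using assms(2) by (auto simp: model_category_def)
  interpret bicat C by (rule bicat_of_bicomplete[OF assms(1) C(1,2)])
  interpret model_setting C M by unfold_locales (rule C(3))
  obtain P where P: "is_model_structure (arrow_cat C) P" "weq P = pointwise C (weq M)" "fib P = pointwise C (fib M)"
    "cof P = llp (arrow_cat C) (pointwise C (fib M \<inter> weq M))" by (rule projective_model_structure)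
  have tcof: "cof P \<inter> weq P = llp (arrow_cat C) (pointwise C (fib M))" unfolding P by (rule arrow_tcof_eq)
  have D: "is_category (arrow_cat C)" "bicomplete TYPE('u) (arrow_cat C)"
    by (rule is_category_arrow_cat, rule bicomplete_arrow_cat[OF C(2)])
  then have 1: "model_category TYPE('u) (arrow_cat C) P" using P(1) by (simp add: model_category_def)
  have 2: "\<alpha> \<in> weq P \<longleftrightarrow> sq0 \<alpha> \<in> weq M \<and> sq1 \<alpha> \<in> weq M" "\<alpha> \<in> fib P \<longleftrightarrow> sq0 \<alpha> \<in> fib M \<and> sq1 \<alpha> \<in> fib M"
    "\<alpha> \<in> cof P \<longleftrightarrow> sq0 \<alpha> \<in> cof M \<and> corner C \<alpha> \<in> cof M"
    "\<alpha> \<in> cof P \<inter> weq P \<longleftrightarrow> sq0 \<alpha> \<in> cof M \<inter> weq M \<and> corner C \<alpha> \<in> cof M \<inter> weq M" if "\<alpha> \<in> Arr (arrow_cat C)" for \<alpha>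
    unfolding tcof using that arrow_cof_iff[OF that] arrow_tcof_iff[OF that] by (simp_all add: P pointwise_def[of C "weq M"] pointwise_def[of C "fib M"])
  have A: "\<alpha> \<in> Arr (arrow_cat C)" if "\<alpha> \<in> cof P" for \<alpha> using that by (simp add: P llp_def)
  have 3: "sq1 \<alpha> \<in> cof M" if "\<alpha> \<in> cof P" for \<alpha>
  proof -
    note c = corner_props[OF A[OF that]] and c' = 2(3)[OF A[OF that], THEN iffD1, OF that]
    show ?thesis
      using model_comp(2)[OF c(2) po_in1_cobase(1)[OF A[OF that] conjunct1[OF c']] conjunct2[OF c']] c(4) by simp
  qed
  \<comment> \<open>Transposing lifting problems carries a left lifting property against
    \<open>R\<close> to one against the pointwise class of \<open>R\<close>; taking fibrations and
    trivial fibrations for \<open>R\<close> yields both conditions on a left Quillen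
    functor.\<close>
  have L: "far (L0 C) u \<in> llp (arrow_cat C) (pointwise C R)" "far (L1 C) u \<in> llp (arrow_cat C) (pointwise C R)" if "u \<in> llp C R" for u R
    using that functor_simps(2)[OF is_functor_L0] functor_simps(2)[OF is_functor_L1]
    by (auto simp: llp_def pointwise_def has_lifting_L0 has_lifting_L1)
  have 4: "left_quillen C M (arrow_cat C) P (L0 C)" "left_quillen C M (arrow_cat C) P (L1 C)"
    unfolding left_quillen_def tcof tcof_eq_llp unfolding P(4) cof_eq_llp using left_adjoint_L0 left_adjoint_L1 L by auto
  have ev: "sq0 \<alpha> \<in> cof M" "sq1 \<alpha> \<in> cof M" "\<alpha> \<in> weq P \<Longrightarrow> sq0 \<alpha> \<in> weq M" "\<alpha> \<in> weq P \<Longrightarrow> sq1 \<alpha> \<in> weq M"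
    if "\<alpha> \<in> cof P" for \<alpha>
    using 2(1,3)[OF A[OF that]] 3[OF that] that by blast+
  have 5: "left_quillen (arrow_cat C) P C M (Ev0 C)" "left_quillen (arrow_cat C) P C M (Ev1 C)"
    unfolding left_quillen_def using left_adjoint_Ev0 left_adjoint_Ev1 ev by (simp_all add: Ev0_def Ev1_def)
  have 6: "cofibrantly_generated TYPE('u) (arrow_cat C) P" if "cofibrantly_generated TYPE('u) C M"
    by (rule cofibrantly_generated_arrow_cat[OF assms(1) that 1 P(2,3)])
  have 7: "symmetric_monoidal_model_category TYPE('u) (arrow_cat C) P (pushout_product_monoidal C T)"
    if "symmetric_monoidal_model_category TYPE('u) C M T" for T
  proof -
    have T: "is_closed_symmetric_monoidal C T" "pushout_product_axiom C M T" "unit_axiom C M T"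
      using that by (auto simp: symmetric_monoidal_model_category_def)
    interpret closed_sym_mon C T by unfold_locales (rule T(1))
    interpret monoidal_model C T M
      by (intro monoidal_model.intro monoidal_model_axioms.intro closed_sym_mon_axioms model_setting_axioms T(2,3) bicat_of_bicomplete[OF assms(1) D]
        pullbacks_of_bicomplete[OF assms(1) C(1,2)] closed_sym_mon.intro bicat_axioms) unfold_locales
    show ?thesis
      unfolding symmetric_monoidal_model_category_def
      using 1 is_closed_symmetric_monoidal_pp[OF pullbacks] pushout_product_axiom_arrow[OF P(2,4)] unit_axiom_arrow[OF P(2,4)] by blast
  qed
  show ?thesis
    by (rule exI[of _ P]) (use 1 2 3 4 5 6 7 in \<open>simp add: Ev0_def Ev1_def\<close>)
qed

end
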